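(* Let $D$ be a division ring with center $F$, and let $G$ be a subnormal subgroup of the multiplicative group $D^*$. If $M$ is a non-abelian solvable maximal subgroup of $G$, then the following conditions hold: (i) There exists a maximal subfield $K$ of $D$ such that $K/F$ is a finite Galois extension with $\mathrm{Gal}(K/F)\cong M/(K^*\cap G)\cong \mathbb{Z}_p$ for some prime $p$, and $[D:F]=p^2$. (ii) The subgroup $K^*\cap G$ is the $FC$-center of $M$, and $K^*\cap G$ is the Fitting subgroup of $M$. Furthermore, for any $x\in M\setminus K$, we have $x^p\in F$ and $D=F[M]=\bigoplus_{i=1}^pKx^i$.
   Context: $K^*$ is the multiplicative group of $K$. For a subset $S\subseteq D$, $F[S]$ denotes the subring of $D$ generated by $S\cup F$. The $FC$-center of a group $M$ is the set of elements of $M$ having only finitely many conjugates in $M$. *)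

theory Defs
  imports "HOL-Algebra.Solvable_Groups" "HOL-Algebra.Elementary_Groups"
          "HOL-Computational_Algebra.Primes" "HOL-Library.FuncSet"
begin

definition grp :: "'a::division_ring set \<Rightarrow> 'a monoid" where
  "grp S = \<lparr>carrier = S, monoid.mult = (*), one = 1\<rparr>"

definition units_of_D :: "'a::division_ring set" where
  "units_of_D = UNIV - {0}"

definition center :: "'a::division_ring set" where
  "center = {z. \<forall>x. z * x = x * z}"

definition subnormal_in :: "'a::division_ring set \<Rightarrow> 'a set \<Rightarrow> bool" where
  "subnormal_in G A \<longleftrightarrow> (\<exists>n N. N 0 = G \<and> N n = A \<and> (\<forall>i<n. N i \<lhd> grp (N (Suc i))))"

definition maximal_subgroup :: "'a::division_ring set \<Rightarrow> 'a set \<Rightarrow> bool" where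
  "maximal_subgroup M G \<longleftrightarrow> subgroup M (grp G) \<and> M \<noteq> G \<and>
     (\<forall>H. subgroup H (grp G) \<and> M \<subseteq> H \<longrightarrow> H = M \<or> H = G)"

definition is_abelian_set :: "'a::division_ring set \<Rightarrow> bool" where
  "is_abelian_set M \<longleftrightarrow> (\<forall>x\<in>M. \<forall>y\<in>M. x * y = y * x)"

fun lower_central :: "('a, 'b) monoid_scheme \<Rightarrow> nat \<Rightarrow> 'a set" where
  "lower_central G 0 = carrier G"
| "lower_central G (Suc n) = generate G
     (\<Union>x\<in>lower_central G n. \<Union>y\<in>carrier G. {x \<otimes>\<^bsub>G\<^esub> y \<otimes>\<^bsub>G\<^esub> inv\<^bsub>G\<^esub> x \<otimes>\<^bsub>G\<^esub> inv\<^bsub>G\<^esub> y})"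

definition nilpotent :: "('a, 'b) monoid_scheme \<Rightarrow> bool" where
  "nilpotent G \<longleftrightarrow> (\<exists>n. lower_central G n = {\<one>\<^bsub>G\<^esub>})"

definition fitting :: "('a, 'b) monoid_scheme \<Rightarrow> 'a set" where
  "fitting G = generate G (\<Union>{N. N \<lhd> G \<and> nilpotent (G\<lparr>carrier := N\<rparr>)})"

definition FC_center :: "'a::division_ring set \<Rightarrow> 'a set" where
  "FC_center M = {x \<in> M. finite {y * x * inverse y | y. y \<in> M}}"

definition is_subring :: "'a::division_ring set \<Rightarrow> bool" where
  "is_subring R \<longleftrightarrow> 0 \<in> R \<and> 1 \<in> R \<and> (\<forall>x\<in>R. \<forall>y\<in>R. x + y \<in> R \<and> x * y \<in> R) \<and> (\<forall>x\<in>R. - x \<in> R)"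

definition is_subfield :: "'a::division_ring set \<Rightarrow> bool" where
  "is_subfield K \<longleftrightarrow> is_subring K \<and> (\<forall>x\<in>K. inverse x \<in> K) \<and> (\<forall>x\<in>K. \<forall>y\<in>K. x * y = y * x)"

definition maximal_subfield :: "'a::division_ring set \<Rightarrow> bool" where
  "maximal_subfield K \<longleftrightarrow> is_subfield K \<and> (\<forall>L. is_subfield L \<and> K \<subseteq> L \<longrightarrow> L = K)"

definition gen_subring :: "'a::division_ring set \<Rightarrow> 'a set \<Rightarrow> 'a set" where
  "gen_subring F S = \<Inter>{R. is_subring R \<and> S \<union> F \<subseteq> R}"

definition has_dim :: "'a::division_ring set \<Rightarrow> 'a set \<Rightarrow> nat \<Rightarrow> bool" where
  "has_dim F V n \<longleftrightarrow> (\<exists>B. finite B \<and> card B = n \<and> B \<subseteq> V \<and>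
      (\<forall>v\<in>V. \<exists>!c. c \<in> B \<rightarrow>\<^sub>E F \<and> v = (\<Sum>b\<in>B. c b * b)))"

definition Gal :: "'a::division_ring set \<Rightarrow> 'a set \<Rightarrow> ('a \<Rightarrow> 'a) set" where
  "Gal K F = {\<sigma> \<in> K \<rightarrow>\<^sub>E K. bij_betw \<sigma> K K \<and> \<sigma> 1 = 1 \<and>
      (\<forall>x\<in>K. \<forall>y\<in>K. \<sigma> (x + y) = \<sigma> x + \<sigma> y \<and> \<sigma> (x * y) = \<sigma> x * \<sigma> y) \<and>
      (\<forall>a\<in>F. \<sigma> a = a)}"

definition galgrp :: "'a::division_ring set \<Rightarrow> 'a set \<Rightarrow> ('a \<Rightarrow> 'a) monoid" where
  "galgrp K F = \<lparr>carrier = Gal K F, monoid.mult = compose K, one = restrict id K\<rparr>"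

definition finite_galois :: "'a::division_ring set \<Rightarrow> 'a set \<Rightarrow> bool" where
  "finite_galois K F \<longleftrightarrow> F \<subseteq> K \<and> (\<exists>n. has_dim F K n) \<and>
      {x \<in> K. \<forall>\<sigma>\<in>Gal K F. \<sigma> x = x} = F"

end

theory Submission
  imports Defs "HOL-Library.Multiset" "HOL-Number_Theory.Residues"
begin

text \<open>
  A solvable subnormal subgroup of the unit group of a division ring is central, and a noncentral subnormal
  subgroup generates the division ring.  Hence a division subring normalised by \<open>M\<close> is either \<open>D\<close> or meets \<open>G\<close> in
  an abelian subgroup of \<open>M\<close>.

  Suppose first that \<open>M\<close> has a noncentral abelian normal subgroup, and let \<open>K\<close> be the bicentraliser of a suitable
  one.  Sums of elements of \<open>K\<^sup>* T\<close>, for normal subgroups \<open>T\<close> of \<open>M\<close> that commute modulo \<open>K\<close>, satisfy the Ore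
  condition because the words in two sums outgrow the monomials, and their quotients fill \<open>D\<close>.  Cosets of \<open>K\<^sup>*\<close>
  being independent by Dedekind's lemma, maximality of \<open>M\<close> makes \<open>M / (M \<inter> K)\<close> cyclic of prime order \<open>p\<close>, so that
  \<open>D\<close> is the cyclic algebra \<open>\<Oplus> K x\<^sup>i\<close>; degrees and automorphisms are counted with linear systems.

  Otherwise \<open>M\<close> has a normal subgroup \<open>H\<close> of class two on whose quotient by the centre it acts irreducibly.  Then \<open>H\<close>
  is generated by central elements and a quaternion group \<open>\<langle>x, y\<rangle>\<close>, and \<open>M\<close> stabilises the quaternion order
  localised at 5.  The high powers of \<open>(3 - 4y)/5\<close> and \<open>(5 - 12y)/13\<close> lie in \<open>G\<close>; the former does not stabilise
  that order, the latter does but lies outside \<open>M\<close>, against maximality.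

  Let \<open>\<sigma>\<close> be conjugation by \<open>x \<in> M - K\<close>.  If \<open>x\<close> were in the FC-center or in a nilpotent normal subgroup of \<open>M\<close>, some
  power of \<open>\<sigma> - 1\<close> would send \<open>K\<^sup>*\<close> to elements of bounded order, since \<open>(\<sigma> - 1)\<^sup>n\<close> maps \<open>K\<^sup>*\<close> into \<open>G\<close>.  Norms show
  that then \<open>\<sigma> - 1\<close> itself maps \<open>K\<^sup>*\<close> into finitely many roots of unity.  This is impossible when \<open>K\<close> is infinite,
  and \<open>K\<close> is not finite by an argument of Wedderburn's type.
\<close>

section \<open>Division subrings and multiplicative groups\<close>

text \<open>The obstacle is that finite dimension over the center is a conclusion: no determinant,
  reduced norm or polynomial identity is available beforehand. In their place stands one climbing
  argument, used both for the centrality of solvable subnormal subgroups and for generation by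
  noncentral ones. Given monomials \<open>\<Gamma>\<close> over \<open>L\<close> and a subnormal
  chain, induction from the bottom shows that every fraction lying in the chain is a monomial: an
  element \<open>d\<close> one level up conjugates the lower level into itself, hence into
  \<open>\<Gamma>\<close>, hence (by commutators or by a degree) a sufficient set into
  \<open>L\<close>, and \<open>conj_into_layer\<close> returns \<open>d\<close> to
  \<open>\<Gamma>\<close>. At the top all nonzero fractions would normalize \<open>L\<close>, which
  the Cartan-Brauer-Hua computation refutes. The Pythagorean triples are chosen for the primes 5 and
  13. Elements of norm one in \<open>y\<close> are inverted by \<open>x\<close>, so squaring them is
  taking a commutator with \<open>x\<close>, and repeated squaring descends the chain. A denominator
  5 is visible to a lattice localized at 5, while 13 is a unit there; but \<open>M\<close> permutes
  six units up to which \<open>x\<close> can be conjugated, and a denominator 13 leaves that finite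
  set.\<close>

definition div_subring :: "'a::division_ring set \<Rightarrow> bool" where
  "div_subring L \<longleftrightarrow> is_subring L \<and> (\<forall>x\<in>L. inverse x \<in> L)"

definition mult_group :: "'a::division_ring set \<Rightarrow> bool" where
  "mult_group H \<longleftrightarrow> 1 \<in> H \<and> 0 \<notin> H \<and> (\<forall>x\<in>H. \<forall>y\<in>H. x * y \<in> H) \<and> (\<forall>x\<in>H. inverse x \<in> H)"

definition centralizer :: "'a::division_ring set \<Rightarrow> 'a set" where
  "centralizer S = {z. \<forall>s\<in>S. z * s = s * z}"

definition conjg :: "'a::division_ring \<Rightarrow> 'a \<Rightarrow> 'a" where
  "conjg g x = g * x * inverse g"

definition commutator :: "'a::division_ring \<Rightarrow> 'a \<Rightarrow> 'a" where
  "commutator x y = x * y * inverse x * inverse y"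

definition normalizes :: "'a::division_ring set \<Rightarrow> 'a set \<Rightarrow> bool" where
  "normalizes H S \<longleftrightarrow> (\<forall>g\<in>H. \<forall>s\<in>S. conjg g s \<in> S)"

lemma div_subringD:
  assumes "div_subring L"
  shows "0 \<in> L" "1 \<in> L" "x \<in> L \<Longrightarrow> y \<in> L \<Longrightarrow> x + y \<in> L" "x \<in> L \<Longrightarrow> y \<in> L \<Longrightarrow> x * y \<in> L"
    "x \<in> L \<Longrightarrow> - x \<in> L" "x \<in> L \<Longrightarrow> inverse x \<in> L"
  using assms unfolding div_subring_def is_subring_def by auto

lemma div_subring_diff: "div_subring L \<Longrightarrow> x \<in> L \<Longrightarrow> y \<in> L \<Longrightarrow> x - y \<in> L"
  using div_subringD(3)[of L x "-y"] div_subringD(5)[of L y] by simp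

lemma div_subring_sum: "div_subring L \<Longrightarrow> (\<And>i. i \<in> I \<Longrightarrow> f i \<in> L) \<Longrightarrow> sum f I \<in> L"
  by (induction I rule: infinite_finite_induct) (auto simp: div_subringD)

lemma div_subring_prod: "div_subring L \<Longrightarrow> x \<in> L \<Longrightarrow> x ^ n \<in> L"
  by (induction n) (auto simp: div_subringD)

lemma mult_groupD:
  assumes "mult_group H"
  shows "1 \<in> H" "0 \<notin> H" "x \<in> H \<Longrightarrow> x \<noteq> 0" "x \<in> H \<Longrightarrow> y \<in> H \<Longrightarrow> x * y \<in> H" "x \<in> H \<Longrightarrow> inverse x \<in> H"
  using assms unfolding mult_group_def by auto

lemma mult_group_power: "mult_group H \<Longrightarrow> x \<in> H \<Longrightarrow> x ^ n \<in> H"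
  by (induction n) (auto simp: mult_groupD)

lemma mult_group_powi: "mult_group H \<Longrightarrow> x \<in> H \<Longrightarrow> x powi n \<in> H"
  by (auto simp: power_int_def mult_group_power mult_groupD power_inverse)

lemma mult_group_conjg: "mult_group H \<Longrightarrow> g \<in> H \<Longrightarrow> x \<in> H \<Longrightarrow> conjg g x \<in> H"
  by (auto simp: conjg_def mult_groupD)

lemma mult_group_commutator: "mult_group H \<Longrightarrow> g \<in> H \<Longrightarrow> x \<in> H \<Longrightarrow> commutator g x \<in> H"
  by (auto simp: commutator_def mult_groupD)

lemma mult_group_Int: "mult_group H \<Longrightarrow> mult_group K \<Longrightarrow> mult_group (H \<inter> K)"
  unfolding mult_group_def by auto

lemma mult_group_Int_div_subring: "mult_group H \<Longrightarrow> div_subring K \<Longrightarrow> mult_group (H \<inter> K)"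
  unfolding mult_group_def div_subring_def is_subring_def by auto

lemma mult_group_units: "div_subring L \<Longrightarrow> mult_group (L - {0})"
  unfolding mult_group_def div_subring_def is_subring_def by auto

lemma div_subring_UNIV: "div_subring UNIV" by (auto simp: div_subring_def is_subring_def)

lemma div_subring_Int: "div_subring L \<Longrightarrow> div_subring K \<Longrightarrow> div_subring (L \<inter> K)"
  unfolding div_subring_def is_subring_def by auto

lemma inverse_comm: "z * s = s * z \<Longrightarrow> inverse z * s = s * inverse (z::'a::division_ring)"
proof (cases "z = 0")
  case False
  assume "z * s = s * z"
  have "inverse z * s = inverse z * (s * (z * inverse z))" using False by simp
  also have "\<dots> = inverse z * (s * z) * inverse z" by (simp only: mult.assoc)
  also have "s * z = z * s" using \<open>z * s = s * z\<close> by simp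
  also have "inverse z * (z * s) * inverse z = (inverse z * z) * (s * inverse z)" by (simp only: mult.assoc)
  also have "\<dots> = s * inverse z" using False by simp
  finally show ?thesis .
qed simp

lemma div_subring_centralizer: "div_subring (centralizer S)"
  unfolding div_subring_def is_subring_def centralizer_def
  by (auto simp: algebra_simps inverse_comm) (metis mult.assoc)

lemma centralizerI: "(\<And>s. s \<in> S \<Longrightarrow> z * s = s * z) \<Longrightarrow> z \<in> centralizer S" by (auto simp: centralizer_def)
lemma centralizerD: "z \<in> centralizer S \<Longrightarrow> s \<in> S \<Longrightarrow> z * s = s * z" by (auto simp: centralizer_def)
lemma centralizer_mono: "S \<subseteq> T \<Longrightarrow> centralizer T \<subseteq> centralizer S" by (auto simp: centralizer_def)
lemma centralizer_centralizer: "S \<subseteq> centralizer (centralizer S)" by (auto simp: centralizer_def)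
lemma centralizer_centralizer_comm: assumes "S \<subseteq> centralizer S" shows "centralizer (centralizer S) \<subseteq> centralizer (centralizer (centralizer S))"
  using assms centralizer_mono by metis
lemma cent3: "centralizer (centralizer (centralizer S)) = centralizer S"
  by (metis centralizer_centralizer centralizer_mono equalityI)
lemma center_eq: "center = centralizer UNIV" by (auto simp: center_def centralizer_def)
lemma center_subset_centralizer: "center \<subseteq> centralizer S" by (auto simp: center_def centralizer_def)

lemma conjg_mult: "g \<noteq> 0 \<Longrightarrow> conjg g (x * y) = conjg g x * conjg g y"
  unfolding conjg_def by (simp add: mult.assoc) (simp add: mult.assoc[symmetric])
lemma conjg_add: "conjg g (x + y) = conjg g x + conjg g y" by (simp add: conjg_def algebra_simps)
lemma conjg_minus: "conjg g (- x) = - conjg g x" by (simp add: conjg_def)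
lemma conjg_diff: "conjg g (x - y) = conjg g x - conjg g y" by (simp add: conjg_def algebra_simps)
lemma conjg_0: "conjg g 0 = 0" by (simp add: conjg_def)
lemma conjg_1: "g \<noteq> 0 \<Longrightarrow> conjg g 1 = 1" by (simp add: conjg_def)
lemma conjg_inverse: "g \<noteq> 0 \<Longrightarrow> conjg g (inverse x) = inverse (conjg g x)"
  by (cases "x = 0") (auto simp: conjg_def nonzero_inverse_mult_distrib mult.assoc)
lemma conjg_conjg: "conjg g (conjg h x) = conjg (g * h) x"
  by (cases "g = 0 \<or> h = 0") (auto simp: conjg_def nonzero_inverse_mult_distrib mult.assoc)
lemma conjg_inv_cancel: "g \<noteq> 0 \<Longrightarrow> conjg (inverse g) (conjg g x) = x" "g \<noteq> 0 \<Longrightarrow> conjg g (conjg (inverse g) x) = x"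
  by (simp_all add: conjg_conjg) (simp_all add: conjg_def)
lemma conjg_eq_iff: "g \<noteq> 0 \<Longrightarrow> conjg g x = y \<longleftrightarrow> g * x = y * g"
  unfolding conjg_def by (metis left_inverse mult.assoc mult_1_right right_inverse)
lemma conjg_fix_iff: "g \<noteq> 0 \<Longrightarrow> conjg g x = x \<longleftrightarrow> g * x = x * g"
  by (rule conjg_eq_iff)
lemma conjg_power: "g \<noteq> 0 \<Longrightarrow> conjg g (x ^ n) = conjg g x ^ n"
  by (induction n) (simp_all add: conjg_1 conjg_mult)
lemma conjg_sum: "conjg g (sum f I) = (\<Sum>i\<in>I. conjg g (f i))"
  by (simp add: conjg_def sum_distrib_left sum_distrib_right)
lemma conjg_eq_0: "g \<noteq> 0 \<Longrightarrow> conjg g x = 0 \<longleftrightarrow> x = 0" by (auto simp: conjg_def)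
lemma conjg_one: "conjg 1 x = x" by (simp add: conjg_def)
lemma conjg_powi: "g \<noteq> 0 \<Longrightarrow> conjg g (x powi n) = conjg g x powi n"
  by (auto simp: power_int_def conjg_power conjg_inverse power_inverse)
lemma commutator_conjg: "commutator x y = conjg x y * inverse y" by (simp add: commutator_def conjg_def)
lemma commutator_nonzero: "x \<noteq> 0 \<Longrightarrow> y \<noteq> 0 \<Longrightarrow> commutator x y \<noteq> 0" by (simp add: commutator_def)
lemma commutator_eq: "x \<noteq> 0 \<Longrightarrow> y \<noteq> 0 \<Longrightarrow> x * y = commutator x y * y * x"
  by (simp add: commutator_def mult.assoc)
lemma commutator_1_iff: "x \<noteq> 0 \<Longrightarrow> y \<noteq> 0 \<Longrightarrow> commutator x y = 1 \<longleftrightarrow> x * y = y * x"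
  by (metis commutator_eq commutator_conjg conjg_fix_iff mult_1 right_inverse)
lemma conjg_centralizer: assumes "g \<noteq> 0" "z \<in> centralizer S" shows "conjg g z \<in> centralizer (conjg g ` S)"
  using assms by (auto simp: centralizer_def simp flip: conjg_mult)

lemma normalizesD: "normalizes H S \<Longrightarrow> g \<in> H \<Longrightarrow> s \<in> S \<Longrightarrow> conjg g s \<in> S" by (auto simp: normalizes_def)

lemma normalizes_image: assumes "mult_group H" "normalizes H S" "g \<in> H" shows "conjg g ` S = S"
proof
  show "conjg g ` S \<subseteq> S" using assms by (auto simp: normalizes_def)
  show "S \<subseteq> conjg g ` S"
  proof
    fix s assume "s \<in> S"
    hence "conjg (inverse g) s \<in> S" using assms by (auto simp: normalizes_def mult_groupD)
    moreover have "s = conjg g (conjg (inverse g) s)" using assms by (simp add: conjg_inv_cancel mult_groupD)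
    ultimately show "s \<in> conjg g ` S" by blast
  qed
qed

lemma normalizes_centralizer: assumes "mult_group H" "normalizes H S" shows "normalizes H (centralizer S)"
  unfolding normalizes_def
  using assms conjg_centralizer[of _ _ S] normalizes_image[of H S] by (metis mult_groupD(3))

lemma normalizes_Int: "normalizes H S \<Longrightarrow> normalizes H T \<Longrightarrow> normalizes H (S \<inter> T)" by (auto simp: normalizes_def)
lemma normalizes_subset: "normalizes H S \<Longrightarrow> K \<subseteq> H \<Longrightarrow> normalizes K S" by (auto simp: normalizes_def)
lemma normalizes_self: "mult_group H \<Longrightarrow> normalizes H H" by (auto simp: normalizes_def mult_group_conjg)

section \<open>Linear systems and independence of characters\<close>

text \<open>Gaussian elimination by induction on the equations. The unknowns stand on the left of
  the coefficients, so equation \<open>i0\<close> is solved for \<open>c j0\<close> with the left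
  factors \<open>r j\<close>, and the other equations are solved for the remaining unknowns.\<close>

lemma homogeneous_system:
  fixes a :: "'j \<Rightarrow> 'i \<Rightarrow> 'a::division_ring"
  assumes "div_subring L" "finite I" "finite J" "card I < card J" "\<And>j i. j \<in> J \<Longrightarrow> i \<in> I \<Longrightarrow> a j i \<in> L"
  shows "\<exists>c. (\<forall>j\<in>J. c j \<in> L) \<and> (\<exists>j\<in>J. c j \<noteq> 0) \<and> (\<forall>i\<in>I. (\<Sum>j\<in>J. c j * a j i) = 0)"
  using assms(2-5)
proof (induction I arbitrary: J a rule: finite_induct)
  case empty
  then obtain j where "j \<in> J" by fastforce
  thus ?case using assms(1) by (intro exI[of _ "\<lambda>_. 1"]) (auto simp: div_subringD)
next
  case (insert i0 I)
  show ?case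
  proof (cases "\<forall>j\<in>J. a j i0 = 0")
    case True
    obtain c where "(\<forall>j\<in>J. c j \<in> L) \<and> (\<exists>j\<in>J. c j \<noteq> 0) \<and> (\<forall>i\<in>I. (\<Sum>j\<in>J. c j * a j i) = 0)"
      using insert.IH[of J a] insert by fastforce
    thus ?thesis using True by (intro exI[of _ c]) auto
  next
    case False
    then obtain j0 where j0: "j0 \<in> J" "a j0 i0 \<noteq> 0" by auto
    define r where "r j = a j i0 * inverse (a j0 i0)" for j
    have rL: "r j \<in> L" if "j \<in> J" for j using that insert.prems j0 assms(1) by (auto simp: r_def div_subringD)
    have cards: "card I < card (J - {j0})" using insert j0 by (simp add: card_Diff_singleton)
    obtain c where c: "\<forall>j\<in>J-{j0}. c j \<in> L" "\<exists>j\<in>J-{j0}. c j \<noteq> 0"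
       "\<forall>i\<in>I. (\<Sum>j\<in>J-{j0}. c j * (a j i - r j * a j0 i)) = 0"
      using insert.IH[of "J-{j0}" "\<lambda>j i. a j i - r j * a j0 i"] insert.prems cards j0 rL assms(1)
      by (auto simp: div_subringD div_subring_diff)
    define c' where "c' = c(j0 := - (\<Sum>j\<in>J-{j0}. c j * r j))"
    have eq: "(\<Sum>j\<in>J. c' j * a j i) = (\<Sum>j\<in>J-{j0}. c j * (a j i - r j * a j0 i))" for i
    proof -
      have "(\<Sum>j\<in>J. c' j * a j i) = c' j0 * a j0 i + (\<Sum>j\<in>J-{j0}. c' j * a j i)"
        using insert.prems j0 by (simp add: sum.remove)
      also have "(\<Sum>j\<in>J-{j0}. c' j * a j i) = (\<Sum>j\<in>J-{j0}. c j * a j i)"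
        by (rule sum.cong) (auto simp: c'_def)
      also have "c' j0 * a j0 i = - (\<Sum>j\<in>J-{j0}. c j * r j * a j0 i)"
        by (simp add: c'_def sum_distrib_right)
      finally show ?thesis by (simp add: algebra_simps sum_subtractf)
    qed
    have "(\<Sum>j\<in>J-{j0}. c j * r j) \<in> L" using c rL assms(1) by (intro div_subring_sum) (auto simp: div_subringD)
    hence "\<forall>j\<in>J. c' j \<in> L" using c assms(1) by (auto simp: c'_def div_subringD)
    moreover have "\<exists>j\<in>J. c' j \<noteq> 0" using c(2) by (auto simp: c'_def)
    moreover have "(\<Sum>j\<in>J. c' j * a j i) = 0" if "i \<in> insert i0 I" for i
    proof (cases "i = i0")
      case True
      thus ?thesis unfolding eq using j0 by (simp add: r_def mult.assoc)
    next
      case False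
      thus ?thesis unfolding eq using c that by auto
    qed
    ultimately show ?thesis by blast
  qed
qed

text \<open>Dedekind's independence of characters, with arbitrary coefficients on the right; only
  the values of the characters commute with each other. The operation is abstract because it is
  addition of exponents for roots of unity and multiplication elsewhere.\<close>

lemma dedekind:
  fixes \<theta> :: "'j \<Rightarrow> 'b \<Rightarrow> 'a::division_ring" and op :: "'b \<Rightarrow> 'b \<Rightarrow> 'b"
  assumes "finite J"
    and X: "\<And>q r. q \<in> X \<Longrightarrow> r \<in> X \<Longrightarrow> op q r \<in> X"
    and mult: "\<And>j q r. j \<in> J \<Longrightarrow> q \<in> X \<Longrightarrow> r \<in> X \<Longrightarrow> \<theta> j (op q r) = \<theta> j q * \<theta> j r"
    and comm: "\<And>j k q r. j \<in> J \<Longrightarrow> k \<in> J \<Longrightarrow> q \<in> X \<Longrightarrow> r \<in> X \<Longrightarrow> \<theta> j q * \<theta> k r = \<theta> k r * \<theta> j q"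
    and nonz: "\<And>j. j \<in> J \<Longrightarrow> \<exists>q\<in>X. \<theta> j q \<noteq> 0"
    and dist: "\<And>j k. j \<in> J \<Longrightarrow> k \<in> J \<Longrightarrow> j \<noteq> k \<Longrightarrow> \<exists>q\<in>X. \<theta> j q \<noteq> \<theta> k q"
    and zero: "\<And>q. q \<in> X \<Longrightarrow> (\<Sum>j\<in>J. \<theta> j q * g j) = 0"
    and "j \<in> J"
  shows "g j = 0"
proof -
  have main: "\<lbrakk>S \<subseteq> J; \<forall>q\<in>X. (\<Sum>j\<in>S. \<theta> j q * g j) = 0; j \<in> S\<rbrakk> \<Longrightarrow> g j = 0" if "finite S" for S g j
      using that
    proof (induction S arbitrary: g j rule: finite_induct)
      case (insert k S)
      have *: "g i = 0" if i: "i \<in> S" for i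
      proof -
        obtain r where r: "r \<in> X" "\<theta> i r \<noteq> \<theta> k r" using dist[of i k] insert i by blast
        have "(\<Sum>j\<in>S. \<theta> j q * ((\<theta> j r - \<theta> k r) * g j)) = 0" if q: "q \<in> X" for q
        proof -
          \<comment> \<open>The relation at \<open>op r q\<close> minus \<open>\<theta> k r\<close>
            times the relation at \<open>q\<close> has lost the term for \<open>k\<close>, and its
            coefficients are \<open>(\<theta> j r - \<theta> k r) * g j\<close>.\<close>
          have e1: "(\<Sum>j\<in>insert k S. \<theta> j (op r q) * g j) = 0" using insert.prems X r q by blast
          have e2: "\<theta> k r * (\<Sum>j\<in>insert k S. \<theta> j q * g j) = 0" using insert.prems q by simp
          have "(\<Sum>j\<in>insert k S. \<theta> j (op r q) * g j) = (\<Sum>j\<in>insert k S. \<theta> j q * (\<theta> j r * g j))"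
          proof (intro sum.cong refl)
            fix j assume "j \<in> insert k S"
            hence j: "j \<in> J" using insert.prems by blast
            show "\<theta> j (op r q) * g j = \<theta> j q * (\<theta> j r * g j)"
              using mult[OF j r(1) q] comm[OF j j r(1) q] by (simp add: mult.assoc[symmetric])
          qed
          moreover have "\<theta> k r * (\<Sum>j\<in>insert k S. \<theta> j q * g j) = (\<Sum>j\<in>insert k S. \<theta> j q * (\<theta> k r * g j))"
            unfolding sum_distrib_left
          proof (intro sum.cong refl)
            fix j assume "j \<in> insert k S"
            hence j: "j \<in> J" "k \<in> J" using insert.prems by auto
            show "\<theta> k r * (\<theta> j q * g j) = \<theta> j q * (\<theta> k r * g j)"
              using comm[OF j(2,1) r(1) q] by (simp add: mult.assoc[symmetric])
          qed
          ultimately have "(\<Sum>j\<in>insert k S. \<theta> j q * (\<theta> j r * g j) - \<theta> j q * (\<theta> k r * g j)) = 0"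
            using e1 e2 by (simp add: sum_subtractf)
          moreover have "\<theta> j q * (\<theta> j r * g j) - \<theta> j q * (\<theta> k r * g j) = \<theta> j q * ((\<theta> j r - \<theta> k r) * g j)" for j
            by (simp add: algebra_simps)
          ultimately show ?thesis using insert by simp
        qed
        hence "(\<theta> i r - \<theta> k r) * g i = 0" using insert.IH[of "\<lambda>j. (\<theta> j r - \<theta> k r) * g j" i] insert.prems i by auto
        thus ?thesis using r by simp
      qed
      hence "(\<Sum>j\<in>insert k S. \<theta> j q * g j) = \<theta> k q * g k" for q using insert by simp
      moreover have "k \<in> J" using insert.prems(1) by blast
      then obtain q where "q \<in> X" "\<theta> k q \<noteq> 0" using nonz by blast
      ultimately have "g k = 0" using insert.prems by auto
      thus ?case using * insert.prems by auto
    qed simp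
  show ?thesis using main[OF assms(1) subset_refl, of g j] zero \<open>j \<in> J\<close> by simp
qed

section \<open>Additive spans, layers and shortest representations\<close>

text \<open>Lists rather than coefficient functions, because the arguments below minimize the length
  of a representation.\<close>

definition add_span :: "'a::division_ring set \<Rightarrow> 'a set" where
  "add_span \<Gamma> = {sum_list xs | xs. set xs \<subseteq> \<Gamma>}"

lemma add_spanI: "set xs \<subseteq> \<Gamma> \<Longrightarrow> sum_list xs \<in> add_span \<Gamma>" by (auto simp: add_span_def)
lemma add_span_0: "0 \<in> add_span \<Gamma>" using add_spanI[of "[]"] by simp
lemma add_span_in: "x \<in> \<Gamma> \<Longrightarrow> x \<in> add_span \<Gamma>" using add_spanI[of "[x]"] by simp
lemma add_span_add: assumes "x \<in> add_span \<Gamma>" "y \<in> add_span \<Gamma>" shows "x + y \<in> add_span \<Gamma>"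
proof -
  obtain xs ys where "x = sum_list xs" "set xs \<subseteq> \<Gamma>" "y = sum_list ys" "set ys \<subseteq> \<Gamma>"
    using assms by (auto simp: add_span_def)
  thus ?thesis using add_spanI[of "xs @ ys"] by simp
qed
lemma add_span_sum: "(\<And>i. i \<in> I \<Longrightarrow> f i \<in> add_span \<Gamma>) \<Longrightarrow> sum f I \<in> add_span \<Gamma>"
  by (induction I rule: infinite_finite_induct) (auto simp: add_span_0 add_span_add)
lemma add_span_induct [consumes 1, case_names zero add]:
  assumes "a \<in> add_span \<Gamma>" "P 0" "\<And>g a. g \<in> \<Gamma> \<Longrightarrow> a \<in> add_span \<Gamma> \<Longrightarrow> P a \<Longrightarrow> P (g + a)"
  shows "P a"
proof -
  obtain xs where xs: "a = sum_list xs" "set xs \<subseteq> \<Gamma>" using assms by (auto simp: add_span_def)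
  have "P (sum_list xs)" using xs(2)
    by (induction xs) (auto simp: assms add_spanI)
  thus ?thesis using xs by simp
qed
lemma add_span_scale_left: assumes "\<And>g. g \<in> \<Gamma> \<Longrightarrow> l * g \<in> add_span \<Delta>" "a \<in> add_span \<Gamma>" shows "l * a \<in> add_span \<Delta>"
  using assms(2) by (induction rule: add_span_induct) (auto simp: add_span_0 add_span_add algebra_simps assms)
lemma add_span_scale_right: assumes "\<And>g. g \<in> \<Gamma> \<Longrightarrow> g * l \<in> add_span \<Delta>" "a \<in> add_span \<Gamma>" shows "a * l \<in> add_span \<Delta>"
  using assms(2) by (induction rule: add_span_induct) (auto simp: add_span_0 add_span_add algebra_simps assms)
lemma add_span_mult: assumes "mult_group \<Gamma>" "a \<in> add_span \<Gamma>" "b \<in> add_span \<Gamma>" shows "a * b \<in> add_span \<Gamma>"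
  using assms(3) by (rule add_span_scale_left[rotated])
    (rule add_span_scale_right[OF _ assms(2)], auto simp: add_span_in mult_groupD[OF assms(1)])
lemma add_span_conjg: assumes "normalizes H \<Gamma>" shows "normalizes H (add_span \<Gamma>)"
proof -
  have "conjg g a \<in> add_span \<Gamma>" if "g \<in> H" "a \<in> add_span \<Gamma>" for g a
    using that(2) by (induction rule: add_span_induct) (auto simp: conjg_0 conjg_add add_span_0 intro!: add_span_add[OF add_span_in] normalizesD[OF assms] that)
  thus ?thesis by (auto simp: normalizes_def)
qed

text \<open>\<open>\<Gamma>\<close> plays the role of the monomials of a crossed product over \<open>L\<close>, and \<open>add_span \<Gamma>\<close> that of its ring.\<close>

locale layer =
  fixes L \<Gamma> :: "'a::division_ring set"
  assumes L: "div_subring L" and \<Gamma>: "mult_group \<Gamma>" and sub: "L - {0} \<subseteq> \<Gamma>" and norm: "normalizes \<Gamma> L"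
begin

lemma L_in: "l \<in> L \<Longrightarrow> l \<noteq> 0 \<Longrightarrow> l \<in> \<Gamma>" using sub by auto

lemma L_add_span: "l \<in> L \<Longrightarrow> l \<in> add_span \<Gamma>" using L_in add_span_in add_span_0 by metis

lemma scale: "l \<in> L \<Longrightarrow> g \<in> \<Gamma> \<Longrightarrow> l \<noteq> 0 \<Longrightarrow> l * g \<in> \<Gamma>" using L_in mult_groupD[OF \<Gamma>] by metis

lemma add_span_minus: "a \<in> add_span \<Gamma> \<Longrightarrow> - a \<in> add_span \<Gamma>"
  using add_span_mult[OF \<Gamma>, of "-1" a] L_add_span[of "-1"] div_subringD[OF L] by simp

lemma add_span_diff: "a \<in> add_span \<Gamma> \<Longrightarrow> b \<in> add_span \<Gamma> \<Longrightarrow> a - b \<in> add_span \<Gamma>"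
  using add_span_add[of a \<Gamma> "-b"] add_span_minus by simp

lemma scale_list:
  assumes "set xs \<subseteq> \<Gamma>" "\<And>x. x \<in> set xs \<Longrightarrow> c x \<in> L"
  shows "\<exists>ys. set ys \<subseteq> \<Gamma> \<and> length ys \<le> length xs \<and> sum_list ys = (\<Sum>x\<leftarrow>xs. c x * x)"
  using assms
proof (induction xs)
  case (Cons x xs)
  then obtain ys where ys: "set ys \<subseteq> \<Gamma>" "length ys \<le> length xs" "sum_list ys = (\<Sum>x\<leftarrow>xs. c x * x)" by auto
  show ?case
  proof (cases "c x = 0")
    case True thus ?thesis using ys by (intro exI[of _ ys]) auto
  next
    case False
    thus ?thesis using ys Cons.prems scale[of "c x" x] by (intro exI[of _ "c x * x # ys"]) auto
  qed
qed auto

text \<open>A shortest representation as a sum splits into simultaneous eigenvectors.\<close>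

lemma eigen_split:
  assumes "a \<in> add_span \<Gamma>" "a \<noteq> 0"
  shows "\<exists>xs. xs \<noteq> [] \<and> set xs \<subseteq> \<Gamma> \<and> a = sum_list xs \<and>
     (\<forall>q\<in>L. \<forall>\<theta>\<in>L. a * q = \<theta> * a \<longrightarrow> (\<forall>g\<in>set xs. g * q = \<theta> * g))"
proof -
  let ?P = "\<lambda>n. \<exists>xs. length xs = n \<and> set xs \<subseteq> \<Gamma> \<and> a = sum_list xs"
  have "\<exists>n. ?P n" using assms by (auto simp: add_span_def)
  then obtain n where n: "?P n" and min: "\<And>m. m < n \<Longrightarrow> \<not> ?P m"
    using exists_least_iff[of ?P] by blast
  obtain xs where xs: "length xs = n" "set xs \<subseteq> \<Gamma>" "a = sum_list xs" using n by blast
  have "g * q = \<theta> * g" if q: "q \<in> L" "\<theta> \<in> L" "a * q = \<theta> * a" "g \<in> set xs" for q \<theta> g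
  proof (rule ccontr)
    assume ne: "g * q \<noteq> \<theta> * g"
    have gG: "g \<in> \<Gamma>" using xs q by auto
    have g0: "g \<noteq> 0" using mult_groupD(3)[OF \<Gamma> gG] .
    \<comment> \<open>\<open>a * q - \<theta>' * a\<close> equals
      \<open>(\<theta> - \<theta>') * a\<close>, and its term from \<open>g\<close> vanishes.
      Dividing by \<open>\<theta> - \<theta>'\<close> gives a shorter representation of
      \<open>a\<close>.\<close>
    define \<theta>' where "\<theta>' = conjg g q"
    have \<theta>': "\<theta>' \<in> L" using norm gG q by (auto simp: normalizes_def \<theta>'_def)
    have gq: "g * q = \<theta>' * g" using g0 by (metis \<theta>'_def conjg_eq_iff)
    obtain ys zs where s: "xs = ys @ g # zs" using q(4) by (auto simp: in_set_conv_decomp)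
    define c where "c x = conjg x q - \<theta>'" for x
    have cx: "c x * x = x * q - \<theta>' * x" if "x \<in> set xs" for x
    proof -
      have "x \<noteq> 0" using that xs mult_groupD(3)[OF \<Gamma>] by blast
      thus ?thesis unfolding c_def by (metis conjg_eq_iff left_diff_distrib)
    qed
    have sl: "a * q - \<theta>' * a = (\<Sum>x\<leftarrow>xs. c x * x)"
    proof -
      have "(\<Sum>x\<leftarrow>xs. c x * x) = (\<Sum>x\<leftarrow>xs. x * q - \<theta>' * x)"
        using cx by (intro arg_cong[of _ _ sum_list] map_cong) auto
      also have "\<dots> = sum_list xs * q - \<theta>' * sum_list xs"
        by (induction xs) (simp_all add: algebra_simps)
      finally show ?thesis using xs by simp
    qed
    have "c g * g = 0" using cx[OF q(4)] gq by simp
    hence "(\<Sum>x\<leftarrow>xs. c x * x) = (\<Sum>x\<leftarrow>ys @ zs. c x * x)" using s by simp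
    moreover have "\<exists>ws. set ws \<subseteq> \<Gamma> \<and> length ws \<le> length (ys@zs) \<and> sum_list ws = (\<Sum>x\<leftarrow>ys@zs. c x * x)"
      by (rule scale_list) (use xs s q \<theta>' norm L in \<open>auto simp: c_def normalizes_def intro!: div_subring_diff\<close>)
    ultimately obtain ws where ws: "set ws \<subseteq> \<Gamma>" "length ws < n" "sum_list ws = (\<theta> - \<theta>') * a"
      using sl q(3) s xs(1) by (auto simp: left_diff_distrib)
    have "\<theta> - \<theta>' \<noteq> 0" using ne gq by auto
    moreover from this have "\<exists>vs. set vs \<subseteq> \<Gamma> \<and> length vs \<le> length ws \<and> sum_list vs = (\<Sum>x\<leftarrow>ws. inverse (\<theta> - \<theta>') * x)"
      by (intro scale_list) (use ws q \<theta>' L in \<open>auto intro!: div_subring_diff div_subringD\<close>)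
    then obtain vs where vs: "set vs \<subseteq> \<Gamma>" "length vs < n" "sum_list vs = inverse (\<theta> - \<theta>') * sum_list ws"
      using ws by (auto simp: sum_list_const_mult)
    ultimately have "a = sum_list vs" using ws by (simp add: mult.assoc[symmetric])
    thus False using min[OF vs(2)] vs by blast
  qed
  moreover have "xs \<noteq> []" using assms xs by auto
  ultimately show ?thesis using xs by blast
qed

text \<open>Terms from one coset of \<open>L\<close> are merged:
  \<open>g + h = (g * inverse h + 1) * h\<close> is again a monomial, or zero when the coefficient
  vanishes.\<close>

lemma coset_rep:
  assumes "a \<in> add_span \<Gamma>"
  shows "\<exists>S. finite S \<and> S \<subseteq> \<Gamma> \<and> a = \<Sum>S \<and> (\<forall>g\<in>S. \<forall>h\<in>S. g \<noteq> h \<longrightarrow> g * inverse h \<notin> L)"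
  using assms
proof (induction rule: add_span_induct)
  case zero thus ?case by (intro exI[of _ "{}"]) auto
next
  case (add g a)
  then obtain S where S: "finite S" "S \<subseteq> \<Gamma>" "a = \<Sum>S" "\<forall>g\<in>S. \<forall>h\<in>S. g \<noteq> h \<longrightarrow> g * inverse h \<notin> L" by blast
  show ?case
  proof (cases "\<exists>h\<in>S. g * inverse h \<in> L")
    case False
    hence "h * inverse g \<notin> L" if "h \<in> S" for h
      using that S add mult_groupD(3)[OF \<Gamma>] div_subringD(6)[OF L, of "h * inverse g"]
      by (metis nonzero_inverse_mult_distrib nonzero_inverse_inverse_eq nonzero_imp_inverse_nonzero subsetD)
    moreover have "g \<notin> S" using False add mult_groupD[OF \<Gamma>] div_subringD(2)[OF L] by (metis right_inverse)
    ultimately show ?thesis using False S add by (intro exI[of _ "insert g S"]) auto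
  next
    case True
    then obtain h where h: "h \<in> S" "g * inverse h \<in> L" by blast
    have h0: "h \<noteq> 0" "h \<in> \<Gamma>" using h S mult_groupD(3)[OF \<Gamma>] by auto
    define l where "l = g * inverse h + 1"
    have l: "l \<in> L" using h L by (auto simp: l_def div_subringD)
    have eq: "g + a = l * h + \<Sum>(S - {h})"
      using S h h0 by (simp add: l_def algebra_simps mult.assoc sum.remove)
    show ?thesis
    proof (cases "l = 0")
      case True
      thus ?thesis using S eq by (intro exI[of _ "S - {h}"]) auto
    next
      case False
      have lh: "l * h \<in> \<Gamma>" using scale l False h0 by blast
      have a: "k * inverse (l * h) \<notin> L" "l * h * inverse k \<notin> L" if k: "k \<in> S" "k \<noteq> h" for k
      proof -
        have 1: "k * inverse h \<notin> L" "h * inverse k \<notin> L" using S h k by auto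
        have k0: "k \<in> \<Gamma>" "k \<noteq> 0" using k S mult_groupD(3)[OF \<Gamma>] by auto
        show "l * h * inverse k \<notin> L"
        proof
          assume "l * h * inverse k \<in> L"
          hence "inverse l * (l * h * inverse k) \<in> L" using l L by (auto simp: div_subringD)
          thus False using 1 False by (simp add: mult.assoc[symmetric])
        qed
        hence "inverse (l * h * inverse k) \<notin> L" using div_subringD(6)[OF L, of "inverse (l * h * inverse k)"] 
          by auto
        thus "k * inverse (l * h) \<notin> L" using False h0 k0
          by (simp add: nonzero_inverse_mult_distrib nonzero_inverse_inverse_eq mult.assoc)
      qed
      have "l * h \<notin> S - {h}" using a(1)[of "l*h"] div_subringD(2)[OF L] False h0 by auto
      hence "g + a = \<Sum>(insert (l * h) (S - {h}))" using S eq by simp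
      moreover have "\<forall>x\<in>insert (l * h) (S - {h}). \<forall>y\<in>insert (l * h) (S - {h}). x \<noteq> y \<longrightarrow> x * inverse y \<notin> L"
        using a S(4) by blast
      ultimately show ?thesis using S lh by (intro exI[of _ "insert (l * h) (S - {h})"]) blast
    qed
  qed
qed

end

section \<open>The Ore condition\<close>

text \<open>For \<open>n = 2 ^ k - 1\<close> the claim becomes \<open>k * s < 2 ^ k - 1\<close>. The
  choice \<open>k = 2 * t\<close> with \<open>t = 2 * s + 1\<close> works because
  \<open>(t + 1) ^ 2 \<le> 2 ^ k\<close>.\<close>

lemma ex_poly_less_exp: "\<exists>n::nat. (n + 1) ^ s < 2 ^ n"
proof -
  define t where "t = 2 * s + 1"
  define k where "k = 2 * t"
  have "t + 1 \<le> 2 ^ t" by (induction t) auto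
  hence "(t + 1) ^ 2 \<le> (2 ^ t) ^ 2" by (rule power_mono) simp
  hence "(t + 1) ^ 2 \<le> (2::nat) ^ k" by (simp add: k_def power_mult[symmetric] mult.commute)
  moreover have "k * s + 1 < (t + 1) ^ 2" unfolding k_def t_def by (simp add: power2_eq_square algebra_simps)
  ultimately have lt: "k * s + 1 < 2 ^ k" by linarith
  have "((2 ^ k - 1) + 1) ^ s = (2::nat) ^ (k * s)" by (simp add: power_mult)
  also have "\<dots> < 2 ^ (2 ^ k - 1)" using lt by (intro power_strict_increasing) auto
  finally show ?thesis by blast
qed

text \<open>These index the monomials of degree \<open>n\<close> once the order of the letters is
  forgotten.\<close>

definition msets :: "'b set \<Rightarrow> nat \<Rightarrow> 'b multiset set" where
  "msets S n = {M. set_mset M \<subseteq> S \<and> size M = n}"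

text \<open>A multiset is its vector of multiplicities on \<open>S\<close>, each between 0 and
  \<open>n\<close>.\<close>

lemma msets_card:
  assumes "finite S"
  shows "finite (msets S n)" "card (msets S n) \<le> (n + 1) ^ card S"
proof -
  let ?f = "\<lambda>M. restrict (count M) S"
  have inj: "inj_on ?f (msets S n)"
  proof (rule inj_onI)
    fix M N assume MN: "M \<in> msets S n" "N \<in> msets S n" "?f M = ?f N"
    show "M = N"
    proof (rule multiset_eqI)
      fix x show "count M x = count N x"
      proof (cases "x \<in> S")
        case True thus ?thesis using fun_cong[OF MN(3), of x] by simp
      next
        case False
        hence "x \<notin># M" "x \<notin># N" using MN by (auto simp: msets_def)
        thus ?thesis by (simp add: not_in_iff)
      qed
    qed
  qed
  have im: "?f ` msets S n \<subseteq> S \<rightarrow>\<^sub>E {0..n}"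
    using count_le_size by (fastforce simp: msets_def)
  have fin: "finite (S \<rightarrow>\<^sub>E {0..n})" using assms by (auto intro: finite_PiE)
  show "finite (msets S n)" using inj im fin by (metis finite_imageD finite_subset)
  have "card (msets S n) = card (?f ` msets S n)" using inj by (simp add: card_image)
  also have "\<dots> \<le> card (S \<rightarrow>\<^sub>E {0..n})" by (rule card_mono[OF fin im])
  also have "\<dots> = (n + 1) ^ card S" using assms by (simp add: card_PiE)
  finally show "card (msets S n) \<le> (n + 1) ^ card S" .
qed

text \<open>\<open>\<Gamma>\<close> is commutative modulo \<open>L\<close>, so a product of
  monomials depends on their order only up to a left factor from \<open>L\<close>. This keeps the
  growth polynomial.\<close>

locale abelian_layer = layer +
  assumes comm: "g \<in> \<Gamma> \<Longrightarrow> h \<in> \<Gamma> \<Longrightarrow> commutator g h \<in> L"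
begin

definition same_coset where "same_coset g h \<longleftrightarrow> g * inverse h \<in> L"

lemma same_coset_refl: "g \<in> \<Gamma> \<Longrightarrow> same_coset g g" using mult_groupD(3)[OF \<Gamma>, of g] div_subringD(2)[OF L] by (simp add: same_coset_def)

lemma same_coset_trans:
  assumes "g \<in> \<Gamma>" "h \<in> \<Gamma>" "k \<in> \<Gamma>" "same_coset g h" "same_coset h k" shows "same_coset g k"
proof -
  have "(g * inverse h) * (h * inverse k) \<in> L" using assms(4,5) unfolding same_coset_def by (rule div_subringD(4)[OF L])
  moreover have "(g * inverse h) * (h * inverse k) = g * inverse k"
    using mult_groupD(3)[OF \<Gamma> assms(2)] by (simp add: mult.assoc) (simp add: mult.assoc[symmetric])
  ultimately show ?thesis unfolding same_coset_def by simp
qed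

lemma same_coset_left: assumes "g \<in> \<Gamma>" "h \<in> \<Gamma>" "x \<in> \<Gamma>" "same_coset g h" shows "same_coset (x * g) (x * h)"
proof -
  have "conjg x (g * inverse h) \<in> L" using assms(4) norm assms(3) unfolding same_coset_def normalizes_def by auto
  thus ?thesis using mult_groupD(3)[OF \<Gamma> assms(3)] mult_groupD(3)[OF \<Gamma> assms(2)]
    by (simp add: same_coset_def conjg_def nonzero_inverse_mult_distrib mult.assoc)
qed

lemma same_coset_swap: assumes "g \<in> \<Gamma>" "h \<in> \<Gamma>" shows "same_coset (g * h) (h * g)"
  using comm[OF assms] mult_groupD(3)[OF \<Gamma>] assms
  by (simp add: same_coset_def commutator_def nonzero_inverse_mult_distrib mult.assoc)

lemma same_coset_right: assumes "g \<in> \<Gamma>" "h \<in> \<Gamma>" "x \<in> \<Gamma>" "same_coset g h" shows "same_coset (g * x) (h * x)"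
  using mult_groupD(3)[OF \<Gamma> assms(2)] mult_groupD(3)[OF \<Gamma> assms(3)] assms(4)
  by (simp add: same_coset_def nonzero_inverse_mult_distrib mult.assoc) (simp add: mult.assoc[symmetric])

lemma prod_list_in: "set xs \<subseteq> \<Gamma> \<Longrightarrow> prod_list xs \<in> \<Gamma>"
  by (induction xs) (auto simp: mult_groupD[OF \<Gamma>])

lemma same_coset_perm: "set xs \<subseteq> \<Gamma> \<Longrightarrow> mset xs = mset ys \<Longrightarrow> same_coset (prod_list xs) (prod_list ys)"
proof (induction xs arbitrary: ys)
  case Nil thus ?case using same_coset_refl mult_groupD(1)[OF \<Gamma>] by simp
next
  case (Cons x xs)
  have "x \<in> set ys" using Cons.prems(2) by (metis list.set_intros(1) set_mset_mset)
  then obtain us vs where ys: "ys = us @ x # vs" by (auto simp: in_set_conv_decomp)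
  have sG: "set us \<subseteq> \<Gamma>" "set vs \<subseteq> \<Gamma>" "x \<in> \<Gamma>" "set xs \<subseteq> \<Gamma>"
    using Cons.prems ys by (metis Un_subset_iff set_append set_mset_mset, metis Un_subset_iff set_append set_mset_mset insert_subset list.simps(15), auto)
  have "mset xs = mset (us @ vs)" using Cons.prems(2) ys by simp
  hence 1: "same_coset (prod_list xs) (prod_list us * prod_list vs)" using Cons.IH sG by (metis prod_list.append)
  have in': "prod_list xs \<in> \<Gamma>" "prod_list us \<in> \<Gamma>" "prod_list vs \<in> \<Gamma>" using sG by (simp_all add: prod_list_in)
  have 2: "same_coset (x * prod_list xs) (x * (prod_list us * prod_list vs))"
    by (rule same_coset_left) (use in' sG 1 mult_groupD[OF \<Gamma>] in auto)
  have 3: "same_coset ((x * prod_list us) * prod_list vs) ((prod_list us * x) * prod_list vs)"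
    by (rule same_coset_right[OF _ _ _ same_coset_swap]) (use in' sG mult_groupD[OF \<Gamma>] in auto)
  have "same_coset (x * prod_list xs) ((prod_list us * x) * prod_list vs)"
    by (rule same_coset_trans[OF _ _ _ 2]) (use 3 in' sG mult_groupD[OF \<Gamma>] in \<open>auto simp: mult.assoc\<close>)
  thus ?case using ys by (simp add: mult.assoc)
qed

text \<open>One ordering is chosen for each multiset; any other changes the product by a left factor
  from \<open>L\<close>.\<close>

definition rep :: "'a multiset \<Rightarrow> 'a" where "rep M = prod_list (SOME xs. mset xs = M)"

lemma rep_eq: assumes "set xs \<subseteq> \<Gamma>" shows "\<exists>l\<in>L. prod_list xs = l * rep (mset xs)" "rep (mset xs) \<in> \<Gamma>"
proof -
  define ys where "ys = (SOME ys. mset ys = mset xs)"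
  have ys: "mset ys = mset xs" unfolding ys_def by (rule someI) simp
  have r: "rep (mset xs) = prod_list ys" by (simp add: rep_def ys_def)
  have sy: "set ys \<subseteq> \<Gamma>" using ys assms by (metis set_mset_mset)
  show rG: "rep (mset xs) \<in> \<Gamma>" using r sy prod_list_in by simp
  have "same_coset (prod_list xs) (prod_list ys)" using same_coset_perm assms ys by simp
  thus "\<exists>l\<in>L. prod_list xs = l * rep (mset xs)"
    using mult_groupD(3)[OF \<Gamma> rG] unfolding r same_coset_def
    by (intro bexI[of _ "prod_list xs * inverse (prod_list ys)"]) (simp_all add: mult.assoc)
qed

text \<open>A left \<open>L\<close>-space spanned by \<open>card (msets S n)\<close> elements, a
  number that is polynomial in \<open>n\<close>.\<close>

definition layerspan :: "'a set \<Rightarrow> nat \<Rightarrow> 'a set" where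
  "layerspan S n = {(\<Sum>M\<in>msets S n. e M * rep M) | e. \<forall>M. e M \<in> L}"

lemma layerspan_0: "0 \<in> layerspan S n"
  using div_subringD(1)[OF L] by (auto simp: layerspan_def intro!: exI[of _ "\<lambda>_. 0"])

lemma layerspan_add: "a \<in> layerspan S n \<Longrightarrow> b \<in> layerspan S n \<Longrightarrow> a + b \<in> layerspan S n"
  unfolding layerspan_def
proof safe
  fix e f :: "'a multiset \<Rightarrow> 'a" assume "\<forall>M. e M \<in> L" "\<forall>M. f M \<in> L"
  thus "\<exists>g. (\<Sum>M\<in>msets S n. e M * rep M) + (\<Sum>M\<in>msets S n. f M * rep M) = (\<Sum>M\<in>msets S n. g M * rep M) \<and> (\<forall>M. g M \<in> L)"
    by (intro exI[of _ "\<lambda>M. e M + f M"]) (auto simp: div_subringD[OF L] sum.distrib distrib_right)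
qed

lemma layerspan_prod:
  assumes "finite S" "S \<subseteq> \<Gamma>" "set xs \<subseteq> S" "length xs = n" "l \<in> L"
  shows "l * prod_list xs \<in> layerspan S n"
proof -
  have "set xs \<subseteq> \<Gamma>" using assms by blast
  then obtain k where k: "k \<in> L" "prod_list xs = k * rep (mset xs)" using rep_eq(1) by blast
  have "mset xs \<in> msets S n" using assms by (auto simp: msets_def)
  hence "(\<Sum>M\<in>msets S n. (if M = mset xs then l * k else 0) * rep M) = l * prod_list xs"
    using msets_card(1)[OF assms(1), of n] k(2)
    by (simp add: if_distrib[of "\<lambda>z. z * _"] sum.delta mult.assoc cong: if_cong)
  thus ?thesis unfolding layerspan_def using k assms div_subringD[OF L]
    by (intro CollectI exI[of _ "\<lambda>M. if M = mset xs then l * k else 0"]) auto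
qed

text \<open>The head of the list is the rightmost factor, so that sorting words by their head writes
  a combination of words of length \<open>n + 1\<close> as \<open>u * a + v * b\<close>.\<close>

fun word where
  "word a b [] = 1"
| "word a b (x # w) = word a b w * (if x then a else (b::'a))"

lemma layerspan_word:
  assumes "finite S" "S \<subseteq> \<Gamma>" "set xa \<subseteq> S" "set xb \<subseteq> S" "length w = n"
  shows "word (sum_list xa) (sum_list xb) w \<in> layerspan S n"
proof -
  let ?X = "\<lambda>n. {prod_list xs | xs. set xs \<subseteq> S \<and> length xs = n}"
  have "word (sum_list xa) (sum_list xb) w \<in> add_span (?X n)" using assms(5)
  proof (induction w arbitrary: n)
    case Nil thus ?case by (intro add_span_in) auto
  next
    case (Cons x w)
    then obtain m where m: "n = Suc m" "length w = m" by auto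
    have *: "g * sum_list ys \<in> add_span (?X n)" if "set ys \<subseteq> S" and gX: "g \<in> ?X m" for ys g
      using that(1)
    proof (induction ys)
      case (Cons y ys)
      obtain xs where xs: "g = prod_list xs" "set xs \<subseteq> S" "length xs = m" using gX by blast
      have "g * y \<in> ?X n" using xs Cons.prems m by (intro CollectI exI[of _ "xs @ [y]"]) auto
      thus ?case using Cons by (simp add: distrib_left add_span_add add_span_in)
    qed (auto simp: add_span_0)
    have w: "word (sum_list xa) (sum_list xb) w \<in> add_span (?X m)" using Cons.IH m by blast
    have "word (sum_list xa) (sum_list xb) w * sum_list ys \<in> add_span (?X n)" if "set ys \<subseteq> S" for ys
      by (rule add_span_scale_right[OF _ w]) (rule *[OF that])
    thus ?case using assms(3,4) by (cases x) simp_all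
  qed
  thus ?thesis
  proof (induction rule: add_span_induct)
    case (add g a)
    thus ?case using layerspan_prod[OF assms(1,2), of _ n 1] div_subringD(2)[OF L] by (auto intro!: layerspan_add)
  qed (rule layerspan_0)
qed

lemma word_add_span: "a \<in> add_span \<Gamma> \<Longrightarrow> b \<in> add_span \<Gamma> \<Longrightarrow> word a b w \<in> add_span \<Gamma>"
  by (induction w) (auto simp: add_span_in mult_groupD[OF \<Gamma>] add_span_mult[OF \<Gamma>])

text \<open>If \<open>a\<close> and \<open>b\<close> had no common left multiple, the \<open>2 ^ n\<close> words of length \<open>n\<close> in them would
  be left independent over \<open>L\<close>, whereas they lie in a space of polynomially bounded dimension.\<close>

lemma ore:
  assumes a: "a \<in> add_span \<Gamma>" "a \<noteq> 0" and b: "b \<in> add_span \<Gamma>" "b \<noteq> 0"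
  shows "\<exists>u\<in>add_span \<Gamma>. \<exists>v\<in>add_span \<Gamma>. u \<noteq> 0 \<and> v \<noteq> 0 \<and> u * a = v * b"
proof (rule ccontr)
  assume no: "\<not> ?thesis"
  \<comment> \<open>Without a common left multiple, \<open>a\<close> and \<open>b\<close> are left
    independent even over \<open>add_span \<Gamma>\<close>, which is what the induction over words
    uses.\<close>
  have free: "u = 0 \<and> v = 0" if "u \<in> add_span \<Gamma>" "v \<in> add_span \<Gamma>" "u * a + v * b = 0" for u v
  proof (rule ccontr)
    assume ne: "\<not> (u = 0 \<and> v = 0)"
    have e: "u * a = (- v) * b" using that(3) by (simp add: eq_neg_iff_add_eq_0)
    hence "u \<noteq> 0" "- v \<noteq> 0" using ne a b by (auto simp: eq_neg_iff_add_eq_0)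
    thus False using no e that(1) add_span_minus[OF that(2)] by blast
  qed
  have indep: "c w = 0" if "\<And>w. c w \<in> L" "(\<Sum>w\<in>{w. length w = n}. c w * word a b w) = 0" "length w = n" for n c w
    using that
  proof (induction n arbitrary: c w)
    case 0
    hence "{w::bool list. length w = 0} = {[]}" by auto
    thus ?case using 0 by simp
  next
    case (Suc n)
    let ?W = "{w::bool list. length w = n}"
    have fin: "finite ?W" using finite_lists_length_eq[of "UNIV::bool set" n] by simp
    have split: "{w::bool list. length w = Suc n} = (Cons True ` ?W) \<union> (Cons False ` ?W)"
    proof (intro equalityI subsetI)
      fix w :: "bool list" assume "w \<in> {w. length w = Suc n}"
      then obtain x v where "w = x # v" "length v = n" by (auto simp: length_Suc_conv)
      thus "w \<in> (Cons True ` ?W) \<union> (Cons False ` ?W)" by (cases x) auto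
    qed auto
    define u where "u = (\<Sum>w\<in>?W. c (True # w) * word a b w)"
    define v where "v = (\<Sum>w\<in>?W. c (False # w) * word a b w)"
    have "u \<in> add_span \<Gamma>" "v \<in> add_span \<Gamma>" unfolding u_def v_def
      using Suc.prems(1) L_add_span word_add_span[OF a(1) b(1)] add_span_mult[OF \<Gamma>] by (auto intro!: add_span_sum)
    moreover have "(\<Sum>w\<in>{w. length w = Suc n}. c w * word a b w) = u * a + v * b"
      unfolding split u_def v_def
      by (subst sum.union_disjoint) (auto simp: fin sum.reindex sum_distrib_right mult.assoc)
    ultimately have uv: "u = 0" "v = 0" using free[of u v] Suc.prems(2) by auto
    obtain x w' where w: "w = x # w'" "length w' = n" using Suc.prems(3) by (auto simp: length_Suc_conv)
    show ?case
    proof (cases x)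
      case True
      have "c (True # w') = 0" by (rule Suc.IH[of "\<lambda>w. c (True # w)"]) (use Suc.prems(1) uv w u_def in auto)
      thus ?thesis using w True by simp
    next
      case False
      have "c (False # w') = 0" by (rule Suc.IH[of "\<lambda>w. c (False # w)"]) (use Suc.prems(1) uv w v_def in auto)
      thus ?thesis using w False by simp
    qed
  qed
  obtain xa xb where x: "a = sum_list xa" "set xa \<subseteq> \<Gamma>" "b = sum_list xb" "set xb \<subseteq> \<Gamma>"
    using a b by (auto simp: add_span_def)
  define S where "S = set xa \<union> set xb"
  have S: "finite S" "S \<subseteq> \<Gamma>" "set xa \<subseteq> S" "set xb \<subseteq> S" using x by (auto simp: S_def)
  obtain n where n: "(n + 1) ^ card S < 2 ^ n" using ex_poly_less_exp by blast
  let ?W = "{w::bool list. length w = n}"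
  have W: "finite ?W" "card ?W = 2 ^ n"
    using finite_lists_length_eq[of "UNIV::bool set" n] card_lists_length_eq[of "UNIV::bool set" n] by simp_all
  have "\<forall>w\<in>?W. \<exists>e. (\<forall>M. e M \<in> L) \<and> word a b w = (\<Sum>M\<in>msets S n. e M * rep M)"
    using layerspan_word[OF S] x unfolding layerspan_def by blast
  then obtain e where e: "\<And>w M. w \<in> ?W \<Longrightarrow> e w M \<in> L"
      "\<And>w. w \<in> ?W \<Longrightarrow> word a b w = (\<Sum>M\<in>msets S n. e w M * rep M)" by metis
  \<comment> \<open>There are \<open>2 ^ n\<close> unknowns, one per word, and at most
    \<open>(n + 1) ^ card S\<close> equations, one per multiset.\<close>
  have "\<exists>c. (\<forall>w\<in>?W. c w \<in> L) \<and> (\<exists>w\<in>?W. c w \<noteq> 0) \<and> (\<forall>M\<in>msets S n. (\<Sum>w\<in>?W. c w * e w M) = 0)"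
    by (rule homogeneous_system[OF L]) (use msets_card[OF S(1), of n] W n e in auto)
  then obtain c where c: "\<forall>w\<in>?W. c w \<in> L" "\<exists>w\<in>?W. c w \<noteq> 0" "\<forall>M\<in>msets S n. (\<Sum>w\<in>?W. c w * e w M) = 0"
    by blast
  have "(\<Sum>w\<in>?W. c w * word a b w) = (\<Sum>w\<in>?W. \<Sum>M\<in>msets S n. c w * e w M * rep M)"
    using e(2) by (intro sum.cong) (auto simp: sum_distrib_left mult.assoc)
  also have "\<dots> = (\<Sum>M\<in>msets S n. (\<Sum>w\<in>?W. c w * e w M) * rep M)"
    by (subst sum.swap) (simp add: sum_distrib_right)
  also have "\<dots> = 0" using c(3) by simp
  finally have z: "(\<Sum>w\<in>?W. c w * word a b w) = 0" .
  \<comment> \<open>\<open>indep\<close> expects a coefficient in \<open>L\<close> for words of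
    every length, so \<open>c\<close> is continued by zero.\<close>
  define c' where "c' w = (if w \<in> ?W then c w else 0)" for w
  have "(\<Sum>w\<in>?W. c' w * word a b w) = (\<Sum>w\<in>?W. c w * word a b w)"
    by (rule sum.cong) (auto simp: c'_def)
  hence z: "(\<Sum>w\<in>?W. c' w * word a b w) = 0" using z by simp
  have "c' w = 0" if "w \<in> ?W" for w
    by (rule indep[OF _ z]) (use c div_subringD(1)[OF L] that in \<open>auto simp: c'_def\<close>)
  thus False using c(2) by (auto simp: c'_def)
qed

text \<open>The left quotients \<open>inverse f * g\<close> of elements of the span.\<close>

definition fractions where "fractions = {d. \<exists>f\<in>add_span \<Gamma>. f \<noteq> 0 \<and> f * d \<in> add_span \<Gamma>}"

lemma fractionsI: "f \<in> add_span \<Gamma> \<Longrightarrow> f \<noteq> 0 \<Longrightarrow> f * d \<in> add_span \<Gamma> \<Longrightarrow> d \<in> fractions" by (auto simp: fractions_def)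

lemma add_span_fractions: "add_span \<Gamma> \<subseteq> fractions"
  using add_span_in[OF mult_groupD(1)[OF \<Gamma>]] by (auto intro!: fractionsI[of 1])

lemma \<Gamma>_fractions: "\<Gamma> \<subseteq> fractions" using add_span_in add_span_fractions by blast

text \<open>For a product the Ore condition carries the numerator \<open>f * x\<close> past the
  denominator of \<open>y\<close>; for a sum it supplies a common denominator.\<close>

lemma div_subring_fractions: "div_subring fractions"
proof -
  have neg: "- x \<in> fractions" if x: "x \<in> fractions" for x
  proof -
    obtain f where "f \<in> add_span \<Gamma>" "f \<noteq> 0" "f * x \<in> add_span \<Gamma>" using x by (auto simp: fractions_def)
    thus ?thesis using add_span_minus[of "f * x"] by (intro fractionsI[of f]) simp_all
  qed
  have inv: "inverse x \<in> fractions" if x: "x \<in> fractions" for x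
  proof (cases "x = 0")
    case True thus ?thesis using x by simp
  next
    case False
    obtain f where "f \<in> add_span \<Gamma>" "f \<noteq> 0" "f * x \<in> add_span \<Gamma>" using x by (auto simp: fractions_def)
    thus ?thesis using False by (intro fractionsI[of "f * x"]) (simp_all add: mult.assoc)
  qed
  have mul: "x * y \<in> fractions" if xy: "x \<in> fractions" "y \<in> fractions" for x y
  proof (cases "x = 0")
    case True thus ?thesis using xy by simp
  next
    case False
    obtain f where f: "f \<in> add_span \<Gamma>" "f \<noteq> 0" "f * x \<in> add_span \<Gamma>" using xy by (auto simp: fractions_def)
    obtain g where g: "g \<in> add_span \<Gamma>" "g \<noteq> 0" "g * y \<in> add_span \<Gamma>" using xy by (auto simp: fractions_def)
    have "f * x \<noteq> 0" using f False by simp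
    then obtain u v where uv: "u \<in> add_span \<Gamma>" "v \<in> add_span \<Gamma>" "u \<noteq> 0" "u * (f * x) = v * g"
      using ore[OF f(3) _ g(1,2)] by blast
    have "u * f * (x * y) = u * (f * x) * y" by (simp add: mult.assoc)
    also have "\<dots> = v * (g * y)" unfolding uv(4) by (simp add: mult.assoc)
    also have "\<dots> \<in> add_span \<Gamma>" using uv g add_span_mult[OF \<Gamma>] by blast
    finally have "u * f * (x * y) \<in> add_span \<Gamma>" .
    moreover have "u * f \<in> add_span \<Gamma>" using uv(1) f(1) add_span_mult[OF \<Gamma>] by blast
    ultimately show ?thesis using uv f by (intro fractionsI[of "u * f"]) simp_all
  qed
  have add: "x + y \<in> fractions" if xy: "x \<in> fractions" "y \<in> fractions" for x y
  proof -
    obtain f where f: "f \<in> add_span \<Gamma>" "f \<noteq> 0" "f * x \<in> add_span \<Gamma>" using xy by (auto simp: fractions_def)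
    obtain g where g: "g \<in> add_span \<Gamma>" "g \<noteq> 0" "g * y \<in> add_span \<Gamma>" using xy by (auto simp: fractions_def)
    obtain u v where uv: "u \<in> add_span \<Gamma>" "v \<in> add_span \<Gamma>" "u \<noteq> 0" "u * f = v * g"
      using ore[OF f(1,2) g(1,2)] by blast
    have uf0: "u * f \<noteq> 0" using uv(3) f(2) by simp
    have "u * f * (x + y) = u * (f * x) + u * f * y" by (simp add: mult.assoc distrib_left)
    also have "\<dots> = u * (f * x) + v * (g * y)" unfolding uv(4) by (simp add: mult.assoc)
    also have "\<dots> \<in> add_span \<Gamma>" using uv(1,2) f(3) g(3) add_span_mult[OF \<Gamma>] add_span_add by blast
    finally have "u * f * (x + y) \<in> add_span \<Gamma>" .
    moreover have "u * f \<in> add_span \<Gamma>" using uv(1) f(1) add_span_mult[OF \<Gamma>] by blast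
    ultimately show ?thesis using uf0 by (intro fractionsI[of "u * f"])
  qed
  have "0 \<in> fractions" "1 \<in> fractions" using \<Gamma>_fractions mult_groupD(1)[OF \<Gamma>] add_span_fractions add_span_0 by auto
  thus ?thesis unfolding div_subring_def is_subring_def by (auto intro: neg inv mul add)
qed

lemma fractions_least: assumes "div_subring R" "\<Gamma> \<subseteq> R" shows "fractions \<subseteq> R"
proof -
  have spnR: "a \<in> R" if "a \<in> add_span \<Gamma>" for a
    using that by (induction rule: add_span_induct) (use assms in \<open>auto simp: div_subringD\<close>)
  show ?thesis
  proof
    fix d assume "d \<in> fractions"
    then obtain f where "f \<in> add_span \<Gamma>" "f \<noteq> 0" "f * d \<in> add_span \<Gamma>" by (auto simp: fractions_def)
    hence "inverse f * (f * d) \<in> R" using spnR[of f] spnR[of "f * d"] by (simp add: div_subringD(4,6)[OF assms(1)])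
    thus "d \<in> R" using \<open>f \<noteq> 0\<close> by (simp add: mult.assoc[symmetric])
  qed
qed

lemma fractions_normal: assumes "normalizes H \<Gamma>" "0 \<notin> H" shows "normalizes H fractions"
proof -
  have "conjg g d \<in> fractions" if gd: "g \<in> H" "d \<in> fractions" for g d
  proof -
    have g0: "g \<noteq> 0" using gd assms by auto
    obtain f where f: "f \<in> add_span \<Gamma>" "f \<noteq> 0" "f * d \<in> add_span \<Gamma>" using gd by (auto simp: fractions_def)
    have "conjg g f \<in> add_span \<Gamma>" "conjg g f * conjg g d \<in> add_span \<Gamma>"
      using normalizesD[OF add_span_conjg[OF assms(1)] gd(1)] f by (auto simp: conjg_mult[OF g0, symmetric])
    thus ?thesis using f g0 by (intro fractionsI[of "conjg g f"]) (simp_all add: conjg_eq_0)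
  qed
  thus ?thesis by (auto simp: normalizes_def)
qed

text \<open>Elements of the quotient division ring that conjugate \<open>Q\<close> into \<open>L\<close> lie in \<open>\<Gamma>\<close>.  The denominators
  \<open>f\<close> of \<open>d\<close> form a left ideal stable under right multiplication by \<open>d Q d\<inverse>\<close>, so a shortest one commutes
  with \<open>d Q d\<inverse>\<close>.\<close>

lemma conj_into_layer:
  assumes Q: "Q \<subseteq> L" and H: "add_span \<Gamma> \<inter> centralizer Q \<subseteq> insert 0 \<Gamma>"
    and d: "d \<in> fractions" "d \<noteq> 0" "\<And>q. q \<in> Q \<Longrightarrow> conjg d q \<in> L"
  shows "d \<in> \<Gamma>"
proof -
  let ?J = "\<lambda>f. f \<in> add_span \<Gamma> \<and> f * d \<in> add_span \<Gamma>"
  let ?P = "\<lambda>n. \<exists>xs. length xs = n \<and> set xs \<subseteq> \<Gamma> \<and> sum_list xs \<noteq> 0 \<and> ?J (sum_list xs)"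
  obtain f where "f \<in> add_span \<Gamma>" "f \<noteq> 0" "f * d \<in> add_span \<Gamma>" using d by (auto simp: fractions_def)
  hence "\<exists>n. ?P n" by (auto simp: add_span_def)
  then obtain n where n: "?P n" and min: "\<And>m. m < n \<Longrightarrow> \<not> ?P m"
    using exists_least_iff[of ?P] by blast
  then obtain xs where xs: "length xs = n" "set xs \<subseteq> \<Gamma>" "sum_list xs \<noteq> 0" "?J (sum_list xs)" by blast
  then obtain x zs where xz: "xs = x # zs" by (cases xs) auto
  have x: "x \<in> \<Gamma>" "x \<noteq> 0" using xs xz mult_groupD(3)[OF \<Gamma>] by auto
  \<comment> \<open>Dividing by the first monomial turns one term into 1, which commutes with
    everything.\<close>
  define f where "f = inverse x * sum_list xs"
  define ys where "ys = map ((*) (inverse x)) zs"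
  have ix: "inverse x \<in> \<Gamma>" using x mult_groupD(5)[OF \<Gamma>] by blast
  have f: "f = 1 + sum_list ys" using x by (simp add: f_def ys_def xz distrib_left sum_list_const_mult)
  have ys: "set ys \<subseteq> \<Gamma>" "length ys < n" using xs xz ix mult_groupD[OF \<Gamma>] by (auto simp: ys_def)
  have fJ: "?J f" using xs(4) ix add_span_in add_span_mult[OF \<Gamma>] unfolding f_def mult.assoc by blast
  have f0: "f \<noteq> 0" using x xs by (simp add: f_def)
  have J_left: "?J (l * g)" if "l \<in> L" "?J g" for l g
    using that L_add_span add_span_mult[OF \<Gamma>] by (simp add: mult.assoc)
  have J_right: "?J (g * conjg d q)" if "q \<in> Q" "?J g" for g q
  proof -
    have "g * conjg d q * d = g * d * q" using d(2) by (simp add: conjg_def mult.assoc)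
    thus ?thesis using that d(3)[of q] Q L_add_span add_span_mult[OF \<Gamma>] by auto
  qed
  \<comment> \<open>The additive commutator of \<open>f\<close> with \<open>conjg d q\<close> loses
    the term 1 and is still a denominator of \<open>d\<close> or zero. Minimality leaves only
    zero.\<close>
  have fcomm: "f * conjg d q = conjg d q * f" if q: "q \<in> Q" for q
  proof (rule ccontr)
    assume ne: "f * conjg d q \<noteq> conjg d q * f"
    define \<theta> where "\<theta> = conjg d q"
    have \<theta>: "\<theta> \<in> L" using d q \<theta>_def by simp
    have "f * \<theta> - \<theta> * f = (\<Sum>y\<leftarrow>ys. (conjg y \<theta> - \<theta>) * y)"
    proof -
      have "(\<Sum>y\<leftarrow>ys. (conjg y \<theta> - \<theta>) * y) = (\<Sum>y\<leftarrow>ys. y * \<theta> - \<theta> * y)"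
      proof (intro arg_cong[of _ _ sum_list] map_cong refl)
        fix y assume "y \<in> set ys"
        hence "y \<noteq> 0" using ys mult_groupD(3)[OF \<Gamma>] by blast
        thus "(conjg y \<theta> - \<theta>) * y = y * \<theta> - \<theta> * y" by (metis conjg_eq_iff left_diff_distrib)
      qed
      also have "\<dots> = sum_list ys * \<theta> - \<theta> * sum_list ys"
        by (induction ys) (simp_all add: algebra_simps)
      finally show ?thesis unfolding f by (simp add: algebra_simps)
    qed
    moreover have "\<exists>ws. set ws \<subseteq> \<Gamma> \<and> length ws \<le> length ys \<and> sum_list ws = (\<Sum>y\<leftarrow>ys. (conjg y \<theta> - \<theta>) * y)"
      by (rule scale_list) (use ys norm \<theta> L in \<open>auto simp: normalizes_def intro!: div_subring_diff\<close>)
    ultimately obtain ws where ws: "set ws \<subseteq> \<Gamma>" "length ws < n" "sum_list ws = f * \<theta> - \<theta> * f"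
      using ys(2) by auto
    have "?J (f * \<theta> - \<theta> * f)"
      using J_right[OF q fJ] J_left[OF \<theta> fJ] add_span_diff unfolding \<theta>_def[symmetric]
      by (simp add: left_diff_distrib)
    moreover have "f * \<theta> - \<theta> * f \<noteq> 0" using ne by (simp add: \<theta>_def)
    ultimately show False using min[OF ws(2)] ws by metis
  qed
  define g where "g = f * d"
  have g: "g \<in> add_span \<Gamma>" "g \<noteq> 0" using fJ f0 d by (auto simp: g_def)
  have gq: "g * q = conjg d q * g" if q: "q \<in> Q" for q
  proof -
    have "g * q = f * (conjg d q * d)" using d(2) by (simp add: g_def conjg_def mult.assoc)
    also have "\<dots> = conjg d q * g" using fcomm[OF q] by (simp add: g_def mult.assoc[symmetric])
    finally show ?thesis .
  qed
  \<comment> \<open>\<open>g\<close> intertwines \<open>q\<close> with \<open>conjg d q\<close>,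
    hence so does each monomial of a shortest sum for it. One of them, \<open>\<gamma>\<close>,
    therefore conjugates \<open>Q\<close> exactly as \<open>d\<close> does.\<close>
  obtain gs where gs: "gs \<noteq> []" "set gs \<subseteq> \<Gamma>"
     "\<forall>q\<in>L. \<forall>\<theta>\<in>L. g * q = \<theta> * g \<longrightarrow> (\<forall>h\<in>set gs. h * q = \<theta> * h)"
    using eigen_split[OF g] by blast
  define \<gamma> where "\<gamma> = hd gs"
  have "hd gs \<in> \<Gamma>" using gs(1,2) by auto
  hence \<gamma>: "\<gamma> \<in> \<Gamma>" "\<gamma> \<noteq> 0" using mult_groupD(3)[OF \<Gamma>] by (auto simp: \<gamma>_def)
  have \<gamma>q: "\<gamma> * q = conjg d q * \<gamma>" if q: "q \<in> Q" for q
    using gs q Q d(3) gq by (auto simp: \<gamma>_def)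
  have i\<gamma>: "inverse \<gamma> \<in> \<Gamma>" using \<gamma> mult_groupD(5)[OF \<Gamma>] by blast
  \<comment> \<open>Conjugation by \<open>\<gamma>\<close> carries \<open>f\<close> into the
    centralizer of \<open>Q\<close>, where \<open>H\<close> makes it a monomial. The quotient
    \<open>inverse \<gamma> * d\<close> also centralizes \<open>Q\<close> and is treated in the same
    way below.\<close>
  have key: "inverse \<gamma> * h * \<gamma> \<in> centralizer Q" if "\<And>q. q \<in> Q \<Longrightarrow> h * conjg d q = conjg d q * h" for h
  proof (rule centralizerI)
    fix q assume q: "q \<in> Q"
    have "inverse \<gamma> * h * \<gamma> * q = inverse \<gamma> * (h * conjg d q) * \<gamma>" using \<gamma>q[OF q] by (simp add: mult.assoc)
    also have "\<dots> = inverse \<gamma> * conjg d q * (\<gamma> * (inverse \<gamma> * (h * \<gamma>)))" using that[OF q] \<gamma>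
      by (simp add: mult.assoc) (simp add: mult.assoc[symmetric])
    also have "inverse \<gamma> * conjg d q * (\<gamma> * (inverse \<gamma> * (h * \<gamma>))) = inverse \<gamma> * (conjg d q * \<gamma>) * (inverse \<gamma> * h * \<gamma>)"
      by (simp add: mult.assoc)
    also have "\<dots> = q * (inverse \<gamma> * h * \<gamma>)" using \<gamma>q[OF q, symmetric] \<gamma> by (simp add: mult.assoc[symmetric])
    finally show "inverse \<gamma> * h * \<gamma> * q = q * (inverse \<gamma> * h * \<gamma>)" .
  qed
  have "inverse \<gamma> * f * \<gamma> \<in> add_span \<Gamma>"
    using fJ \<gamma>(1) i\<gamma> add_span_in[of \<gamma> \<Gamma>] add_span_in[of "inverse \<gamma>" \<Gamma>] add_span_mult[OF \<Gamma>] by simp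
  hence "inverse \<gamma> * f * \<gamma> \<in> \<Gamma>" using key[OF fcomm] H f0 \<gamma>(2) by auto
  hence "\<gamma> * (inverse \<gamma> * f * \<gamma>) * inverse \<gamma> \<in> \<Gamma>" using \<gamma> i\<gamma> by (simp add: mult_groupD(4)[OF \<Gamma>])
  hence fG: "f \<in> \<Gamma>" using \<gamma> by (simp add: mult.assoc) (simp add: mult.assoc[symmetric])
  have "d = inverse f * g" using f0 by (simp add: g_def mult.assoc[symmetric])
  hence dspn: "d \<in> add_span \<Gamma>" using fG g add_span_in mult_groupD(5)[OF \<Gamma>] add_span_mult[OF \<Gamma>] by metis
  have "inverse \<gamma> * d \<in> centralizer Q"
  proof (rule centralizerI)
    fix q assume q: "q \<in> Q"
    have "inverse \<gamma> * d * q = inverse \<gamma> * (conjg d q * d)" using d(2) by (simp add: conjg_def mult.assoc)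
    also have "\<dots> = inverse \<gamma> * (conjg d q * \<gamma>) * (inverse \<gamma> * d)" using \<gamma>
      by (simp add: mult.assoc) (simp add: mult.assoc[symmetric])
    also have "\<dots> = q * (inverse \<gamma> * d)" using \<gamma>q[OF q, symmetric] \<gamma> by (simp add: mult.assoc[symmetric])
    finally show "inverse \<gamma> * d * q = q * (inverse \<gamma> * d)" .
  qed
  moreover have "inverse \<gamma> * d \<in> add_span \<Gamma>" using i\<gamma> dspn add_span_in add_span_mult[OF \<Gamma>] by blast
  ultimately have "inverse \<gamma> * d \<in> \<Gamma>" using H \<gamma> d(2) by auto
  hence "\<gamma> * (inverse \<gamma> * d) \<in> \<Gamma>" using \<gamma> by (simp add: mult_groupD(4)[OF \<Gamma>])
  thus ?thesis using \<gamma> by (simp add: mult.assoc[symmetric])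
qed

end

text \<open>The conjugates \<open>s\<close> and \<open>t\<close> of \<open>a\<close> under
  \<open>b\<close> and \<open>1 + b\<close> satisfy \<open>a - t = (t - s) * b\<close>. If they
  differ, \<open>b\<close> is a quotient of elements of \<open>L\<close>; if they agree,
  \<open>a\<close> commutes with \<open>b\<close>. An element of \<open>L\<close> is a difference of
  two elements outside \<open>L\<close>.\<close>

lemma cartan_brauer_hua:
  assumes "div_subring L" "div_subring D1" "L \<subset> D1" "normalizes (D1 - {0}) L"
  shows "L \<subseteq> centralizer D1"
proof -
  have *: "a * b = b * a" if a: "a \<in> L" and b: "b \<in> D1" "b \<notin> L" for a b
  proof -
    have b0: "b \<noteq> 0" "1 + b \<noteq> 0" using b div_subringD[OF assms(1)] by (auto simp: add_eq_0_iff)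
    have in1: "1 + b \<in> D1" using b by (simp add: div_subringD[OF assms(2)])
    define s t where "s = conjg b a" and "t = conjg (1 + b) a"
    have st: "s \<in> L" "t \<in> L" using normalizesD[OF assms(4)] a b b0 in1 by (auto simp: s_def t_def)
    have "b * a = s * b" "(1 + b) * a = t * (1 + b)" using b0 conjg_eq_iff s_def t_def by metis+
    hence e: "a - t = (t - s) * b" by (simp add: algebra_simps)
    have "t = s"
    proof (rule ccontr)
      assume "t \<noteq> s"
      hence "b = inverse (t - s) * (a - t)" using e by (simp add: mult.assoc[symmetric])
      moreover have "inverse (t - s) * (a - t) \<in> L" using st a by (simp add: div_subring_diff[OF assms(1)] div_subringD(4,6)[OF assms(1)])
      ultimately show False using b by simp
    qed
    thus ?thesis using e \<open>b * a = s * b\<close> by simp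
  qed
  obtain c where c: "c \<in> D1" "c \<notin> L" using assms by auto
  show ?thesis
  proof (intro subsetI centralizerI)
    fix a b assume ab: "a \<in> L" "b \<in> D1"
    show "a * b = b * a"
    proof (cases "b \<in> L")
      case True
      have "b + c \<notin> L" using True c div_subring_diff[OF assms(1), of "b+c" b] by auto
      hence "a * (b + c) = (b + c) * a" using ab c div_subringD[OF assms(2)] by (intro *) auto
      thus ?thesis using *[OF ab(1) c] by (simp add: algebra_simps)
    qed (use * ab in auto)
  qed
qed

section \<open>Cyclic extensions\<close>

lemma conjg_image_centralizer: assumes "g \<noteq> 0" shows "conjg g ` centralizer S = centralizer (conjg g ` S)"
proof
  show "conjg g ` centralizer S \<subseteq> centralizer (conjg g ` S)" using conjg_centralizer[OF assms] by blast
  show "centralizer (conjg g ` S) \<subseteq> conjg g ` centralizer S"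
  proof
    fix z assume z: "z \<in> centralizer (conjg g ` S)"
    have "conjg (inverse g) z \<in> centralizer (conjg (inverse g) ` conjg g ` S)" using conjg_centralizer[OF _ z, of "inverse g"] assms by simp
    also have "conjg (inverse g) ` conjg g ` S = S" using assms by (simp add: image_image conjg_inv_cancel)
    finally have "conjg (inverse g) z \<in> centralizer S" .
    moreover have "z = conjg g (conjg (inverse g) z)" using assms by (simp add: conjg_inv_cancel)
    ultimately show "z \<in> conjg g ` centralizer S" by blast
  qed
qed

lemma conjg_image_div_subring: assumes "div_subring R" "g \<in> R" "g \<noteq> 0" shows "conjg g ` R = R"
  using normalizes_image[OF mult_group_units[OF assms(1)], of R g] assms by (auto simp: normalizes_def conjg_def div_subringD)

lemma conjg_image_Int: "g \<noteq> 0 \<Longrightarrow> conjg g ` (A \<inter> B) = conjg g ` A \<inter> conjg g ` B"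
  by (rule image_Int) (metis conjg_inv_cancel(1) injI)

lemma conjg_pow_image: assumes "g \<noteq> 0" "conjg g ` S = S" "s \<in> S" shows "conjg (g ^ n) s \<in> S"
proof (induction n)
  case (Suc n)
  have "conjg (g ^ Suc n) s = conjg g (conjg (g ^ n) s)" by (simp add: conjg_conjg)
  thus ?case using Suc assms(2) by (metis imageI)
qed (use assms in \<open>simp add: conjg_one\<close>)

lemma div_subring_powi: "div_subring L \<Longrightarrow> x \<in> L \<Longrightarrow> x powi n \<in> L"
  by (auto simp: power_int_def div_subring_prod div_subringD power_inverse)

lemma power_centralizer_coprime:
  assumes "x \<noteq> 0" "x ^ i \<in> centralizer S" "x ^ j \<in> centralizer S" "coprime i (j::nat)"
  shows "x \<in> centralizer S"
proof -
  obtain u v where uv: "int i * u + int j * v = 1"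
    using bezout_int[of "int i" "int j"] assms(4) by (auto simp: coprime_iff_gcd_eq_1 mult.commute)
  have "x = x powi (int i * u + int j * v)" using uv by simp
  also have "\<dots> = (x ^ i) powi u * (x ^ j) powi v"
    using assms(1) by (simp add: power_int_add power_int_mult)
  also have "\<dots> \<in> centralizer S" using assms(2,3) by (simp add: div_subringD[OF div_subring_centralizer] div_subring_powi[OF div_subring_centralizer])
  finally show ?thesis .
qed

lemma power_centralizer_prime:
  assumes "x \<noteq> 0" "prime p" "x ^ p \<in> centralizer S" "x \<notin> centralizer S" "x ^ i \<in> centralizer S"
  shows "p dvd i"
  using power_centralizer_coprime[OF assms(1,5,3)] assms(2,4) by (metis coprime_commute prime_imp_coprime)

text \<open>Equal conjugations on \<open>S\<close> would make \<open>x ^ (j - i)\<close> centralize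
  \<open>S\<close>, although \<open>p\<close> does not divide \<open>j - i\<close>.\<close>

lemma powers_distinct_on:
  assumes "x \<noteq> 0" "prime p" "x ^ p \<in> centralizer S" "x \<notin> centralizer S" "i < p" "j < p" "i \<noteq> j"
  shows "\<exists>q\<in>S. conjg (x ^ i) q \<noteq> conjg (x ^ j) q"
proof -
  have *: "\<exists>q\<in>S. conjg (x ^ i) q \<noteq> conjg (x ^ j) q" if ij: "i < j" "j < p" for i j
  proof (rule ccontr)
    assume n: "\<not> ?thesis"
    have "x ^ (j - i) \<in> centralizer S"
    proof (rule centralizerI)
      fix q assume q: "q \<in> S"
      have "x ^ j = x ^ i * x ^ (j - i)" using ij by (metis less_imp_le power_add le_add_diff_inverse)
      hence "conjg (x ^ i) (conjg (x ^ (j - i)) q) = conjg (x ^ i) q" using n q by (simp add: conjg_conjg)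
      hence "conjg (x ^ (j - i)) q = q" using assms(1) by (metis conjg_inv_cancel(1) power_not_zero)
      thus "x ^ (j - i) * q = q * x ^ (j - i)" using assms(1) by (simp add: conjg_fix_iff)
    qed
    hence "p dvd j - i" by (rule power_centralizer_prime[OF assms(1-4)])
    thus False using ij dvd_imp_le[of p "j - i"] by simp
  qed
  show ?thesis using *[of i j] *[of j i] assms by (metis nat_neq_iff)
qed

text \<open>No polynomials are involved. More than \<open>m\<close> roots would admit a nontrivial
  solution of the \<open>m\<close> equations for the exponents below \<open>m\<close>; periodicity
  extends them to all exponents, against the independence of the characters sending \<open>n\<close>
  to \<open>j ^ n\<close>.\<close>

lemma roots_of_unity:
  assumes "div_subring K" "K \<subseteq> centralizer K" "m > 0"
  shows "finite {w \<in> K. w ^ m = 1}" "card {w \<in> K. w ^ m = 1} \<le> m"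
proof -
  have *: "card J \<le> m" if J: "finite J" "J \<subseteq> {w \<in> K. w ^ m = 1}" for J
  proof (rule ccontr)
    assume "\<not> card J \<le> m"
    hence "\<exists>c. (\<forall>j\<in>J. c j \<in> K) \<and> (\<exists>j\<in>J. c j \<noteq> 0) \<and> (\<forall>i\<in>{..<m}. (\<Sum>j\<in>J. c j * j ^ i) = 0)"
      using J by (intro homogeneous_system[OF assms(1)]) (auto intro: div_subring_prod[OF assms(1)])
    then obtain c where c: "\<forall>j\<in>J. c j \<in> K" "\<exists>j\<in>J. c j \<noteq> 0" "\<forall>i<m. (\<Sum>j\<in>J. c j * j ^ i) = 0" by auto
    have "c j = 0" if j: "j \<in> J" for j
    proof (rule dedekind[where J=J and X=UNIV and op="(+)" and \<theta>="\<lambda>j (n::nat). j ^ n" and g=c])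
      fix q
      have "j ^ q = j ^ (q mod m)" if "j \<in> J" for j
      proof -
        have "j ^ q = (j ^ m) ^ (q div m) * j ^ (q mod m)"
          by (simp add: power_mult[symmetric] power_add[symmetric])
        thus ?thesis using that J by auto
      qed
      hence "(\<Sum>j\<in>J. j ^ q * c j) = (\<Sum>j\<in>J. c j * j ^ (q mod m))"
        using J c(1) centralizerD[OF subsetD[OF assms(2)]] div_subring_prod[OF assms(1)] by (intro sum.cong) auto
      thus "(\<Sum>j\<in>J. j ^ q * c j) = 0" using c(3) assms(3) by simp
    next
      fix j k q r assume "j \<in> J" "k \<in> J"
      thus "j ^ q * k ^ r = k ^ r * j ^ q" using J by (intro centralizerD[OF subsetD[OF assms(2)]] div_subring_prod[OF assms(1)]) auto
    next
      fix j k assume "j \<in> J" "k \<in> J" "j \<noteq> k"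
      thus "\<exists>q\<in>UNIV. j ^ q \<noteq> k ^ q" by (intro bexI[of _ 1]) auto
    next
      fix j :: "'a" show "\<exists>q\<in>UNIV. j ^ q \<noteq> 0" by (intro bexI[of _ 0]) auto
    qed (use J j in \<open>auto simp: power_add\<close>)
    thus False using c(2) by blast
  qed
  show f: "finite {w \<in> K. w ^ m = 1}"
  proof (rule ccontr)
    assume "infinite {w \<in> K. w ^ m = 1}"
    then obtain J where "finite J" "card J = Suc m" "J \<subseteq> {w \<in> K. w ^ m = 1}"
      using infinite_arbitrarily_large by blast
    thus False using *[of J] by simp
  qed
  show "card {w \<in> K. w ^ m = 1} \<le> m" using *[OF f] by simp
qed

lemma card_fibres:
  assumes "finite A" "\<And>b. b \<in> f ` A \<Longrightarrow> card {a \<in> A. f a = b} = c"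
  shows "card A = c * card (f ` A)"
proof -
  have "card A = (\<Sum>b\<in>f ` A. card {a \<in> A. f a = b})"
    using sum.image_gen[OF assms(1), of "\<lambda>_. 1::nat" f] by simp
  thus ?thesis using assms(2) by simp
qed

text \<open>Each fibre over the image is a coset of the kernel.\<close>

lemma card_mult_hom:
  fixes A :: "'a::division_ring set" and f :: "'a \<Rightarrow> 'a"
  assumes "finite A" "mult_group A" "\<And>a b. a \<in> A \<Longrightarrow> b \<in> A \<Longrightarrow> f (a * b) = f a * f b" "\<And>a. a \<in> A \<Longrightarrow> f a \<noteq> 0"
  shows "card A = card {a \<in> A. f a = 1} * card (f ` A)"
proof (rule card_fibres[OF assms(1)])
  fix b assume "b \<in> f ` A"
  then obtain a where a: "a \<in> A" "b = f a" by blast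
  have "bij_betw ((*) a) {a \<in> A. f a = 1} {a' \<in> A. f a' = b}"
  proof (rule bij_betwI[where g="(*) (inverse a)"])
    show "(*) a \<in> {a \<in> A. f a = 1} \<rightarrow> {a' \<in> A. f a' = b}" using a assms(3) mult_groupD[OF assms(2)] by auto
    show "(*) (inverse a) \<in> {a' \<in> A. f a' = b} \<rightarrow> {a \<in> A. f a = 1}"
    proof safe
      fix a' assume a': "a' \<in> A" "b = f a'"
      have ia: "inverse a * a' \<in> A" using a a' by (simp add: mult_groupD[OF assms(2)])
      thus "inverse a * a' \<in> A" .
      have "f a * f (inverse a * a') = f a'"
        using assms(3)[OF a(1) ia] mult_groupD(3)[OF assms(2) a(1)] by (simp add: mult.assoc[symmetric])
      thus "f (inverse a * a') = 1" using a a' assms(4)[of a] by (metis mult_cancel_left1)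
    qed
  qed (use a mult_groupD(3)[OF assms(2)] in \<open>auto simp: mult.assoc[symmetric]\<close>)
  thus "card {a' \<in> A. f a' = b} = card {a \<in> A. f a = 1}" by (simp add: bij_betw_same_card)
qed

lemma geometric_zero:
  assumes "u ^ p = 1" "u \<noteq> (1::'a::division_ring)" shows "(\<Sum>i<p. u ^ i) = 0"
proof -
  have "(u - 1) * (\<Sum>i<p. u ^ i) = u ^ p - 1" by (induction p) (simp_all add: algebra_simps)
  thus ?thesis using assms by simp
qed

section \<open>Linear independence and bases over a division subring\<close>

definition lin_indep :: "'a::division_ring set \<Rightarrow> 'a set \<Rightarrow> bool" where
  "lin_indep L B \<longleftrightarrow> finite B \<and> (\<forall>c. (\<forall>b\<in>B. c b \<in> L) \<longrightarrow> (\<Sum>b\<in>B. c b * b) = 0 \<longrightarrow> (\<forall>b\<in>B. c b = 0))"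

lemma lin_indepD: "lin_indep L B \<Longrightarrow> (\<forall>b\<in>B. c b \<in> L) \<Longrightarrow> (\<Sum>b\<in>B. c b * b) = 0 \<Longrightarrow> b \<in> B \<Longrightarrow> c b = 0"
  by (auto simp: lin_indep_def)

lemma lin_indep_insert:
  assumes L: "div_subring L" and B: "lin_indep L B" "v \<notin> B"
    and no: "\<nexists>c. (\<forall>b\<in>B. c b \<in> L) \<and> v = (\<Sum>b\<in>B. c b * b)"
  shows "lin_indep L (insert v B)"
  unfolding lin_indep_def
proof (intro conjI allI impI)
  show fin: "finite (insert v B)" using B(1) by (simp add: lin_indep_def)
  fix c assume c: "\<forall>b\<in>insert v B. c b \<in> L" and z: "(\<Sum>b\<in>insert v B. c b * b) = 0"
  have s: "c v * v + (\<Sum>b\<in>B. c b * b) = 0" using z fin B(2) by simp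
  have "c v = 0"
  proof (rule ccontr)
    assume n: "c v \<noteq> 0"
    have "v = inverse (c v) * (c v * v)" using n by (simp add: mult.assoc[symmetric])
    also have "c v * v = - (\<Sum>b\<in>B. c b * b)" using s by (simp add: eq_neg_iff_add_eq_0)
    also have "inverse (c v) * - (\<Sum>b\<in>B. c b * b) = (\<Sum>b\<in>B. (- inverse (c v) * c b) * b)"
      by (simp add: sum_distrib_left mult.assoc sum_negf)
    finally have e: "v = (\<Sum>b\<in>B. (- inverse (c v) * c b) * b)" .
    have "\<forall>b\<in>B. - inverse (c v) * c b \<in> L" using c by (simp add: div_subringD(4,5,6)[OF L])
    with e have "(\<forall>b\<in>B. - inverse (c v) * c b \<in> L) \<and> v = (\<Sum>b\<in>B. (- inverse (c v) * c b) * b)" by (rule conjI[rotated])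
    hence "\<exists>c. (\<forall>b\<in>B. c b \<in> L) \<and> v = (\<Sum>b\<in>B. c b * b)" by (rule exI[of _ "\<lambda>b. - inverse (c v) * c b"])
    thus False by (rule notE[OF no])
  qed
  moreover from this have "(\<Sum>b\<in>B. c b * b) = 0" using s by simp
  hence "\<forall>b\<in>B. c b = 0" using lin_indepD[OF B(1), of c] c by blast
  ultimately show "\<forall>b\<in>insert v B. c b = 0" by blast
qed

text \<open>The bound provides an independent set of largest size, and
  \<open>lin_indep_insert\<close> shows that such a set spans.\<close>

lemma ex_basis:
  assumes L: "div_subring L" and bound: "\<And>B. B \<subseteq> V \<Longrightarrow> lin_indep L B \<Longrightarrow> card B \<le> m"
  shows "\<exists>B\<subseteq>V. lin_indep L B \<and> (\<forall>v\<in>V. \<exists>c. (\<forall>b\<in>B. c b \<in> L) \<and> v = (\<Sum>b\<in>B. c b * b))"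
proof -
  let ?P = "\<lambda>B. B \<subseteq> V \<and> lin_indep L B"
  have e1: "?P {}" by (simp add: lin_indep_def)
  have e2: "\<forall>B. ?P B \<longrightarrow> card B < Suc m" using bound by (simp add: less_Suc_eq_le)
  obtain B where B: "?P B" "\<forall>C. ?P C \<longrightarrow> card C \<le> card B"
    using ex_has_greatest_nat[where P="?P" and f=card, OF e1 e2] by (elim exE conjE) (rule that, simp_all)
  have "\<exists>c. (\<forall>b\<in>B. c b \<in> L) \<and> v = (\<Sum>b\<in>B. c b * b)" if v: "v \<in> V" for v
  proof (cases "v \<in> B")
    case True
    have "finite B" using B(1) by (simp add: lin_indep_def)
    hence "(\<Sum>b\<in>B. (if b = v then 1 else 0) * b) = v"
      using True by (simp add: if_distrib[of "\<lambda>z. z * _"] cong: if_cong)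
    thus ?thesis using div_subringD(1,2)[OF L] by (intro exI[of _ "\<lambda>b. if b = v then 1 else 0"]) auto
  next
    case False
    show ?thesis
    proof (rule ccontr)
      assume "\<not> ?thesis"
      hence "lin_indep L (insert v B)" using lin_indep_insert[OF L _ False] B(1) by blast
      hence "card (insert v B) \<le> card B" using B v by blast
      thus False using False B(1) by (simp add: lin_indep_def)
    qed
  qed
  thus ?thesis using B(1) by blast
qed

section \<open>Fields with an automorphism of prime order\<close>

text \<open>Conjugation by \<open>x\<close> induces on the field \<open>K\<close> an automorphism of
  exact order \<open>p\<close>, and \<open>S\<close> is its fixed field.\<close>

locale cyclic_layer =
  fixes K :: "'a::division_ring set" and x :: 'a and p :: nat
  assumes K: "div_subring K" and Kc: "K \<subseteq> centralizer K" and x0: "x \<noteq> 0" and xK: "conjg x ` K = K"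
    and p: "prime p" and xp: "x ^ p \<in> centralizer K" and xnc: "x \<notin> centralizer K"
begin

abbreviation S where "S \<equiv> K \<inter> centralizer {x}"

lemma Kcomm: "a \<in> K \<Longrightarrow> b \<in> K \<Longrightarrow> a * b = b * a" using Kc centralizerD by blast
lemma pow_in: "k \<in> K \<Longrightarrow> conjg (x ^ i) k \<in> K" using conjg_pow_image[OF x0 xK] by blast
lemma conjg_in: "k \<in> K \<Longrightarrow> conjg x k \<in> K" using xK by blast
lemma S_iff: "k \<in> S \<longleftrightarrow> k \<in> K \<and> conjg x k = k" using x0 by (auto simp: conjg_fix_iff centralizer_def)
lemma S: "div_subring S" using div_subring_Int[OF K div_subring_centralizer] .
lemma p0: "0 < p" using p prime_gt_0_nat by blast
lemma period: "k \<in> K \<Longrightarrow> conjg (x ^ p) k = k" using centralizerD[OF xp] x0 by (simp add: conjg_fix_iff)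

lemma cyclic_dedekind:
  assumes "\<And>q. q \<in> K \<Longrightarrow> (\<Sum>i<p. conjg (x ^ i) q * g i) = 0" "i < p"
  shows "g i = 0"
proof (rule dedekind[where J="{..<p}" and X=K and op="(*)" and \<theta>="\<lambda>i. conjg (x ^ i)"])
  fix i q r assume "q \<in> K" "r \<in> K" thus "conjg (x ^ i) (q * r) = conjg (x ^ i) q * conjg (x ^ i) r" using x0 by (simp add: conjg_mult)
next
  fix i j assume "i \<in> {..<p}" "j \<in> {..<p}" "i \<noteq> j"
  thus "\<exists>q\<in>K. conjg (x ^ i) q \<noteq> conjg (x ^ j) q" using powers_distinct_on[OF x0 p xp xnc] by auto
next
  fix i show "\<exists>q\<in>K. conjg (x ^ i) q \<noteq> 0" using x0 div_subringD(2)[OF K] by (intro bexI[of _ 1]) (auto simp: conjg_1)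
qed (use assms in \<open>auto simp: div_subringD[OF K] intro: Kcomm pow_in\<close>)

text \<open>Artin's bound: among solutions of the conjugated system, one of minimal support is fixed by \<open>x\<close>.\<close>

lemma artin:
  assumes "finite J" "p < card J" "\<And>j. j \<in> J \<Longrightarrow> u j \<in> K"
  shows "\<exists>c. (\<forall>j\<in>J. c j \<in> S) \<and> (\<exists>j\<in>J. c j \<noteq> 0) \<and> (\<Sum>j\<in>J. c j * u j) = 0"
proof -
  let ?Q = "\<lambda>c. (\<forall>j\<in>J. c j \<in> K) \<and> (\<exists>j\<in>J. c j \<noteq> 0) \<and> (\<forall>i<p. (\<Sum>j\<in>J. c j * conjg (x ^ i) (u j)) = 0)"
  let ?P = "\<lambda>n. \<exists>c. ?Q c \<and> card {j \<in> J. c j \<noteq> 0} = n"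
  have "\<exists>c. (\<forall>j\<in>J. c j \<in> K) \<and> (\<exists>j\<in>J. c j \<noteq> 0) \<and> (\<forall>i\<in>{..<p}. (\<Sum>j\<in>J. c j * conjg (x ^ i) (u j)) = 0)"
    using assms pow_in by (intro homogeneous_system[OF K]) auto
  hence "\<exists>n. ?P n" by auto
  then obtain n where n: "?P n" and min: "\<And>m. m < n \<Longrightarrow> \<not> ?P m"
    using exists_least_iff[of ?P] by blast
  obtain c0 where c0: "?Q c0" "card {j \<in> J. c0 j \<noteq> 0} = n" using n by blast
  obtain j0 where j0: "j0 \<in> J" "c0 j0 \<noteq> 0" using c0 by blast
  define c where "c j = inverse (c0 j0) * c0 j" for j
  have cK: "\<forall>j\<in>J. c j \<in> K" using c0 j0 by (simp add: c_def div_subringD[OF K])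
  have csum: "(\<Sum>j\<in>J. c j * conjg (x ^ i) (u j)) = 0" if "i < p" for i
  proof -
    have "(\<Sum>j\<in>J. c j * conjg (x ^ i) (u j)) = inverse (c0 j0) * (\<Sum>j\<in>J. c0 j * conjg (x ^ i) (u j))"
      by (simp add: c_def sum_distrib_left mult.assoc)
    thus ?thesis using c0 that by simp
  qed
  have csup: "{j \<in> J. c j \<noteq> 0} = {j \<in> J. c0 j \<noteq> 0}" using j0 by (auto simp: c_def)
  have c1: "c j0 = 1" using j0 by (simp add: c_def)
  \<comment> \<open>The automorphism permutes the equations cyclically, so the difference
    \<open>e\<close> solves them too. It vanishes wherever \<open>c\<close> does and also at
    \<open>j0\<close>, where \<open>c\<close> has been normalized to 1.\<close>
  define e where "e j = conjg x (c j) - c j" for j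
  have eK: "\<forall>j\<in>J. e j \<in> K" using cK conjg_in div_subring_diff[OF K] by (simp add: e_def)
  have cxsum: "(\<Sum>j\<in>J. conjg x (c j) * conjg (x ^ i) (u j)) = 0" if i: "i < p" for i
  proof -
    define i' where "i' = (if i = 0 then p - 1 else i - 1)"
    have i': "i' < p" using i p0 by (auto simp: i'_def)
    have "conjg x (conjg (x ^ i') (u j)) = conjg (x ^ i) (u j)" if "j \<in> J" for j
    proof (cases "i = 0")
      case True
      hence "Suc i' = p" using p0 by (simp add: i'_def)
      hence "conjg x (conjg (x ^ i') (u j)) = conjg (x ^ p) (u j)" by (simp only: conjg_conjg power_Suc[symmetric])
      thus ?thesis using True period assms(3) that by (simp add: conjg_one)
    next
      case False
      thus ?thesis by (simp add: i'_def conjg_conjg power_Suc[symmetric])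
    qed
    hence "(\<Sum>j\<in>J. conjg x (c j) * conjg (x ^ i) (u j)) = conjg x (\<Sum>j\<in>J. c j * conjg (x ^ i') (u j))"
      unfolding conjg_sum using x0 by (intro sum.cong) (auto simp: conjg_mult)
    thus ?thesis using csum[OF i'] by (simp add: conjg_0)
  qed
  have esum: "(\<Sum>j\<in>J. e j * conjg (x ^ i) (u j)) = 0" if "i < p" for i
    using cxsum[OF that] csum[OF that] by (simp add: e_def left_diff_distrib sum_subtractf)
  have "j0 \<in> {j \<in> J. c j \<noteq> 0}" "j0 \<notin> {j \<in> J. e j \<noteq> 0}" using j0 c1 x0 by (simp_all add: e_def conjg_1)
  moreover have "{j \<in> J. e j \<noteq> 0} \<subseteq> {j \<in> J. c j \<noteq> 0}" by (auto simp: e_def conjg_0)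
  ultimately have "{j \<in> J. e j \<noteq> 0} \<subset> {j \<in> J. c j \<noteq> 0}" by blast
  hence lt: "card {j \<in> J. e j \<noteq> 0} < n" using psubset_card_mono[of "{j \<in> J. c j \<noteq> 0}"] assms(1) c0(2) csup by simp
  have "\<forall>j\<in>J. e j = 0"
  proof (rule ccontr)
    assume "\<not> ?thesis"
    hence Qe: "?Q e" using eK esum by blast
    have "?P (card {j \<in> J. e j \<noteq> 0})" by (rule exI[of _ e], rule conjI, rule Qe, rule refl)
    thus False by (rule notE[OF min[OF lt]])
  qed
  hence "\<forall>j\<in>J. c j \<in> S" using cK S_iff by (auto simp: e_def)
  moreover have "(\<Sum>j\<in>J. c j * u j) = 0" using csum[OF p0] by (simp add: conjg_one)
  moreover have "\<exists>j\<in>J. c j \<noteq> 0" using j0(1) c1 by (intro bexI[of _ j0]) simp_all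
  ultimately show ?thesis by blast
qed

lemma indep_card: assumes "lin_indep S B" "B \<subseteq> K" shows "card B \<le> p"
proof (rule ccontr)
  assume "\<not> card B \<le> p"
  then obtain c b where "\<forall>b\<in>B. c b \<in> S" "b \<in> B" "c b \<noteq> 0" "(\<Sum>b\<in>B. c b * b) = 0"
    using artin[of B "\<lambda>b. b"] assms by (auto simp: lin_indep_def)
  thus False using lin_indepD[OF assms(1), of c b] by simp
qed

lemma finite_K: assumes "finite S" shows "finite K"
proof -
  obtain B where B: "B \<subseteq> K" "lin_indep S B" "\<forall>v\<in>K. \<exists>c. (\<forall>b\<in>B. c b \<in> S) \<and> v = (\<Sum>b\<in>B. c b * b)"
    using ex_basis[OF S, of K p] indep_card by auto
  have fB: "finite B" using B(2) by (simp add: lin_indep_def)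
  have "K \<subseteq> (\<lambda>c. \<Sum>b\<in>B. c b * b) ` (B \<rightarrow>\<^sub>E S)"
  proof
    fix k assume "k \<in> K"
    then obtain c where c: "\<forall>b\<in>B. c b \<in> S" "k = (\<Sum>b\<in>B. c b * b)" using B(3) by blast
    have "k = (\<Sum>b\<in>B. restrict c B b * b)" using c(2) by simp
    thus "k \<in> (\<lambda>c. \<Sum>b\<in>B. c b * b) ` (B \<rightarrow>\<^sub>E S)"
      by (rule image_eqI[where f="\<lambda>c. \<Sum>b\<in>B. c b * b" and x="restrict c B"]) (use c(1) in auto)
  qed
  moreover have "finite (B \<rightarrow>\<^sub>E S)" using fB assms by (intro finite_PiE) auto
  ultimately show ?thesis by (meson finite_imageI finite_subset)
qed

text \<open>The norm of \<open>k\<close> is \<open>pnorm k p\<close>.\<close>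

definition pnorm where "pnorm k i = (k * x) ^ i * inverse (x ^ i)"

lemma pnorm_0: "pnorm k 0 = 1" by (simp add: pnorm_def)
lemma pnorm_Suc: "pnorm k (Suc i) = k * conjg x (pnorm k i)"
  using x0 by (simp add: pnorm_def conjg_def nonzero_inverse_mult_distrib mult.assoc)
lemma pnorm_in: "k \<in> K \<Longrightarrow> pnorm k i \<in> K"
  by (induction i) (auto simp: pnorm_0 pnorm_Suc div_subringD[OF K] conjg_in)
lemma pnorm_mult: "k \<in> K \<Longrightarrow> l \<in> K \<Longrightarrow> pnorm (k * l) i = pnorm k i * pnorm l i"
proof (induction i)
  case (Suc i)
  have in': "conjg x (pnorm k i) \<in> K" "conjg x (pnorm l i) \<in> K" using Suc pnorm_in conjg_in by auto
  have "pnorm (k * l) (Suc i) = k * (l * conjg x (pnorm k i)) * conjg x (pnorm l i)"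
    using Suc x0 by (simp add: pnorm_Suc conjg_mult mult.assoc)
  also have "l * conjg x (pnorm k i) = conjg x (pnorm k i) * l" using Kcomm Suc in' by blast
  finally show ?case by (simp add: pnorm_Suc mult.assoc)
qed (simp add: pnorm_0)
lemma pnorm_power: "(k * x) ^ i = pnorm k i * x ^ i" using x0 by (simp add: pnorm_def mult.assoc)
lemma pnorm_nonzero: "k \<noteq> 0 \<Longrightarrow> pnorm k i \<noteq> 0" using x0 by (simp add: pnorm_def)

lemma hilbert90:
  assumes k: "k \<in> K" and N: "pnorm k p = 1"
  shows "\<exists>r\<in>K - {0}. k = r * inverse (conjg x r)"
proof -
  define r where "r s = (\<Sum>i<p. pnorm k i * conjg (x ^ i) s)" for s
  have rK: "r s \<in> K" if "s \<in> K" for s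
    unfolding r_def by (intro div_subring_sum[OF K]) (simp add: div_subringD[OF K] pnorm_in[OF k] pow_in that)
  have shift: "k * conjg x (r s) = r s" if s: "s \<in> K" for s
  proof -
    have "k * conjg x (r s) = (\<Sum>i<p. pnorm k (Suc i) * conjg (x ^ Suc i) s)"
      using x0 by (simp add: r_def conjg_sum sum_distrib_left conjg_mult pnorm_Suc conjg_conjg mult.assoc)
    also have "\<dots> = (\<Sum>i<Suc p. pnorm k i * conjg (x ^ i) s) - s"
      by (simp only: sum.lessThan_Suc_shift pnorm_0 power_0 conjg_one mult_1) simp
    also have "\<dots> = r s" using N period[OF s] by (simp add: r_def)
    finally show ?thesis .
  qed
  have "\<exists>s\<in>K. r s \<noteq> 0"
  proof (rule ccontr)
    assume n: "\<not> ?thesis"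
    have "pnorm k 0 = 0"
    proof (rule cyclic_dedekind[OF _ p0])
      fix q assume q: "q \<in> K"
      have "(\<Sum>i<p. conjg (x ^ i) q * pnorm k i) = r q" unfolding r_def
        using Kcomm pow_in[OF q] pnorm_in[OF k] by (intro sum.cong) auto
      thus "(\<Sum>i<p. conjg (x ^ i) q * pnorm k i) = 0" using n q by simp
    qed
    thus False by (simp add: pnorm_0)
  qed
  then obtain s where s: "s \<in> K" "r s \<noteq> 0" by blast
  have "conjg x (r s) \<noteq> 0" using s x0 conjg_eq_0 by blast
  hence "k = r s * inverse (conjg x (r s))" using shift[OF s(1)] by (metis mult.assoc right_inverse mult_1_right)
  thus ?thesis using rK s by blast
qed

text \<open>\<open>u ^ i\<close> intertwines \<open>q\<close> with \<open>conjg (x ^ i) q\<close>.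
  These characters differ for distinct \<open>i < p\<close>, so the powers of \<open>u\<close>
  cannot sum to zero.\<close>

lemma power_indep:
  assumes "u = k * x" "k \<in> K" "k \<noteq> 0" "(\<Sum>i<p. u ^ i) = 0"
  shows False
proof -
  have "u ^ 0 = 0"
  proof (rule cyclic_dedekind[OF _ p0])
    fix q assume q: "q \<in> K"
    have "conjg (x ^ i) q * u ^ i = u ^ i * q" for i
    proof -
      have "pnorm k i * (conjg (x ^ i) q * x ^ i) = pnorm k i * (x ^ i * q)" using x0 by (simp add: conjg_def mult.assoc)
      hence "pnorm k i * conjg (x ^ i) q * x ^ i = u ^ i * q" using assms by (simp add: pnorm_power mult.assoc)
      thus ?thesis using Kcomm[OF pnorm_in[OF assms(2)] pow_in[OF q]] assms by (simp add: pnorm_power mult.assoc)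
    qed
    hence "(\<Sum>i<p. conjg (x ^ i) q * u ^ i) = (\<Sum>i<p. u ^ i) * q" by (simp add: sum_distrib_right)
    thus "(\<Sum>i<p. conjg (x ^ i) q * u ^ i) = 0" using assms by simp
  qed
  thus False by simp
qed

text \<open>A form of Wedderburn's theorem: over a finite \<open>K\<close> the norm is onto, so some \<open>k * x\<close> is a \<open>p\<close>-th root of unity.\<close>

lemma finite_impossible:
  assumes fin: "finite K" and xpK: "x ^ p \<in> K"
  shows False
proof -
  let ?A = "K - {0}" and ?B = "S - {0}"
  let ?nu = "\<lambda>k. pnorm k p" and ?lam = "\<lambda>r. r * inverse (conjg x r)"
  have A: "mult_group ?A" "finite ?A" using mult_group_units[OF K] fin by auto
  \<comment> \<open>Both homomorphisms are counted on \<open>?A\<close>. The kernel of the norm lies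
    in the image of \<open>?lam\<close> by Hilbert 90, and the kernel of \<open>?lam\<close> is
    \<open>?B\<close>; so the image of the norm is at least as large as \<open>?B\<close>.\<close>
  have c1: "card ?A = card {a \<in> ?A. ?nu a = 1} * card (?nu ` ?A)"
    by (rule card_mult_hom[OF A(2,1)]) (auto simp: pnorm_mult pnorm_nonzero)
  have c2: "card ?A = card {a \<in> ?A. ?lam a = 1} * card (?lam ` ?A)"
  proof (rule card_mult_hom[OF A(2,1)])
    fix a b assume ab: "a \<in> ?A" "b \<in> ?A"
    have ne: "conjg x a \<noteq> 0" "conjg x b \<noteq> 0" using ab x0 conjg_eq_0 by auto
    have in': "inverse (conjg x a) \<in> K" "inverse (conjg x b) \<in> K" using ab conjg_in div_subringD(6)[OF K] by auto
    have "?lam (a * b) = a * (b * inverse (conjg x b)) * inverse (conjg x a)"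
      using x0 ne by (simp add: conjg_mult nonzero_inverse_mult_distrib mult.assoc)
    also have "b * inverse (conjg x b) * inverse (conjg x a) = inverse (conjg x a) * (b * inverse (conjg x b))"
      using Kcomm[of "b * inverse (conjg x b)" "inverse (conjg x a)"] in' ab div_subringD(4)[OF K] by auto
    hence "a * (b * inverse (conjg x b)) * inverse (conjg x a) = ?lam a * ?lam b" by (simp add: mult.assoc)
    finally show "?lam (a * b) = ?lam a * ?lam b" .
  qed (use x0 conjg_eq_0 in auto)
  have k2: "{a \<in> ?A. ?lam a = 1} = ?B"
  proof (intro equalityI subsetI)
    fix a assume a: "a \<in> {a \<in> ?A. ?lam a = 1}"
    hence ne: "conjg x a \<noteq> 0" and a1: "a * inverse (conjg x a) = 1" and aK: "a \<in> K" "a \<noteq> 0" using x0 conjg_eq_0 by auto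
    have "a * inverse (conjg x a) * conjg x a = a" using ne by (simp add: mult.assoc)
    hence "conjg x a = a" unfolding a1 by simp
    thus "a \<in> ?B" using aK S_iff[of a] by blast
  next
    fix a assume a: "a \<in> ?B"
    hence "conjg x a = a" using S_iff[of a] by blast
    thus "a \<in> {a \<in> ?A. ?lam a = 1}" using a by simp
  qed
  have "{a \<in> ?A. ?nu a = 1} \<subseteq> ?lam ` ?A" using hilbert90 by blast
  hence le: "card {a \<in> ?A. ?nu a = 1} \<le> card (?lam ` ?A)" using A by (intro card_mono) auto
  \<comment> \<open>\<open>(k * x) ^ p\<close> lies in \<open>K\<close> and commutes with
    \<open>k * x\<close> and with \<open>k\<close>, hence with \<open>x\<close>. Cancelling
    \<open>x ^ p\<close> leaves the norm fixed.\<close>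
  have im: "?nu ` ?A \<subseteq> ?B"
  proof
    fix y assume "y \<in> ?nu ` ?A"
    then obtain k where k: "k \<in> K" "k \<noteq> 0" "y = pnorm k p" by auto
    have yK: "y \<in> K" "y \<noteq> 0" using k pnorm_in pnorm_nonzero by auto
    have e: "(k * x) ^ p = y * x ^ p" using k pnorm_power by simp
    have "(k * x) ^ p * (k * x) = (k * x) * (k * x) ^ p" by (simp add: power_commutes)
    moreover have "(k * x) ^ p * k = k * (k * x) ^ p"
      unfolding e using Kcomm[OF div_subringD(4)[OF K yK(1) xpK] k(1)] .
    ultimately have "k * ((k * x) ^ p * x) = k * (x * (k * x) ^ p)" by (simp add: mult.assoc[symmetric])
    hence "(k * x) ^ p * x = x * (k * x) ^ p" using k by simp
    hence "y * x * x ^ p = x * y * x ^ p" unfolding e by (simp add: mult.assoc power_commutes[symmetric])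
    hence "y * x = x * y" using x0 by simp
    thus "y \<in> ?B" using yK by (auto simp: centralizer_def)
  qed
  have pos: "card ?A > 0" "card ?B > 0" using A fin div_subringD(2)[OF K] div_subringD(2)[OF S]
    by (auto simp: card_gt_0_iff)
  have "card ?B \<le> card (?nu ` ?A)"
  proof (rule ccontr)
    assume "\<not> ?thesis"
    moreover have "card (?lam ` ?A) > 0" using c2 pos by (metis gr0I mult_0_right less_irrefl)
    ultimately have "card (?lam ` ?A) * card (?nu ` ?A) < card (?lam ` ?A) * card ?B" by simp
    moreover have "card {a \<in> ?A. ?nu a = 1} * card (?nu ` ?A) \<le> card (?lam ` ?A) * card (?nu ` ?A)"
      using le by (rule mult_le_mono1)
    ultimately have "card {a \<in> ?A. ?nu a = 1} * card (?nu ` ?A) < card (?lam ` ?A) * card ?B" by linarith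
    thus False using c1 c2 k2 by (simp add: mult.commute)
  qed
  hence surj: "?nu ` ?A = ?B" using im fin by (intro card_seteq) auto
  have "x ^ p \<in> ?B" using xpK x0 by (auto simp: centralizer_def power_commutes)
  hence "inverse (x ^ p) \<in> ?B" using div_subringD(6)[OF S] by simp
  then obtain k where k: "k \<in> K" "k \<noteq> 0" "pnorm k p = inverse (x ^ p)" using surj by (metis (no_types, lifting) DiffD1 DiffD2 imageE singletonI)
  have u: "(k * x) ^ p = 1" using k x0 by (simp add: pnorm_power)
  have "k * x \<noteq> 1"
  proof
    assume "k * x = 1"
    hence "x = inverse k" by (metis inverse_unique inverse_inverse_eq)
    thus False using k Kc xnc div_subringD(6)[OF K] by auto
  qed
  thus False using power_indep[OF refl k(1,2)] geometric_zero[OF u] by blast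
qed

text \<open>If the fixed field is infinite, the infinitely many \<open>t + k0\<close> have only
  finitely many quotients. A common quotient \<open>w\<close> at \<open>t\<close> and
  \<open>s\<close> gives \<open>w * (t - s) = t - s\<close>, so \<open>w = 1\<close> and
  \<open>k0\<close> would be fixed.\<close>

lemma bounded_torsion:
  assumes xpK: "x ^ p \<in> K" and m: "m > 0" "\<And>k. k \<in> K \<Longrightarrow> k \<noteq> 0 \<Longrightarrow> (commutator x k) ^ m = 1"
  shows False
proof (cases "finite S")
  case True
  thus False using finite_impossible[OF finite_K xpK] by blast
next
  case False
  obtain k0 where k0: "k0 \<in> K" "conjg x k0 \<noteq> k0" using xnc x0 by (auto simp: centralizer_def conjg_fix_iff)
  have ne: "t + k0 \<in> K" "t + k0 \<noteq> 0" if "t \<in> S" for t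
  proof -
    show "t + k0 \<in> K" using that k0 div_subringD(3)[OF K] by auto
    show "t + k0 \<noteq> 0" using that k0 div_subringD(5)[OF S, of t] S_iff[of k0] by (metis add.commute minus_unique)
  qed
  let ?om = "\<lambda>t. commutator x (t + k0)"
  have cmK: "commutator x k \<in> K" if "k \<in> K" for k using that conjg_in div_subringD[OF K] by (simp add: commutator_conjg)
  have "?om ` S \<subseteq> {w \<in> K. w ^ m = 1}" using ne m(2) cmK by auto
  hence "finite (?om ` S)" using roots_of_unity(1)[OF K Kc m(1)] finite_subset by blast
  hence "\<not> inj_on ?om S" using False finite_imageD by blast
  then obtain t s where ts: "t \<in> S" "s \<in> S" "t \<noteq> s" "?om t = ?om s" by (auto simp: inj_on_def)
  have *: "?om t * (t + k0) = t + conjg x k0" if "t \<in> S" for t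
    using ne(2)[OF that] that S_iff[of t] by (simp add: commutator_conjg mult.assoc conjg_add)
  have "?om t * (t - s) = ?om t * (t + k0) - ?om s * (s + k0)" unfolding ts(4) by (simp add: algebra_simps)
  also have "\<dots> = t - s" unfolding *[OF ts(1)] *[OF ts(2)] by simp
  finally have "?om t * (t - s) = t - s" .
  hence "?om t = 1" using ts(3) by (metis eq_iff_diff_eq_0 mult_cancel_right1)
  thus False using *[OF ts(1)] k0 by simp
qed

lemma commutator_in: "k \<in> K \<Longrightarrow> commutator x k \<in> K" using conjg_in div_subringD[OF K] by (simp add: commutator_conjg)

lemma commutator_mult: assumes "a \<in> K" "b \<in> K" shows "commutator x (a * b) = commutator x a * commutator x b"
proof -
  have "commutator x (a * b) = conjg x a * (conjg x b * inverse b) * inverse a"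
    by (cases "a = 0 \<or> b = 0") (auto simp: commutator_conjg conjg_mult x0 nonzero_inverse_mult_distrib mult.assoc conjg_0)
  also have "\<dots> = conjg x a * inverse a * (conjg x b * inverse b)"
    using Kcomm[of "conjg x b * inverse b" "inverse a"] assms conjg_in div_subringD(4,6)[OF K] by (simp add: mult.assoc)
  finally show ?thesis by (simp add: commutator_conjg)
qed

lemma commutator_iter:
  assumes "a \<in> K" "a \<noteq> 0"
  shows "(commutator x ^^ n) a \<in> K" "(commutator x ^^ n) a \<noteq> 0"
  using assms x0 by (induction n) (auto simp: commutator_in commutator_nonzero)

lemma commutator_power: assumes "a \<in> K" shows "commutator x (a ^ q) = commutator x a ^ q"
proof (induction q)
  case 0 show ?case using x0 by (simp add: commutator_conjg conjg_1)
next
  case (Suc q)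
  thus ?case using commutator_mult[OF assms div_subring_prod[OF K assms]] by simp
qed

lemma commutator_iter_power: "a \<in> K \<Longrightarrow> a \<noteq> 0 \<Longrightarrow> (commutator x ^^ n) (a ^ q) = ((commutator x ^^ n) a) ^ q"
  by (induction n) (auto simp: commutator_power commutator_iter)

text \<open>As the quotient is fixed, \<open>conjg (x ^ i) r = (commutator x r) ^ i * r\<close>; at
  \<open>i = p\<close> the left side is \<open>r\<close> again.\<close>

lemma commutator_fixed_root:
  assumes r: "r \<in> K" "r \<noteq> 0" and fx: "conjg x (commutator x r) = commutator x r"
  shows "commutator x r ^ p = 1"
proof -
  let ?s = "commutator x r"
  have "conjg (x ^ i) r = ?s ^ i * r" for i
  proof (induction i)
    case (Suc i)
    have "conjg (x ^ Suc i) r = conjg x (conjg (x ^ i) r)" by (simp add: conjg_conjg)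
    also have "\<dots> = ?s ^ i * conjg x r" using Suc fx x0 by (simp add: conjg_mult conjg_power)
    also have "conjg x r = ?s * r" using r by (simp add: commutator_conjg mult.assoc)
    finally show ?case by (simp add: power_commutes[symmetric] mult.assoc)
  qed (simp add: conjg_one)
  hence "?s ^ p * r = r" using period[OF r(1)] by metis
  thus ?thesis using r by simp
qed

text \<open>Fixed quotients \<open>commutator x r\<close> have norm one, hence are \<open>p\<close>-th roots of unity.\<close>
lemma torsion_of_engel:
  assumes "\<And>k. k \<in> K \<Longrightarrow> k \<noteq> 0 \<Longrightarrow> conjg x ((commutator x ^^ n) (k ^ e)) = (commutator x ^^ n) (k ^ e)"
    "k \<in> K" "k \<noteq> 0"
  shows "(commutator x k) ^ (e * p ^ n) = 1"
  using assms
proof (induction n arbitrary: e)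
  case 0
  have "commutator x (k ^ e) = 1" using 0 by (simp add: commutator_conjg)
  thus ?case using commutator_power[OF 0(2)] by simp
next
  case (Suc n)
  \<comment> \<open>The \<open>p\<close>-th power kills the last quotient, so with the exponent
    \<open>e * p\<close> one iteration fewer already lands in the fixed field.\<close>
  have "conjg x ((commutator x ^^ n) (k ^ (e * p))) = (commutator x ^^ n) (k ^ (e * p))" if k: "k \<in> K" "k \<noteq> 0" for k
  proof -
    let ?r = "(commutator x ^^ n) (k ^ e)"
    have r: "?r \<in> K" "?r \<noteq> 0" using k by (simp_all add: commutator_iter div_subring_prod[OF K])
    have "commutator x ?r ^ p = 1" using commutator_fixed_root[OF r] Suc.prems(1)[OF k] by simp
    hence "commutator x (?r ^ p) = 1" using commutator_power[OF r(1)] by simp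
    hence "conjg x (?r ^ p) = ?r ^ p" using r x0 by (metis commutator_1_iff conjg_fix_iff power_not_zero)
    moreover have "?r ^ p = (commutator x ^^ n) (k ^ (e * p))"
      using k by (simp add: commutator_iter_power[symmetric] div_subring_prod[OF K] power_mult)
    ultimately show ?thesis by simp
  qed
  from Suc.IH[OF this Suc.prems(2,3)] show ?case by (simp add: mult.assoc)
qed

text \<open>The common endpoint of the Engel-type arguments: the symbol case below, the FC-center
  and the nilpotent normal subgroups are all settled here. The exponent \<open>e\<close> serves the
  FC-center, where only a bounded order is known.\<close>

lemma engel_impossible:
  assumes "x ^ p \<in> K" "e > 0"
    "\<And>k. k \<in> K \<Longrightarrow> k \<noteq> 0 \<Longrightarrow> conjg x ((commutator x ^^ n) (k ^ e)) = (commutator x ^^ n) (k ^ e)"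
  shows False
  using bounded_torsion[OF assms(1), of "e * p ^ n"] torsion_of_engel[OF assms(3)] assms(2) p0 by simp

end

section \<open>Derived series and subnormal chains\<close>

inductive_set gen_group :: "'a::division_ring set \<Rightarrow> 'a set" for S where
  gen_group_1: "1 \<in> gen_group S"
| gen_group_in: "s \<in> S \<Longrightarrow> s \<in> gen_group S"
| gen_group_mult: "a \<in> gen_group S \<Longrightarrow> b \<in> gen_group S \<Longrightarrow> a * b \<in> gen_group S"
| gen_group_inv: "a \<in> gen_group S \<Longrightarrow> inverse a \<in> gen_group S"

definition derived_grp :: "'a::division_ring set \<Rightarrow> 'a set" where
  "derived_grp H = gen_group {commutator x y | x y. x \<in> H \<and> y \<in> H}"

lemma gen_group_least: assumes "mult_group H" "S \<subseteq> H" shows "gen_group S \<subseteq> H"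
proof
  fix x assume "x \<in> gen_group S" thus "x \<in> H" by induction (use assms in \<open>auto simp: mult_groupD\<close>)
qed

lemma gen_group_mult_group: assumes "0 \<notin> S" shows "mult_group (gen_group S)"
proof -
  have "x \<noteq> 0" if "x \<in> gen_group S" for x using that by induction (use assms in auto)
  thus ?thesis unfolding mult_group_def by (auto intro: gen_group.intros)
qed

lemma derived_grp_mult_group: assumes H: "mult_group H" shows "mult_group (derived_grp H)"
  unfolding derived_grp_def
proof (rule gen_group_mult_group, rule notI)
  assume "0 \<in> {commutator x y | x y. x \<in> H \<and> y \<in> H}"
  then obtain x y where xy: "commutator x y = 0" "x \<in> H" "y \<in> H" by auto
  thus False using commutator_nonzero[OF mult_groupD(3)[OF H xy(2)] mult_groupD(3)[OF H xy(3)]] by simp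
qed

lemma derived_grp_least: "mult_group K \<Longrightarrow> (\<And>x y. x \<in> H \<Longrightarrow> y \<in> H \<Longrightarrow> commutator x y \<in> K) \<Longrightarrow> derived_grp H \<subseteq> K"
  unfolding derived_grp_def by (rule gen_group_least) auto

lemma derived_grp_sub: "mult_group H \<Longrightarrow> derived_grp H \<subseteq> H" by (rule derived_grp_least) (auto simp: mult_group_commutator)

lemma commutator_in_derived_grp: "x \<in> H \<Longrightarrow> y \<in> H \<Longrightarrow> commutator x y \<in> derived_grp H" unfolding derived_grp_def by (rule gen_group_in) auto

lemma derived_grp_mono: "H \<subseteq> K \<Longrightarrow> mult_group K \<Longrightarrow> derived_grp H \<subseteq> derived_grp K"
  by (rule derived_grp_least[OF derived_grp_mult_group]) (auto intro!: commutator_in_derived_grp)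

lemma conjg_commutator: "g \<noteq> 0 \<Longrightarrow> conjg g (commutator x y) = commutator (conjg g x) (conjg g y)"
  by (simp add: commutator_def conjg_mult conjg_inverse)

lemma gen_group_normalizes: assumes "0 \<notin> K" "\<And>g s. g \<in> K \<Longrightarrow> s \<in> S \<Longrightarrow> conjg g s \<in> gen_group S" shows "normalizes K (gen_group S)"
proof -
  have "conjg g a \<in> gen_group S" if g: "g \<in> K" and a: "a \<in> gen_group S" for g a
  proof -
    have g0: "g \<noteq> 0" using g assms by auto
    show ?thesis using a
      by induction (use assms(2)[OF g] in \<open>auto simp: conjg_mult[OF g0] conjg_inverse[OF g0] conjg_1[OF g0] intro: gen_group.intros\<close>)
  qed
  thus ?thesis by (auto simp: normalizes_def)
qed

lemma derived_grp_normalizes: assumes "0 \<notin> K" "normalizes K H" shows "normalizes K (derived_grp H)"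
  unfolding derived_grp_def
proof (rule gen_group_normalizes[OF assms(1)])
  fix g s assume g: "g \<in> K" and "s \<in> {commutator x y | x y. x \<in> H \<and> y \<in> H}"
  then obtain x y where xy: "s = commutator x y" "x \<in> H" "y \<in> H" by blast
  have "conjg g s = commutator (conjg g x) (conjg g y)" unfolding xy(1) by (rule conjg_commutator) (use g assms in auto)
  thus "conjg g s \<in> gen_group {commutator x y | x y. x \<in> H \<and> y \<in> H}" using normalizesD[OF assms(2) g] xy by (auto intro: gen_group_in)
qed

lemma derived_series_mult_group: "mult_group H \<Longrightarrow> mult_group ((derived_grp ^^ n) H)" by (induction n) (auto simp: derived_grp_mult_group)
lemma derived_series_normalizes: "0 \<notin> K \<Longrightarrow> normalizes K H \<Longrightarrow> normalizes K ((derived_grp ^^ n) H)" by (induction n) (auto simp: derived_grp_normalizes)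
lemma derived_series_anti: assumes "mult_group H" "m \<le> n" shows "(derived_grp ^^ n) H \<subseteq> (derived_grp ^^ m) H"
  using assms(2) by (induction rule: dec_induct) (use derived_grp_sub[OF derived_series_mult_group[OF assms(1)]] in auto)
lemma derived_series_sub: "mult_group H \<Longrightarrow> (derived_grp ^^ n) H \<subseteq> H" using derived_series_anti[of H 0 n] by simp
lemma derived_series_mono: "H \<subseteq> K \<Longrightarrow> mult_group H \<Longrightarrow> mult_group K \<Longrightarrow> (derived_grp ^^ n) H \<subseteq> (derived_grp ^^ n) K"
  by (induction n) (auto simp: derived_grp_mono derived_series_mult_group)

definition solvable_set :: "'a::division_ring set \<Rightarrow> bool" where
  "solvable_set H \<longleftrightarrow> (\<exists>n. (derived_grp ^^ n) H \<subseteq> {1})"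

lemma solvable_set_subset: "solvable_set K \<Longrightarrow> H \<subseteq> K \<Longrightarrow> mult_group H \<Longrightarrow> mult_group K \<Longrightarrow> solvable_set H"
  unfolding solvable_set_def using derived_series_mono by blast

lemma derived_grp_comm: assumes "mult_group H" "H \<subseteq> centralizer H" shows "derived_grp H \<subseteq> {1}"
proof (rule derived_grp_least)
  fix x y assume "x \<in> H" "y \<in> H"
  thus "commutator x y \<in> {1}" using assms(1) centralizerD[OF subsetD[OF assms(2)], of x y] by (simp add: commutator_1_iff mult_groupD)
qed (auto simp: mult_group_def)

text \<open>Counted upwards from the subnormal group \<open>N 0\<close>, so that
  \<open>case_nat\<close> can insert a smaller group at the bottom without touching the
  rest.\<close>

definition subnormal_chain :: "(nat \<Rightarrow> 'a::division_ring set) \<Rightarrow> nat \<Rightarrow> 'a set \<Rightarrow> bool" where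
  "subnormal_chain N n R \<longleftrightarrow> N n = R - {0} \<and> (\<forall>i\<le>n. mult_group (N i)) \<and> (\<forall>i<n. N i \<subseteq> N (Suc i) \<and> normalizes (N (Suc i)) (N i))"

lemma subnormal_chainD:
  assumes "subnormal_chain N n R"
  shows "N n = R - {0}" "i \<le> n \<Longrightarrow> mult_group (N i)" "i < n \<Longrightarrow> N i \<subseteq> N (Suc i)" "i < n \<Longrightarrow> normalizes (N (Suc i)) (N i)"
  using assms by (auto simp: subnormal_chain_def)

lemma subnormal_chain_mono: assumes "subnormal_chain N n R" "i \<le> j" "j \<le> n" shows "N i \<subseteq> N j"
  using assms(2,3)
proof (induction j rule: dec_induct)
  case (step m)
  thus ?case using subnormal_chainD(3)[OF assms(1), of m] by auto
qed simp

lemma subnormal_chain_sub: "subnormal_chain N n R \<Longrightarrow> i \<le> n \<Longrightarrow> N i \<subseteq> R - {0}"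
  using subnormal_chain_mono[of N n R i n] subnormal_chainD(1) by fastforce

lemma subnormal_chain_step: assumes "subnormal_chain N n R" "k < n" "d \<in> N (Suc k)" "x \<in> N 0" shows "conjg d x \<in> N k"
  using subnormal_chain_mono[OF assms(1), of 0 k] subnormal_chainD(4)[OF assms(1,2)] assms by (auto simp: normalizes_def)

lemma subnormal_chain_tail: "subnormal_chain N (Suc n) R \<Longrightarrow> subnormal_chain (\<lambda>i. N (Suc i)) n R"
  unfolding subnormal_chain_def by auto

lemma subnormal_chain_cons: assumes "subnormal_chain N n R" "mult_group H" "H \<subseteq> N 0" "normalizes (N 0) H"
  shows "subnormal_chain (case_nat H N) (Suc n) R"
  using assms unfolding subnormal_chain_def
  by (auto split: nat.split simp: less_Suc_eq_0_disj)

lemma subnormal_chain_Int: assumes "subnormal_chain N n UNIV" "div_subring L" shows "subnormal_chain (\<lambda>i. N i \<inter> L) n L"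
proof -
  have "normalizes (N (Suc i) \<inter> L) (N i \<inter> L)" if "i < n" for i
    using subnormal_chainD(4)[OF assms(1) that] div_subringD[OF assms(2)] by (auto simp: normalizes_def conjg_def)
  thus ?thesis using assms unfolding subnormal_chain_def by (auto simp: mult_group_Int_div_subring)
qed

text \<open>\<open>commutator x w = x * conjg w (inverse x)\<close>, and conjugation by an element
  of one level sends \<open>N 0\<close> into the level below. After \<open>n\<close> steps every
  unit of \<open>R\<close> has been brought into \<open>N 0\<close>.\<close>

lemma subnormal_chain_commutator:
  assumes "subnormal_chain N n R" "x \<in> N 0" "k \<in> R" "k \<noteq> 0"
  shows "j \<le> n \<Longrightarrow> (commutator x ^^ j) k \<in> N (n - j)"
proof (induction j)
  case 0 thus ?case using assms subnormal_chainD(1) by auto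
next
  case (Suc j)
  define w where "w = (commutator x ^^ j) k"
  have w: "w \<in> N (Suc (n - Suc j))" using Suc by (simp add: w_def Suc_diff_Suc)
  have m: "mult_group (N (n - Suc j))" "mult_group (N 0)" using subnormal_chainD(2)[OF assms(1)] by auto
  have ix: "inverse x \<in> N 0" using m assms(2) mult_groupD(5) by blast
  have "x \<in> N (n - Suc j)" using subnormal_chain_mono[OF assms(1), of 0 "n - Suc j"] assms(2) by auto
  moreover have "conjg w (inverse x) \<in> N (n - Suc j)" using subnormal_chain_step[OF assms(1) _ w ix] Suc by simp
  moreover have "(commutator x ^^ Suc j) k = x * conjg w (inverse x)" by (simp add: w_def commutator_def conjg_def mult.assoc)
  ultimately show ?case using mult_groupD(4)[OF m(1)] by simp
qed

section \<open>Solvable subnormal subgroups\<close>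

lemma CC_comm: assumes "T \<subseteq> centralizer T" "K \<subseteq> centralizer (centralizer T)" shows "K \<subseteq> centralizer K"
  using centralizer_centralizer_comm[OF assms(1)] centralizer_mono[OF assms(2)] assms(2) by blast

lemma conjg_powi_image: assumes "g \<noteq> 0" "conjg g ` S = S" "s \<in> S" shows "conjg (g powi i) s \<in> S"
proof -
  have "conjg (inverse g) ` S = conjg (inverse g) ` conjg g ` S" using assms(2) by simp
  also have "\<dots> = S" using assms(1) by (simp add: image_image conjg_inv_cancel)
  finally have inv: "conjg (inverse g) ` S = S" .
  show ?thesis
    using conjg_pow_image[OF assms, of "nat i"] conjg_pow_image[of "inverse g", OF _ inv assms(3), of "nat (- i)"] assms(1)
    by (auto simp: power_int_def)
qed

definition scaled :: "'a::division_ring set \<Rightarrow> 'a set \<Rightarrow> 'a set" where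
  "scaled L T = {l * t | l t. l \<in> L \<and> l \<noteq> 0 \<and> t \<in> T}"

definition int_powers :: "'a::division_ring \<Rightarrow> 'a set" where "int_powers h = range (\<lambda>i. h powi i)"

lemma mult_group_int_powers: assumes "h \<noteq> 0" shows "mult_group (int_powers h)"
proof -
  have "1 \<in> int_powers h" unfolding int_powers_def by (rule range_eqI[of _ _ 0]) simp
  moreover have "x * y \<in> int_powers h" if "x \<in> int_powers h" "y \<in> int_powers h" for x y
    using that assms by (auto simp: int_powers_def power_int_add[symmetric])
  moreover have "inverse x \<in> int_powers h" if "x \<in> int_powers h" for x
    using that by (auto simp: int_powers_def power_int_minus[symmetric])
  moreover have "0 \<notin> int_powers h" using assms by (auto simp: int_powers_def)
  ultimately show ?thesis by (auto simp: mult_group_def)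
qed

lemma commutator_int_powers: assumes "h \<noteq> 0" "s \<in> int_powers h" "t \<in> int_powers h" shows "commutator s t = 1"
proof -
  obtain i j where "s = h powi i" "t = h powi j" using assms by (auto simp: int_powers_def)
  thus ?thesis using assms(1) by (subst commutator_1_iff) (auto simp: power_int_add[symmetric] add.commute)
qed

lemma layer_scaled:
  assumes L: "div_subring L" and T: "mult_group T" and n: "normalizes T L"
  shows "layer L (scaled L T)"
proof
  note D = div_subringD[OF L] and G = mult_groupD[OF T]
  have 1: "l \<in> scaled L T" if "l \<in> L - {0}" for l
    unfolding scaled_def using that G(1) by (intro CollectI exI[of _ l] exI[of _ 1]) simp
  show "L - {0} \<subseteq> scaled L T" using 1 by blast
  have nzl: "x \<noteq> 0" if "x \<in> scaled L T" for x using that G(3) by (auto simp: scaled_def)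
  have mul: "x * y \<in> scaled L T" if "x \<in> scaled L T" "y \<in> scaled L T" for x y
  proof -
    obtain l s m t where e: "x = l * s" "y = m * t" "l \<in> L" "l \<noteq> 0" "m \<in> L" "m \<noteq> 0" "s \<in> T" "t \<in> T"
      using \<open>x \<in> scaled L T\<close> \<open>y \<in> scaled L T\<close> by (auto simp: scaled_def)
    have "x * y = (l * conjg s m) * (s * t)" using G(3)[OF e(7)] unfolding e(1,2) conjg_def
      by (simp add: mult.assoc) (simp add: mult.assoc[symmetric])
    moreover have "l * conjg s m \<in> L" using e n D(4) by (auto simp: normalizes_def)
    moreover have "l * conjg s m \<noteq> 0" using e G(3) conjg_eq_0 by auto
    moreover have "s * t \<in> T" using e G(4) by blast
    ultimately show ?thesis unfolding scaled_def by blast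
  qed
  have inv: "inverse x \<in> scaled L T" if "x \<in> scaled L T" for x
  proof -
    obtain l t where e: "x = l * t" "l \<in> L" "l \<noteq> 0" "t \<in> T" using \<open>x \<in> scaled L T\<close> by (auto simp: scaled_def)
    have t0: "t \<noteq> 0" using e G(3) by blast
    have it: "inverse t \<in> T" using e G(5) by blast
    have "inverse x = conjg (inverse t) (inverse l) * inverse t"
      using e t0 by (simp add: conjg_def nonzero_inverse_mult_distrib mult.assoc)
    moreover have "conjg (inverse t) (inverse l) \<in> L" using normalizesD[OF n it] D(6)[OF e(2)] by blast
    moreover have "conjg (inverse t) (inverse l) \<noteq> 0" using e t0 conjg_eq_0[of "inverse t" "inverse l"] by simp
    ultimately show ?thesis using it unfolding scaled_def by blast
  qed
  show "mult_group (scaled L T)" unfolding mult_group_def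
    using 1 D(2) nzl mul inv by auto
  have "conjg g a \<in> L" if g: "g \<in> scaled L T" and a: "a \<in> L" for g a
  proof -
    obtain l t where e: "g = l * t" "l \<in> L" "l \<noteq> 0" "t \<in> T" using g by (auto simp: scaled_def)
    have "conjg g a = l * conjg t a * inverse l" unfolding e(1) conjg_conjg[symmetric] by (simp add: conjg_def)
    thus ?thesis using normalizesD[OF n e(4) a] e D by simp
  qed
  thus "normalizes (scaled L T) L" by (auto simp: normalizes_def)
qed (rule L)

lemma abelian_layer_scaled:
  assumes L: "div_subring L" and T: "mult_group T" and n: "normalizes T L" and c: "\<And>s t. s \<in> T \<Longrightarrow> t \<in> T \<Longrightarrow> commutator s t \<in> L"
  shows "abelian_layer L (scaled L T)"
proof -
  interpret layer L "scaled L T" by (rule layer_scaled[OF L T n])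
  note D = div_subringD[OF L] and G = mult_groupD[OF T]
  show ?thesis
  proof
    fix g h assume "g \<in> scaled L T" "h \<in> scaled L T"
    then obtain l s m t where e: "g = l * s" "h = m * t" "l \<in> L" "l \<noteq> 0" "m \<in> L" "m \<noteq> 0" "s \<in> T" "t \<in> T"
      by (auto simp: scaled_def)
    have st: "s \<noteq> 0" "t \<noteq> 0" using e G(3) by auto
    have "commutator g h = l * conjg s m * commutator s t * conjg t (inverse l) * inverse m"
      unfolding e(1,2) commutator_def conjg_def using st e
      by (simp add: nonzero_inverse_mult_distrib mult.assoc) (simp add: mult.assoc[symmetric])
    thus "commutator g h \<in> L" using e c[OF e(7,8)] n D by (simp add: normalizes_def)
  qed
qed

lemma scaled_sub: "div_subring R \<Longrightarrow> L \<subseteq> R \<Longrightarrow> T \<subseteq> R \<Longrightarrow> scaled L T \<subseteq> R"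
  by (auto simp: scaled_def intro!: div_subringD(4))

lemma T_sub_scaled: "div_subring L \<Longrightarrow> T \<subseteq> scaled L T"
  using div_subringD(2) by (force simp: scaled_def)

section \<open>Skew Laurent polynomials\<close>

text \<open>\<open>add_span G\<close> is the image of a ring of skew Laurent polynomials over the
  field \<open>E\<close> under evaluation at \<open>h\<close>.\<close>

locale power_layer =
  fixes E :: "'a::division_ring set" and h
  assumes E: "div_subring E" and Ec: "E \<subseteq> centralizer E" and h0: "h \<noteq> 0" and hE: "conjg h ` E = E"
begin

abbreviation G where "G \<equiv> scaled E (int_powers h)"

lemma powi_in: "e \<in> E \<Longrightarrow> conjg (h powi i) e \<in> E" using conjg_powi_image[OF h0 hE] .

lemma normalizes_int_powers: "normalizes (int_powers h) E" by (auto simp: normalizes_def int_powers_def powi_in)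

sublocale abelian_layer E G
  by (rule abelian_layer_scaled[OF E mult_group_int_powers[OF h0] normalizes_int_powers]) (simp add: commutator_int_powers[OF h0] div_subringD[OF E])

lemma G_iff: "g \<in> G \<longleftrightarrow> (\<exists>b i. b \<in> E \<and> b \<noteq> 0 \<and> g = b * h powi i)"
  by (auto simp: scaled_def int_powers_def)

lemma mult_powi:
  assumes "b \<in> E" "c \<in> E" shows "(b * h powi i) * (c * h powi j) = (b * conjg (h powi i) c) * h powi (i + j)"
  using h0 by (simp add: power_int_add conjg_def mult.assoc) (simp add: mult.assoc[symmetric])

definition ge where "ge k = add_span {b * h powi j | b j. b \<in> E \<and> b \<noteq> 0 \<and> j \<ge> k}"

text \<open>\<open>k\<close> is the lowest exponent, that is, the order of a Laurent series; it
  serves as a valuation.\<close>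

definition lead where "lead a k \<longleftrightarrow> (\<exists>b\<in>E. b \<noteq> 0 \<and> (\<exists>a'\<in>ge (k + 1). a = b * h powi k + a'))"

lemma coeffs:
  assumes "a \<in> ge k"
  shows "\<exists>J f. finite J \<and> J \<subseteq> {k..} \<and> (\<forall>j\<in>J. f j \<in> E) \<and> a = (\<Sum>j\<in>J. f j * h powi j)"
  using assms unfolding ge_def
proof (induction rule: add_span_induct)
  case zero thus ?case by (intro exI[of _ "{}"]) auto
next
  case (add g a)
  then obtain J f where J: "finite J" "J \<subseteq> {k..}" "\<forall>j\<in>J. f j \<in> E" "a = (\<Sum>j\<in>J. f j * h powi j)" by blast
  obtain b i where b: "g = b * h powi i" "b \<in> E" "i \<ge> k" using add by blast
  let ?f = "\<lambda>j. (if j \<in> J then f j else 0) + (if j = i then b else 0)"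
  have "(\<Sum>j\<in>insert i J. ?f j * h powi j) = (\<Sum>j\<in>insert i J. (if j \<in> J then f j * h powi j else 0))
     + (\<Sum>j\<in>insert i J. (if j = i then b * h powi j else 0))"
    by (subst sum.distrib[symmetric]) (auto intro!: sum.cong simp: distrib_right)
  also have "\<dots> = a + g" using J b by (simp add: sum.If_cases Int_absorb1 subset_insertI sum.delta insert_absorb)
  finally have "g + a = (\<Sum>j\<in>insert i J. ?f j * h powi j)" by (simp add: add.commute)
  thus ?case using J b div_subringD[OF E]
    by (intro exI[of _ "insert i J"] exI[of _ ?f]) auto
qed

lemma ge_mono: "k \<le> l \<Longrightarrow> ge l \<subseteq> ge k"
  unfolding ge_def add_span_def by fastforce

lemma ge_add: "a \<in> ge k \<Longrightarrow> b \<in> ge k \<Longrightarrow> a + b \<in> ge k" unfolding ge_def by (rule add_span_add)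

lemma ge_in: "b \<in> E \<Longrightarrow> b \<noteq> 0 \<Longrightarrow> k \<le> j \<Longrightarrow> b * h powi j \<in> ge k" unfolding ge_def by (rule add_span_in) blast

lemma ge_mult: assumes "a \<in> ge k" "b \<in> ge l" shows "a * b \<in> ge (k + l)"
proof -
  have *: "g * g' \<in> ge (k + l)" if g: "g \<in> {b * h powi j | b j. b \<in> E \<and> b \<noteq> 0 \<and> j \<ge> k}"
    "g' \<in> {b * h powi j | b j. b \<in> E \<and> b \<noteq> 0 \<and> j \<ge> l}" for g g'
  proof -
    obtain b i c j where e: "g = b * h powi i" "g' = c * h powi j" "b \<in> E" "c \<in> E" "b \<noteq> 0" "c \<noteq> 0" "i \<ge> k" "j \<ge> l"
      using g by blast
    have "b * conjg (h powi i) c \<noteq> 0" using e h0 conjg_eq_0[of "h powi i"] by simp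
    thus ?thesis unfolding e(1,2) mult_powi[OF e(3,4)] using e powi_in div_subringD(4)[OF E] by (intro ge_in) auto
  qed
  show ?thesis
    using assms(2) unfolding ge_def
    by (rule add_span_scale_left[rotated]) (rule add_span_scale_right[OF _ assms(1)[unfolded ge_def]], rule *[unfolded ge_def])
qed

lemma lead_mult: assumes "lead a k" "lead b l" shows "lead (a * b) (k + l)"
proof -
  obtain c a' where a: "c \<in> E" "c \<noteq> 0" "a' \<in> ge (k + 1)" "a = c * h powi k + a'" using assms(1) by (auto simp: lead_def)
  obtain d b' where b: "d \<in> E" "d \<noteq> 0" "b' \<in> ge (l + 1)" "b = d * h powi l + b'" using assms(2) by (auto simp: lead_def)
  have 1: "c * h powi k * b' \<in> ge (k + l + 1)" using ge_mult[OF ge_in[OF a(1,2) order_refl] b(3)] by (simp add: add.assoc)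
  have 2: "a' * (d * h powi l) \<in> ge (k + l + 1)" using ge_mult[OF a(3) ge_in[OF b(1,2) order_refl]]
    by (metis add.assoc add.commute)
  have 3: "a' * b' \<in> ge (k + l + 1)" using subsetD[OF ge_mono ge_mult[OF a(3) b(3)]] by simp
  have "a * b = (c * conjg (h powi k) d) * h powi (k + l) + (c * h powi k * b' + a' * (d * h powi l) + a' * b')"
    unfolding a b mult_powi[OF a(1) b(1), symmetric] by (simp add: algebra_simps)
  moreover have "c * conjg (h powi k) d \<in> E" "c * conjg (h powi k) d \<noteq> 0"
    using a b powi_in div_subringD(4)[OF E] h0 conjg_eq_0[of "h powi k"] by auto
  ultimately show ?thesis unfolding lead_def using 1 2 3 ge_add by blast
qed

end

text \<open>The orbit of \<open>x\<close> under conjugation by powers of \<open>h\<close> is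
  infinite, so these powers act as distinct characters on \<open>E\<close> and are independent over
  it. This makes the order well defined.\<close>

locale free_power_layer = power_layer +
  fixes x
  assumes xE: "x \<in> E" and free: "i \<noteq> 0 \<Longrightarrow> h powi i * x \<noteq> x * h powi i"
begin

lemma indep:
  assumes "finite J" "\<And>j. j \<in> J \<Longrightarrow> f j \<in> E" "(\<Sum>j\<in>J. f j * h powi j) = 0" "j \<in> J"
  shows "f j = 0"
proof -
  have "f j * h powi j = 0"
  proof (rule dedekind[where J=J and X=E and op="(*)" and \<theta>="\<lambda>i. conjg (h powi i)" and g="\<lambda>j. f j * h powi j"])
    fix q assume q: "q \<in> E"
    have "conjg (h powi j) q * (f j * h powi j) = f j * h powi j * q" if "j \<in> J" for j
    proof -
      have "conjg (h powi j) q * (f j * h powi j) = f j * (conjg (h powi j) q * h powi j)"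
        using centralizerD[OF subsetD[OF Ec powi_in[OF q]] assms(2)[OF that]] by (simp add: mult.assoc[symmetric])
      thus ?thesis using h0 by (simp add: conjg_def mult.assoc)
    qed
    hence "(\<Sum>j\<in>J. conjg (h powi j) q * (f j * h powi j)) = (\<Sum>j\<in>J. f j * h powi j) * q"
      by (simp add: sum_distrib_right)
    thus "(\<Sum>j\<in>J. conjg (h powi j) q * (f j * h powi j)) = 0" using assms(3) by simp
  next
    fix j k :: int assume "j \<noteq> k"
    have "conjg (h powi j) x \<noteq> conjg (h powi k) x"
    proof
      assume "conjg (h powi j) x = conjg (h powi k) x"
      hence "conjg (h powi (-k)) (conjg (h powi j) x) = x" using h0
        by (simp add: conjg_conjg power_int_add[symmetric]) (simp add: conjg_def)
      hence "conjg (h powi (j - k)) x = x" using h0 by (simp add: conjg_conjg power_int_add[symmetric])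
      hence "h powi (j - k) * x = x * h powi (j - k)" using h0 by (simp add: conjg_fix_iff)
      thus False using free[of "j - k"] \<open>j \<noteq> k\<close> by simp
    qed
    thus "\<exists>q\<in>E. conjg (h powi j) q \<noteq> conjg (h powi k) q" using xE by blast
  next
    fix j show "\<exists>q\<in>E. conjg (h powi j) q \<noteq> 0" using h0 div_subringD(2)[OF E] by (intro bexI[of _ 1]) (auto simp: conjg_1)
  next
    fix j k q r assume "q \<in> E" "r \<in> E"
    thus "conjg (h powi j) q * conjg (h powi k) r = conjg (h powi k) r * conjg (h powi j) q"
      using centralizerD[OF subsetD[OF Ec]] powi_in by blast
  qed (use assms h0 in \<open>auto simp: div_subringD[OF E] conjg_mult\<close>)
  thus ?thesis using h0 by simp
qed

lemma lead_unique: assumes "lead a k" "lead a l" shows "k = l"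
proof -
  have *: False if lt: "k < l" and k: "lead a k" and l: "lead a l" for k l
  proof -
    obtain c a' where a: "c \<in> E" "c \<noteq> 0" "a' \<in> ge (k + 1)" "a = c * h powi k + a'" using k by (auto simp: lead_def)
    obtain d b' where b: "d \<in> E" "d \<noteq> 0" "b' \<in> ge (l + 1)" "a = d * h powi l + b'" using l by (auto simp: lead_def)
    have "-1 * h powi 0 \<in> ge 0" by (rule ge_in) (auto simp: div_subringD[OF E])
    from ge_mult[OF this a(3)] have "- a' \<in> ge (k + 1)" by simp
    moreover have "d * h powi l + b' \<in> ge (k + 1)"
      using lt ge_in[OF b(1,2)] subsetD[OF ge_mono b(3)] by (intro ge_add) auto
    ultimately have "(d * h powi l + b') + - a' \<in> ge (k + 1)" by (rule ge_add[rotated])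
    moreover have "(d * h powi l + b') + - a' = c * h powi k" using a(4) b(4) by (simp add: algebra_simps)
    ultimately have "c * h powi k \<in> ge (k + 1)" by simp
    from coeffs[OF this] obtain J f where J: "finite J" "J \<subseteq> {k+1..}" "\<forall>j\<in>J. f j \<in> E" "c * h powi k = (\<Sum>j\<in>J. f j * h powi j)"
      by (elim exE conjE)
    have kJ: "k \<notin> J" using J(2) by auto
    let ?f = "\<lambda>j. if j = k then c else - f j"
    have "(\<Sum>j\<in>J. ?f j * h powi j) = - (\<Sum>j\<in>J. f j * h powi j)"
      unfolding sum_negf[symmetric] using kJ by (intro sum.cong) auto
    hence "(\<Sum>j\<in>insert k J. ?f j * h powi j) = 0" using J kJ by simp
    hence "?f k = 0" by (rule indep[rotated 2]) (use J a div_subringD[OF E] in auto)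
    thus False using a by simp
  qed
  show ?thesis using *[of k l] *[of l k] assms by (metis linorder_neqE)
qed

lemma lead_exists: assumes "a \<in> add_span G" "a \<noteq> 0" shows "\<exists>k. lead a k"
proof -
  have "\<exists>k. a \<in> ge k" using assms(1)
  proof (induction rule: add_span_induct)
    case zero thus ?case by (auto simp: ge_def add_span_0)
  next
    case (add g a)
    then obtain k where k: "a \<in> ge k" by blast
    obtain b i where b: "g = b * h powi i" "b \<in> E" "b \<noteq> 0" using add G_iff by blast
    have "g + a \<in> ge (min i k)" using subsetD[OF ge_mono k, of "min i k"] ge_in[OF b(2,3), of "min i k" i] b(1)
      by (intro ge_add) auto
    thus ?case by blast
  qed
  then obtain k where k: "a \<in> ge k" by blast
  from coeffs[OF k] obtain J f where J: "finite J" "\<forall>j\<in>J. f j \<in> E" "a = (\<Sum>j\<in>J. f j * h powi j)"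
    by (elim exE conjE)
  let ?J = "{j \<in> J. f j \<noteq> 0}"
  have aJ: "a = (\<Sum>j\<in>?J. f j * h powi j)" unfolding J(3) using J(1) by (intro sum.mono_neutral_right) auto
  have ne: "?J \<noteq> {}"
  proof
    assume e: "?J = {}"
    show False using aJ assms(2) unfolding e by simp
  qed
  define m where "m = Min ?J"
  have fin: "finite ?J" using J by simp
  have m: "m \<in> ?J" unfolding m_def using Min_in[OF fin ne] .
  have "a = f m * h powi m + (\<Sum>j\<in>?J - {m}. f j * h powi j)" unfolding aJ using fin m by (rule sum.remove)
  moreover have "(\<Sum>j\<in>?J - {m}. f j * h powi j) \<in> ge (m + 1)" unfolding ge_def
  proof (rule add_span_sum)
    fix j assume j: "j \<in> ?J - {m}"
    have "m \<le> j" unfolding m_def using Min_le[OF fin] j by blast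
    hence "m + 1 \<le> j" using j by auto
    thus "f j * h powi j \<in> add_span {b * h powi j | b j. b \<in> E \<and> b \<noteq> 0 \<and> m + 1 \<le> j}"
      using j J(2) by (intro add_span_in) blast
  qed
  ultimately show ?thesis unfolding lead_def using m J(2) by blast
qed

text \<open>A valuation is invariant under conjugation, but \<open>d\<close> is only a fraction.
  With \<open>y = conjg d x\<close> and \<open>g = f * d\<close>, the Ore relation
  \<open>u * f * y = v * f\<close> implies \<open>u * g * x = v * g\<close>. Since \<open>x\<close>
  has order 0, the second shows that \<open>u\<close> and \<open>v\<close> have equal order, and the
  first then gives \<open>i = 0\<close>.\<close>

lemma degree_zero:
  assumes d: "d \<in> fractions" "d \<noteq> 0" and c: "conjg d x \<in> G"
  shows "conjg d x \<in> E"
proof -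
  obtain b i where b: "conjg d x = b * h powi i" "b \<in> E" "b \<noteq> 0" using c G_iff by blast
  obtain f where f: "f \<in> add_span G" "f \<noteq> 0" "f * d \<in> add_span G" using d by (auto simp: fractions_def)
  define g where "g = f * d"
  define y where "y = conjg d x"
  have y: "y \<in> add_span G" "y \<noteq> 0" using c add_span_in b h0 by (auto simp: y_def)
  have fy: "f * y \<in> add_span G" "f * y \<noteq> 0" using f y add_span_mult[OF \<Gamma>] by auto
  obtain u v where uv: "u \<in> add_span G" "v \<in> add_span G" "u \<noteq> 0" "v \<noteq> 0" "u * (f * y) = v * f" using ore[OF fy f(1,2)] by blast
  have g: "g \<in> add_span G" "g \<noteq> 0" using f d by (auto simp: g_def)
  have "y * d = d * x" using d by (simp add: y_def conjg_def mult.assoc)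
  hence "u * g * x = u * (f * y) * d" by (simp add: g_def mult.assoc)
  hence e: "u * g * x = v * g" unfolding uv(5) by (simp add: g_def mult.assoc)
  obtain a where a: "lead u a" using lead_exists uv by blast
  obtain b' where b': "lead v b'" using lead_exists uv by blast
  obtain c' where c': "lead g c'" using lead_exists g by blast
  obtain k where k: "lead f k" using lead_exists f by blast
  have z: "0 \<in> ge l" for l by (simp add: ge_def add_span_0)
  have x0: "x \<noteq> 0" using free[of 1] by auto
  have lx: "lead x 0" unfolding lead_def using xE z x0 by (intro bexI[of _ x] conjI bexI[of _ 0]) auto
  have ly: "lead y i" unfolding lead_def using b z by (intro bexI[of _ b] conjI bexI[of _ 0]) (auto simp: y_def)
  have "lead (v * g) (a + c' + 0)" using lead_mult[OF lead_mult[OF a c'] lx] e by simp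
  hence "a + c' + 0 = b' + c'" by (rule lead_unique[OF _ lead_mult[OF b' c']])
  hence 1: "a = b'" by simp
  have "lead (v * f) (a + (k + i))" using lead_mult[OF a lead_mult[OF k ly]] uv by simp
  hence "a + (k + i) = b' + k" by (rule lead_unique[OF _ lead_mult[OF b' k]])
  hence "i = 0" using 1 by simp
  thus ?thesis using b by simp
qed

end


lemma subnormal_chain_in: "subnormal_chain N n R \<Longrightarrow> i \<le> n \<Longrightarrow> x \<in> N i \<Longrightarrow> x \<in> R \<and> x \<noteq> 0"
  using subnormal_chain_sub by blast

section \<open>Abelian subnormal subgroups\<close>

text \<open>The situation of a symbol algebra. \<open>h\<close>, \<open>z\<close> and
  \<open>x ^ p\<close> commute, and conjugation by \<open>x\<close> multiplies \<open>h\<close> by a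
  root of unity, so \<open>x\<close> acts with order \<open>p\<close> on the bicentralizer
  \<open>K\<close>. Iterated commutators with \<open>x\<close> end in \<open>N 0\<close>, which
  commutes with \<open>x\<close>: an Engel condition.\<close>

lemma symbol_impossible:
  assumes R: "div_subring R" and N: "subnormal_chain N n R" and ab: "N 0 \<subseteq> centralizer (N 0)" and x: "x \<in> N 0"
    and h: "h \<in> R" "h \<noteq> 0" and z: "h * x = z * x * h" "z * h = h * z" "z * x = x * z" "z ^ p = 1" "z \<noteq> 1"
    and p: "prime p"
  shows False
proof -
  have x0: "x \<in> R" "x \<noteq> 0" using subnormal_chain_in[OF N _ x] by auto
  have z0: "z \<noteq> 0"
  proof
    assume "z = 0"
    hence "h * x = 0" using z(1) by simp
    thus False using h x0 by simp
  qed
  define T where "T = {h, z, x ^ p}"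
  define K where "K = R \<inter> centralizer (centralizer T)"
  have hx: "h * x ^ i = z ^ i * x ^ i * h" for i
  proof (induction i)
    case (Suc i)
    have zi: "z ^ i * x = x * z ^ i" using z(3) by (metis power_commuting_commutes)
    have "h * x ^ Suc i = (h * x) * x ^ i" by (simp add: mult.assoc)
    also have "\<dots> = z * x * (h * x ^ i)" unfolding z(1) by (simp add: mult.assoc)
    also have "\<dots> = z * (x * z ^ i) * x ^ i * h" unfolding Suc by (simp add: mult.assoc)
    also have "\<dots> = z ^ Suc i * x ^ Suc i * h" unfolding zi[symmetric] by (simp add: mult.assoc)
    finally show ?case .
  qed simp
  have hxp: "h * x ^ p = x ^ p * h" using hx[of p] z(4) by simp
  have zxp: "z * x ^ p = x ^ p * z" using z(3) by (metis power_commuting_commutes)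
  have T: "T \<subseteq> centralizer T" using hxp zxp z(2) by (auto simp: T_def centralizer_def)
  have cjx: "conjg x h = inverse z * h"
  proof -
    have "z * (x * h) = h * x" using z(1) by (simp add: mult.assoc)
    hence "x * h = inverse z * (h * x)" using z0 by (metis mult.assoc left_inverse mult_1)
    thus ?thesis using x0 by (simp add: conjg_eq_iff mult.assoc)
  qed
  have "conjg x z = z" "conjg x (x ^ p) = x ^ p" using x0 z(3) by (simp_all add: conjg_fix_iff power_commutes)
  hence img: "conjg x ` T = {inverse z * h, z, x ^ p}" using cjx by (simp add: T_def)
  have cT: "centralizer (conjg x ` T) = centralizer T"
  proof (intro equalityI subsetI)
    fix w assume "w \<in> centralizer T"
    hence w: "w \<in> centralizer T" .
    have "z \<in> centralizer {w}" "h \<in> centralizer {w}" using w by (auto simp: T_def centralizer_def)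
    hence "inverse z * h \<in> centralizer {w}" by (simp add: div_subringD(4,6)[OF div_subring_centralizer])
    thus "w \<in> centralizer (conjg x ` T)" unfolding img using w by (auto simp: T_def centralizer_def)
  next
    fix w assume w: "w \<in> centralizer (conjg x ` T)"
    have "z \<in> centralizer {w}" "inverse z * h \<in> centralizer {w}" using w unfolding img by (auto simp: centralizer_def)
    hence "z * (inverse z * h) \<in> centralizer {w}" by (simp add: div_subringD(4)[OF div_subring_centralizer])
    moreover have "z * (inverse z * h) = h" using z0 by (simp add: mult.assoc[symmetric])
    ultimately show "w \<in> centralizer T" using w unfolding img by (auto simp: T_def centralizer_def)
  qed
  have xK: "conjg x ` K = K" unfolding K_def
    using conjg_image_Int[OF x0(2)] conjg_image_div_subring[OF R x0] conjg_image_centralizer[OF x0(2)] cT by simp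
  have Kc: "K \<subseteq> centralizer K" by (rule CC_comm[OF T]) (simp add: K_def)
  have xpK: "x ^ p \<in> K" "h \<in> K" using x0 h div_subring_prod[OF R] subsetD[OF centralizer_centralizer[of T]] by (auto simp: K_def T_def)
  have "x \<notin> centralizer K"
  proof
    assume "x \<in> centralizer K"
    hence "x * h = h * x" using centralizerD xpK by blast
    hence "1 * (x * h) = z * (x * h)" using z(1) by (simp add: mult.assoc)
    hence "1 = z" using x0 h by (metis mult_cancel_right no_zero_divisors)
    thus False using z by simp
  qed
  then interpret cyclic_layer K x p
    using R Kc x0 xK p xpK by unfold_locales (auto simp: K_def div_subring_Int div_subring_centralizer)
  show False
  proof (rule engel_impossible[OF xpK(1), of 1 n])
    fix k assume k: "k \<in> K" "k \<noteq> 0"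
    have "(commutator x ^^ n) k \<in> N (n - n)" by (rule subnormal_chain_commutator[OF N x _ k(2)]) (use k in \<open>auto simp: K_def\<close>)
    hence "x * (commutator x ^^ n) k = (commutator x ^^ n) k * x" using ab x by (auto simp: centralizer_def)
    thus "conjg x ((commutator x ^^ n) (k ^ 1)) = (commutator x ^^ n) (k ^ 1)" using x0 by (simp add: conjg_fix_iff)
  qed simp
qed

text \<open>The climbing argument with \<open>Q = {x}\<close>. The hypothesis \<open>Y\<close>,
  proved differently for free and for prime orbits, turns a monomial conjugate of \<open>x\<close>
  into an element of \<open>E\<close>. At the top this makes \<open>1 + h\<close> a monomial, and
  comparing conjugation by \<open>h\<close> and by \<open>1 + h\<close> forces \<open>h\<close> into
  \<open>E\<close> or makes it commute with \<open>x\<close>.\<close>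

lemma power_layer_impossible:
  assumes R: "div_subring R" and N: "subnormal_chain N n R" and ab: "N 0 \<subseteq> centralizer (N 0)" and x: "x \<in> N 0"
    and pl: "power_layer E h" and ER: "E \<subseteq> R" "x \<in> E" and h: "h \<in> R" "h * x \<noteq> x * h"
    and H: "\<And>i. h powi i * x = x * h powi i \<Longrightarrow> h powi i \<in> E"
    and Y: "\<And>d. d \<in> abelian_layer.fractions (scaled E (int_powers h)) \<Longrightarrow> d \<noteq> 0 \<Longrightarrow> conjg d x \<in> scaled E (int_powers h) \<Longrightarrow> conjg d x \<in> E"
  shows False
proof -
  interpret power_layer E h by (rule pl)
  \<comment> \<open>By \<open>eigen_split\<close> each monomial of such a sum commutes with
    \<open>x\<close>. So does its power of \<open>h\<close>, which then lies in \<open>E\<close> by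
    \<open>H\<close>.\<close>
  have cx: "add_span G \<inter> centralizer {x} \<subseteq> insert 0 G"
  proof
    fix a assume a: "a \<in> add_span G \<inter> centralizer {x}"
    show "a \<in> insert 0 G"
    proof (cases "a = 0")
      case False
      then obtain xs where xs: "set xs \<subseteq> G" "a = sum_list xs"
         "\<forall>q\<in>E. \<forall>\<theta>\<in>E. a * q = \<theta> * a \<longrightarrow> (\<forall>g\<in>set xs. g * q = \<theta> * g)"
        using eigen_split[of a] a by blast
      have ax: "a * x = x * a" using a by (auto simp: centralizer_def)
      have "g \<in> E" if g: "g \<in> set xs" for g
      proof -
        have gx: "g * x = x * g" using xs(3) ax ER(2) g by blast
        obtain b i where b: "b \<in> E" "b \<noteq> 0" "g = b * h powi i" using g xs(1) G_iff by blast
        have "b * (h powi i * x) = b * (x * h powi i)"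
          using gx b centralizerD[OF subsetD[OF Ec b(1)] ER(2)] by (simp add: mult.assoc) (simp add: mult.assoc[symmetric])
        hence "h powi i \<in> E" using b(2) by (intro H) simp
        thus ?thesis using b div_subringD(4)[OF L] by simp
      qed
      hence "sum_list xs \<in> E" using div_subringD(1,3)[OF L] by (induction xs) auto
      thus ?thesis using xs(2) False sub by auto
    qed simp
  qed
  have FrR: "fractions \<subseteq> R"
  proof (rule fractions_least[OF R scaled_sub[OF R ER(1)]])
    show "int_powers h \<subseteq> R" using div_subring_powi[OF R h(1)] by (auto simp: int_powers_def)
  qed
  have main: "k \<le> n \<Longrightarrow> N k \<inter> fractions \<subseteq> G" for k
  proof (induction k)
    case 0
    show ?case
    proof
      fix d assume d: "d \<in> N 0 \<inter> fractions"
      have d0: "d \<noteq> 0" using subnormal_chain_in[OF N, of 0 d] d by auto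
      have "d * x = x * d" using ab d x by (auto simp: centralizer_def)
      hence "conjg d x = x" using d0 by (simp add: conjg_fix_iff)
      thus "d \<in> G" using conj_into_layer[OF _ cx, of d] ER(2) d d0 by auto
    qed
  next
    case (Suc k)
    show ?case
    proof
      fix d assume d: "d \<in> N (Suc k) \<inter> fractions"
      have d0: "d \<noteq> 0" using subnormal_chain_in[OF N, of "Suc k" d] d Suc by auto
      have "conjg d x \<in> N k" using subnormal_chain_step[OF N _ _ x, of k d] d Suc by auto
      moreover have "conjg d x \<in> fractions" unfolding conjg_def
        using d ER(2) L_in[OF ER(2)] subnormal_chain_in[OF N _ x] \<Gamma>_fractions div_subringD(4,6)[OF div_subring_fractions] by blast
      ultimately have "conjg d x \<in> G" using Suc by auto
      hence "conjg d x \<in> E" using Y[of d] d d0 by blast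
      thus "d \<in> G" using conj_into_layer[OF _ cx, of d] ER(2) d d0 by auto
    qed
  qed
  have hG: "h \<in> G" using T_sub_scaled[OF L, of "int_powers h"] rangeI[of "\<lambda>i. h powi i" 1] by (auto simp: int_powers_def)
  have hE: "h \<notin> E" using h(2) centralizerD[OF subsetD[OF Ec], of h x] ER(2) by blast
  have n0: "1 + h \<noteq> 0"
  proof
    assume "1 + h = 0"
    hence "h = -1" by (simp add: add_eq_0_iff)
    thus False using hE div_subringD(2,5)[OF L] by blast
  qed
  have "1 + h \<in> fractions" using \<Gamma>_fractions hG div_subringD(2,3)[OF div_subring_fractions] by blast
  moreover from this have "1 + h \<in> N n" using FrR n0 subnormal_chainD(1)[OF N] by blast
  ultimately have "1 + h \<in> G" using main[of n] by blast
  hence t: "conjg (1 + h) x \<in> E" using norm ER(2) by (auto simp: normalizes_def)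
  have s: "conjg h x \<in> E" using norm ER(2) hG by (auto simp: normalizes_def)
  have "(1 + h) * x = conjg (1 + h) x * (1 + h)" "h * x = conjg h x * h" using n0 h0 conjg_eq_iff by metis+
  hence e: "x - conjg (1 + h) x = (conjg (1 + h) x - conjg h x) * h" by (simp add: algebra_simps)
  show False
  proof (cases "conjg (1 + h) x = conjg h x")
    case True
    hence "conjg h x = x" using e by simp
    thus False using h h0 by (simp add: conjg_fix_iff)
  next
    case False
    hence "h = inverse (conjg (1 + h) x - conjg h x) * (x - conjg (1 + h) x)" unfolding e by (simp add: mult.assoc[symmetric])
    moreover have "inverse (conjg (1 + h) x - conjg h x) * (x - conjg (1 + h) x) \<in> E"
      using t s ER(2) by (simp add: div_subringD(4,6)[OF L] div_subring_diff[OF L])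
    ultimately show False using hE by simp
  qed
qed

lemma eq_1_of_coprime_powers:
  assumes "z ^ i = 1" "z ^ j = 1" "coprime i j" shows "z = (1::'a::division_ring)"
proof (cases "z = 0")
  case True
  hence "i = 0" "j = 0" using assms by (auto simp: power_0_left split: if_splits)
  thus ?thesis using assms by simp
next
  case False
  obtain u v where uv: "int i * u + int j * v = 1"
    using bezout_int[of "int i" "int j"] assms(3) by (auto simp: coprime_iff_gcd_eq_1 mult.commute)
  have "z = z powi (int i * u + int j * v)" using uv by simp
  also have "\<dots> = (z ^ i) powi u * (z ^ j) powi v" using False by (simp add: power_int_add power_int_mult)
  finally show ?thesis using assms by simp
qed

lemma commuting_power_mult: "a * b = b * a \<Longrightarrow> (a * b) ^ n = a ^ n * (b::'a::monoid_mult) ^ n"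
proof (induction n)
  case (Suc n)
  have "b * a ^ n = a ^ n * b" using Suc.prems by (metis power_commuting_commutes)
  have "(a * b) ^ Suc n = a * (b * a ^ n) * b ^ n" using Suc.IH[OF Suc.prems] by (simp add: mult.assoc)
  also have "\<dots> = a ^ Suc n * b ^ Suc n" unfolding \<open>b * a ^ n = a ^ n * b\<close> by (simp add: mult.assoc)
  finally show ?case .
qed simp

lemma power_mod_eq: assumes "z ^ p = (1::'a::monoid_mult)" "[i = j] (mod p)" shows "z ^ i = z ^ j"
proof -
  have *: "z ^ k = z ^ (k mod p)" for k
  proof -
    have "z ^ k = z ^ (p * (k div p) + k mod p)" by simp
    also have "\<dots> = z ^ (k mod p)" unfolding power_add power_mult assms(1) by simp
    finally show ?thesis .
  qed
  show ?thesis using *[of i] *[of j] assms(2) by (simp add: cong_def)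
qed

text \<open>An automorphism of order \<open>p\<close> acts trivially on a group of order \<open>p\<close>.\<close>

lemma fixed_root_of_unity:
  assumes E: "div_subring E" "E \<subseteq> centralizer E" and h: "h \<noteq> 0" "conjg h ` E = E" "h ^ p \<in> centralizer E" and p: "prime p"
    and z: "z \<in> E" "z ^ p = 1" "z \<noteq> 1"
  shows "conjg h z = z"
proof -
  have p0: "p > 0" using p prime_gt_0_nat by blast
  let ?W = "{w \<in> E. w ^ p = 1}"
  have W: "finite ?W" "card ?W \<le> p" using roots_of_unity[OF E p0] by auto
  have inj: "inj_on (\<lambda>i. z ^ i) {..<p}"
  proof -
    have *: False if ij: "i < j" "j < p" "z ^ i = z ^ j" for i j
    proof -
      have z0: "z \<noteq> 0" using z(2) p0 by (auto simp: power_0_left)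
      have "z ^ i * z ^ (j - i) = z ^ (i + (j - i))" by (rule power_add[symmetric])
      hence "z ^ i * z ^ (j - i) = z ^ i" using ij by simp
      hence "z ^ (j - i) = 1" using z0 by simp
      moreover have "coprime (j - i) p" using ij p by (metis coprime_commute diff_is_0_eq dvd_imp_le less_imp_diff_less not_le prime_imp_coprime zero_less_diff)
      ultimately show False using eq_1_of_coprime_powers z by blast
    qed
    show ?thesis by (rule inj_onI) (metis * lessThan_iff linorder_neqE_nat)
  qed
  have sub: "(\<lambda>i. z ^ i) ` {..<p} \<subseteq> ?W"
  proof
    fix w assume "w \<in> (\<lambda>i. z ^ i) ` {..<p}"
    then obtain i where w: "w = z ^ i" by blast
    have "w ^ p = (z ^ p) ^ i" unfolding w by (simp only: power_mult[symmetric] mult.commute)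
    thus "w \<in> ?W" using z div_subring_prod[OF E(1) z(1)] w by simp
  qed
  have "card ((\<lambda>i. z ^ i) ` {..<p}) = p" using inj by (simp add: card_image)
  hence "(\<lambda>i. z ^ i) ` {..<p} = ?W" using W card_mono[OF W(1) sub] sub by (intro card_subset_eq) auto
  moreover have "conjg h z \<in> ?W" using h(2) z h(1) by (auto simp: conjg_power[symmetric] conjg_1)
  ultimately obtain j where j: "conjg h z = z ^ j" by blast
  have "conjg (h ^ k) z = z ^ (j ^ k)" for k
  proof (induction k)
    case (Suc k)
    have "conjg (h ^ Suc k) z = conjg h (conjg (h ^ k) z)" by (simp add: conjg_conjg)
    also have "\<dots> = (z ^ j) ^ (j ^ k)" using Suc h(1) j by (simp add: conjg_power)
    finally show ?case by (simp add: power_mult)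
  qed (simp add: conjg_one)
  moreover have "conjg (h ^ p) z = z" using centralizerD[OF h(3) z(1)] h(1) by (simp add: conjg_fix_iff)
  ultimately have 1: "z ^ (j ^ p) = z" by metis
  \<comment> \<open>\<open>h\<close> sends \<open>z\<close> to \<open>z ^ j\<close>, and its
    \<open>p\<close>-th power fixes \<open>z\<close>, so \<open>z ^ (j ^ p) = z\<close>. Fermat's
    little theorem replaces \<open>j ^ p\<close> by \<open>j\<close>.\<close>
  have "[j ^ p = j] (mod p)"
  proof (cases "p dvd j")
    case True
    hence "p dvd j ^ p" using p0 dvd_power[of p j] dvd_trans by blast
    thus ?thesis using True by (simp add: cong_def mod_eq_0_iff_dvd)
  next
    case False
    have "[j ^ (p - 1) * j = 1 * j] (mod p)" using fermat_theorem[OF p False] by (rule cong_mult) simp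
    moreover have "j ^ (p - 1) * j = j ^ p" using p0 by (metis power_minus_mult)
    ultimately show ?thesis by simp
  qed
  hence "z ^ (j ^ p) = z ^ j" using z(2) power_mod_eq by blast
  thus ?thesis using j 1 by simp
qed

lemma orbit_image: "h \<noteq> 0 \<Longrightarrow> conjg h ` range (\<lambda>i. conjg (h powi i) x) = range (\<lambda>i. conjg (h powi i) x)"
proof -
  assume h: "h \<noteq> 0"
  have *: "conjg h (conjg (h powi i) x) = conjg (h powi (i + 1)) x" for i
    using h by (simp add: conjg_conjg power_int_add_1')
  show ?thesis
  proof (intro equalityI subsetI)
    fix y assume "y \<in> range (\<lambda>i. conjg (h powi i) x)"
    then obtain i where "y = conjg (h powi i) x" by blast
    hence "y = conjg h (conjg (h powi (i - 1)) x)" using *[of "i - 1"] by simp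
    thus "y \<in> conjg h ` range (\<lambda>i. conjg (h powi i) x)" by blast
  qed (use * in auto)
qed

lemma power_layer_CC:
  assumes "div_subring R" "h \<in> R" "h \<noteq> 0" "T \<subseteq> centralizer T" "conjg h ` T = T"
  shows "power_layer (R \<inter> centralizer (centralizer T)) h"
proof
  show "div_subring (R \<inter> centralizer (centralizer T))" using assms by (simp add: div_subring_Int div_subring_centralizer)
  show "R \<inter> centralizer (centralizer T) \<subseteq> centralizer (R \<inter> centralizer (centralizer T))" by (rule CC_comm[OF assms(4)]) simp
  show "conjg h ` (R \<inter> centralizer (centralizer T)) = R \<inter> centralizer (centralizer T)"
    using assms by (simp add: conjg_image_Int conjg_image_centralizer conjg_image_div_subring)
qed (rule assms)

text \<open>\<open>h ^ p\<close> is put into \<open>T\<close> so that \<open>E\<close> contains it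
  and exponents matter only modulo \<open>p\<close>. If a conjugate \<open>y\<close> of
  \<open>x\<close> had an exponent prime to \<open>p\<close>, then \<open>y ^ p\<close> would
  commute with all fractions, whence \<open>x ^ p = y ^ p\<close>; then
  \<open>conjg h x * inverse x\<close> is a \<open>p\<close>-th root of unity, which is the symbol
  case.\<close>

lemma prime_orbit_impossible:
  assumes R: "div_subring R" and N: "subnormal_chain N (Suc n) R" and ab: "N 0 \<subseteq> centralizer (N 0)" and x: "x \<in> N 0"
    and h: "h \<in> N 1" "h * x \<noteq> x * h" "prime p" "h ^ p * x = x * h ^ p"
  shows False
proof -
  have x0: "x \<in> R" "x \<noteq> 0" using subnormal_chain_in[OF N, of 0 x] x by auto
  have h0: "h \<in> R" "h \<noteq> 0" using subnormal_chain_in[OF N, of 1 h] h by auto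
  have orb: "conjg (h powi i) x \<in> N 0" for i
    using normalizesD[OF subnormal_chainD(4)[OF N, of 0], of "h powi i" x] mult_group_powi[OF subnormal_chainD(2)[OF N, of 1]] h x by simp
  define T where "T = insert (h ^ p) (range (\<lambda>i. conjg (h powi i) x))"
  have hp: "conjg (h ^ p) x = x" using h h0 by (simp add: conjg_fix_iff)
  have hpo: "h ^ p * conjg (h powi i) x = conjg (h powi i) x * h ^ p" for i
  proof -
    have "conjg (h ^ p) (conjg (h powi i) x) = conjg (h powi i) (conjg (h ^ p) x)"
      using h0 by (simp add: conjg_conjg power_int_add[symmetric] add.commute flip: power_int_of_nat)
    thus ?thesis using h0 hp by (simp add: conjg_fix_iff[symmetric])
  qed
  have T: "T \<subseteq> centralizer T"
  proof (intro subsetI centralizerI)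
    fix s t assume st: "s \<in> T" "t \<in> T"
    have "N 0 \<subseteq> centralizer (N 0)" by (rule ab)
    hence "a * b = b * a" if "a \<in> N 0" "b \<in> N 0" for a b using that by (auto simp: centralizer_def)
    thus "s * t = t * s" using st orb hpo by (auto simp: T_def)
  qed
  have TR: "T \<subseteq> R" using h0 div_subring_prod[OF R] subnormal_chain_in[OF N, of 0] orb by (auto simp: T_def)
  have "conjg h (h ^ p) = h ^ p" using h0 by (simp add: conjg_fix_iff power_commutes)
  hence hT: "conjg h ` T = T" unfolding T_def using orbit_image[OF h0(2)] by simp
  define E where "E = R \<inter> centralizer (centralizer T)"
  note hR = h0(1)
  interpret power_layer E h unfolding E_def by (rule power_layer_CC[OF R h0 T hT])
  have TE: "T \<subseteq> E" using TR centralizer_centralizer by (auto simp: E_def)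
  have xE: "x \<in> E" using TE rangeI[of "\<lambda>i. conjg (h powi i) x" 0] by (auto simp: T_def conjg_one)
  have hpE: "h ^ p \<in> E" using TE by (auto simp: T_def)
  have pdvd: "h powi i \<in> E" if dv: "int p dvd i" for i
  proof -
    obtain k where "i = int p * k" using dv by (elim dvdE)
    hence "h powi i = (h ^ p) powi k" by (simp add: power_int_mult)
    thus ?thesis using div_subring_powi[OF E hpE] by simp
  qed
  have absp: "h ^ nat \<bar>i\<bar> \<in> centralizer {w}" if "h powi i \<in> centralizer {w}" for i w
  proof (cases "i \<ge> 0")
    case True thus ?thesis using that by (simp add: power_int_def)
  next
    case False
    have "inverse (h powi i) \<in> centralizer {w}" using that by (rule div_subringD(6)[OF div_subring_centralizer])
    thus ?thesis using False by (simp add: power_int_def power_inverse)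
  qed
  show False
  proof (rule power_layer_impossible[OF R N ab x power_layer_axioms])
    show "E \<subseteq> R" by (simp add: E_def)
    show "h powi i \<in> E" if "h powi i * x = x * h powi i" for i
    proof -
      have "h powi i \<in> centralizer {x}" using that by (auto simp: centralizer_def)
      hence "h ^ nat \<bar>i\<bar> \<in> centralizer {x}" by (rule absp)
      hence "p dvd nat \<bar>i\<bar>" using h h0 by (intro power_centralizer_prime[of h p "{x}"]) (auto simp: centralizer_def)
      hence "int p dvd i" by (simp add: int_dvd_int_iff[symmetric])
      thus ?thesis by (rule pdvd)
    qed
    fix d assume d: "d \<in> fractions" "d \<noteq> 0" "conjg d x \<in> G"
    define y where "y = conjg d x"
    obtain b i where b: "y = b * h powi i" "b \<in> E" "b \<noteq> 0" using d G_iff y_def by blast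
    show "conjg d x \<in> E"
    proof (cases "int p dvd i")
      case True
      thus ?thesis using b pdvd div_subringD(4)[OF E] by (simp add: y_def[symmetric])
    next
      case False
      have "\<exists>c\<in>E. y ^ k = c * h powi (i * int k)" for k
      proof (induction k)
        case 0 show ?case using div_subringD(2)[OF E] by (intro bexI[of _ 1]) auto
      next
        case (Suc k)
        then obtain c where c: "c \<in> E" "y ^ k = c * h powi (i * int k)" by blast
        have "y ^ Suc k = (b * conjg (h powi i) c) * h powi (i + i * int k)"
          using mult_powi[OF b(2) c(1)] c(2) b(1) by simp
        moreover have "b * conjg (h powi i) c \<in> E" using b c powi_in div_subringD(4)[OF E] by blast
        ultimately show ?case by (intro bexI[of _ "b * conjg (h powi i) c"]) (auto simp: algebra_simps)
      qed
      then obtain c where c: "c \<in> E" "y ^ p = c * h powi (i * int p)" by blast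
      define w where "w = y ^ p"
      have wE: "w \<in> E" using c pdvd[of "i * int p"] div_subringD(4)[OF E] by (simp add: w_def)
      have cE: "e * w = w * e" if "e \<in> E" for e using centralizerD[OF subsetD[OF Ec that] wE] .
      have "y * w = w * y" by (simp add: w_def power_commutes)
      hence "b * (h powi i * w) = (w * b) * h powi i" unfolding b(1) by (simp add: mult.assoc)
      hence "b * (h powi i * w) = b * (w * h powi i)" unfolding cE[OF b(2), symmetric] by (simp add: mult.assoc)
      hence "h powi i \<in> centralizer {w}" using b(3) by (auto simp: centralizer_def)
      hence 1: "h ^ nat \<bar>i\<bar> \<in> centralizer {w}" by (rule absp)
      have 2: "h ^ p \<in> centralizer {w}" using cE[OF hpE] by (auto simp: centralizer_def)
      have "coprime (nat \<bar>i\<bar>) p"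
      proof -
        have "\<not> p dvd nat \<bar>i\<bar>"
        proof
          assume "p dvd nat \<bar>i\<bar>"
          hence "int p dvd int (nat \<bar>i\<bar>)" by (simp only: int_dvd_int_iff)
          thus False using \<open>\<not> int p dvd i\<close> by simp
        qed
        hence "coprime p (nat \<bar>i\<bar>)" by (rule prime_imp_coprime[OF h(3)])
        thus ?thesis by (simp only: coprime_commute)
      qed
      hence hw: "h \<in> centralizer {w}" using power_centralizer_coprime[OF h0 1 2] by blast
      have "G \<subseteq> centralizer {w}"
      proof (rule scaled_sub[OF div_subring_centralizer])
        show "E \<subseteq> centralizer {w}" using cE by (auto simp: centralizer_def)
        show "int_powers h \<subseteq> centralizer {w}" using div_subring_powi[OF div_subring_centralizer hw] by (auto simp: int_powers_def)
      qed
      hence "fractions \<subseteq> centralizer {w}" by (rule fractions_least[OF div_subring_centralizer])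
      hence "conjg d w = w" using d by (auto simp: conjg_fix_iff centralizer_def)
      hence "conjg d (x ^ p) = conjg d w" using d by (simp add: conjg_power y_def w_def)
      hence xpw: "x ^ p = w" using conjg_inv_cancel(1)[OF d(2)] by metis
      define z where "z = conjg h x * inverse x"
      have hxE: "conjg h x \<in> E" using powi_in[OF xE, of 1] by simp
      have zE: "z \<in> E" using hxE xE div_subringD(4,6)[OF E] by (simp add: z_def)
      have zx: "z * x = conjg h x" using x0 by (simp add: z_def mult.assoc)
      have z1: "h * x = z * x * h" unfolding zx using h0 by (simp add: conjg_def mult.assoc)
      have "z * x = x * z" using centralizerD[OF subsetD[OF Ec zE] xE] .
      moreover have "z ^ p * x ^ p = x ^ p"
      proof -
        have "z ^ p * x ^ p = conjg h x ^ p" using commuting_power_mult[OF \<open>z * x = x * z\<close>] zx by simp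
        also have "\<dots> = conjg h w" using h0 xpw by (simp add: conjg_power[symmetric])
        also have "\<dots> = w" using hw h0 by (auto simp: conjg_fix_iff centralizer_def)
        finally show ?thesis using xpw by simp
      qed
      hence zp: "z ^ p = 1" using x0 by simp
      moreover have "z \<noteq> 1" using z1 h(2) by auto
      moreover from this have "conjg h z = z"
        using hpE Ec zE zp h(3) by (intro fixed_root_of_unity[OF E Ec h0 hE]) auto
      hence "h * z = z * h" using h0 by (simp add: conjg_fix_iff)
      ultimately have False using symbol_impossible[OF R N ab x hR h0 z1] h(3) by metis
      thus ?thesis ..
    qed
  qed (use xE hR h in auto)
qed

text \<open>Here the hypothesis \<open>Y\<close> of the climbing argument is
  \<open>degree_zero\<close>.\<close>

lemma free_orbit_impossible:
  assumes R: "div_subring R" and N: "subnormal_chain N (Suc n) R" and ab: "N 0 \<subseteq> centralizer (N 0)" and x: "x \<in> N 0"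
    and h: "h \<in> N 1" "\<And>i. i \<noteq> 0 \<Longrightarrow> h powi i * x \<noteq> x * h powi i"
  shows False
proof -
  have x0: "x \<in> R" "x \<noteq> 0" using subnormal_chain_in[OF N, of 0 x] x by auto
  have h0: "h \<in> R" "h \<noteq> 0" using subnormal_chain_in[OF N, of 1 h] h by auto
  have orb: "conjg (h powi i) x \<in> N 0" for i
    using normalizesD[OF subnormal_chainD(4)[OF N, of 0], of "h powi i" x] mult_group_powi[OF subnormal_chainD(2)[OF N, of 1]] h x by simp
  define T where "T = range (\<lambda>i. conjg (h powi i) x)"
  have T: "T \<subseteq> centralizer T" using ab orb by (auto simp: T_def centralizer_def)
  have TR: "T \<subseteq> R" using subnormal_chain_in[OF N, of 0] orb by (auto simp: T_def)
  have hT: "conjg h ` T = T" unfolding T_def using orbit_image[OF h0(2)] by simp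
  define E where "E = R \<inter> centralizer (centralizer T)"
  have xT: "x \<in> T" using rangeI[of "\<lambda>i. conjg (h powi i) x" 0] by (simp add: T_def conjg_one)
  hence xE: "x \<in> E" using x0 centralizer_centralizer by (auto simp: E_def)
  note hR = h0(1)
  interpret power_layer E h unfolding E_def by (rule power_layer_CC[OF R h0 T hT])
  interpret free_power_layer E h x using xE h(2) by unfold_locales auto
  show False
  proof (rule power_layer_impossible[OF R N ab x power_layer_axioms])
    show "E \<subseteq> R" by (simp add: E_def)
    show "h powi i \<in> E" if "h powi i * x = x * h powi i" for i
      using h(2)[of i] that div_subringD(2)[OF E] by (cases "i = 0") auto
    show "h * x \<noteq> x * h" using h(2)[of 1] by simp
  qed (use xE hR degree_zero in auto)
qed

text \<open>If some positive power of \<open>h\<close> commutes with \<open>x\<close>, take the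
  least such exponent \<open>r\<close> and a prime \<open>p\<close> dividing it:
  \<open>h ^ (r div p)\<close> falls under the prime case. Otherwise the orbit is free.\<close>

lemma abelian_bottom:
  assumes R: "div_subring R" and N: "subnormal_chain N (Suc n) R" and ab: "N 0 \<subseteq> centralizer (N 0)" and x: "x \<in> N 0" and h: "h \<in> N 1"
  shows "h * x = x * h"
proof (rule ccontr)
  assume ne: "h * x \<noteq> x * h"
  have h0: "h \<noteq> 0" using subnormal_chain_in[OF N, of 1 h] h by auto
  show False
  proof (cases "\<exists>r>0. h ^ r \<in> centralizer {x}")
    case False
    have "h powi i * x \<noteq> x * h powi i" if "i \<noteq> 0" for i
    proof
      assume "h powi i * x = x * h powi i"
      hence c: "h powi i \<in> centralizer {x}" by (auto simp: centralizer_def)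
      have "h ^ nat \<bar>i\<bar> \<in> centralizer {x}"
      proof (cases "i \<ge> 0")
        case True thus ?thesis using c by (simp add: power_int_def)
      next
        case False
        have "inverse (h powi i) \<in> centralizer {x}" using c by (rule div_subringD(6)[OF div_subring_centralizer])
        thus ?thesis using False by (simp add: power_int_def power_inverse)
      qed
      moreover have "nat \<bar>i\<bar> > 0" using that by simp
      ultimately show False using False by blast
    qed
    thus False using free_orbit_impossible[OF R N ab x h] by blast
  next
    case True
    define r where "r = (LEAST r. r > 0 \<and> h ^ r \<in> centralizer {x})"
    have r: "r > 0 \<and> h ^ r \<in> centralizer {x}" unfolding r_def using True by (rule LeastI_ex)
    have least: "\<not> (s > 0 \<and> h ^ s \<in> centralizer {x})" if "s < r" for s
      using not_less_Least[of s "\<lambda>r. r > 0 \<and> h ^ r \<in> centralizer {x}"] that unfolding r_def by simp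
    have "r \<noteq> 1"
    proof
      assume "r = 1"
      thus False using r ne by (auto simp: centralizer_def)
    qed
    then obtain p where p: "prime p" "p dvd r" using prime_factor_nat by blast
    then obtain s where s: "r = p * s" by blast
    have s0: "s > 0" using r s by (cases s) auto
    have "s < r" unfolding s using s0 prime_gt_1_nat[OF p(1)] by simp
    hence "h ^ s \<notin> centralizer {x}" using least s0 by blast
    moreover have "(h ^ s) ^ p \<in> centralizer {x}" using r s by (simp add: power_mult[symmetric] mult.commute)
    ultimately show False
      using mult_group_power[OF subnormal_chainD(2)[OF N, of 1] h, of s] p(1)
      by (intro prime_orbit_impossible[OF R N ab x, of "h ^ s" p]) (auto simp: centralizer_def)
  qed
qed

text \<open>By \<open>abelian_bottom\<close> the group is central in \<open>N 1\<close>. The center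
  of \<open>N 1\<close> is normal in \<open>N 2\<close>, so it stands at the bottom of a chain
  shorter by one.\<close>

lemma abelian_subnormal_central:
  assumes "div_subring R" "subnormal_chain N n R" "N 0 \<subseteq> centralizer (N 0)" shows "N 0 \<subseteq> centralizer R"
  using assms(2,3)
proof (induction n arbitrary: N)
  case 0
  thus ?case using subnormal_chainD(1)[OF 0(1)] by (fastforce simp: centralizer_def)
next
  case (Suc n)
  have "h * x = x * h" if "x \<in> N 0" "h \<in> N 1" for x h
    using abelian_bottom[OF assms(1) Suc.prems that] .
  hence c: "N 0 \<subseteq> centralizer (N 1)" by (auto simp: centralizer_def)
  show ?case
  proof (cases n)
    case 0
    thus ?thesis using subnormal_chainD(1)[OF Suc.prems(1)] c by (fastforce simp: centralizer_def)
  next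
    case (Suc m)
    define Z where "Z = N 1 \<inter> centralizer (N 1)"
    have N1: "mult_group (N 1)" "mult_group (N 2)" "normalizes (N 2) (N 1)" "N 1 \<subseteq> N 2"
      using subnormal_chainD[OF Suc.prems(1)] Suc subnormal_chainD(3)[OF Suc.prems(1), of 1] subnormal_chainD(4)[OF Suc.prems(1), of 1]
      by (auto simp: numeral_2_eq_2)
    have "subnormal_chain (\<lambda>i. N (Suc (Suc i))) m R" using subnormal_chain_tail[OF subnormal_chain_tail] Suc.prems(1) Suc by blast
    hence "subnormal_chain (case_nat Z (\<lambda>i. N (Suc (Suc i)))) (Suc m) R"
      using N1 by (intro subnormal_chain_cons) (auto simp: Z_def mult_group_Int_div_subring div_subring_centralizer normalizes_Int normalizes_centralizer numeral_2_eq_2)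
    moreover have "Z \<subseteq> centralizer Z" by (auto simp: Z_def centralizer_def)
    ultimately have "Z \<subseteq> centralizer R" using Suc.IH[of "case_nat Z (\<lambda>i. N (Suc (Suc i)))"] Suc by simp
    moreover have "N 0 \<subseteq> Z" using c subnormal_chainD(3)[OF Suc.prems(1), of 0] by (auto simp: Z_def)
    ultimately show ?thesis by blast
  qed
qed

text \<open>Induction on the derived length makes all commutators of \<open>N 0\<close> central.
  Then the centralizer \<open>C\<close> of \<open>x\<close> in \<open>N 0\<close> is normal, and so
  is its center \<open>X\<close>, which is abelian and contains \<open>x\<close>.\<close>

theorem solvable_subnormal_central:
  assumes R: "div_subring R" and "subnormal_chain N n R" "solvable_set (N 0)" shows "N 0 \<subseteq> centralizer R"
proof -
  obtain m where "(derived_grp ^^ m) (N 0) \<subseteq> {1}" using assms(3) by (auto simp: solvable_set_def)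
  thus ?thesis using assms(2)
  proof (induction m arbitrary: N n)
    case 0 thus ?case by (auto simp: centralizer_def)
  next
    case (Suc m)
    have N0: "mult_group (N 0)" using subnormal_chainD(2)[OF Suc.prems(2)] by simp
    have N0R: "N 0 \<subseteq> R" using subnormal_chain_sub[OF Suc.prems(2), of 0] by auto
    have "subnormal_chain (case_nat (derived_grp (N 0)) N) (Suc n) R"
      using N0 Suc.prems(2) derived_grp_mult_group derived_grp_sub derived_grp_normalizes[OF mult_groupD(2)[OF N0] normalizes_self[OF N0]] by (intro subnormal_chain_cons) auto
    moreover have "(derived_grp ^^ m) (derived_grp (N 0)) \<subseteq> {1}" using Suc.prems(1) by (simp add: funpow_swap1)
    ultimately have d: "derived_grp (N 0) \<subseteq> centralizer R" using Suc.IH[of "case_nat (derived_grp (N 0)) N" "Suc n"] by simp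
    show ?case
    proof
      fix x assume x: "x \<in> N 0"
      define C where "C = N 0 \<inter> centralizer {x}"
      define X where "X = N 0 \<inter> centralizer C"
      have "normalizes (N 0) C"
        unfolding normalizes_def
      proof (intro ballI)
        fix g w assume g: "g \<in> N 0" and w: "w \<in> C"
        have gi: "inverse g \<in> N 0" using g N0 mult_groupD(5) by blast
        have g0: "g \<noteq> 0" using g N0 mult_groupD(3) by blast
        have x0: "x \<noteq> 0" using x N0 mult_groupD(3) by blast
        define c where "c = commutator (inverse g) x"
        have "c \<in> centralizer R" using commutator_in_derived_grp[OF gi x] d by (auto simp: c_def)
        hence cw: "c * w = w * c" using w N0R by (auto simp: C_def centralizer_def)
        have e: "conjg (inverse g) x = c * x" using x0 by (simp add: c_def commutator_conjg mult.assoc)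
        have wx: "w * x = x * w" using w by (simp add: C_def centralizer_def)
        have "w * (c * x) = (c * w) * x" unfolding cw by (simp add: mult.assoc)
        hence "w * (c * x) = c * x * w" using wx by (simp add: mult.assoc)
        hence "conjg g (w * conjg (inverse g) x) = conjg g (conjg (inverse g) x * w)" unfolding e by simp
        hence "conjg g w * x = x * conjg g w" using g0 by (simp add: conjg_mult conjg_inv_cancel)
        thus "conjg g w \<in> C" using mult_group_conjg[OF N0 g] w by (auto simp: C_def centralizer_def)
      qed
      hence nX: "normalizes (N 0) X" unfolding X_def using N0 by (intro normalizes_Int normalizes_self normalizes_centralizer)
      have XC: "X \<subseteq> C" using x by (auto simp: X_def C_def centralizer_def)
      have "subnormal_chain (case_nat X N) (Suc n) R"
        using nX Suc.prems(2) N0 by (intro subnormal_chain_cons) (auto simp: X_def mult_group_Int_div_subring div_subring_centralizer)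
      moreover have "X \<subseteq> centralizer X" using XC by (auto simp: X_def centralizer_def)
      ultimately have "X \<subseteq> centralizer R" using abelian_subnormal_central[OF R, of "case_nat X N"] by simp
      moreover have "x \<in> X" using x by (auto simp: X_def C_def centralizer_def)
      ultimately show "x \<in> centralizer R" by blast
    qed
  qed
qed

section \<open>Division rings generated by subnormal subgroups\<close>

lemma subnormal_chain_derived_series: "subnormal_chain N n R \<Longrightarrow> \<exists>N'. subnormal_chain N' (n + j) R \<and> N' 0 = (derived_grp ^^ j) (N 0)"
proof (induction j)
  case 0 thus ?case by (intro exI[of _ N]) simp
next
  case (Suc j)
  then obtain N' where N': "subnormal_chain N' (n + j) R" "N' 0 = (derived_grp ^^ j) (N 0)" by blast
  have m: "mult_group (N' 0)" using subnormal_chainD(2)[OF N'(1)] by simp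
  have "subnormal_chain (case_nat (derived_grp (N' 0)) N') (Suc (n + j)) R"
    using m derived_grp_mult_group derived_grp_sub derived_grp_normalizes[OF mult_groupD(2)[OF m] normalizes_self[OF m]] by (intro subnormal_chain_cons[OF N'(1)]) auto
  moreover have "case_nat (derived_grp (N' 0)) N' 0 = (derived_grp ^^ Suc j) (N 0)" using N'(2) by simp
  ultimately show ?case unfolding add_Suc_right by blast
qed

text \<open>Kaloujnine's argument: a group stabilising a normal series of length \<open>n\<close> is solvable.  It shows that the
  centralizers of the derived subgroups of a subnormal subgroup become stationary.\<close>

lemma centralizers_stationary:
  assumes N: "subnormal_chain N n UNIV" and J: "n \<le> J"
  shows "(derived_grp ^^ n) (N 0) \<subseteq> centralizer (centralizer ((derived_grp ^^ J) (N 0)))"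
proof -
  define P where "P = N 0"
  define B where "B = centralizer ((derived_grp ^^ J) P)"
  have P: "mult_group P" using subnormal_chainD(2)[OF N] by (simp add: P_def)
  have B: "div_subring B" by (simp add: B_def div_subring_centralizer)
  have nPB: "normalizes P B" unfolding B_def
    using P by (intro normalizes_centralizer derived_series_normalizes mult_groupD(2) normalizes_self)
  have main: "k \<le> n \<Longrightarrow> (derived_grp ^^ k) P \<subseteq> centralizer (N k \<inter> B)" for k
  proof (induction k)
    case 0
    \<comment> \<open>\<open>P \<inter> B\<close> is solvable: its \<open>J\<close>-th derived group
      lies in the \<open>J\<close>-th derived group of \<open>P\<close> and also in the centralizer
      \<open>B\<close> of the latter, hence is abelian.\<close>
    have m: "mult_group (P \<inter> B)" using P B by (rule mult_group_Int_div_subring)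
    define Q where "Q = (derived_grp ^^ J) (P \<inter> B)"
    have "Q \<subseteq> (derived_grp ^^ J) P" unfolding Q_def using m P by (intro derived_series_mono) auto
    moreover have "Q \<subseteq> B" unfolding Q_def using derived_series_sub[OF m, of J] by blast
    ultimately have "Q \<subseteq> centralizer Q" by (auto simp: B_def centralizer_def)
    hence "derived_grp Q \<subseteq> {1}" using derived_series_mult_group[OF m] by (intro derived_grp_comm) (auto simp: Q_def)
    hence "(derived_grp ^^ Suc J) (P \<inter> B) \<subseteq> {1}" by (simp add: Q_def)
    hence "solvable_set (P \<inter> B)" unfolding solvable_set_def by blast
    moreover have "subnormal_chain (case_nat (P \<inter> B) N) (Suc n) UNIV"
      using m P nPB by (intro subnormal_chain_cons[OF N]) (auto simp: P_def intro!: normalizes_Int normalizes_self)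
    ultimately have "P \<inter> B \<subseteq> centralizer UNIV"
      using solvable_subnormal_central[OF div_subring_UNIV, of "case_nat (P \<inter> B) N"] by simp
    thus ?case by (auto simp: P_def centralizer_def)
  next
    case (Suc k)
    let ?V = "N k \<inter> B" and ?W = "N (Suc k) \<inter> B"
    let ?Pk = "(derived_grp ^^ k) P"
    have V: "mult_group ?V" and W: "mult_group ?W" using subnormal_chainD(2)[OF N] B Suc by (auto intro!: mult_group_Int_div_subring)
    have Pk: "mult_group ?Pk" "?Pk \<subseteq> P" using derived_series_mult_group[OF P] derived_series_sub[OF P] by auto
    have PkV: "p * v = v * p" if "p \<in> ?Pk" "v \<in> ?V" for p v using Suc that by (auto simp: centralizer_def)
    have nWV: "normalizes ?W ?V" using subnormal_chainD(4)[OF N, of k] div_subringD[OF B] Suc by (auto simp: normalizes_def conjg_def)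
    have PN: "?Pk \<subseteq> N k" using Pk subnormal_chain_mono[OF N, of 0 k] Suc by (auto simp: P_def)
    \<comment> \<open>\<open>?Pk\<close> acts on \<open>?W\<close> trivially modulo
      \<open>?V\<close>, and trivially on \<open>?V\<close>. Such an action is given by the factors
      \<open>commutator p w\<close>, and any two of these actions commute, so commutators in
      \<open>?Pk\<close> act trivially.\<close>
    have chi: "commutator p w \<in> ?V" if p: "p \<in> ?Pk" and w: "w \<in> ?W" for p w
    proof -
      have "inverse p \<in> N k" using p PN mult_groupD(5)[OF Pk(1)] by blast
      hence "conjg w (inverse p) \<in> N k" using normalizesD[OF subnormal_chainD(4)[OF N, of k]] w Suc by auto
      moreover have "commutator p w = p * conjg w (inverse p)" by (simp add: commutator_def conjg_def mult.assoc)
      moreover have "p \<in> N k" using p PN by blast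
      ultimately have "commutator p w \<in> N k" using mult_groupD(4)[OF subnormal_chainD(2)[OF N, of k]] Suc by auto
      moreover have "commutator p w \<in> B"
        unfolding commutator_conjg using normalizesD[OF nPB, of p w] p Pk(2) w by (auto intro!: div_subringD(4,6)[OF B])
      ultimately show ?thesis by blast
    qed
    have chi_comm: "commutator p w * v = v * commutator p w" if p: "p \<in> ?Pk" and w: "w \<in> ?W" and v: "v \<in> ?V" for p w v
    proof -
      have p0: "p \<noteq> 0" and w0: "w \<noteq> 0" using mult_groupD(3)[OF Pk(1) p] mult_groupD(3)[OF W w] by auto
      have "conjg (inverse w) v \<in> ?V" using normalizesD[OF nWV] mult_groupD(5)[OF W w] v by blast
      hence "conjg p (conjg (inverse w) v) = conjg (inverse w) v" using PkV[OF p] p0 by (simp add: conjg_fix_iff)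
      hence "conjg p (conjg w (conjg (inverse w) v)) = conjg (conjg p w) (conjg (inverse w) v)"
        using p0 by (simp add: conjg_def[of w] conjg_def[of "conjg p w"] conjg_mult conjg_inverse)
      hence "conjg p v = conjg (conjg p w) (conjg (inverse w) v)" using w0 by (simp add: conjg_inv_cancel)
      moreover have "conjg p w = commutator p w * w" using w0 by (simp add: commutator_conjg mult.assoc)
      moreover have "conjg p v = v" using PkV[OF p v] p0 by (simp add: conjg_fix_iff)
      ultimately have "conjg (commutator p w * w) (conjg (inverse w) v) = v" by simp
      hence "conjg (commutator p w) (conjg w (conjg (inverse w) v)) = v" by (simp only: conjg_conjg mult.assoc)
      hence "conjg (commutator p w) v = v" using w0 by (simp add: conjg_inv_cancel)
      thus ?thesis using commutator_nonzero[OF p0 w0] by (simp add: conjg_fix_iff)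
    qed
    have act: "conjg p (conjg q w) = commutator q w * commutator p w * w" if p: "p \<in> ?Pk" and q: "q \<in> ?Pk" and w: "w \<in> ?W" for p q w
    proof -
      have p0: "p \<noteq> 0" and w0: "w \<noteq> 0" using mult_groupD(3)[OF Pk(1) p] mult_groupD(3)[OF W w] by auto
      have e: "conjg r w = commutator r w * w" for r using w0 by (simp add: commutator_conjg mult.assoc)
      have "conjg p (commutator q w) = commutator q w" using PkV[OF p chi[OF q w]] p0 by (simp add: conjg_fix_iff)
      thus ?thesis using p0 by (simp add: e[of q] conjg_mult e[of p] mult.assoc)
    qed
    have "derived_grp ?Pk \<subseteq> centralizer ?W - {0}"
    proof (rule derived_grp_least)
      show "mult_group (centralizer ?W - {0})" by (rule mult_group_units[OF div_subring_centralizer])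
      fix p q assume pq: "p \<in> ?Pk" "q \<in> ?Pk"
      define a b where "a = inverse p" and "b = inverse q"
      have ab: "a \<in> ?Pk" "b \<in> ?Pk" "a \<noteq> 0" "b \<noteq> 0"
        using mult_groupD(5)[OF Pk(1) pq(1)] mult_groupD(5)[OF Pk(1) pq(2)] mult_groupD(3)[OF Pk(1)] pq by (auto simp: a_def b_def)
      have c: "commutator p q = inverse (b * a) * (a * b)"
        using mult_groupD(3)[OF Pk(1)] pq ab by (simp add: commutator_def a_def b_def nonzero_inverse_mult_distrib mult.assoc)
      have "commutator p q * w = w * commutator p q" if w: "w \<in> ?W" for w
      proof -
        have "conjg (a * b) w = conjg (b * a) w"
          using act[OF ab(1,2) w] act[OF ab(2,1) w] chi_comm[OF ab(1) w chi[OF ab(2) w]] by (simp add: conjg_conjg)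
        hence "conjg (inverse (b * a)) (conjg (a * b) w) = w" using ab by (simp add: conjg_inv_cancel)
        thus ?thesis unfolding c using ab by (simp add: conjg_conjg conjg_fix_iff)
      qed
      thus "commutator p q \<in> centralizer ?W - {0}" using commutator_nonzero mult_groupD(3)[OF Pk(1)] pq by (auto simp: centralizer_def)
    qed
    thus ?case by auto
  qed
  have "(derived_grp ^^ n) P \<subseteq> centralizer (N n \<inter> B)" using main by blast
  moreover have "B - {0} \<subseteq> N n \<inter> B" using subnormal_chainD(1)[OF N] by auto
  ultimately have "p * b = b * p" if "p \<in> (derived_grp ^^ n) P" "b \<in> B" for p b
    using that by (cases "b = 0") (auto simp: centralizer_def)
  hence "(derived_grp ^^ n) P \<subseteq> centralizer B" by (auto simp: centralizer_def)
  thus ?thesis by (simp add: P_def B_def)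
qed

definition gen_div_subring :: "'a::division_ring set \<Rightarrow> 'a set" where
  "gen_div_subring S = \<Inter>{R. div_subring R \<and> S \<subseteq> R}"

lemma div_subring_gen_div_subring: "div_subring (gen_div_subring S)" unfolding gen_div_subring_def div_subring_def is_subring_def by auto
lemma gen_div_subring_sub: "S \<subseteq> gen_div_subring S" by (auto simp: gen_div_subring_def)
lemma gen_div_subring_least: "div_subring R \<Longrightarrow> S \<subseteq> R \<Longrightarrow> gen_div_subring S \<subseteq> R" by (auto simp: gen_div_subring_def)

lemma centralizer_gen_div_subring: "centralizer (gen_div_subring S) = centralizer S"
proof
  show "centralizer (gen_div_subring S) \<subseteq> centralizer S" using centralizer_mono gen_div_subring_sub by blast
  show "centralizer S \<subseteq> centralizer (gen_div_subring S)"
  proof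
    fix z assume z: "z \<in> centralizer S"
    have "gen_div_subring S \<subseteq> centralizer {z}" using z by (intro gen_div_subring_least div_subring_centralizer) (auto simp: centralizer_def)
    thus "z \<in> centralizer (gen_div_subring S)" by (auto simp: centralizer_def)
  qed
qed

lemma div_subring_vimage_conjg: assumes "div_subring R" "g \<noteq> 0" shows "div_subring {x. conjg g x \<in> R}"
  unfolding div_subring_def is_subring_def using div_subringD[OF assms(1)] assms(2)
  by (auto simp: conjg_add conjg_mult conjg_minus conjg_inverse conjg_0 conjg_1)

lemma normalizes_gen_div_subring: assumes "0 \<notin> H" "normalizes H S" shows "normalizes H (gen_div_subring S)"
  unfolding normalizes_def
proof (intro ballI)
  fix g s assume g: "g \<in> H" and s: "s \<in> gen_div_subring S"
  have g0: "g \<noteq> 0" using g assms by auto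
  have "gen_div_subring S \<subseteq> {x. conjg g x \<in> gen_div_subring S}"
    using normalizesD[OF assms(2) g] gen_div_subring_sub by (intro gen_div_subring_least div_subring_vimage_conjg div_subring_gen_div_subring g0) blast
  thus "conjg g s \<in> gen_div_subring S" using s by blast
qed

text \<open>The layer is spanned by the powers of \<open>y\<close> if \<open>L\<close> is its own bicentralizer, and otherwise by a
  commutative division subring centralizing \<open>L\<close>.\<close>

lemma exists_layer:
  assumes L: "div_subring L" and y: "y \<noteq> 0" "y \<notin> L" and nH: "mult_group H" "y \<in> H" "normalizes H L"
  shows "\<exists>\<Gamma>. abelian_layer L \<Gamma> \<and> add_span \<Gamma> \<inter> centralizer L \<subseteq> insert 0 \<Gamma> \<and> \<not> \<Gamma> \<subseteq> L"
proof (cases "centralizer L \<subseteq> L")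
  case True
  have n: "normalizes (int_powers y) L" using nH mult_group_powi[OF nH(1,2)] by (auto simp: normalizes_def int_powers_def)
  interpret abelian_layer L "scaled L (int_powers y)"
    by (rule abelian_layer_scaled[OF L mult_group_int_powers[OF y(1)] n]) (simp add: commutator_int_powers[OF y(1)] div_subringD[OF L])
  have "add_span (scaled L (int_powers y)) \<inter> centralizer L \<subseteq> insert 0 (scaled L (int_powers y))" using True sub by auto
  moreover have "y \<in> scaled L (int_powers y)" using T_sub_scaled[OF L, of "int_powers y"] rangeI[of "\<lambda>i. y powi i" 1] by (auto simp: int_powers_def)
  ultimately show ?thesis using y abelian_layer_axioms by blast
next
  case False
  then obtain c where c: "c \<in> centralizer L" "c \<notin> L" by blast
  \<comment> \<open>The centralizer of \<open>L\<close> may be noncommutative. Intersecting it with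
    the bicentralizer of \<open>insert c L\<close> leaves a commutative part that still contains
    \<open>c\<close>.\<close>
  define C where "C = centralizer L \<inter> centralizer (centralizer (insert c L))"
  define T where "T = C - {0}"
  have C: "div_subring C" by (simp add: C_def div_subring_Int div_subring_centralizer)
  have Cc: "a * b = b * a" if "a \<in> C" "b \<in> C" for a b
  proof -
    have "c * b = b * c" using that(2) c centralizerD[of b "centralizer (insert c L)" c] by (auto simp: C_def centralizer_def)
    hence "b \<in> centralizer (insert c L)" using that(2) by (auto simp: C_def centralizer_def)
    thus ?thesis using that(1) by (auto simp: C_def centralizer_def)
  qed
  have cC: "c \<in> C" using c by (auto simp: C_def centralizer_def)
  have c0: "c \<noteq> 0" using c div_subringD(1)[OF L] by auto
  have T: "mult_group T" unfolding T_def by (rule mult_group_units[OF C])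
  have CL: "t * l = l * t" if "t \<in> C" "l \<in> L" for t l using that by (auto simp: C_def centralizer_def)
  have "conjg t l = l" if "t \<in> T" "l \<in> L" for t l using CL that by (simp add: T_def conjg_fix_iff)
  hence n: "normalizes T L" by (auto simp: normalizes_def)
  have cmT: "commutator s t \<in> L" if "s \<in> T" "t \<in> T" for s t
    using that Cc[of s t] div_subringD(2)[OF L] by (auto simp: T_def commutator_1_iff[THEN iffD2])
  interpret abelian_layer L "scaled L T" by (rule abelian_layer_scaled[OF L T n cmT])
  have "a \<in> insert 0 (scaled L T)" if a: "a \<in> add_span (scaled L T)" "a \<in> centralizer L" for a
  proof (cases "a = 0")
    case False
    then obtain xs where xs: "set xs \<subseteq> scaled L T" "a = sum_list xs"
       "\<forall>q\<in>L. \<forall>\<theta>\<in>L. a * q = \<theta> * a \<longrightarrow> (\<forall>g\<in>set xs. g * q = \<theta> * g)"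
      using eigen_split[of a] a by blast
    have "g \<in> C" if g: "g \<in> set xs" for g
    proof -
      obtain l t where lt: "g = l * t" "l \<in> L" "l \<noteq> 0" "t \<in> T" using g xs(1) by (auto simp: scaled_def)
      have t: "t \<in> C" "t \<noteq> 0" using lt by (auto simp: T_def)
      have "l * q = q * l" if q: "q \<in> L" for q
      proof -
        have "a * q = q * a" using a(2) q by (auto simp: centralizer_def)
        hence "g * q = q * g" using xs(3) q g by blast
        hence "(l * q) * t = (q * l) * t" unfolding lt(1) using CL[OF t(1) q] by (simp add: mult.assoc)
        thus ?thesis using t by simp
      qed
      hence "l \<in> centralizer L" by (auto simp: centralizer_def)
      moreover have "l \<in> centralizer (centralizer (insert c L))" using lt(2) by (auto simp: centralizer_def)
      ultimately show ?thesis using lt(1) t div_subringD(4)[OF C] by (auto simp: C_def)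
    qed
    hence "sum_list xs \<in> C" using div_subringD(1,3)[OF C] by (induction xs) auto
    hence "a \<in> T" using xs(2) False by (simp add: T_def)
    thus ?thesis using T_sub_scaled[OF L, of T] by blast
  qed simp
  moreover have "c \<in> scaled L T" using cC c0 T_sub_scaled[OF L, of T] by (auto simp: T_def)
  ultimately show ?thesis using c abelian_layer_axioms by blast
qed

text \<open>Stuth's theorem.\<close>

theorem subnormal_generates:
  fixes N :: "nat \<Rightarrow> 'a::division_ring set"
  assumes N: "subnormal_chain N n UNIV" and nc: "\<not> N 0 \<subseteq> centralizer UNIV" and R: "div_subring R" "N 0 \<subseteq> R"
  shows "R = UNIV"
proof (rule ccontr)
  assume RU: "R \<noteq> UNIV"
  define Q where "Q = (derived_grp ^^ n) (N 0)"
  have N0: "mult_group (N 0)" using subnormal_chainD(2)[OF N] by simp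
  have Q: "mult_group Q" "Q \<subseteq> N 0" using derived_series_mult_group[OF N0] derived_series_sub[OF N0] by (auto simp: Q_def)
  have nsolv: "\<not> Q \<subseteq> centralizer Q"
  proof
    assume "Q \<subseteq> centralizer Q"
    hence "derived_grp Q \<subseteq> {1}" using Q by (intro derived_grp_comm)
    hence "(derived_grp ^^ Suc n) (N 0) \<subseteq> {1}" by (simp add: Q_def)
    hence "solvable_set (N 0)" unfolding solvable_set_def by blast
    thus False using solvable_subnormal_central[OF div_subring_UNIV N] nc by blast
  qed
  \<comment> \<open>At the \<open>n\<close>-th derived group the centralizers have become
    stationary, so replacing \<open>Q\<close> by its derived group does not enlarge the
    centralizer.\<close>
  have cQ: "centralizer (derived_grp Q) \<subseteq> centralizer Q"
  proof -
    have "Q \<subseteq> centralizer (centralizer (derived_grp Q))" using centralizers_stationary[OF N, of "Suc n"] by (simp add: Q_def)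
    thus ?thesis by (auto simp: centralizer_def)
  qed
  obtain M where M: "subnormal_chain M (n + n) UNIV" "M 0 = Q" using subnormal_chain_derived_series[OF N, of n] by (auto simp: Q_def)
  define m where "m = n + n"
  define L where "L = gen_div_subring Q"
  have L: "div_subring L" by (simp add: L_def div_subring_gen_div_subring)
  have LR: "L \<subseteq> R" unfolding L_def using Q R by (intro gen_div_subring_least) auto
  have LU: "L \<noteq> UNIV" using LR RU by auto
  note M = M(1)[folded m_def] M(2)
  have "M m = UNIV - {0}" using subnormal_chainD(1)[OF M(1)] .
  hence top: "\<not> M m \<subseteq> L" using LU div_subringD(1)[OF L] by blast
  have bot: "M 0 \<subseteq> L" using M(2) gen_div_subring_sub by (simp add: L_def)
  \<comment> \<open>\<open>M i\<close> will be the last level inside \<open>L\<close>, and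
    \<open>y\<close> an element of the next level that normalizes \<open>L\<close> without belonging
    to it.\<close>
  define j where "j = (LEAST j. \<not> M j \<subseteq> L)"
  have j: "\<not> M j \<subseteq> L" unfolding j_def by (rule LeastI[of _ m]) (rule top)
  have jm: "j \<le> m" unfolding j_def by (rule Least_le) (rule top)
  have "j \<noteq> 0" using j bot by (metis)
  then obtain i where i: "j = Suc i" by (cases j) auto
  have iL: "M i \<subseteq> L" using not_less_Least[of i "\<lambda>j. \<not> M j \<subseteq> L"] i by (auto simp: j_def)
  have im: "i < m" using i jm by simp
  obtain y where y: "y \<in> M (Suc i)" "y \<notin> L" using j i by blast
  have H: "mult_group (M (Suc i))" using subnormal_chainD(2)[OF M(1)] im by simp
  have Mi: "mult_group (M i)" using subnormal_chainD(2)[OF M(1)] im by simp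
  have QM: "Q \<subseteq> M i" using subnormal_chain_mono[OF M(1), of 0 i] im M(2) by auto
  have Leq: "L = gen_div_subring (M i)"
  proof
    show "L \<subseteq> gen_div_subring (M i)" unfolding L_def using QM gen_div_subring_sub by (intro gen_div_subring_least div_subring_gen_div_subring) blast
    show "gen_div_subring (M i) \<subseteq> L" using L iL by (rule gen_div_subring_least)
  qed
  have nL: "normalizes (M (Suc i)) L" unfolding Leq using H subnormal_chainD(4)[OF M(1) im] by (intro normalizes_gen_div_subring) (auto simp: mult_groupD)
  have cL: "centralizer (derived_grp (M i)) \<subseteq> centralizer L"
  proof -
    have "centralizer (derived_grp (M i)) \<subseteq> centralizer (derived_grp Q)" using QM Mi by (intro centralizer_mono derived_grp_mono)
    also have "\<dots> \<subseteq> centralizer Q" by (rule cQ)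
    also have "centralizer Q = centralizer L" by (simp add: L_def centralizer_gen_div_subring)
    finally show ?thesis .
  qed
  obtain \<Gamma> where G: "abelian_layer L \<Gamma>" "add_span \<Gamma> \<inter> centralizer L \<subseteq> insert 0 \<Gamma>" "\<not> \<Gamma> \<subseteq> L"
    using exists_layer[OF L mult_groupD(3)[OF H y(1)] y(2) H y(1) nL] by blast
  interpret abelian_layer L \<Gamma> by (rule G(1))
  have LFr: "L \<subseteq> fractions" using L_add_span add_span_fractions by blast
  have Ql: "derived_grp (M i) \<subseteq> L" using derived_grp_sub[OF Mi] iL by blast
  have HQ: "add_span \<Gamma> \<inter> centralizer (derived_grp (M i)) \<subseteq> insert 0 \<Gamma>" using G(2) cL by blast
  \<comment> \<open>An element \<open>d\<close> is only known to conjugate \<open>M i\<close> into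
    \<open>\<Gamma>\<close>, but then it conjugates commutators of \<open>M i\<close> into
    \<open>L\<close>. So \<open>conj_into_layer\<close> is applied to
    \<open>derived_grp (M i)\<close>, whose centralizer is controlled by \<open>cL\<close>.\<close>
  have main: "M (i + k) \<inter> fractions \<subseteq> \<Gamma>" if "i + k \<le> m" for k
    using that
  proof (induction k)
    case 0
    thus ?case using iL sub mult_groupD(2)[OF Mi] by auto
  next
    case (Suc k)
    show ?case
    proof
      fix d assume d: "d \<in> M (i + Suc k) \<inter> fractions"
      have d0: "d \<noteq> 0" using subnormal_chain_in[OF M(1) _, of "i + Suc k" d] d Suc by auto
      have into: "conjg d q \<in> \<Gamma>" if q: "q \<in> M i" for q
      proof -
        have "q \<in> M (i + k)" using q subnormal_chain_mono[OF M(1), of i "i + k"] Suc by auto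
        hence "conjg d q \<in> M (i + k)" using normalizesD[OF subnormal_chainD(4)[OF M(1), of "i + k"]] d Suc by auto
        moreover have "d \<in> fractions" "q \<in> fractions" using d q iL LFr by auto
        hence "conjg d q \<in> fractions" unfolding conjg_def by (simp add: div_subringD(4,6)[OF div_subring_fractions])
        ultimately show ?thesis using Suc by auto
      qed
      have "derived_grp (M i) \<subseteq> {q. conjg d q \<in> L} - {0}"
      proof (rule derived_grp_least)
        show "mult_group ({q. conjg d q \<in> L} - {0})" by (rule mult_group_units[OF div_subring_vimage_conjg[OF L d0]])
        fix p q assume pq: "p \<in> M i" "q \<in> M i"
        have "conjg d (commutator p q) \<in> L" unfolding conjg_commutator[OF d0] using comm into pq by blast
        thus "commutator p q \<in> {q. conjg d q \<in> L} - {0}" using commutator_nonzero mult_groupD(3)[OF Mi] pq by auto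
      qed
      thus "d \<in> \<Gamma>" using conj_into_layer[OF Ql HQ, of d] d d0 by auto
    qed
  qed
  \<comment> \<open>At the top every nonzero fraction is a monomial and normalizes \<open>L\<close>.
    Cartan-Brauer-Hua makes \<open>L\<close> central in the fractions, and with it \<open>Q\<close>
    becomes abelian.\<close>
  have "fractions - {0} \<subseteq> \<Gamma>" using main[of "m - i"] im subnormal_chainD(1)[OF M(1)] by auto
  hence "normalizes (fractions - {0}) L" using norm normalizes_subset by blast
  moreover have "L \<subset> fractions" using LFr G(3) \<Gamma>_fractions by blast
  ultimately have "L \<subseteq> centralizer fractions" using cartan_brauer_hua[OF L div_subring_fractions] by blast
  hence "Q \<subseteq> centralizer Q" using LFr gen_div_subring_sub[of Q] unfolding L_def[symmetric] by (fastforce simp: centralizer_def)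
  thus False using nsolv by simp
qed

section \<open>Maximal solvable subgroups\<close>

context layer begin

text \<open>Linear independence of distinct cosets over \<open>L\<close>, where the coefficients
  have been absorbed into the monomials.\<close>

definition independent where
  "independent \<longleftrightarrow> (\<forall>S. finite S \<longrightarrow> S \<subseteq> \<Gamma> \<longrightarrow> (\<forall>g\<in>S. \<forall>h\<in>S. g \<noteq> h \<longrightarrow> g * inverse h \<notin> L) \<longrightarrow> \<Sum>S = 0 \<longrightarrow> S = {})"

text \<open>If \<open>t\<close> were outside \<open>\<Delta>\<close>, the terms of
  \<open>a * t\<close> would lie in other cosets than the elements of \<open>\<Delta>\<close>.
  Equating \<open>a * t\<close> with its expansion over \<open>\<Delta>\<close> would then be a
  nontrivial dependence.\<close>

lemma quotient_in:
  assumes ind: independent and D: "mult_group \<Delta>" "L - {0} \<subseteq> \<Delta>" "\<Delta> \<subseteq> \<Gamma>"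
    and a: "a \<in> add_span \<Delta>" "a \<noteq> 0" and b: "a * t \<in> add_span \<Delta>" and t: "t \<in> \<Gamma>"
  shows "t \<in> \<Delta>"
proof (rule ccontr)
  assume nt: "t \<notin> \<Delta>"
  interpret D: layer L \<Delta> using L D norm normalizes_subset by unfold_locales auto
  obtain S where S: "finite S" "S \<subseteq> \<Delta>" "a = \<Sum>S" "\<forall>g\<in>S. \<forall>h\<in>S. g \<noteq> h \<longrightarrow> g * inverse h \<notin> L"
    using D.coset_rep[OF a(1)] by blast
  obtain S' where S': "finite S'" "S' \<subseteq> \<Delta>" "a * t = \<Sum>S'" "\<forall>g\<in>S'. \<forall>h\<in>S'. g \<noteq> h \<longrightarrow> g * inverse h \<notin> L"
    using D.coset_rep[OF b] by blast
  have t0: "t \<noteq> 0" using mult_groupD(3)[OF \<Gamma> t] .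
  have normalizes: "s \<noteq> 0" if "s \<in> \<Delta>" for s using mult_groupD(3)[OF D(1) that] .
  have nzS: "s \<noteq> 0" if "s \<in> S" for s using normalizes S(2) that by blast
  have nzS': "s \<noteq> 0" if "s \<in> S'" for s using normalizes S'(2) that by blast
  let ?A = "(\<lambda>s. s * t) ` S" and ?B = "uminus ` S'"
  have key: False if s: "s \<in> S" "s' \<in> S'" and e: "s * t * inverse s' \<in> L" for s s'
  proof -
    have ss: "s \<in> \<Delta>" "s' \<in> \<Delta>" using s S(2) S'(2) by auto
    note ss = ss normalizes[OF ss(1)] normalizes[OF ss(2)]
    have "s * t * inverse s' \<in> \<Delta>" using e D(2) ss t0 by auto
    hence "inverse s * (s * t * inverse s' * s') \<in> \<Delta>" using ss mult_groupD(4,5)[OF D(1)] by blast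
    moreover have "inverse s * (s * t * inverse s' * s') = t" using ss
      by (simp add: mult.assoc) (simp add: mult.assoc[symmetric])
    ultimately show False using nt by simp
  qed
  have minus: "x * inverse (- y) = - (x * inverse y)" "(- x) * inverse (- y) = x * inverse y" for x y :: 'a by simp_all
  have neg: "l \<in> L" if "- l \<in> L" for l using div_subringD(5)[OF L that] by simp
  have inv: "y * inverse x \<in> L" if "x * inverse y \<in> L" "x \<noteq> 0" "y \<noteq> 0" for x y
    using div_subringD(6)[OF L that(1)] that(2,3) by (simp add: nonzero_inverse_mult_distrib)
  have disj: "?A \<inter> ?B = {}"
  proof (rule ccontr)
    assume "?A \<inter> ?B \<noteq> {}"
    then obtain s s' where s: "s \<in> S" "s' \<in> S'" "s * t = - s'" by auto
    hence "s * t * inverse s' = -1" using normalizes S' by (auto simp: minus_mult_left[symmetric])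
    thus False using key[OF s(1,2)] div_subringD(2,5)[OF L] by simp
  qed
  have m1: "-1 \<in> \<Delta>" using D(2) div_subringD(2,5)[OF L] by auto
  have "?A \<union> ?B \<subseteq> \<Gamma>"
  proof
    fix u assume "u \<in> ?A \<union> ?B"
    then consider s where "s \<in> S" "u = s * t" | s where "s \<in> S'" "u = (-1) * s" by auto
    thus "u \<in> \<Gamma>"
    proof cases
      case 1 thus ?thesis using S(2) D(3) t mult_groupD(4)[OF \<Gamma>] by blast
    next
      case 2 thus ?thesis using S'(2) D(3) m1 mult_groupD(4)[OF \<Gamma>] by blast
    qed
  qed
  moreover have "g * inverse h \<notin> L" if gh: "g \<in> ?A \<union> ?B" "h \<in> ?A \<union> ?B" "g \<noteq> h" for g h
  proof
    assume e: "g * inverse h \<in> L"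
    have tt: "s * t * inverse (s' * t) = s * inverse s'" if "s' \<noteq> 0" for s s'
      using that t0 by (simp add: nonzero_inverse_mult_distrib mult.assoc) (simp add: mult.assoc[symmetric])
    consider s s' where "g = s * t" "h = s' * t" "s \<in> S" "s' \<in> S" | s s' where "g = s * t" "h = - s'" "s \<in> S" "s' \<in> S'"
      | s s' where "g = - s'" "h = s * t" "s \<in> S" "s' \<in> S'" | s s' where "g = - s" "h = - s'" "s \<in> S'" "s' \<in> S'"
      using gh(1,2) by (elim UnE imageE) blast+
    thus False
    proof cases
      case 1
      have "s' \<noteq> 0" using 1 S normalizes by blast
      thus False using 1 e gh(3) S(4) tt by auto
    next
      case 2
      have "- (s * t * inverse s') \<in> L" using e unfolding 2(1,2) minus(1) .
      thus False using key[OF 2(3,4)] neg by blast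
    next
      case 3
      have n: "s \<noteq> 0" "s' \<noteq> 0" using 3 nzS nzS' by blast+
      have "g \<noteq> 0" "h \<noteq> 0" using 3(1,2) n t0 by auto
      hence "h * inverse g \<in> L" using inv[OF e] by blast
      hence "- (s * t * inverse s') \<in> L" unfolding 3(1,2) minus(1) .
      thus False using key[OF 3(3,4)] neg by blast
    next
      case 4
      thus False using e gh(3) S'(4) minus by auto
    qed
  qed
  moreover have "\<Sum>(?A \<union> ?B) = 0"
  proof -
    have "\<Sum>(?A \<union> ?B) = \<Sum>?A + \<Sum>?B" using S S' disj by (intro sum.union_disjoint) auto
    also have "\<Sum>?A = (\<Sum>s\<in>S. s * t)" using t0 by (subst sum.reindex) (auto intro: inj_onI)
    also have "\<dots> = a * t" using S by (simp add: sum_distrib_right)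
    also have "\<Sum>?B = - \<Sum>S'" by (subst sum.reindex) (auto intro: inj_onI simp: sum_negf)
    finally show ?thesis using S' by simp
  qed
  ultimately have "?A \<union> ?B = {}" using ind S(1) S'(1) unfolding independent_def by (metis (no_types, lifting) finite_UnI finite_imageI)
  hence "S = {}" by auto
  thus False using a S by simp
qed

text \<open>Dedekind's lemma with one character per monomial. The characters are conjugation on
  \<open>K\<close> in the split case and commutators with elements of \<open>H\<close> in the class
  two case.\<close>

lemma independentI:
  assumes X: "\<And>q r. q \<in> X \<Longrightarrow> r \<in> X \<Longrightarrow> q * r \<in> X" "1 \<in> X"
    and val: "\<And>g q. g \<in> \<Gamma> \<Longrightarrow> q \<in> X \<Longrightarrow> \<theta> g q \<in> C" and C: "C \<subseteq> centralizer C"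
    and mult: "\<And>g q r. g \<in> \<Gamma> \<Longrightarrow> q \<in> X \<Longrightarrow> r \<in> X \<Longrightarrow> \<theta> g (q * r) = \<theta> g q * \<theta> g r"
    and one: "\<And>g. g \<in> \<Gamma> \<Longrightarrow> \<theta> g 1 \<noteq> 0"
    and lin: "\<And>S q. finite S \<Longrightarrow> S \<subseteq> \<Gamma> \<Longrightarrow> \<Sum>S = 0 \<Longrightarrow> q \<in> X \<Longrightarrow> (\<Sum>g\<in>S. \<theta> g q * g) = 0"
    and sep: "\<And>g h. g \<in> \<Gamma> \<Longrightarrow> h \<in> \<Gamma> \<Longrightarrow> (\<And>q. q \<in> X \<Longrightarrow> \<theta> g q = \<theta> h q) \<Longrightarrow> g * inverse h \<in> L"
  shows independent
  unfolding independent_def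
proof (intro allI impI)
  fix S assume S: "finite S" "S \<subseteq> \<Gamma>" "\<forall>g\<in>S. \<forall>h\<in>S. g \<noteq> h \<longrightarrow> g * inverse h \<notin> L" "\<Sum>S = 0"
  have "g = 0" if g: "g \<in> S" for g
  proof (rule dedekind[where J=S and X=X and op="(*)" and \<theta>=\<theta> and g="\<lambda>g. g"])
    fix q assume "q \<in> X" thus "(\<Sum>g\<in>S. \<theta> g q * g) = 0" using lin S by blast
  next
    fix g h assume "g \<in> S" "h \<in> S" "g \<noteq> h"
    thus "\<exists>q\<in>X. \<theta> g q \<noteq> \<theta> h q" using sep[of g h] S by blast
  next
    fix g h q r assume "g \<in> S" "h \<in> S" "q \<in> X" "r \<in> X"
    thus "\<theta> g q * \<theta> h r = \<theta> h r * \<theta> g q" using val C S(2) centralizerD[of "\<theta> g q" C] by blast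
  next
    fix g assume "g \<in> S" thus "\<exists>q\<in>X. \<theta> g q \<noteq> 0" using one X(2) S(2) by blast
  next
    fix g q r assume "g \<in> S" "q \<in> X" "r \<in> X" thus "\<theta> g (q * r) = \<theta> g q * \<theta> g r" using mult S(2) by blast
  qed (use S X g in auto)
  thus "S = {}" using S(2) mult_groupD(2)[OF \<Gamma>] by blast
qed

end

definition set_product :: "'a::division_ring set \<Rightarrow> 'a set \<Rightarrow> 'a set" where
  "set_product B D = {b * d | b d. b \<in> B \<and> d \<in> D}"

lemma mult_group_set_product: assumes B: "mult_group B" and D: "mult_group D" and n: "normalizes D B" shows "mult_group (set_product B D)"
proof -
  have "x * y \<in> set_product B D" if "x \<in> set_product B D" "y \<in> set_product B D" for x y
  proof -
    obtain b d c e where e: "x = b * d" "y = c * e" "b \<in> B" "c \<in> B" "d \<in> D" "e \<in> D" using \<open>x \<in> set_product B D\<close> \<open>y \<in> set_product B D\<close> by (auto simp: set_product_def)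
    have "x * y = (b * conjg d c) * (d * e)" using mult_groupD(3)[OF D e(5)] unfolding e(1,2) conjg_def
      by (simp add: mult.assoc) (simp add: mult.assoc[symmetric])
    moreover have "b * conjg d c \<in> B" "d * e \<in> D" using e normalizesD[OF n] mult_groupD(4)[OF B] mult_groupD(4)[OF D] by auto
    ultimately show ?thesis unfolding set_product_def by blast
  qed
  moreover have "inverse x \<in> set_product B D" if "x \<in> set_product B D" for x
  proof -
    obtain b d where e: "x = b * d" "b \<in> B" "d \<in> D" using \<open>x \<in> set_product B D\<close> by (auto simp: set_product_def)
    have d: "inverse d \<in> D" using e mult_groupD(5)[OF D] by blast
    have "inverse x = conjg (inverse d) (inverse b) * inverse d"
      using e mult_groupD(3)[OF B] mult_groupD(3)[OF D] by (simp add: conjg_def nonzero_inverse_mult_distrib mult.assoc)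
    moreover have "conjg (inverse d) (inverse b) \<in> B" using normalizesD[OF n d] mult_groupD(5)[OF B e(2)] by blast
    ultimately show ?thesis using d unfolding set_product_def by blast
  qed
  moreover have "1 \<in> set_product B D" unfolding set_product_def using mult_groupD(1)[OF B] mult_groupD(1)[OF D]
    by (intro CollectI exI[of _ 1]) simp
  moreover have "0 \<notin> set_product B D" using mult_groupD(2)[OF B] mult_groupD(2)[OF D] by (auto simp: set_product_def)
  ultimately show ?thesis by (auto simp: mult_group_def)
qed

lemma set_product_sub: "mult_group B \<Longrightarrow> mult_group D \<Longrightarrow> B \<subseteq> set_product B D \<and> D \<subseteq> set_product B D"
  by (auto simp: set_product_def mult_group_def) (metis mult_1_right, metis mult_1)

lemma scaled_int_powersD: assumes "g \<in> scaled L (int_powers h)" shows "\<exists>l i. g = l * h powi i \<and> l \<in> L \<and> l \<noteq> 0"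
  using assms unfolding scaled_def int_powers_def by blast

context power_layer begin

lemma power_form: assumes "b \<in> E" shows "\<exists>c\<in>E. (b * h powi i) ^ k = c * h powi (i * int k)"
proof (induction k)
  case 0 show ?case using div_subringD(2)[OF E] by (intro bexI[of _ 1]) auto
next
  case (Suc k)
  then obtain c where c: "c \<in> E" "(b * h powi i) ^ k = c * h powi (i * int k)" by blast
  have "(b * h powi i) ^ Suc k = (b * conjg (h powi i) c) * h powi (i + i * int k)"
    using mult_powi[OF assms c(1)] c(2) by simp
  moreover have "b * conjg (h powi i) c \<in> E" using assms c powi_in div_subringD(4)[OF E] by blast
  ultimately show ?case by (intro bexI[of _ "b * conjg (h powi i) c"]) (auto simp: algebra_simps)
qed

end

lemma power_layerI:
  assumes "div_subring K" "K \<subseteq> centralizer K" "mult_group M" "normalizes M K" "x \<in> M"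
  shows "power_layer K x"
  using assms normalizes_image[OF assms(3,4,5)] mult_groupD(3)[OF assms(3,5)] by unfold_locales auto

section \<open>The dichotomy for division subrings normalized by M\<close>

locale maximal_solvable =
  fixes N :: "nat \<Rightarrow> 'a::division_ring set" and n :: nat and M :: "'a set"
  assumes N: "subnormal_chain N n UNIV" and M: "mult_group M" and MG: "M \<subseteq> N 0" and MnG: "M \<noteq> N 0"
    and maximal: "mult_group H \<Longrightarrow> M \<subseteq> H \<Longrightarrow> H \<subseteq> N 0 \<Longrightarrow> H = M \<or> H = N 0"
    and nonab: "\<not> M \<subseteq> centralizer M" and solvM: "solvable_set M"
begin

abbreviation "U \<equiv> N 0"

lemma G: "mult_group U" using subnormal_chainD(2)[OF N] by simp

lemma G_nc: "\<not> U \<subseteq> centralizer UNIV" using MG nonab by (auto simp: centralizer_def)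

lemma nMG: "normalizes M U" using normalizes_subset[OF normalizes_self[OF G] MG] .

text \<open>The product of \<open>U \<inter> L\<close> with \<open>M\<close> is \<open>M\<close> or
  \<open>U\<close>. In the first case \<open>U \<inter> L\<close> is solvable and subnormal in
  \<open>L\<close>, hence central there. In the second it is normal in \<open>U\<close>; were it
  central, \<open>U\<close> and \<open>M\<close> would have the same derived group and
  \<open>U\<close> would be solvable. So it generates everything.\<close>

lemma dichotomy:
  assumes L: "div_subring L" and nL: "normalizes M L"
  shows "L = UNIV \<or> (L \<inter> U \<subseteq> M \<and> L \<inter> U \<subseteq> centralizer L)"
proof -
  define P where "P = U \<inter> L"
  have P: "mult_group P" unfolding P_def by (rule mult_group_Int_div_subring[OF G L])
  have nP: "normalizes M P" unfolding P_def by (rule normalizes_Int[OF nMG nL])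
  have PM: "mult_group (set_product P M)" by (rule mult_group_set_product[OF P M nP])
  have MPM: "P \<subseteq> set_product P M" "M \<subseteq> set_product P M" using set_product_sub[OF P M] by auto
  have "set_product P M \<subseteq> U" using MG mult_groupD(4)[OF G] by (auto simp: set_product_def P_def)
  with maximal[OF PM MPM(2)] consider "set_product P M = M" | "set_product P M = U" by blast
  thus ?thesis
  proof cases
    case 1
    hence PM': "P \<subseteq> M" using MPM by simp
    hence "solvable_set P" using solvable_set_subset[OF solvM _ P M] by blast
    moreover have "subnormal_chain (\<lambda>i. N i \<inter> L) n L" by (rule subnormal_chain_Int[OF N L])
    ultimately have "P \<subseteq> centralizer L" using solvable_subnormal_central[OF L, of "\<lambda>i. N i \<inter> L"] by (simp add: P_def)
    thus ?thesis using PM' by (auto simp: P_def)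
  next
    case 2
    have nGP: "normalizes U P"
      unfolding normalizes_def
    proof (intro ballI)
      fix g s assume g: "g \<in> U" and s: "s \<in> P"
      have "g \<in> set_product P M" using g 2 by simp
      then obtain p m where pm: "g = p * m" "p \<in> P" "m \<in> M" by (auto simp: set_product_def)
      have "conjg g s = conjg p (conjg m s)" by (simp add: pm conjg_conjg)
      thus "conjg g s \<in> P" using mult_group_conjg[OF P pm(2)] normalizesD[OF nP pm(3) s] by simp
    qed
    have c: "subnormal_chain (case_nat P N) (Suc n) UNIV" using P nGP by (intro subnormal_chain_cons[OF N]) (auto simp: P_def)
    have "\<not> P \<subseteq> centralizer UNIV"
    proof
      assume Pc: "P \<subseteq> centralizer UNIV"
      have "derived_grp U \<subseteq> derived_grp M"
      proof (rule derived_grp_least[OF derived_grp_mult_group[OF M]])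
        fix x y assume "x \<in> U" "y \<in> U"
        hence "x \<in> set_product P M" "y \<in> set_product P M" using 2 by simp_all
        then obtain p m q r where e: "x = p * m" "y = q * r" "p \<in> P" "m \<in> M" "q \<in> P" "r \<in> M" by (auto simp: set_product_def)
        have p0: "p \<noteq> 0" "q \<noteq> 0" "m \<noteq> 0" "r \<noteq> 0" using mult_groupD(3)[OF P] mult_groupD(3)[OF M] e by auto
        have pc: "p * z = z * p" "q * z = z * q" for z using Pc e by (auto simp: centralizer_def)
        have pcc: "p * q * z = z * (p * q)" for z
        proof -
          have "p * q * z = p * (z * q)" by (simp only: mult.assoc pc(2)[of z])
          also have "\<dots> = z * (p * q)" using pc(1)[of z] by (simp add: mult.assoc[symmetric])
          finally show ?thesis .
        qed
        have "commutator x y * (y * x) = commutator m r * (y * x)"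
        proof -
          have "x \<noteq> 0" "y \<noteq> 0" using p0 e by auto
          hence "commutator x y * (y * x) = x * y" unfolding mult.assoc[symmetric] by (rule commutator_eq[symmetric])
          also have "\<dots> = p * q * (m * r)" unfolding e(1,2) using pc(2)[of m] by (simp add: mult.assoc) (simp add: mult.assoc[symmetric])
          also have "m * r = commutator m r * (r * m)" unfolding mult.assoc[symmetric] using p0(3,4) by (rule commutator_eq)
          also have "p * q * (commutator m r * (r * m)) = commutator m r * (p * q * (r * m))"
            using pcc[of "commutator m r"] by (simp add: mult.assoc[symmetric])
          also have "p * q * (r * m) = y * x"
          proof -
            have "y * x = q * (p * r) * m" unfolding e(1,2) using pc(1)[of r] by (simp add: mult.assoc)
            also have "\<dots> = (p * q) * (r * m)" using pc(1)[of q] by (simp add: mult.assoc[symmetric])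
            finally show ?thesis by simp
          qed
          finally show ?thesis .
        qed
        hence "commutator x y = commutator m r" using p0 e by simp
        thus "commutator x y \<in> derived_grp M" using e by (simp add: commutator_in_derived_grp)
      qed
      moreover obtain k where k: "(derived_grp ^^ k) M \<subseteq> {1}" using solvM by (auto simp: solvable_set_def)
      ultimately have "(derived_grp ^^ k) (derived_grp U) \<subseteq> (derived_grp ^^ k) (derived_grp M)" using derived_grp_mult_group[OF M] derived_grp_mult_group[OF G] by (intro derived_series_mono)
      also have "\<dots> = (derived_grp ^^ Suc k) M" by (simp add: funpow_swap1)
      also have "\<dots> \<subseteq> (derived_grp ^^ k) M" by (rule derived_series_anti[OF M]) simp
      finally have "(derived_grp ^^ Suc k) U \<subseteq> {1}" using k by (simp add: funpow_swap1)
      hence "solvable_set U" unfolding solvable_set_def by blast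
      thus False using solvable_subnormal_central[OF div_subring_UNIV N] G_nc by blast
    qed
    hence "L = UNIV" using subnormal_generates[OF c _ L] by (simp add: P_def)
    thus ?thesis ..
  qed
qed

lemma drM_normalizes: "normalizes M ((derived_grp ^^ k) M)" using mult_groupD(2)[OF M] normalizes_self[OF M] by (rule derived_series_normalizes)

text \<open>\<open>K\<close> is the future maximal subfield and \<open>p\<close> its degree over the center.\<close>

definition splitting where
  "splitting K p \<longleftrightarrow> div_subring K \<and> K \<subseteq> centralizer K \<and> normalizes M K \<and> K \<inter> U \<subseteq> M \<and> \<not> M \<subseteq> K \<and> prime p \<and> (\<forall>m\<in>M. m \<in> centralizer K \<longrightarrow> m \<in> K) \<and>
     (\<forall>x\<in>M. x ^ p \<in> K) \<and> (\<forall>x\<in>M - K. M \<subseteq> scaled K (int_powers x) \<and> abelian_layer.fractions (scaled K (int_powers x)) = UNIV)"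

text \<open>The dichotomy makes \<open>centralizer A\<close> meet \<open>U\<close> in an abelian
  group \<open>B\<close> inside \<open>M\<close>, which is its own centralizer in \<open>U\<close>;
  its bicentralizer \<open>K\<close> is the wanted field. The rest shows that every element of
  \<open>M\<close> outside \<open>B\<close> generates \<open>M\<close> modulo \<open>B\<close>,
  which is possible only for a group of prime order.\<close>

lemma noncentral_abelian_normal:
  assumes A: "mult_group A" "A \<subseteq> M" "normalizes M A" "A \<subseteq> centralizer A" and Anc: "\<not> A \<subseteq> centralizer UNIV"
  shows "\<exists>K p. splitting K p"
proof -
  have nLA: "normalizes M (centralizer A)" by (rule normalizes_centralizer[OF M A(3)])
  have "centralizer A \<noteq> UNIV"
  proof
    assume "centralizer A = UNIV"
    hence "z * a = a * z" if "a \<in> A" for a z using centralizerD[of z A a] that by auto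
    thus False using Anc by (auto simp: centralizer_def)
  qed
  hence dA: "centralizer A \<inter> U \<subseteq> M" "centralizer A \<inter> U \<subseteq> centralizer (centralizer A)" using dichotomy[OF div_subring_centralizer nLA] by auto
  define B where "B = M \<inter> centralizer A"
  define K where "K = centralizer (centralizer B)"
  have BG: "B = U \<inter> centralizer A" using dA MG by (auto simp: B_def)
  have Bc: "B \<subseteq> centralizer B" using dA(2) BG centralizer_mono[of B "centralizer A"] by auto
  have AB: "A \<subseteq> B" using A by (auto simp: B_def)
  have nB: "normalizes M B" unfolding B_def by (intro normalizes_Int normalizes_self M nLA)
  have GB: "U \<inter> centralizer B \<subseteq> B" using BG centralizer_mono[OF AB] by auto
  have K: "div_subring K" by (simp add: K_def div_subring_centralizer)
  have Kc: "K \<subseteq> centralizer K" by (rule CC_comm[OF Bc]) (simp add: K_def)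
  have BK: "B \<subseteq> K" unfolding K_def by (rule centralizer_centralizer)
  have cK: "centralizer K = centralizer B" by (simp add: K_def cent3)
  have KB: "K \<subseteq> centralizer B" using Kc cK by simp
  have KG: "K \<inter> U \<subseteq> B" using KB GB by blast
  have MK: "M \<inter> K \<subseteq> B" using KG MG by blast
  have nK: "normalizes M K" unfolding K_def by (intro normalizes_centralizer M nB)
  have McK: "m \<in> B" if "m \<in> M" "m \<in> centralizer K" for m using GB that MG cK by blast
  have MnB: "\<not> M \<subseteq> B" using nonab Bc by (auto simp: centralizer_def)
  interpret LM: layer K "scaled K M" by (rule layer_scaled[OF K M nK])
  have ind: "LM.independent"
  proof (rule LM.independentI[where X=K and \<theta>=conjg and C=K])
    fix S q assume S: "finite S" "S \<subseteq> scaled K M" "\<Sum>S = 0" "q \<in> K"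
    have "(\<Sum>g\<in>S. conjg g q * g) = (\<Sum>g\<in>S. g * q)"
    proof (rule sum.cong[OF refl])
      fix g assume "g \<in> S"
      hence "g \<noteq> 0" using S mult_groupD(3)[OF LM.\<Gamma>] by blast
      thus "conjg g q * g = g * q" by (simp add: conjg_def mult.assoc)
    qed
    thus "(\<Sum>g\<in>S. conjg g q * g) = 0" using S by (simp add: sum_distrib_right[symmetric])
  next
    fix g h assume gh: "g \<in> scaled K M" "h \<in> scaled K M" "\<And>q. q \<in> K \<Longrightarrow> conjg g q = conjg h q"
    have g0: "g \<noteq> 0" "h \<noteq> 0" using mult_groupD(3)[OF LM.\<Gamma>] gh by auto
    have ih: "inverse h \<in> scaled K M" using mult_groupD(5)[OF LM.\<Gamma> gh(2)] .
    have c: "g * inverse h \<in> centralizer K"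
    proof (rule centralizerI)
      fix q assume q: "q \<in> K"
      have q': "conjg (inverse h) q \<in> K" using normalizesD[OF LM.norm ih q] .
      have "conjg (g * inverse h) q = conjg h (conjg (inverse h) q)" using gh(3)[OF q'] by (simp add: conjg_conjg)
      hence "conjg (g * inverse h) q = q" using g0 by (simp add: conjg_inv_cancel)
      thus "g * inverse h * q = q * (g * inverse h)" using g0 by (simp add: conjg_fix_iff)
    qed
    have "g * inverse h \<in> scaled K M" using mult_groupD(4)[OF LM.\<Gamma> gh(1) ih] .
    then obtain l m where lm: "g * inverse h = l * m" "l \<in> K" "l \<noteq> 0" "m \<in> M" by (auto simp: scaled_def)
    have "inverse l * (l * m) \<in> centralizer K" using c lm Kc div_subringD(4,6)[OF div_subring_centralizer] by (metis subsetD)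
    hence "m \<in> centralizer K" using lm by (simp add: mult.assoc[symmetric])
    hence "m \<in> K" using McK lm BK by blast
    thus "g * inverse h \<in> K" using lm div_subringD(4)[OF K] by simp
  qed (use mult_groupD(3)[OF LM.\<Gamma>] Kc normalizesD[OF LM.norm] in \<open>auto simp: div_subringD[OF K] conjg_mult conjg_1\<close>)
  \<comment> \<open>If the fractions were not everything, the dichotomy would make \<open>T\<close>
    centralize \<open>K\<close>, hence lie in \<open>B\<close>. Once they are everything,
    \<open>quotient_in\<close> forces each element of \<open>M\<close> into
    \<open>scaled K T\<close>.\<close>
  have gen: "abelian_layer.fractions (scaled K T) = UNIV \<and> M \<subseteq> scaled K T"
    if T: "mult_group T" "T \<subseteq> M" "\<not> T \<subseteq> B" "\<And>s t. s \<in> T \<Longrightarrow> t \<in> T \<Longrightarrow> commutator s t \<in> K" "normalizes M (scaled K T)" for T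
  proof -
    interpret abelian_layer K "scaled K T" by (rule abelian_layer_scaled[OF K T(1) normalizes_subset[OF nK T(2)] T(4)])
    have KFr: "K \<subseteq> fractions" using L_add_span add_span_fractions by blast
    have TFr: "T \<subseteq> fractions" using T_sub_scaled[OF K, of T] \<Gamma>_fractions by blast
    have "fractions = UNIV"
    proof (rule ccontr)
      assume "fractions \<noteq> UNIV"
      hence "fractions \<inter> U \<subseteq> centralizer fractions" using dichotomy[OF div_subring_fractions fractions_normal[OF T(5) mult_groupD(2)[OF M]]] by blast
      hence "T \<subseteq> centralizer K" using TFr T(2) MG centralizer_mono[OF KFr] by blast
      thus False using T(2,3) McK by blast
    qed
    moreover have "t \<in> scaled K T" if t: "t \<in> M" for t
    proof -
      have "t \<in> fractions" using \<open>fractions = UNIV\<close> by simp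
      then obtain a where a: "a \<in> add_span (scaled K T)" "a \<noteq> 0" "a * t \<in> add_span (scaled K T)" by (auto simp: fractions_def)
      have "scaled K T \<subseteq> scaled K M" using T(2) by (auto simp: scaled_def)
      moreover have "t \<in> scaled K M" using T_sub_scaled[OF K, of M] t by blast
      ultimately show ?thesis using LM.quotient_in[OF ind \<Gamma> sub _ a] by blast
    qed
    ultimately show ?thesis by blast
  qed
  obtain k where k: "(derived_grp ^^ k) M \<subseteq> {1}" using solvM by (auto simp: solvable_set_def)
  have "{1} \<subseteq> B" using div_subringD(2)[OF div_subring_centralizer] mult_groupD(1)[OF M] by (auto simp: B_def)
  hence ex: "(derived_grp ^^ k) M \<subseteq> B" using k by blast
  \<comment> \<open>The last derived group \<open>D\<close> not contained in \<open>B\<close> is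
    commutative modulo \<open>B\<close>. Through \<open>gen\<close> this commutativity spreads to
    all of \<open>M\<close>, after which the powers of a single element can take the place of
    \<open>D\<close>.\<close>
  define j where "j = (LEAST j. (derived_grp ^^ j) M \<subseteq> B)"
  have j: "(derived_grp ^^ j) M \<subseteq> B" unfolding j_def by (rule LeastI[of _ k]) (rule ex)
  have "j \<noteq> 0" using j MnB by (metis funpow_0)
  then obtain i where i: "j = Suc i" by (cases j) auto
  have iB: "\<not> (derived_grp ^^ i) M \<subseteq> B" using not_less_Least[of i "\<lambda>j. (derived_grp ^^ j) M \<subseteq> B"] i by (auto simp: j_def)
  define D where "D = (derived_grp ^^ i) M"
  have D: "mult_group D" "D \<subseteq> M" using derived_series_mult_group[OF M] derived_series_sub[OF M] by (auto simp: D_def)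
  have commutatorD: "commutator s t \<in> K" if "s \<in> D" "t \<in> D" for s t
    using commutator_in_derived_grp[OF that] j i BK by (auto simp: D_def)
  have nExt: "normalizes M (scaled K T)" if "normalizes M T" for T
  proof -
    have "conjg m g \<in> scaled K T" if m: "m \<in> M" and g: "g \<in> scaled K T" for m g
    proof -
      obtain l t where lt: "g = l * t" "l \<in> K" "l \<noteq> 0" "t \<in> T" using g by (auto simp: scaled_def)
      have m0: "m \<noteq> 0" using mult_groupD(3)[OF M m] .
      have "conjg m g = conjg m l * conjg m t" using lt m0 by (simp add: conjg_mult)
      moreover have "conjg m l \<in> K" "conjg m l \<noteq> 0" "conjg m t \<in> T"
        using normalizesD[OF nK m lt(2)] normalizesD[OF \<open>normalizes M T\<close> m lt(4)] lt m0 conjg_eq_0 by auto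
      ultimately show ?thesis unfolding scaled_def by blast
    qed
    thus ?thesis by (auto simp: normalizes_def)
  qed
  have MD: "M \<subseteq> scaled K D" using gen[OF D _ commutatorD nExt] iB drM_normalizes by (auto simp: D_def)
  have cmM: "commutator s t \<in> B" if "s \<in> M" "t \<in> M" for s t
  proof -
    interpret abelian_layer K "scaled K D" by (rule abelian_layer_scaled[OF K D(1) normalizes_subset[OF nK D(2)] commutatorD])
    have "commutator s t \<in> K" using comm MD that by blast
    thus ?thesis using mult_group_commutator[OF M that] MK by blast
  qed
  have genx: "abelian_layer.fractions (scaled K (int_powers x)) = UNIV \<and> M \<subseteq> scaled K (int_powers x)" if x: "x \<in> M" "x \<notin> B" for x
  proof (rule gen)
    have x0: "x \<noteq> 0" using mult_groupD(3)[OF M x(1)] .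
    show "mult_group (int_powers x)" by (rule mult_group_int_powers[OF x0])
    show pM: "int_powers x \<subseteq> M" using mult_group_powi[OF M x(1)] by (auto simp: int_powers_def)
    show "\<not> int_powers x \<subseteq> B" using x rangeI[of "\<lambda>i. x powi i" 1] by (auto simp: int_powers_def)
    show "commutator s t \<in> K" if "s \<in> int_powers x" "t \<in> int_powers x" for s t using commutator_int_powers[OF x0 that] div_subringD(2)[OF K] by simp
    interpret power_layer K x by (rule power_layerI[OF K Kc M nK x(1)])
    show "normalizes M (scaled K (int_powers x))"
      unfolding normalizes_def
    proof (intro ballI)
      fix m g assume m: "m \<in> M" and g: "g \<in> scaled K (int_powers x)"
      obtain l i where li: "g = l * x powi i" "l \<in> K" "l \<noteq> 0" using g by (auto simp: scaled_def int_powers_def)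
      have m0: "m \<noteq> 0" using mult_groupD(3)[OF M m] .
      have xG: "x \<in> scaled K (int_powers x)" using T_sub_scaled[OF K, of "int_powers x"] rangeI[of "\<lambda>i. x powi i" 1] by (auto simp: int_powers_def)
      have "commutator m x \<in> K" "commutator m x \<noteq> 0" using cmM[OF m x(1)] BK commutator_nonzero[OF m0 x0] by auto
      hence "commutator m x * x \<in> scaled K (int_powers x)" using scale xG by blast
      moreover have "commutator m x * x = conjg m x" using x0 by (simp add: commutator_conjg mult.assoc)
      ultimately have "conjg m x powi i \<in> scaled K (int_powers x)" using mult_group_powi[OF \<Gamma>] by simp
      moreover have "conjg m l \<in> K" "conjg m l \<noteq> 0" using normalizesD[OF nK m li(2)] li m0 conjg_eq_0 by auto
      moreover have "conjg m g = conjg m l * conjg m x powi i" using li m0 by (simp add: conjg_mult conjg_powi)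
      ultimately show "conjg m g \<in> scaled K (int_powers x)" using scale by simp
    qed
  qed
  obtain x where x: "x \<in> M" "x \<notin> B" using MnB by blast
  have x0: "x \<noteq> 0" using mult_groupD(3)[OF M x(1)] .
  have xi: "x powi i \<in> M" for i using mult_group_powi[OF M x(1)] .
  have Bgrp: "mult_group B" unfolding B_def by (rule mult_group_Int_div_subring[OF M div_subring_centralizer])
  have abs: "x ^ nat \<bar>i\<bar> \<in> B" if "x powi i \<in> B" for i
    using that mult_groupD(5)[OF Bgrp that] by (cases "i \<ge> 0") (auto simp: power_int_def power_inverse)
  \<comment> \<open>\<open>x ^ a\<close> generates \<open>M\<close> modulo \<open>B\<close> as well,
    so \<open>x\<close> is one of its powers there.\<close>
  have root: "\<exists>i. x powi (1 - int a * i) \<in> B" if a: "x ^ a \<notin> B" for a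
  proof -
    have xa: "x ^ a \<in> M" using mult_group_power[OF M x(1)] .
    have "x \<in> scaled K (int_powers (x ^ a))" using genx[OF xa a] x by blast
    then obtain l i where li: "x = l * (x ^ a) powi i" "l \<in> K" using scaled_int_powersD by blast
    have "x powi (1 + - (int a * i)) = x powi 1 * x powi (- (int a * i))" by (rule power_int_add) (simp add: x0)
    hence "x powi (1 - int a * i) = x * inverse ((x ^ a) powi i)"
      by (simp add: power_int_minus power_int_mult)
    also have "\<dots> = l" using li(1) x0 by (metis mult.assoc mult_1_right power_int_not_zero power_not_zero right_inverse)
    finally show ?thesis using li MK xi by blast
  qed
  \<comment> \<open>With \<open>a = 2\<close> the exponent \<open>1 - 2 * i\<close> is odd, hence
    nonzero; so \<open>x\<close> has finite order modulo \<open>B\<close>.\<close>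
  have "\<exists>r>0. x ^ r \<in> B"
  proof (cases "x ^ 2 \<in> B")
    case False
    then obtain i where "x powi (1 - int 2 * i) \<in> B" using root by blast
    hence "x ^ nat \<bar>1 - int 2 * i\<bar> \<in> B" by (rule abs)
    moreover have "nat \<bar>1 - int 2 * i\<bar> > 0" by simp presburger
    ultimately show ?thesis by blast
  qed (intro exI[of _ 2], simp)
  define p where "p = (LEAST r. r > 0 \<and> x ^ r \<in> B)"
  have p: "p > 0 \<and> x ^ p \<in> B" unfolding p_def using \<open>\<exists>r>0. x ^ r \<in> B\<close> by (rule LeastI_ex)
  have least: "\<not> (s > 0 \<and> x ^ s \<in> B)" if "s < p" for s
    using not_less_Least[of s "\<lambda>r. r > 0 \<and> x ^ r \<in> B"] that unfolding p_def by simp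
  have pdvd: "p dvd r" if r: "x ^ r \<in> B" for r
  proof -
    have "x ^ r = (x ^ p) ^ (r div p) * x ^ (r mod p)" by (simp add: power_mult[symmetric] power_add[symmetric])
    hence "x ^ (r mod p) = inverse ((x ^ p) ^ (r div p)) * x ^ r" using x0 by (simp add: mult.assoc[symmetric])
    hence "x ^ (r mod p) \<in> B" using r p mult_group_power[OF Bgrp] mult_groupD(4,5)[OF Bgrp] by simp
    moreover have "\<not> (r mod p > 0 \<and> x ^ (r mod p) \<in> B)" using p by (intro least) simp
    ultimately have "r mod p = 0" by simp
    thus ?thesis by (simp add: mod_eq_0_iff_dvd)
  qed
  have "p \<noteq> 1" using p x by auto
  have "prime p"
    unfolding prime_nat_iff
  proof (intro conjI allI impI)
    show "1 < p" using p \<open>p \<noteq> 1\<close> by simp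
    fix a assume a: "a dvd p"
    show "a = 1 \<or> a = p"
    proof (cases "x ^ a \<in> B")
      case True
      thus ?thesis using pdvd a dvd_antisym by blast
    next
      case False
      then obtain i where "x powi (1 - int a * i) \<in> B" using root by blast
      hence "p dvd nat \<bar>1 - int a * i\<bar>" using abs pdvd by blast
      hence "int p dvd int (nat \<bar>1 - int a * i\<bar>)" by (simp only: int_dvd_int_iff)
      hence "int p dvd 1 - int a * i" by simp
      hence "int a dvd 1 - int a * i" using a by (meson dvd_trans int_dvd_int_iff)
      hence "int a dvd 1" by (metis dvd_diff_right_iff dvd_triv_left dvd_diff diff_add_cancel dvd_add)
      thus ?thesis by simp
    qed
  qed
  moreover have "y ^ p \<in> K" if y: "y \<in> M" for y
  proof -
    interpret power_layer K x by (rule power_layerI[OF K Kc M nK x(1)])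
    have "y \<in> scaled K (int_powers x)" using genx[OF x] y by blast
    then obtain l i where li: "y = l * x powi i" "l \<in> K" using scaled_int_powersD by blast
    obtain c where c: "c \<in> K" "y ^ p = c * x powi (i * int p)" using power_form[OF li(2)] li(1) by blast
    have "x powi (i * int p) = (x ^ p) powi i" by (simp add: power_int_mult mult.commute[of i])
    moreover have "(x ^ p) powi i \<in> K" using p BK by (intro div_subring_powi[OF K]) auto
    ultimately show ?thesis using c div_subringD(4)[OF K] by simp
  qed
  moreover have "\<forall>x\<in>M - K. M \<subseteq> scaled K (int_powers x) \<and> abelian_layer.fractions (scaled K (int_powers x)) = UNIV" using genx BK by blast
  moreover have "K \<inter> U \<subseteq> M" using KG by (auto simp: B_def)
  moreover have "\<not> M \<subseteq> K" using MnB MK by blast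
  ultimately have "splitting K p" unfolding splitting_def using K Kc nK McK BK by blast
  thus ?thesis by blast
qed

end

section \<open>Normal subgroups of class two\<close>

lemma class2_shift:
  assumes "b * a = f * (a * b)" "\<And>z. f * z = z * (f::'a::division_ring)"
  shows "b * a ^ k = f ^ k * (a ^ k * b)"
proof (induction k)
  case (Suc k)
  have fk: "f ^ k * z = z * f ^ k" for z using assms(2)[of z] by (metis power_commuting_commutes)
  have "b * a ^ Suc k = f * (a * (b * a ^ k))" using assms(1) by (simp add: mult.assoc[symmetric])
  also have "\<dots> = f * (f ^ k * a) * a ^ k * b" unfolding Suc fk[of a] by (simp add: mult.assoc)
  finally show ?case by (simp add: mult.assoc)
qed simp

text \<open>Sorting the word costs one factor \<open>f\<close> for each of the
  \<open>k * (k - 1) div 2\<close> pairs in which a \<open>b\<close> stands before an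
  \<open>a\<close>.\<close>

lemma class2_power:
  assumes "b * a = f * (a * b)" "\<And>z. f * z = z * (f::'a::division_ring)"
  shows "(a * b) ^ k = f ^ (k * (k - 1) div 2) * (a ^ k * b ^ k)"
proof (induction k)
  case (Suc k)
  let ?t = "k * (k - 1) div 2"
  have c: "f ^ j * z = z * f ^ j" for j z using assms(2)[of z] by (metis power_commuting_commutes)
  have t: "Suc k * (Suc k - 1) div 2 = k + ?t"
    by (cases k) (simp_all add: algebra_simps)
  have ba: "b ^ k * a = f ^ k * (a * b ^ k)"
  proof (induction k)
    case (Suc k)
    have "b ^ Suc k * a = b * (b ^ k * a)" by (simp add: mult.assoc)
    also have "\<dots> = f ^ k * (b * a) * b ^ k" unfolding Suc using c[of k b] by (simp add: mult.assoc) (simp add: mult.assoc[symmetric])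
    also have "\<dots> = f ^ Suc k * (a * b ^ Suc k)" unfolding assms(1) power_Suc2[of f] by (simp add: mult.assoc)
    finally show ?case .
  qed simp
  have "(a * b) ^ Suc k = f ^ ?t * (a ^ k * (b ^ k * a)) * b" unfolding power_Suc2 Suc by (simp add: mult.assoc)
  also have "\<dots> = f ^ ?t * (a ^ k * f ^ k) * (a * b ^ k) * b" unfolding ba by (simp add: mult.assoc)
  also have "\<dots> = (f ^ ?t * f ^ k) * (a ^ k * a) * (b ^ k * b)" unfolding c[of k "a ^ k", symmetric] by (simp add: mult.assoc)
  also have "\<dots> = f ^ (k + ?t) * (a ^ Suc k * b ^ Suc k)"
    by (simp only: power_Suc2 power_add[symmetric] mult.assoc add.commute)
  finally show ?case unfolding t .
qed simp

lemma sqrt_1: "(u::'a::division_ring) * u = 1 \<Longrightarrow> u = 1 \<or> u = -1"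
proof -
  assume "u * u = 1"
  hence "(u - 1) * (u + 1) = 0" by (simp add: algebra_simps)
  thus ?thesis by (auto simp: eq_neg_iff_add_eq_0)
qed

text \<open>The case to be refuted. \<open>ZH\<close> arranges that \<open>H\<close> modulo
  \<open>M \<inter> F\<close> is the abelian group on which \<open>M\<close> acts
  irreducibly.\<close>

locale class_two = maximal_solvable +
  fixes H :: "'a set"
  assumes H: "mult_group H" "H \<subseteq> M" "normalizes M H" and ZH: "M \<inter> centralizer UNIV \<subseteq> H"
    and cmH: "\<And>s t. s \<in> H \<Longrightarrow> t \<in> H \<Longrightarrow> commutator s t \<in> centralizer UNIV" and Hnab: "\<not> H \<subseteq> centralizer H"
    and hyp: "\<And>A. mult_group A \<Longrightarrow> A \<subseteq> M \<Longrightarrow> normalizes M A \<Longrightarrow> A \<subseteq> centralizer A \<Longrightarrow> A \<subseteq> centralizer UNIV"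
begin

abbreviation F :: "'a set" where "F \<equiv> centralizer UNIV"

lemma F: "div_subring F" by (rule div_subring_centralizer)
lemma Fc: "f \<in> F \<Longrightarrow> f * z = z * f" by (auto simp: centralizer_def)
lemma FI: "(\<And>z. f * z = z * f) \<Longrightarrow> f \<in> F" by (auto simp: centralizer_def)
lemma cjF: "f \<in> F \<Longrightarrow> m \<noteq> 0 \<Longrightarrow> conjg m f = f" using Fc[of f m] by (simp add: conjg_fix_iff)
lemma nF: "normalizes T F" if "0 \<notin> T"
proof -
  have "conjg t f = f" if "t \<in> T" "f \<in> F" for t f using cjF[of f t] that \<open>0 \<notin> T\<close> by blast
  thus ?thesis by (simp add: normalizes_def)
qed

lemma layerF: "mult_group T \<Longrightarrow> T \<subseteq> H \<Longrightarrow> abelian_layer F (scaled F T)"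
  using cmH by (intro abelian_layer_scaled F nF mult_groupD(2)) auto

lemma normalizes_extF: assumes "normalizes M T" shows "normalizes M (scaled F T)"
proof -
  have "conjg m g \<in> scaled F T" if m: "m \<in> M" and g: "g \<in> scaled F T" for m g
  proof -
    obtain l t where lt: "g = l * t" "l \<in> F" "l \<noteq> 0" "t \<in> T" using g unfolding scaled_def by blast
    have m0: "m \<noteq> 0" using mult_groupD(3)[OF M m] .
    have "conjg m g = l * conjg m t" using lt m0 cjF by (simp add: conjg_mult)
    thus ?thesis using normalizesD[OF assms m lt(4)] lt unfolding scaled_def by blast
  qed
  thus ?thesis by (auto simp: normalizes_def)
qed

lemma fractions_UNIV:
  assumes T: "mult_group T" "T \<subseteq> H" "normalizes M T" "\<not> T \<subseteq> centralizer T"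
  shows "abelian_layer.fractions (scaled F T) = UNIV"
proof (rule ccontr)
  interpret A: abelian_layer F "scaled F T" by (rule layerF[OF T(1,2)])
  assume "A.fractions \<noteq> UNIV"
  hence "A.fractions \<inter> U \<subseteq> centralizer A.fractions" using dichotomy[OF A.div_subring_fractions A.fractions_normal[OF normalizes_extF[OF T(3)] mult_groupD(2)[OF M]]] by blast
  moreover have "T \<subseteq> A.fractions" using T_sub_scaled[OF F, of T] A.\<Gamma>_fractions by blast
  moreover have "T \<subseteq> U" using T H MG by blast
  ultimately have "T \<subseteq> centralizer T" by (auto simp: centralizer_def)
  thus False using T by simp
qed

abbreviation "\<Gamma> \<equiv> scaled F H"

sublocale A: abelian_layer F \<Gamma> by (rule layerF[OF H(1) subset_refl])

lemma H\<Gamma>: "H \<subseteq> \<Gamma>" using T_sub_scaled[OF F] .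

lemma A_UNIV: "A.fractions = UNIV" by (rule fractions_UNIV[OF H(1) subset_refl H(3) Hnab])

lemma centH: "centralizer H \<subseteq> F"
proof
  fix z assume z: "z \<in> centralizer H"
  have "\<Gamma> \<subseteq> centralizer {z}"
    by (rule scaled_sub[OF div_subring_centralizer]) (use z in \<open>auto simp: centralizer_def\<close>)
  hence "A.fractions \<subseteq> centralizer {z}" by (rule A.fractions_least[OF div_subring_centralizer])
  hence "w \<in> centralizer {z}" for w using A_UNIV by blast
  hence "z * w = w * z" for w using centralizerD[of w "{z}" z] by simp
  thus "z \<in> F" by (rule FI)
qed

text \<open>The character of \<open>g\<close> sends \<open>q\<close> to
  \<open>commutator q g\<close>; it is multiplicative because its values are central. If
  \<open>g\<close> and \<open>h\<close> have the same character, \<open>g * inverse h\<close>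
  centralizes \<open>H\<close> and is central by \<open>centH\<close>.\<close>

lemma ind: "A.independent"
proof (rule A.independentI[where X=H and \<theta>="\<lambda>g q. commutator q g" and C=F])
  have normalizes\<Gamma>: "g \<noteq> 0" if "g \<in> \<Gamma>" for g using mult_groupD(3)[OF A.\<Gamma> that] .
  have nzH: "g \<noteq> 0" if "g \<in> H" for g using mult_groupD(3)[OF H(1) that] .
  fix g q assume g: "g \<in> \<Gamma>" 
  show F1: "commutator q g \<in> F" if "q \<in> H" using A.comm[OF _ g] that H\<Gamma> by blast
  show "commutator 1 g \<noteq> 0" using normalizes\<Gamma>[OF g] by (simp add: commutator_nonzero)
  fix r assume qr: "q \<in> H" "r \<in> H"
  have rF: "commutator r g \<in> F" using A.comm[OF _ g] qr H\<Gamma> by blast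
  have "conjg (q * r) g = conjg q (commutator r g * g)" using normalizes\<Gamma>[OF g] by (simp add: conjg_conjg[symmetric] commutator_conjg mult.assoc)
  also have "\<dots> = commutator r g * conjg q g" using nzH[OF qr(1)] cjF[OF rF] by (simp add: conjg_mult)
  finally have "commutator (q * r) g = commutator r g * commutator q g" by (simp add: commutator_conjg mult.assoc)
  thus "commutator (q * r) g = commutator q g * commutator r g" using Fc[OF rF] by simp
next
  fix S q assume S: "finite S" "S \<subseteq> \<Gamma>" "\<Sum>S = 0" "q \<in> H"
  have "(\<Sum>g\<in>S. commutator q g * g) = (\<Sum>g\<in>S. conjg q g)"
  proof (rule sum.cong[OF refl])
    fix g assume "g \<in> S"
    hence "g \<noteq> 0" using S mult_groupD(3)[OF A.\<Gamma>] by blast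
    thus "commutator q g * g = conjg q g" by (simp add: commutator_conjg mult.assoc)
  qed
  also have "\<dots> = conjg q (\<Sum>S)" by (simp add: conjg_sum)
  finally show "(\<Sum>g\<in>S. commutator q g * g) = 0" using S by (simp add: conjg_0)
next
  fix g h assume gh: "g \<in> \<Gamma>" "h \<in> \<Gamma>" and eq: "\<And>q. q \<in> H \<Longrightarrow> commutator q g = commutator q h"
  have g0: "g \<noteq> 0" "h \<noteq> 0" using mult_groupD(3)[OF A.\<Gamma>] gh by auto
  have "g * inverse h \<in> centralizer H"
  proof (rule centralizerI)
    fix q assume q: "q \<in> H"
    have q0: "q \<noteq> 0" using mult_groupD(3)[OF H(1) q] .
    have cF: "commutator q g \<in> F" using A.comm[OF _ gh(1)] q H\<Gamma> by blast
    have c0: "commutator q g \<noteq> 0" using q0 g0 by (simp add: commutator_nonzero)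
    have "conjg q g = commutator q g * g" "conjg q h = commutator q h * h" using g0 by (simp_all add: commutator_conjg mult.assoc)
    hence "conjg q g = commutator q g * g" "conjg q h = commutator q g * h" using eq[OF q] by simp_all
    hence "conjg q (g * inverse h) = commutator q g * g * (inverse h * inverse (commutator q g))"
      using q0 g0 c0 by (simp add: conjg_mult conjg_inverse nonzero_inverse_mult_distrib)
    also have "\<dots> = commutator q g * (g * inverse h * inverse (commutator q g))" by (simp add: mult.assoc)
    also have "\<dots> = commutator q g * (inverse (commutator q g) * (g * inverse h))" unfolding Fc[OF div_subringD(6)[OF F cF]] ..
    also have "\<dots> = g * inverse h" using c0 by (simp add: mult.assoc[symmetric])
    finally show "g * inverse h * q = q * (g * inverse h)" using q0 by (simp add: conjg_fix_iff)
  qed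
  thus "g * inverse h \<in> F" using centH by blast
qed (auto simp: mult_groupD[OF H(1)] centralizer_def)

text \<open>\<open>M\<close> acts irreducibly on \<open>H / (M \<inter> F)\<close>.\<close>

lemma irreducible:
  assumes T: "mult_group T" "T \<subseteq> H" "normalizes M T" "M \<inter> F \<subseteq> T" "\<not> T \<subseteq> F"
  shows "T = H"
proof -
  \<comment> \<open>A noncentral \<open>T\<close> cannot be abelian by \<open>hyp\<close>, so its
    fractions fill the division ring and \<open>quotient_in\<close> can be applied to the elements
    of \<open>H\<close>.\<close>
  have "\<not> T \<subseteq> centralizer T" using hyp[OF T(1) _ T(3)] T H by blast
  hence U: "abelian_layer.fractions (scaled F T) = UNIV" by (rule fractions_UNIV[OF T(1-3)])
  interpret T: abelian_layer F "scaled F T" by (rule layerF[OF T(1,2)])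
  have "t \<in> T" if t: "t \<in> H" for t
  proof -
    have "t \<in> T.fractions" using U by simp
    then obtain a where a: "a \<in> add_span (scaled F T)" "a \<noteq> 0" "a * t \<in> add_span (scaled F T)" by (auto simp: T.fractions_def)
    have "scaled F T \<subseteq> \<Gamma>" using T(2) unfolding scaled_def by blast
    moreover have "t \<in> \<Gamma>" using t H\<Gamma> by blast
    ultimately have "t \<in> scaled F T" using A.quotient_in[OF ind T.\<Gamma> T.sub _ a] by blast
    then obtain l s where ls: "t = l * s" "l \<in> F" "s \<in> T" unfolding scaled_def by blast
    have s: "s \<in> M" "s \<noteq> 0" "inverse s \<in> M" using ls T H mult_groupD(3)[OF T(1)] mult_groupD(5)[OF M] by auto
    have "l = t * inverse s" using ls s by (simp add: mult.assoc)
    hence "l \<in> M" using t H s mult_groupD(4)[OF M] by blast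
    hence "l \<in> T" using ls T by blast
    thus ?thesis using ls mult_groupD(4)[OF T(1)] by blast
  qed
  thus ?thesis using T by blast
qed

text \<open>The denominators of \<open>m\<close> form an ideal stable under conjugation by \<open>H\<close>, and \<open>add_span \<Gamma>\<close> is simple.\<close>

lemma M_add_span: assumes m: "m \<in> M" shows "m \<in> add_span \<Gamma>"
proof -
  have m0: "m \<noteq> 0" using mult_groupD(3)[OF M m] .
  let ?P = "\<lambda>k. \<exists>xs. length xs = k \<and> set xs \<subseteq> \<Gamma> \<and> sum_list xs \<noteq> 0 \<and> sum_list xs * m \<in> add_span \<Gamma>"
  have "m \<in> A.fractions" using A_UNIV by simp
  then obtain f where "f \<in> add_span \<Gamma>" "f \<noteq> 0" "f * m \<in> add_span \<Gamma>" by (auto simp: A.fractions_def)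
  hence "\<exists>k. ?P k" by (auto simp: add_span_def)
  then obtain k where k: "?P k" and min: "\<And>j. j < k \<Longrightarrow> \<not> ?P j" using exists_least_iff[of ?P] by blast
  then obtain xs where xs: "length xs = k" "set xs \<subseteq> \<Gamma>" "sum_list xs \<noteq> 0" "sum_list xs * m \<in> add_span \<Gamma>" by blast
  then obtain x zs where xz: "xs = x # zs" by (cases xs) auto
  have x: "x \<in> \<Gamma>" "x \<noteq> 0" using xs xz mult_groupD(3)[OF A.\<Gamma>] by auto
  define f where "f = inverse x * sum_list xs"
  define ys where "ys = map ((*) (inverse x)) zs"
  have ix: "inverse x \<in> \<Gamma>" using x mult_groupD(5)[OF A.\<Gamma>] by blast
  have f: "f = 1 + sum_list ys" using x by (simp add: f_def ys_def xz distrib_left sum_list_const_mult)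
  have ys: "set ys \<subseteq> \<Gamma>" "length ys < k" using xs xz ix mult_groupD[OF A.\<Gamma>] by (auto simp: ys_def)
  have fm: "f * m \<in> add_span \<Gamma>" unfolding f_def mult.assoc using add_span_mult[OF A.\<Gamma> add_span_in[OF ix] xs(4)] .
  have f0: "f \<noteq> 0" using x xs by (simp add: f_def)
  have "f \<in> centralizer H"
  proof (rule centralizerI)
    fix g assume g: "g \<in> H"
    have g0: "g \<noteq> 0" using mult_groupD(3)[OF H(1) g] .
    have gG: "g \<in> \<Gamma>" using g H\<Gamma> by blast
    have e: "conjg g f - f = (\<Sum>y\<leftarrow>ys. (commutator g y - 1) * y)"
    proof -
      have "(\<Sum>y\<leftarrow>ys. (commutator g y - 1) * y) = (\<Sum>y\<leftarrow>ys. conjg g y - y)"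
      proof (intro arg_cong[of _ _ sum_list] map_cong refl)
        fix y assume "y \<in> set ys"
        hence "y \<noteq> 0" using ys mult_groupD(3)[OF A.\<Gamma>] by blast
        thus "(commutator g y - 1) * y = conjg g y - y" by (simp add: commutator_conjg left_diff_distrib mult.assoc)
      qed
      also have "\<dots> = conjg g (sum_list ys) - sum_list ys"
        by (induction ys) (simp_all add: conjg_0 conjg_add)
      finally show ?thesis unfolding f using g0 by (simp add: conjg_add conjg_1)
    qed
    have "\<exists>ws. set ws \<subseteq> \<Gamma> \<and> length ws \<le> length ys \<and> sum_list ws = (\<Sum>y\<leftarrow>ys. (commutator g y - 1) * y)"
      by (rule A.scale_list) (use ys gG A.comm div_subringD(2)[OF F] in \<open>auto intro!: div_subring_diff[OF F]\<close>)
    then obtain ws where ws: "set ws \<subseteq> \<Gamma>" "length ws < k" "sum_list ws = conjg g f - f" using ys(2) e by auto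
    have "(conjg g f - f) * m \<in> add_span \<Gamma>"
    proof -
      have "conjg (inverse m) (inverse g) \<in> H" using normalizesD[OF H(3) mult_groupD(5)[OF M m] mult_groupD(5)[OF H(1) g]] .
      hence c: "conjg (inverse m) (inverse g) \<in> add_span \<Gamma>" using H\<Gamma> add_span_in by blast
      \<comment> \<open>Since \<open>M\<close> normalizes \<open>H\<close>, the factor that appears
        on the right is again from \<open>H\<close>. So \<open>conjg g f\<close> is a denominator of
        \<open>m\<close> too, and the difference from \<open>f\<close> is a shorter one.\<close>
      have "conjg g f * m = g * (f * m) * conjg (inverse m) (inverse g)" using m0
        by (simp add: conjg_def mult.assoc) (simp add: mult.assoc[symmetric])
      also have "\<dots> \<in> add_span \<Gamma>" using add_span_mult[OF A.\<Gamma> add_span_mult[OF A.\<Gamma> add_span_in[OF gG] fm] c] .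
      finally show ?thesis using A.add_span_diff[OF _ fm] by (simp add: left_diff_distrib)
    qed
    hence "conjg g f - f = 0" using min[OF ws(2)] ws by metis
    thus "f * g = g * f" using g0 by (simp add: conjg_fix_iff)
  qed
  hence "inverse f \<in> F" using centH div_subringD(6)[OF F] by blast
  hence "inverse f * (f * m) \<in> add_span \<Gamma>" using add_span_mult[OF A.\<Gamma> A.L_add_span fm] by blast
  thus ?thesis using f0 by (simp add: mult.assoc[symmetric])
qed

text \<open>Otherwise the centralizer in \<open>M\<close> of a noncentral \<open>h\<close> is
  normal, and so is its center. The latter is abelian and contains \<open>h\<close>, against
  \<open>hyp\<close>.\<close>

lemma noncentral_commutator: "\<exists>m\<in>M. \<exists>h\<in>H. commutator m h \<notin> F"
proof (rule ccontr)
  assume no: "\<not> ?thesis"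
  have "\<not> H \<subseteq> F" using Hnab by (auto simp: centralizer_def)
  then obtain h where h: "h \<in> H" "h \<notin> F" by blast
  have h0: "h \<noteq> 0" using mult_groupD(3)[OF H(1) h(1)] .
  define C where "C = M \<inter> centralizer {h}"
  define X where "X = M \<inter> centralizer C"
  have "normalizes M C"
    unfolding normalizes_def
  proof (intro ballI)
    fix g w assume g: "g \<in> M" and w: "w \<in> C"
    have g0: "g \<noteq> 0" using mult_groupD(3)[OF M g] .
    define c where "c = commutator (inverse g) h"
    have "c \<in> F" using no mult_groupD(5)[OF M g] h by (auto simp: c_def)
    hence cw: "c * w = w * c" by (rule Fc)
    have e: "conjg (inverse g) h = c * h" using h0 by (simp add: c_def commutator_conjg mult.assoc)
    have wh: "w * h = h * w" using w by (simp add: C_def centralizer_def)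
    have "w * (c * h) = (c * w) * h" unfolding cw by (simp add: mult.assoc)
    hence "w * (c * h) = c * h * w" using wh by (simp add: mult.assoc)
    hence "conjg g (w * conjg (inverse g) h) = conjg g (conjg (inverse g) h * w)" unfolding e by simp
    hence "conjg g w * h = h * conjg g w" using g0 by (simp add: conjg_mult conjg_inv_cancel)
    thus "conjg g w \<in> C" using mult_group_conjg[OF M g] w by (auto simp: C_def centralizer_def)
  qed
  hence nX: "normalizes M X" unfolding X_def using M by (intro normalizes_Int normalizes_self normalizes_centralizer)
  have XC: "X \<subseteq> C" using h H by (auto simp: X_def C_def centralizer_def)
  have "X \<subseteq> F"
  proof (rule hyp[OF _ _ nX])
    show "mult_group X" unfolding X_def by (rule mult_group_Int_div_subring[OF M div_subring_centralizer])
    show "X \<subseteq> centralizer X" using XC by (auto simp: X_def centralizer_def)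
  qed (simp add: X_def)
  moreover have "h \<in> X" using h H by (auto simp: X_def C_def centralizer_def)
  ultimately show False using h by blast
qed

text \<open>Conjugation by \<open>h\<close> multiplies \<open>m\<close> by \<open>c\<close> and each
  term of \<open>m\<close> by a central factor. So all \<open>c ^ i * m\<close> lie in the span of
  these finitely many terms, the powers of \<open>c\<close> are dependent over \<open>F\<close>, and
  independence of cosets makes two of them agree modulo \<open>F\<close>.\<close>

lemma torsion_commutator:
  assumes m: "m \<in> M" and h: "h \<in> H" and c: "c = commutator h m" "c \<in> H"
  shows "\<exists>k>0. c ^ k \<in> F"
proof (rule ccontr)
  assume no: "\<not> ?thesis"
  have m0: "m \<noteq> 0" and h0: "h \<noteq> 0" and c0: "c \<noteq> 0" using mult_groupD(3)[OF M m] mult_groupD(3)[OF H(1) h] mult_groupD(3)[OF H(1) c(2)] by auto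
  obtain S where S: "finite S" "S \<subseteq> \<Gamma>" "m = \<Sum>S" using A.coset_rep[OF M_add_span[OF m]] by blast
  have cmF: "commutator h s \<in> F" if "s \<in> S" for s using A.comm H\<Gamma> h S(2) that by blast
  define \<epsilon> where "\<epsilon> = commutator h c"
  have \<epsilon>: "\<epsilon> \<in> F" "\<epsilon> \<noteq> 0" using cmH[OF h c(2)] commutator_nonzero[OF h0 c0] by (auto simp: \<epsilon>_def)
  have hc: "conjg h c = \<epsilon> * c" using c0 by (simp add: \<epsilon>_def commutator_conjg mult.assoc)
  have hm: "conjg h m = c * m" using m0 by (simp add: c commutator_conjg mult.assoc)
  have \<epsilon>k: "\<epsilon> ^ k \<in> F" for k using div_subring_prod[OF F \<epsilon>(1)] .
  have "\<exists>f. (\<forall>s\<in>S. f s \<in> F) \<and> c ^ i * m = (\<Sum>s\<in>S. f s * s)" for i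
  proof (induction i)
    case 0 show ?case using div_subringD(2)[OF F] S by (intro exI[of _ "\<lambda>_. 1"]) auto
  next
    case (Suc i)
    then obtain f where f: "\<forall>s\<in>S. f s \<in> F" "c ^ i * m = (\<Sum>s\<in>S. f s * s)" by blast
    have "conjg h (c ^ i * m) = (\<epsilon> * c) ^ i * (c * m)" using h0 hc hm by (simp add: conjg_mult conjg_power)
    also have "(\<epsilon> * c) ^ i = \<epsilon> ^ i * c ^ i" by (rule commuting_power_mult) (rule Fc[OF \<epsilon>(1)])
    also have "\<epsilon> ^ i * c ^ i * (c * m) = \<epsilon> ^ i * (c ^ Suc i * m)" by (simp only: power_Suc2 mult.assoc)
    finally have "c ^ Suc i * m = inverse (\<epsilon> ^ i) * conjg h (c ^ i * m)" using \<epsilon> by (simp add: mult.assoc[symmetric])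
    also have "conjg h (c ^ i * m) = (\<Sum>s\<in>S. (f s * commutator h s) * s)"
      unfolding f(2) conjg_sum
    proof (rule sum.cong[OF refl])
      fix s assume s: "s \<in> S"
      have "s \<noteq> 0" using s S mult_groupD(3)[OF A.\<Gamma>] by blast
      thus "conjg h (f s * s) = f s * commutator h s * s" using h0 cjF f s by (simp add: conjg_mult commutator_conjg mult.assoc)
    qed
    also have "inverse (\<epsilon> ^ i) * \<dots> = (\<Sum>s\<in>S. (inverse (\<epsilon> ^ i) * (f s * commutator h s)) * s)"
      by (simp add: sum_distrib_left mult.assoc)
    finally have "c ^ Suc i * m = (\<Sum>s\<in>S. (inverse (\<epsilon> ^ i) * (f s * commutator h s)) * s)" .
    moreover have "\<forall>s\<in>S. inverse (\<epsilon> ^ i) * (f s * commutator h s) \<in> F"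
      using f(1) cmF by (simp add: div_subringD(4,6)[OF F] \<epsilon>k)
    ultimately show ?case by (intro exI[of _ "\<lambda>s. inverse (\<epsilon> ^ i) * (f s * commutator h s)"] conjI)
  qed
  then obtain f where f: "\<And>i s. s \<in> S \<Longrightarrow> f i s \<in> F" "\<And>i. c ^ i * m = (\<Sum>s\<in>S. f i s * s)" by metis
  \<comment> \<open>\<open>card S + 1\<close> exponents against \<open>card S\<close>
    equations.\<close>
  let ?J = "{..card S}"
  have "\<exists>e. (\<forall>i\<in>?J. e i \<in> F) \<and> (\<exists>i\<in>?J. e i \<noteq> 0) \<and> (\<forall>s\<in>S. (\<Sum>i\<in>?J. e i * f i s) = 0)"
    using S f by (intro homogeneous_system[OF F]) auto
  then obtain e where e: "\<forall>i\<in>?J. e i \<in> F" "\<exists>i\<in>?J. e i \<noteq> 0" "\<forall>s\<in>S. (\<Sum>i\<in>?J. e i * f i s) = 0" by blast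
  have "(\<Sum>i\<in>?J. e i * c ^ i) * m = (\<Sum>i\<in>?J. \<Sum>s\<in>S. e i * f i s * s)"
    by (simp add: sum_distrib_right sum_distrib_left mult.assoc f(2))
  also have "\<dots> = (\<Sum>s\<in>S. (\<Sum>i\<in>?J. e i * f i s) * s)" by (subst sum.swap) (simp add: sum_distrib_right)
  also have "\<dots> = 0" using e(3) by simp
  finally have z: "(\<Sum>i\<in>?J. e i * c ^ i) = 0" using m0 by simp
  let ?I = "{i \<in> ?J. e i \<noteq> 0}"
  have zI: "(\<Sum>i\<in>?I. e i * c ^ i) = 0" using z by (subst sum.mono_neutral_left[of ?J]) auto
  have cG: "c ^ i \<in> \<Gamma>" for i using mult_group_power[OF H(1) c(2)] H\<Gamma> by blast
  have dist: "e i * c ^ i * inverse (e j * c ^ j) \<notin> F" if ij: "i \<in> ?I" "j \<in> ?I" "i \<noteq> j" for i j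
  proof
    assume a: "e i * c ^ i * inverse (e j * c ^ j) \<in> F"
    have ei: "e i \<in> F" "e j \<in> F" "e i \<noteq> 0" "e j \<noteq> 0" using ij e by auto
    have ck: "c ^ i * inverse (c ^ j) \<in> F"
    proof -
      have "inverse (e i) * (e i * c ^ i * inverse (e j * c ^ j)) * e j \<in> F" using a ei by (simp add: div_subringD(4,6)[OF F])
      moreover have "inverse (e i) * (e i * c ^ i * inverse (e j * c ^ j)) * e j = c ^ i * inverse (c ^ j)"
        using ei c0 by (simp add: nonzero_inverse_mult_distrib mult.assoc) (simp add: mult.assoc[symmetric])
      ultimately show ?thesis by simp
    qed
    show False
    proof (cases "i < j")
      case True
      have "inverse (c ^ i * inverse (c ^ j)) \<in> F" using div_subringD(6)[OF F ck] .
      also have "inverse (c ^ i * inverse (c ^ j)) = c ^ j * inverse (c ^ i)" using c0 by (simp add: nonzero_inverse_mult_distrib)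
      also have "c ^ j = c ^ (j - i) * c ^ i" using True by (simp add: power_add[symmetric])
      finally have "c ^ (j - i) \<in> F" using c0 by (simp add: mult.assoc)
      moreover have "j - i > 0" using True by simp
      ultimately show False using no by blast
    next
      case False
      have "c ^ i = c ^ (i - j) * c ^ j" using False by (simp add: power_add[symmetric])
      hence "c ^ (i - j) \<in> F" using ck c0 by (simp add: mult.assoc)
      moreover have "i - j > 0" using False ij(3) by simp
      ultimately show False using no by blast
    qed
  qed
  let ?T = "(\<lambda>i. e i * c ^ i) ` ?I"
  have inj: "inj_on (\<lambda>i. e i * c ^ i) ?I"
  proof (rule inj_onI)
    fix i j assume ij: "i \<in> ?I" "j \<in> ?I" "e i * c ^ i = e j * c ^ j"
    have "e j * c ^ j * inverse (e j * c ^ j) = 1" using ij c0 by (intro right_inverse) simp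
    thus "i = j" using dist[OF ij(1,2)] ij(3) div_subringD(2)[OF F] by auto
  qed
  have "?T = {}"
  proof -
    have 1: "finite ?T" by simp
    have 2: "?T \<subseteq> \<Gamma>" using A.scale[OF _ cG] e(1) by auto
    have 3: "\<forall>g\<in>?T. \<forall>h\<in>?T. g \<noteq> h \<longrightarrow> g * inverse h \<notin> F" using dist by blast
    have 4: "\<Sum>?T = 0" using zI inj by (simp add: sum.reindex)
    show ?thesis using ind 1 2 3 4 unfolding A.independent_def by (elim allE[of _ ?T]) simp
  qed
  thus False using e(2) by blast
qed


lemma prime_torsion: "\<exists>p c. prime p \<and> c \<in> H \<and> c \<notin> F \<and> c ^ p \<in> F"
proof -
  obtain m h where mh: "m \<in> M" "h \<in> H" "commutator m h \<notin> F" using noncentral_commutator by blast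
  have nzz: "m \<noteq> 0" "h \<noteq> 0" using mult_groupD(3)[OF M mh(1)] mult_groupD(3)[OF H(1) mh(2)] by auto
  define c where "c = commutator h m"
  have "conjg m (inverse h) \<in> H" using normalizesD[OF H(3) mh(1)] mult_groupD(5)[OF H(1) mh(2)] by blast
  moreover have "c = h * conjg m (inverse h)" by (simp add: c_def commutator_def conjg_def mult.assoc)
  ultimately have cH: "c \<in> H" using mult_groupD(4)[OF H(1) mh(2)] by simp
  have inv: "commutator m h = inverse c" using nzz by (simp add: c_def commutator_def nonzero_inverse_mult_distrib mult.assoc)
  hence cF: "c \<notin> F" using mh(3) div_subringD(6)[OF F, of c] by auto
  define k where "k = (LEAST k. k > 0 \<and> c ^ k \<in> F)"
  have k: "k > 0 \<and> c ^ k \<in> F" unfolding k_def using torsion_commutator[OF mh(1,2) c_def cH] by (rule LeastI_ex)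
  have least: "\<not> (s > 0 \<and> c ^ s \<in> F)" if "s < k" for s
    using not_less_Least[of s "\<lambda>k. k > 0 \<and> c ^ k \<in> F"] that unfolding k_def by simp
  have "k \<noteq> 1" using k cF by auto
  then obtain p where p: "prime p" "p dvd k" using prime_factor_nat by blast
  then obtain s where s: "k = p * s" by blast
  have s0: "s > 0" using k s by (cases s) auto
  have "s < k" unfolding s using s0 prime_gt_1_nat[OF p(1)] by simp
  hence "c ^ s \<notin> F" using least s0 by blast
  moreover have "(c ^ s) ^ p \<in> F" using k s by (simp add: power_mult[symmetric] mult.commute)
  ultimately show ?thesis using p(1) mult_group_power[OF H(1) cH] by blast
qed

lemma H_comm: assumes "a \<in> H" "b \<in> H" shows "b * a = commutator b a * (a * b)" "commutator b a * z = z * commutator b a" "commutator b a \<in> F" "commutator b a \<noteq> 0"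
proof -
  have nzz: "a \<noteq> 0" "b \<noteq> 0" using mult_groupD(3)[OF H(1)] assms by auto
  show "b * a = commutator b a * (a * b)" using commutator_eq[OF nzz(2,1)] by (simp add: mult.assoc)
  show "commutator b a \<in> F" using cmH[OF assms(2,1)] .
  thus "commutator b a * z = z * commutator b a" by (rule Fc)
  show "commutator b a \<noteq> 0" using nzz by (simp add: commutator_nonzero)
qed

lemma H_power_mult: assumes "a \<in> H" "b \<in> H" shows "(a * b) ^ k = commutator b a ^ (k * (k - 1) div 2) * (a ^ k * b ^ k)"
  using class2_power[OF H_comm(1,2)[OF assms]] .

lemma H_commutator_root: assumes "a \<in> H" "b \<in> H" "a ^ k \<in> F" shows "commutator b a ^ k = 1"
proof -
  have nzz: "a \<noteq> 0" "b \<noteq> 0" using mult_groupD(3)[OF H(1)] assms by auto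
  have "b * a ^ k = commutator b a ^ k * (a ^ k * b)" using class2_shift[OF H_comm(1,2)[OF assms(1,2)]] .
  moreover have "b * a ^ k = a ^ k * b" using Fc[OF assms(3), of b] by simp
  ultimately have "commutator b a ^ k * (a ^ k * b) = 1 * (a ^ k * b)" by simp
  thus ?thesis using nzz by (metis mult_cancel_right mult_eq_0_iff power_not_zero)
qed

lemma MF: "mult_group (M \<inter> F)" by (rule mult_group_Int_div_subring[OF M F])

text \<open>In class two the \<open>p\<close>-th power map is multiplicative up to central factors.
  So the elements with central \<open>p\<close>-th power form a normal subgroup, which is
  \<open>H\<close> by irreducibility.\<close>

lemma exponent: assumes p: "prime p" and c: "c \<in> H" "c \<notin> F" "c ^ p \<in> F" and h: "h \<in> H" shows "h ^ p \<in> F"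
proof -
  define T where "T = {h \<in> H. h ^ p \<in> F}"
  have "T = H"
  proof (rule irreducible)
    have "a * b \<in> T" if "a \<in> T" "b \<in> T" for a b
      using that H_power_mult[of a b p] H_comm(3)[of a b] mult_groupD(4)[OF H(1)] div_subringD(4)[OF F] div_subring_prod[OF F] by (simp add: T_def)
    moreover have "inverse a \<in> T" if "a \<in> T" for a
      using that mult_groupD(5)[OF H(1)] div_subringD(6)[OF F] by (auto simp: T_def power_inverse)
    ultimately show "mult_group T" using mult_groupD(1,2)[OF H(1)] div_subringD(2)[OF F] unfolding mult_group_def by (auto simp: T_def)
    show "normalizes M T"
      unfolding normalizes_def
    proof (intro ballI)
      fix m a assume m: "m \<in> M" and a: "a \<in> T"
      have m0: "m \<noteq> 0" using mult_groupD(3)[OF M m] .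
      have "conjg m a ^ p = a ^ p" using cjF[of "a ^ p" m] a m0 by (simp add: T_def conjg_power[symmetric])
      thus "conjg m a \<in> T" using normalizesD[OF H(3) m] a by (simp add: T_def)
    qed
    show "M \<inter> F \<subseteq> T" using ZH div_subring_prod[OF F] by (auto simp: T_def)
    show "\<not> T \<subseteq> F" using c by (auto simp: T_def)
  qed (auto simp: T_def)
  thus ?thesis using h by (auto simp: T_def)
qed

text \<open>The sign absorbs the factor from \<open>H_power_mult\<close>, which is 1 for odd
  \<open>p\<close> and may be -1 for \<open>p = 2\<close>. The set in question is noncentral because
  it contains every \<open>commutator m h\<close>: conjugate elements have the same central
  \<open>p\<close>-th power. Irreducibility does the rest.\<close>

lemma exponent_root:
  assumes p: "prime p" and ex: "\<And>h. h \<in> H \<Longrightarrow> h ^ p \<in> F" and h: "h \<in> H"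
  shows "\<exists>z\<in>M \<inter> F. h ^ p = z ^ p \<or> h ^ p = - (z ^ p)"
proof -
  define T where "T = {h \<in> H. \<exists>z\<in>M \<inter> F. h ^ p = z ^ p \<or> h ^ p = - (z ^ p)}"
  have zc: "(z * w) ^ p = z ^ p * w ^ p" if "z \<in> M \<inter> F" for z w using that Fc[of z w] by (intro commuting_power_mult) auto
  have sgn: "commutator b a ^ (p * (p - 1) div 2) = 1 \<or> commutator b a ^ (p * (p - 1) div 2) = -1" if ab: "a \<in> H" "b \<in> H" for a b
  proof -
    have r: "commutator b a ^ p = 1" using H_commutator_root[OF ab ex[OF ab(1)]] .
    show ?thesis
    proof (cases "p = 2")
      case True
      have "commutator b a * commutator b a = 1" using r True by (simp add: power2_eq_square)
      thus ?thesis using sqrt_1 True by auto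
    next
      case False
      hence "odd p" using p primes_dvd_imp_eq two_is_prime_nat by blast
      then obtain k where "p = 2 * k + 1" by (rule oddE)
      hence "p * (p - 1) div 2 = p * k" by simp
      thus ?thesis using r by (simp add: power_mult)
    qed
  qed
  have prod: "\<exists>z\<in>M \<inter> F. (a * b) ^ p = z ^ p \<or> (a * b) ^ p = - (z ^ p)"
    if ab: "a \<in> H" "b \<in> H" "w \<in> M \<inter> F" "a ^ p * b ^ p = w ^ p \<or> a ^ p * b ^ p = - (w ^ p)" for a b w
    using H_power_mult[OF ab(1,2), of p] sgn[OF ab(1,2)] ab(3,4) by (intro bexI[of _ w]) auto
  have "T = H"
  proof (rule irreducible)
    have "a * b \<in> T" if "a \<in> T" "b \<in> T" for a b
    proof -
      obtain z w where zw: "z \<in> M \<inter> F" "w \<in> M \<inter> F" "a ^ p = z ^ p \<or> a ^ p = - (z ^ p)" "b ^ p = w ^ p \<or> b ^ p = - (w ^ p)"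
        using \<open>a \<in> T\<close> \<open>b \<in> T\<close> by (auto simp: T_def)
      have "a ^ p * b ^ p = (z * w) ^ p \<or> a ^ p * b ^ p = - ((z * w) ^ p)" unfolding zc[OF zw(1)] using zw(3,4) by auto
      hence "\<exists>z\<in>M \<inter> F. (a * b) ^ p = z ^ p \<or> (a * b) ^ p = - (z ^ p)"
        using prod[of a b "z * w"] mult_groupD(4)[OF MF zw(1,2)] \<open>a \<in> T\<close> \<open>b \<in> T\<close> by (simp add: T_def)
      thus ?thesis using mult_groupD(4)[OF H(1)] \<open>a \<in> T\<close> \<open>b \<in> T\<close> by (simp add: T_def)
    qed
    moreover have "inverse a \<in> T" if a: "a \<in> T" for a
    proof -
      obtain z where z: "z \<in> M \<inter> F" "a ^ p = z ^ p \<or> a ^ p = - (z ^ p)" using a by (auto simp: T_def)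
      have "inverse a ^ p = inverse z ^ p \<or> inverse a ^ p = - (inverse z ^ p)" using z(2) by (auto simp: power_inverse)
      thus ?thesis using mult_groupD(5)[OF MF z(1)] mult_groupD(5)[OF H(1)] a by (auto simp: T_def)
    qed
    moreover have "1 \<in> T" using mult_groupD(1)[OF H(1)] mult_groupD(1)[OF MF] by (auto simp: T_def intro!: bexI[of _ 1])
    ultimately show "mult_group T" using mult_groupD(2)[OF H(1)] unfolding mult_group_def by (auto simp: T_def)
    show "normalizes M T"
      unfolding normalizes_def
    proof (intro ballI)
      fix m a assume m: "m \<in> M" and a: "a \<in> T"
      have m0: "m \<noteq> 0" using mult_groupD(3)[OF M m] .
      have "conjg m a ^ p = a ^ p" using cjF[OF ex, of a m] a m0 by (simp add: T_def conjg_power[symmetric])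
      thus "conjg m a \<in> T" using normalizesD[OF H(3) m] a by (simp add: T_def)
    qed
    show "M \<inter> F \<subseteq> T" using ZH by (auto simp: T_def)
    obtain m h where mh: "m \<in> M" "h \<in> H" "commutator m h \<notin> F" using noncentral_commutator by blast
    have nzz: "m \<noteq> 0" "h \<noteq> 0" using mult_groupD(3)[OF M mh(1)] mult_groupD(3)[OF H(1) mh(2)] by auto
    define a b where "a = conjg m h" and "b = inverse h"
    have ab: "a \<in> H" "b \<in> H" using normalizesD[OF H(3) mh(1,2)] mult_groupD(5)[OF H(1) mh(2)] by (auto simp: a_def b_def)
    have "a ^ p = h ^ p" using cjF[OF ex[OF mh(2)] nzz(1)] nzz by (simp add: a_def conjg_power[symmetric])
    hence "a ^ p * b ^ p = 1 ^ p" using nzz by (simp add: b_def power_inverse)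
    hence "\<exists>z\<in>M \<inter> F. (a * b) ^ p = z ^ p \<or> (a * b) ^ p = - (z ^ p)" using prod[OF ab mult_groupD(1)[OF MF]] by blast
    moreover have "commutator m h = a * b" by (simp add: commutator_conjg a_def b_def)
    moreover have "a * b \<in> H" using mult_groupD(4)[OF H(1) ab] .
    ultimately have "commutator m h \<in> T" by (simp add: T_def)
    thus "\<not> T \<subseteq> F" using mh by blast
  qed (auto simp: T_def)
  thus ?thesis using h by (auto simp: T_def)
qed

text \<open>The geometric sum of such a root would vanish, although its first \<open>p\<close>
  powers lie in distinct cosets of \<open>F\<close>.\<close>

lemma no_root_of_unity:
  assumes p: "prime p" and u: "u \<in> \<Gamma>" "u \<notin> F" shows "u ^ p \<noteq> 1"
proof
  assume u1: "u ^ p = 1"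
  have u0: "u \<noteq> 0" using mult_groupD(3)[OF A.\<Gamma> u(1)] .
  have "u \<noteq> 1" using u div_subringD(2)[OF F] by auto
  hence z: "(\<Sum>i<p. u ^ i) = 0" by (rule geometric_zero[OF u1])
  have dvd: "p dvd i" if "u ^ i \<in> F" for i
    using power_centralizer_prime[OF u0 p _ u(2) that] u1 div_subringD(2)[OF F] by simp
  have dist: "u ^ i * inverse (u ^ j) \<notin> F" if ij: "i < p" "j < p" "i \<noteq> j" for i j
  proof
    assume a: "u ^ i * inverse (u ^ j) \<in> F"
    have *: False if "i < j" "j < p" "u ^ j * inverse (u ^ i) \<in> F" for i j
    proof -
      have "u ^ j = u ^ (j - i) * u ^ i" using \<open>i < j\<close> by (simp add: power_add[symmetric])
      hence "u ^ (j - i) \<in> F" using that(3) u0 by (simp add: mult.assoc)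
      hence "p dvd j - i" by (rule dvd)
      thus False using that(1,2) dvd_imp_le[of p "j - i"] by simp
    qed
    have "inverse (u ^ i * inverse (u ^ j)) \<in> F" using div_subringD(6)[OF F a] .
    hence "u ^ j * inverse (u ^ i) \<in> F" using u0 by (simp add: nonzero_inverse_mult_distrib)
    thus False using *[of i j] *[of j i] a ij by (metis linorder_neqE_nat)
  qed
  let ?T = "(\<lambda>i. u ^ i) ` {..<p}"
  have inj: "inj_on (\<lambda>i. u ^ i) {..<p}"
  proof (rule inj_onI)
    fix i j assume ij: "i \<in> {..<p}" "j \<in> {..<p}" "u ^ i = u ^ j"
    have "u ^ j * inverse (u ^ j) = 1" using u0 by (intro right_inverse) simp
    thus "i = j" using dist[of i j] ij div_subringD(2)[OF F] by auto
  qed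
  have 1: "finite ?T" by simp
  have 2: "?T \<subseteq> \<Gamma>" using mult_group_power[OF A.\<Gamma> u(1)] by auto
  have 3: "\<forall>g\<in>?T. \<forall>h\<in>?T. g \<noteq> h \<longrightarrow> g * inverse h \<notin> F" using dist by (auto simp: lessThan_def)
  have 4: "\<Sum>?T = 0" using z inj by (simp add: sum.reindex)
  have "?T = {}" using ind 1 2 3 4 unfolding A.independent_def by (elim allE[of _ ?T]) simp
  moreover have "p > 0" using p prime_gt_0_nat by blast
  ultimately show False by auto
qed

text \<open>Scaling by a central root makes the \<open>p\<close>-th power 1 or -1, and 1 is excluded
  by \<open>no_root_of_unity\<close>. For odd \<open>p\<close> the negative would have
  \<open>p\<close>-th power 1, so \<open>p = 2\<close>.\<close>

lemma quaternion_group: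
  shows "\<And>h. h \<in> H \<Longrightarrow> h \<notin> F \<Longrightarrow> \<exists>z\<in>M \<inter> F. z * h \<in> H \<and> z * h \<notin> F \<and> (z * h) * (z * h) = -1"
    and "\<And>h. h \<in> H \<Longrightarrow> h * h \<in> F"
proof -
  obtain p c where p: "prime p" and c: "c \<in> H" "c \<notin> F" "c ^ p \<in> F" using prime_torsion by blast
  have ex: "h ^ p \<in> F" if "h \<in> H" for h using exponent[OF p c that] .
  have root: "\<exists>z\<in>M \<inter> F. z * h \<in> H \<and> z * h \<notin> F \<and> (z * h) ^ p = -1" if h: "h \<in> H" "h \<notin> F" for h
  proof -
    obtain w where w: "w \<in> M \<inter> F" "h ^ p = w ^ p \<or> h ^ p = - (w ^ p)" using exponent_root[OF p ex h(1)] by blast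
    have w0: "w \<noteq> 0" using mult_groupD(3)[OF MF w(1)] .
    define z where "z = inverse w"
    have z: "z \<in> M \<inter> F" "z \<noteq> 0" using mult_groupD(5)[OF MF w(1)] w0 by (auto simp: z_def)
    have zh: "z * h \<in> H" using z ZH h mult_groupD(4)[OF H(1)] by blast
    have zF: "z * h \<notin> F"
    proof
      assume "z * h \<in> F"
      hence "w * (z * h) \<in> F" using w(1) div_subringD(4)[OF F] by blast
      thus False using h w0 by (simp add: z_def mult.assoc[symmetric])
    qed
    have zp: "(z * h) ^ p = z ^ p * h ^ p" using z Fc[of z h] by (intro commuting_power_mult) auto
    have "(z * h) ^ p = 1 \<or> (z * h) ^ p = -1" unfolding zp using w(2) w0 by (auto simp: z_def power_inverse)
    moreover have "(z * h) ^ p \<noteq> 1" using no_root_of_unity[OF p _ zF] zh H\<Gamma> by blast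
    ultimately show ?thesis using z zh zF by blast
  qed
  have p2: "p = 2"
  proof (rule ccontr)
    assume "p \<noteq> 2"
    hence odd: "odd p" using p primes_dvd_imp_eq two_is_prime_nat by blast
    obtain z where z: "z * c \<in> H" "z * c \<notin> F" "(z * c) ^ p = -1" using root[OF c(1,2)] by blast
    have "- 1 * (z * c) \<in> \<Gamma>" using A.scale[of "-1" "z * c"] z(1) H\<Gamma> div_subringD(2,5)[OF F] by auto
    moreover have "- 1 * (z * c) \<notin> F" using z(2) div_subringD(5)[OF F, of "- (z * c)"] by auto
    ultimately have "(- 1 * (z * c)) ^ p \<noteq> 1" by (rule no_root_of_unity[OF p])
    moreover have "(- (z * c)) ^ p = - ((z * c) ^ p)" using odd by (simp add: power_minus_odd)
    ultimately show False using z(3) by simp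
  qed
  show "\<exists>z\<in>M \<inter> F. z * h \<in> H \<and> z * h \<notin> F \<and> (z * h) * (z * h) = -1" if "h \<in> H" "h \<notin> F" for h
    using root[OF that] by (simp add: p2 power2_eq_square)
  show "h * h \<in> F" if "h \<in> H" for h using ex[OF that] by (simp add: p2 power2_eq_square)
qed

lemma commutator_sign: assumes "a \<in> H" "b \<in> H" shows "b * a = a * b \<or> b * a = - (a * b)"
proof -
  have "commutator b a ^ 2 = 1" using H_commutator_root[OF assms, of 2] quaternion_group(2)[OF assms(1)] by (simp add: power2_eq_square)
  hence "commutator b a = 1 \<or> commutator b a = -1" using sqrt_1 by (simp add: power2_eq_square)
  thus ?thesis using H_comm(1)[OF assms] by auto
qed

lemma exists_quaternions: "\<exists>x y. x \<in> H \<and> y \<in> H \<and> x * x = -1 \<and> y * y = -1 \<and> x * y = - (y * x) \<and> x * y \<noteq> y * x"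
proof -
  obtain a b where ab: "a \<in> H" "b \<in> H" "a * b \<noteq> b * a" using Hnab by (auto simp: centralizer_def)
  have "a \<notin> F" using Fc[of a b] ab by auto
  then obtain z where z: "z \<in> M \<inter> F" "z * a \<in> H" "(z * a) * (z * a) = -1" using quaternion_group(1)[OF ab(1)] by blast
  have "b \<notin> F" using Fc[of b a] ab by auto
  then obtain w where w: "w \<in> M \<inter> F" "w * b \<in> H" "(w * b) * (w * b) = -1" using quaternion_group(1)[OF ab(2)] by blast
  have 0: "z \<noteq> 0" "w \<noteq> 0" using mult_groupD(3)[OF MF] z w by auto
  have zc: "z * t = t * z" "w * t = t * w" for t using z w Fc by auto
  have e1: "(z * a) * (w * b) = z * w * (a * b)" using zc(2)[of a] by (simp add: mult.assoc) (simp add: mult.assoc[symmetric])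
  have e2: "(w * b) * (z * a) = z * w * (b * a)"
    using zc(1)[of b] zc(1)[of w] by (simp add: mult.assoc) (simp add: mult.assoc[symmetric])
  have ne: "(z * a) * (w * b) \<noteq> (w * b) * (z * a)" unfolding e1 e2 using ab(3) 0 by simp
  hence "(z * a) * (w * b) = - ((w * b) * (z * a))" using commutator_sign[OF w(2) z(2)] by blast
  thus ?thesis using z w ne by blast
qed

end

section \<open>Quaternions over the integers\<close>

text \<open>The powers of \<open>z\<close> repeat, so its inverse is one of them.\<close>

lemma inverse_in_finite:
  fixes S :: "'a::division_ring set"
  assumes "finite S" "1 \<in> S" "\<And>a b. a \<in> S \<Longrightarrow> b \<in> S \<Longrightarrow> a * b \<in> S" "z \<in> S" "z \<noteq> 0"
  shows "inverse z \<in> S"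
proof -
  have int_powers: "z ^ i \<in> S" for i by (induction i) (auto simp: assms)
  hence "\<not> inj (\<lambda>i. z ^ i)" using assms(1) finite_imageD[of "\<lambda>i. z ^ i" UNIV] finite_subset[of "range (\<lambda>i. z ^ i)" S] by auto
  then obtain i j where ij: "i \<noteq> j" "z ^ i = z ^ j" by (auto simp: inj_def)
  have *: "inverse z \<in> S" if "i < j" "z ^ i = z ^ j" for i j
  proof -
    have "z * z ^ (j - i - 1) = z ^ (j - i)" using that(1) by (simp add: power_Suc[symmetric] Suc_diff_Suc del: power_Suc)
    moreover have "z ^ i * z ^ (j - i) = z ^ i" using that by (metis le_add_diff_inverse less_imp_le power_add)
    ultimately have "z ^ i * (z * z ^ (j - i - 1)) = z ^ i * 1" by simp
    hence "z * z ^ (j - i - 1) = 1" using assms(5) by simp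
    hence "inverse z = z ^ (j - i - 1)" by (rule inverse_unique)
    thus ?thesis using int_powers by simp
  qed
  show ?thesis using *[of i j] *[of j i] ij by (metis linorder_neqE_nat)
qed

locale quaternion_case = class_two +
  fixes x y :: 'a
  assumes xH: "x \<in> H" and yH: "y \<in> H" and xx: "x * x = -1" and yy: "y * y = -1"
    and xy: "x * y = - (y * x)" and nc: "x * y \<noteq> y * x"
begin

lemma x0: "x \<noteq> 0" and y0: "y \<noteq> 0" using mult_groupD(3)[OF H(1)] xH yH by auto

lemma yx: "y * x = - (x * y)" using xy by simp

lemma xxa: "x * (x * z) = - z" and yya: "y * (y * z) = - z" and yxa: "y * (x * z) = - (x * (y * z))"
  by (simp_all add: mult.assoc[symmetric] xx yy yx)

lemmas quat = xx yy yx xxa yya yxa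

lemma intc: "x * of_int a = of_int a * x" "y * of_int a = of_int a * y"
   "x * (of_int a * z) = of_int a * (x * z)" "y * (of_int a * z) = of_int a * (y * z)"
  by (metis mult_of_int_commute, metis mult_of_int_commute, metis mult.assoc mult_of_int_commute, metis mult.assoc mult_of_int_commute)

lemma int_swap: "of_int s * (of_int t * w) = of_int t * (of_int s * (w::'a))"
  and int_left: "v * (of_int t * w) = of_int t * (v * (w::'a))"
  by (metis mult.assoc mult_of_int_commute)+

lemma cjx: "conjg x y = - y" "conjg y x = - x"
  using x0 y0 by (simp_all add: conjg_eq_iff yx)

lemma conjg_int: "g \<noteq> 0 \<Longrightarrow> conjg g (of_int a) = of_int a" by (simp add: conjg_fix_iff mult_of_int_commute)

text \<open>In positive characteristic the integers and \<open>x\<close> form a finite field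
  \<open>K\<close> on which \<open>y\<close> acts with order two; \<open>finite_impossible\<close>
  excludes this.\<close>

lemma char0: "k \<noteq> 0 \<Longrightarrow> (of_int k :: 'a) \<noteq> 0"
proof
  assume k: "k \<noteq> 0" and z: "(of_int k :: 'a) = 0"
  define K where "K = {of_int a + of_int b * x | a b. True}"
  have modk: "(of_int a :: 'a) = of_int (a mod \<bar>k\<bar>)" for a
  proof -
    have "(of_int a :: 'a) = of_int (\<bar>k\<bar> * (a div \<bar>k\<bar>) + a mod \<bar>k\<bar>)" by simp
    also have "\<dots> = of_int \<bar>k\<bar> * of_int (a div \<bar>k\<bar>) + of_int (a mod \<bar>k\<bar>)" by (simp only: of_int_add of_int_mult)
    also have "(of_int \<bar>k\<bar> :: 'a) = 0" using z by (simp add: abs_if)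
    finally show ?thesis by simp
  qed
  have "K \<subseteq> (\<lambda>(a, b). of_int a + of_int b * x) ` ({0..<\<bar>k\<bar>} \<times> {0..<\<bar>k\<bar>})"
  proof
    fix w assume "w \<in> K"
    then obtain a b where "w = of_int a + of_int b * x" by (auto simp: K_def)
    hence "w = of_int (a mod \<bar>k\<bar>) + of_int (b mod \<bar>k\<bar>) * x" using modk[of a] modk[of b] by simp
    thus "w \<in> (\<lambda>(a, b). of_int a + of_int b * x) ` ({0..<\<bar>k\<bar>} \<times> {0..<\<bar>k\<bar>})"
      using k by (intro image_eqI[of _ _ "(a mod \<bar>k\<bar>, b mod \<bar>k\<bar>)"]) auto
  qed
  hence fin: "finite K" by (rule finite_subset) simp
  have mem: "of_int a + of_int b * x \<in> K" for a b by (auto simp: K_def)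
  have mul: "u * v \<in> K" if "u \<in> K" "v \<in> K" for u v
  proof -
    obtain a b c d where e: "u = of_int a + of_int b * x" "v = of_int c + of_int d * x" using \<open>u \<in> K\<close> \<open>v \<in> K\<close> by (auto simp: K_def)
    have "u * v = of_int (a * c - b * d) + of_int (a * d + b * c) * x"
      unfolding e by (simp add: algebra_simps intc quat)
    thus ?thesis by (simp only: mem)
  qed
  have add: "u + v \<in> K" if "u \<in> K" "v \<in> K" for u v
  proof -
    obtain a b c d where e: "u = of_int a + of_int b * x" "v = of_int c + of_int d * x" using \<open>u \<in> K\<close> \<open>v \<in> K\<close> by (auto simp: K_def)
    have "u + v = of_int (a + c) + of_int (b + d) * x" unfolding e by (simp add: algebra_simps)
    thus ?thesis by (simp only: mem)
  qed
  have K1: "1 \<in> K" "0 \<in> K" "x \<in> K" "-1 \<in> K" using mem[of 1 0] mem[of 0 0] mem[of 0 1] mem[of "-1" 0] by simp_all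
  have neg: "- u \<in> K" if "u \<in> K" for u using mul[OF K1(4) that] by simp
  have inv: "inverse u \<in> K" if "u \<in> K" for u
    using inverse_in_finite[OF fin K1(1) mul that] K1(2) by (cases "u = 0") auto
  have dK: "div_subring K" unfolding div_subring_def is_subring_def by (simp add: K1 add mul neg inv)
  have Kc: "K \<subseteq> centralizer K"
  proof -
    have "K \<subseteq> centralizer {x}" by (auto simp: K_def centralizer_def algebra_simps intc)
    hence "x \<in> centralizer K" by (auto simp: centralizer_def)
    moreover have "of_int a \<in> centralizer K" for a by (simp add: centralizer_def mult_of_int_commute)
    ultimately have "of_int a + of_int b * x \<in> centralizer K" for a b
      by (simp add: div_subringD(3,4)[OF div_subring_centralizer])
    thus ?thesis by (auto simp: K_def)
  qed
  have cy: "conjg y (of_int a + of_int b * x) = of_int a + of_int (- b) * x" for a b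
    using y0 by (simp add: conjg_add conjg_mult conjg_int cjx)
  have yK: "conjg y ` K = K"
  proof
    show "conjg y ` K \<subseteq> K"
    proof
      fix w assume "w \<in> conjg y ` K"
      then obtain a b where "w = conjg y (of_int a + of_int b * x)" by (auto simp: K_def)
      thus "w \<in> K" by (simp only: cy mem)
    qed
    show "K \<subseteq> conjg y ` K"
    proof
      fix w assume "w \<in> K"
      then obtain a b where "w = of_int a + of_int b * x" by (auto simp: K_def)
      hence "w = conjg y (of_int a + of_int (- b) * x)" using cy[of a "-b"] by simp
      thus "w \<in> conjg y ` K" using mem by blast
    qed
  qed
  have "y ^ 2 = -1" by (simp add: power2_eq_square yy)
  hence y2: "y ^ 2 \<in> K" using K1 by simp
  have "y \<notin> centralizer K" using nc K1(3) centralizerD[of y K x] by auto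
  then interpret cyclic_layer K y 2 using dK Kc y0 yK y2 by unfold_locales auto
  show False using finite_impossible[OF fin y2] .
qed

text \<open>Conjugation by \<open>x\<close> or \<open>y\<close> changes the signs of two
  coordinates, and adding conjugates isolates \<open>4 * a\<close>. Right multiplication by
  \<open>x\<close> and \<open>y\<close> moves the other coordinates into the first place.\<close>

lemma coords_unique:
  assumes "of_int a + of_int b * x + of_int c * y + of_int d * (x * y) = 0"
  shows "a = 0" "b = 0" "c = 0" "d = 0"
proof -
  let ?w = "\<lambda>a b c d. of_int a + of_int b * x + of_int c * y + of_int d * (x * y)"
  have cx: "conjg x (?w a b c d) = ?w a b (-c) (-d)" for a b c d
    using x0 by (simp add: conjg_add conjg_mult conjg_int cjx conjg_fix_iff[of x x, THEN iffD2])
  have cy: "conjg y (?w a b c d) = ?w a (-b) c (-d)" for a b c d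
    using y0 by (simp add: conjg_add conjg_mult conjg_int cjx conjg_fix_iff[of y y, THEN iffD2])
  have ab1: "P + P + (Q + Q) = P + Q + R + S + (P + Q + - R + - S)" for P Q R S :: 'a by (simp add: add_ac)
  have ab2: "P + P + (P + P) = P + P + (Q + Q) + (P + P + - (Q + Q))" for P Q :: 'a by (simp add: add_ac)
  have *: "a = 0" if "?w a b c d = 0" for a b c d
  proof -
    have 1: "?w a b (-c) (-d) = 0" using cx[of a b c d] that by (simp add: conjg_0)
    have "?w (a+a) (b+b) 0 0 = ?w a b c d + ?w a b (-c) (-d)"
      by (simp only: of_int_add of_int_0 mult_zero_left distrib_right of_int_minus mult_minus_left add_0_right ab1)
    also have "\<dots> = 0" by (simp only: 1 that add_0_left)
    finally have 2: "?w (a+a) (b+b) 0 0 = 0" .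
    have 3: "?w (a+a) (-(b+b)) 0 0 = 0" using cy[of "a+a" "b+b" 0 0] unfolding 2 by (simp only: conjg_0 minus_zero)
    have "(of_int (a+a+(a+a)) :: 'a) = ?w (a+a) (b+b) 0 0 + ?w (a+a) (-(b+b)) 0 0"
      by (simp only: of_int_add of_int_0 mult_zero_left distrib_right of_int_minus mult_minus_left add_0_right ab2)
    hence "of_int (a+a+(a+a)) = (0::'a)" by (simp only: 2 3 add_0_left)
    thus ?thesis using char0[of "a+a+(a+a)"] by auto
  qed
  show "a = 0" using *[OF assms] .
  have "?w a b c d * x = ?w (-b) a d (-c)" by (simp add: algebra_simps quat intc mult.assoc)
  hence "?w (-b) a d (-c) = 0" using assms by simp
  thus "b = 0" using *[of "-b" a d "-c"] by simp
  have "?w a b c d * y = ?w (-c) (-d) a b" by (simp add: algebra_simps quat intc mult.assoc)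
  hence e: "?w (-c) (-d) a b = 0" using assms by simp
  thus "c = 0" using *[of "-c" "-d" a b] by simp
  have "?w (-c) (-d) a b * x = ?w d (-c) b (-a)" by (simp add: algebra_simps quat intc mult.assoc)
  hence "?w d (-c) b (-a) = 0" using e by simp
  thus "d = 0" using *[of d "-c" b "-a"] by simp
qed

text \<open>Every \<open>h\<close> commutes with \<open>x\<close> and with \<open>y\<close> up to
  sign, so one of \<open>h\<close>, \<open>h * x\<close>, \<open>h * y\<close>,
  \<open>h * (x * y)\<close> commutes with both. Such an element is central: otherwise a central
  multiple \<open>v\<close> of it has square -1, so \<open>v * x\<close> has square 1 and
  \<open>v\<close> is \<open>x\<close> or \<open>- x\<close>, which does not commute with
  \<open>y\<close>.\<close>

lemma H_form:
  assumes h: "h \<in> H"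
  shows "\<exists>l\<in>F. h = l \<or> h = l * x \<or> h = l * y \<or> h = l * (x * y)"
proof -
  have comm: "w \<in> F" if w: "w \<in> H" "w * x = x * w" "w * y = y * w" for w
  proof (rule ccontr)
    assume "w \<notin> F"
    then obtain z where z: "z \<in> M \<inter> F" "z * w \<in> H" "z * w \<notin> F" "(z * w) * (z * w) = -1"
      using quaternion_group(1)[OF w(1)] by blast
    let ?v = "z * w"
    have zc: "z * t = t * z" for t using z Fc by auto
    have vx: "?v * x = x * ?v" using w(2) zc[of x] by (simp add: mult.assoc) (simp add: mult.assoc[symmetric])
    have vy: "?v * y = y * ?v" using w(3) zc[of y] by (simp add: mult.assoc) (simp add: mult.assoc[symmetric])
    have "(?v * x) * (?v * x) = (?v * ?v) * (x * x)" using vx by (metis mult.assoc)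
    hence "(?v * x) * (?v * x) = 1" using z(4) xx by simp
    hence "?v * x = 1 \<or> ?v * x = -1" by (rule sqrt_1)
    hence "?v * x * x = x \<or> ?v * x * x = - x" by auto
    hence "?v = x \<or> ?v = - x" using xx by (auto simp: mult.assoc)
    thus False using vy nc by auto
  qed
  have mem: "x * y \<in> H" using mult_groupD(4)[OF H(1) xH yH] .
  have hx: "h * x = x * h \<or> h * x = - (x * h)" using commutator_sign[OF xH h] .
  have hy: "h * y = y * h \<or> h * y = - (y * h)" using commutator_sign[OF yH h] .
  consider "h * x = x * h" "h * y = y * h" | "h * x = x * h" "h * y = - (y * h)" | "h * x = - (x * h)" "h * y = y * h"
     | "h * x = - (x * h)" "h * y = - (y * h)" using hx hy by blast
  thus ?thesis
  proof cases
    case 1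
    thus ?thesis using comm[OF h] by blast
  next
    case 2
    have "h * x \<in> F"
    proof (rule comm)
      show "h * x \<in> H" using mult_groupD(4)[OF H(1) h xH] .
      show "h * x * x = x * (h * x)" using 2(1) by (metis mult.assoc)
      have "h * x * y = - (h * y * x)" using xy by (simp add: mult.assoc)
      thus "h * x * y = y * (h * x)" using 2(2) by (simp add: mult.assoc)
    qed
    moreover have "h = - (h * x) * x" using xx by (simp add: mult.assoc)
    ultimately show ?thesis using div_subringD(5)[OF F] by metis
  next
    case 3
    have "h * y \<in> F"
    proof (rule comm)
      show "h * y \<in> H" using mult_groupD(4)[OF H(1) h yH] .
      show "h * y * y = y * (h * y)" using 3(2) by (metis mult.assoc)
      have "h * y * x = - (h * x * y)" using xy by (simp add: mult.assoc)
      thus "h * y * x = x * (h * y)" using 3(1) by (simp add: mult.assoc)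
    qed
    moreover have "h = - (h * y) * y" using yy by (simp add: mult.assoc)
    ultimately show ?thesis using div_subringD(5)[OF F] by metis
  next
    case 4
    have "h * (x * y) \<in> F"
    proof (rule comm)
      show "h * (x * y) \<in> H" using mult_groupD(4)[OF H(1) h mem] .
      have "h * (x * y) * x = - (h * x) * (x * y)" by (simp add: quat mult.assoc)
      thus "h * (x * y) * x = x * (h * (x * y))" using 4(1) by (simp add: mult.assoc)
      have "h * (x * y) * y = - (h * y) * (x * y)" by (simp add: quat mult.assoc)
      thus "h * (x * y) * y = y * (h * (x * y))" using 4(2) by (simp add: mult.assoc)
    qed
    moreover have "h = - (h * (x * y)) * (x * y)" by (simp add: quat mult.assoc)
    ultimately show ?thesis using div_subringD(5)[OF F] by metis
  qed
qed

text \<open>By \<open>H_form\<close> the conjugate is central or \<open>l * t\<close> with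
  \<open>t\<close> one of \<open>x\<close>, \<open>y\<close>, \<open>x * y\<close>. It is not
  central, and as both squares are -1, \<open>l * l = 1\<close>.\<close>

lemma conj_unit:
  assumes m: "m \<in> M" and q: "q \<in> H" "q * q = -1" "q \<notin> F"
  shows "conjg m q \<in> {x, y, x * y, - x, - y, - (x * y)}"
proof -
  have m0: "m \<noteq> 0" using mult_groupD(3)[OF M m] .
  have h: "conjg m q \<in> H" using normalizesD[OF H(3) m q(1)] .
  have sq: "conjg m q * conjg m q = -1" using m0 q(2) by (simp add: conjg_mult[symmetric] conjg_minus conjg_1)
  have nF: "conjg m q \<notin> F"
  proof
    assume "conjg m q \<in> F"
    hence "conjg (inverse m) (conjg m q) = conjg m q" using m0 by (intro cjF) auto
    thus False using \<open>conjg m q \<in> F\<close> q(3) m0 by (simp add: conjg_inv_cancel)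
  qed
  obtain l where l: "l \<in> F" "conjg m q = l \<or> conjg m q = l * x \<or> conjg m q = l * y \<or> conjg m q = l * (x * y)"
    using H_form[OF h] by blast
  have key: "l = 1 \<or> l = -1" if e: "conjg m q = l * t" "t * t = -1" for t
  proof -
    have "l * t * (l * t) = (l * l) * (t * t)" using Fc[OF l(1), of t] by (metis mult.assoc)
    hence "l * l = 1" using sq e by simp
    thus ?thesis by (rule sqrt_1)
  qed
  have "(x * y) * (x * y) = -1" by (simp add: quat mult.assoc)
  thus ?thesis using l nF key[of x] key[of y] key[of "x * y"] xx yy by auto
qed

section \<open>The localized quaternion order and its stabilizer\<close>

text \<open>The span of \<open>1\<close>, \<open>x\<close>, \<open>y\<close> and
  \<open>x * y\<close> over the integers localized at \<open>q\<close>; the factor \<open>s\<close>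
  clears the denominators, which are prime to \<open>q\<close>.\<close>

definition int_lattice :: "int \<Rightarrow> 'a set" where
  "int_lattice q = {w. \<exists>s a b c d. \<not> q dvd s \<and> of_int s * w = of_int a + of_int b * x + of_int c * y + of_int d * (x * y)}"

lemma int_latticeI: "\<not> q dvd s \<Longrightarrow> of_int s * w = of_int a + of_int b * x + of_int c * y + of_int d * (x * y) \<Longrightarrow> w \<in> int_lattice q"
  unfolding int_lattice_def by blast

lemma int_lattice_add: assumes "prime q" "w \<in> int_lattice q" "v \<in> int_lattice q" shows "w + v \<in> int_lattice q"
proof -
  obtain s a b c d where w: "\<not> q dvd s" "of_int s * w = of_int a + of_int b * x + of_int c * y + of_int d * (x * y)"
    using assms(2) unfolding int_lattice_def by blast
  obtain t a' b' c' d' where v: "\<not> q dvd t" "of_int t * v = of_int a' + of_int b' * x + of_int c' * y + of_int d' * (x * y)"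
    using assms(3) unfolding int_lattice_def by blast
  have "\<not> q dvd s * t" using w(1) v(1) assms(1) by (simp add: prime_dvd_mult_iff)
  moreover have "of_int (s * t) * (w + v) = of_int t * (of_int s * w) + of_int s * (of_int t * v)"
    by (simp only: of_int_mult distrib_left int_swap mult.assoc)
  hence "of_int (s * t) * (w + v) = of_int (t * a + s * a') + of_int (t * b + s * b') * x + of_int (t * c + s * c') * y
      + of_int (t * d + s * d') * (x * y)"
    unfolding w(2) v(2) by (simp only: of_int_add of_int_mult distrib_left distrib_right mult.assoc add_ac)
  ultimately show ?thesis by (rule int_latticeI)
qed

lemma int_lattice_div: assumes "prime q" "\<not> q dvd t" "of_int t * w \<in> int_lattice q" shows "w \<in> int_lattice q"
proof -
  obtain s a b c d where w: "\<not> q dvd s" "of_int s * (of_int t * w) = of_int a + of_int b * x + of_int c * y + of_int d * (x * y)"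
    using assms(3) unfolding int_lattice_def by blast
  have "\<not> q dvd s * t" using w(1) assms(1,2) by (simp add: prime_dvd_mult_iff)
  thus ?thesis using w(2) by (intro int_latticeI[of q "s * t" w a b c d]) (simp_all add: mult.assoc)
qed

lemma int_lattice_int: assumes "w \<in> int_lattice q" shows "of_int k * w \<in> int_lattice q"
proof -
  obtain s a b c d where w: "\<not> q dvd s" "of_int s * w = of_int a + of_int b * x + of_int c * y + of_int d * (x * y)"
    using assms unfolding int_lattice_def by blast
  have "of_int s * (of_int k * w) = of_int k * (of_int s * w)" by (rule int_swap)
  hence "of_int s * (of_int k * w) = of_int (k * a) + of_int (k * b) * x + of_int (k * c) * y + of_int (k * d) * (x * y)"
    unfolding w(2) by (simp only: of_int_mult distrib_left mult.assoc add_ac)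
  thus ?thesis by (rule int_latticeI[OF w(1)])
qed

lemma int_lattice_x: assumes "w \<in> int_lattice q" shows "w * x \<in> int_lattice q"
proof -
  obtain s a b c d where w: "\<not> q dvd s" "of_int s * w = of_int a + of_int b * x + of_int c * y + of_int d * (x * y)"
    using assms unfolding int_lattice_def by blast
  have "of_int s * (w * x) = (of_int s * w) * x" by (simp add: mult.assoc)
  hence "of_int s * (w * x) = of_int (-b) + of_int a * x + of_int d * y + of_int (-c) * (x * y)"
    unfolding w(2) by (simp add: algebra_simps quat intc mult.assoc)
  thus ?thesis by (rule int_latticeI[OF w(1)])
qed

lemma int_lattice_y: assumes "w \<in> int_lattice q" shows "w * y \<in> int_lattice q"
proof -
  obtain s a b c d where w: "\<not> q dvd s" "of_int s * w = of_int a + of_int b * x + of_int c * y + of_int d * (x * y)"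
    using assms unfolding int_lattice_def by blast
  have "of_int s * (w * y) = (of_int s * w) * y" by (simp add: mult.assoc)
  hence "of_int s * (w * y) = of_int (-c) + of_int (-d) * x + of_int a * y + of_int b * (x * y)"
    unfolding w(2) by (simp add: algebra_simps quat intc mult.assoc)
  thus ?thesis by (rule int_latticeI[OF w(1)])
qed

lemma int_lattice_mult: assumes "prime q" "w \<in> int_lattice q" "v \<in> int_lattice q" shows "w * v \<in> int_lattice q"
proof -
  obtain s a b c d where v: "\<not> q dvd s" "of_int s * v = of_int a + of_int b * x + of_int c * y + of_int d * (x * y)"
    using assms(3) unfolding int_lattice_def by blast
  have "of_int s * (w * v) = w * (of_int s * v)" by (rule int_left[symmetric])
  also have "\<dots> = of_int a * w + of_int b * (w * x) + of_int c * (w * y) + of_int d * (w * x * y)"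
    unfolding v(2) by (simp only: distrib_left int_left mult.assoc mult_of_int_commute)
  also have "\<dots> \<in> int_lattice q" using assms by (intro int_lattice_add int_lattice_int int_lattice_x int_lattice_y)
  finally show ?thesis by (rule int_lattice_div[OF assms(1) v(1)])
qed

lemma int_lattice_units: assumes "prime q" shows "1 \<in> int_lattice q" "{x, y, x * y, - x, - y, - (x * y)} \<subseteq> int_lattice q"
proof -
  have q1: "\<not> q dvd 1" using assms not_prime_unit by blast
  show "1 \<in> int_lattice q" using int_latticeI[OF q1, of 1 1 0 0 0] by simp
  show "{x, y, x * y, - x, - y, - (x * y)} \<subseteq> int_lattice q"
    using int_latticeI[OF q1, of x 0 1 0 0] int_latticeI[OF q1, of y 0 0 1 0] int_latticeI[OF q1, of "x*y" 0 0 0 1]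
      int_latticeI[OF q1, of "-x" 0 "-1" 0 0] int_latticeI[OF q1, of "-y" 0 0 "-1" 0] int_latticeI[OF q1, of "-(x*y)" 0 0 0 "-1"] by simp
qed

lemma xF: "x \<notin> F" and yF: "y \<notin> F" using Fc[of x y] Fc[of y x] nc by auto

lemma int_lattice_M: assumes q: "prime q" and m: "m \<in> M" and w: "w \<in> int_lattice q" shows "conjg m w \<in> int_lattice q"
proof -
  have m0: "m \<noteq> 0" using mult_groupD(3)[OF M m] .
  obtain s a b c d where v: "\<not> q dvd s" "of_int s * w = of_int a + of_int b * x + of_int c * y + of_int d * (x * y)"
    using w unfolding int_lattice_def by blast
  have X: "conjg m x \<in> int_lattice q" using conj_unit[OF m xH xx xF] int_lattice_units(2)[OF q] by blast
  have Y: "conjg m y \<in> int_lattice q" using conj_unit[OF m yH yy yF] int_lattice_units(2)[OF q] by blast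
  have "of_int s * conjg m w = conjg m (of_int s * w)" using m0 by (simp add: conjg_mult conjg_int)
  also have "\<dots> = of_int a * 1 + of_int b * conjg m x + of_int c * conjg m y + of_int d * (conjg m x * conjg m y)"
    unfolding v(2) using m0 by (simp add: conjg_add conjg_mult conjg_int)
  also have "\<dots> \<in> int_lattice q" using X Y int_lattice_units(1)[OF q] q by (intro int_lattice_add int_lattice_int int_lattice_mult)
  finally show ?thesis by (rule int_lattice_div[OF q v(1)])
qed

text \<open>The condition on \<open>inverse g\<close> makes this a group: conjugation alone might
  map the lattice properly into itself.\<close>

definition lattice_stabilizer where "lattice_stabilizer q = {g. g \<noteq> 0 \<and> (\<forall>w\<in>int_lattice q. conjg g w \<in> int_lattice q \<and> conjg (inverse g) w \<in> int_lattice q)}"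

lemma mult_group_lattice_stabilizer: "mult_group (lattice_stabilizer q)"
  unfolding mult_group_def lattice_stabilizer_def
  by (auto simp: conjg_one nonzero_inverse_mult_distrib conjg_conjg[symmetric])

lemma M_lattice_stabilizer: "prime q \<Longrightarrow> M \<subseteq> lattice_stabilizer q"
  using int_lattice_M mult_groupD(3)[OF M] mult_groupD(5)[OF M] by (auto simp: lattice_stabilizer_def)

lemma xU: "x \<in> U" using xH H MG by blast

lemma y_mult: "(of_int a - of_int b * y) * (of_int c - of_int d * y) = of_int (a * c - b * d) - of_int (a * d + b * c) * y"
proof -
  have expand: "(p - q) * (r - s) = p * r - p * s - (q * r - q * s)" for p q r s :: 'a by (simp add: algebra_simps)
  have e1: "of_int a * (of_int d * y) = of_int (a * d) * y" by (simp add: mult.assoc)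
  have e2: "of_int b * y * of_int c = of_int (b * c) * y" by (simp add: mult.assoc intc)
  have e3: "of_int b * y * (of_int d * y) = - of_int (b * d)" by (simp add: mult.assoc intc yy)
  have "(of_int a - of_int b * y) * (of_int c - of_int d * y) = of_int a * of_int c - of_int a * (of_int d * y) - (of_int b * y * of_int c - of_int b * y * (of_int d * y))"
    by (rule expand)
  also have "\<dots> = of_int (a * c) - of_int (a * d) * y - (of_int (b * c) * y - - of_int (b * d))"
    unfolding e1 e2 e3 by simp
  also have "\<dots> = of_int (a * c - b * d) - of_int (a * d + b * c) * y"
    by (simp only: of_int_diff of_int_add distrib_right) (simp only: diff_conv_add_uminus minus_add_distrib minus_minus add_ac)
  finally show ?thesis .
qed

text \<open>Pythagorean triples \<open>c\<^sup>2 + d\<^sup>2 = r\<^sup>2\<close> give elements inverted by \<open>x\<close>, whose high powers lie in \<open>U\<close>.\<close>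

lemma pythagorean:
  assumes r: "c * c + d * d = r * r" "r \<noteq> 0"
  defines "w \<equiv> inverse (of_int r) * (of_int c - of_int d * y)"
  shows "conjg x w = inverse w" "w \<noteq> 0"
proof -
  let ?r = "of_int r :: 'a"
  have r0: "?r \<noteq> 0" using char0 r by blast
  have rc: "inverse ?r * z = z * inverse ?r" for z
    using inverse_comm[of ?r z] by (simp add: mult_of_int_commute)
  have cw: "conjg x w = inverse ?r * (of_int c + of_int d * y)"
    using x0 by (simp add: w_def conjg_mult conjg_inverse conjg_diff conjg_int cjx)
  have "(of_int c - of_int d * y) * (of_int c + of_int d * y) = of_int (c * c + d * d)"
    using y_mult[of c d c "-d"] by simp
  hence e: "(of_int c - of_int d * y) * (of_int c + of_int d * y) = ?r * ?r" unfolding r(1) by simp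
  have "w * conjg x w = inverse ?r * ((of_int c - of_int d * y) * inverse ?r) * (of_int c + of_int d * y)"
    by (subst cw) (simp only: w_def mult.assoc)
  also have "\<dots> = inverse ?r * inverse ?r * (?r * ?r)"
    unfolding rc[of "of_int c - of_int d * y", symmetric] e[symmetric] by (simp only: mult.assoc)
  also have "\<dots> = 1" using r0 by (simp add: mult.assoc) (simp add: mult.assoc[symmetric])
  finally have 1: "w * conjg x w = 1" .
  thus "w \<noteq> 0" by auto
  show "conjg x w = inverse w" using inverse_unique[OF 1] by simp
qed

text \<open>When \<open>x\<close> inverts \<open>v\<close>, the commutator of \<open>x\<close> with
  \<open>inverse v\<close> is \<open>v * v\<close>. Each squaring therefore descends one level of
  the chain.\<close>

lemma square_chain:
  assumes w: "w \<noteq> 0" "conjg x w = inverse w" shows "w ^ (2 ^ n) \<in> U"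
proof -
  have "j \<le> n \<Longrightarrow> w ^ (2 ^ j) \<in> N (n - j)" for j
  proof (induction j)
    case 0 thus ?case using subnormal_chainD(1)[OF N] w by simp
  next
    case (Suc j)
    define v where "v = w ^ (2 ^ j)"
    have v: "v \<in> N (Suc (n - Suc j))" using Suc by (simp add: v_def Suc_diff_Suc)
    have v0: "v \<noteq> 0" using w by (simp add: v_def)
    have m: "mult_group (N (n - Suc j))" and m': "mult_group (N (Suc (n - Suc j)))" using subnormal_chainD(2)[OF N] Suc by auto
    have xv: "conjg x v = inverse v" using x0 w by (simp add: v_def conjg_power power_inverse)
    have "conjg (inverse v) (inverse x) \<in> N (n - Suc j)"
      using subnormal_chain_step[OF N _ mult_groupD(5)[OF m' v], of "inverse x"] mult_groupD(5)[OF G xU] Suc by simp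
    moreover have "x \<in> N (n - Suc j)" using subnormal_chain_mono[OF N, of 0 "n - Suc j"] xU by auto
    ultimately have "x * conjg (inverse v) (inverse x) \<in> N (n - Suc j)" using mult_groupD(4)[OF m] by blast
    moreover have "x * conjg (inverse v) (inverse x) = conjg x (inverse v) * v" using v0 by (simp add: conjg_def mult.assoc)
    moreover have "conjg x (inverse v) = v" using xv x0 by (simp add: conjg_inverse)
    moreover have "v * v = w ^ (2 ^ Suc j)" by (simp add: v_def power_add[symmetric] mult_2)
    ultimately show ?case by simp
  qed
  from this[of n] show ?thesis by simp
qed

lemma conj_by_power:
  assumes w: "w \<noteq> 0" "conjg x w = inverse w" shows "conjg (w ^ k) x = w ^ (2 * k) * x"
proof -
  have "conjg x (inverse (w ^ k)) = w ^ k" using x0 w by (simp add: conjg_inverse conjg_power power_inverse)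
  hence "x * inverse (w ^ k) = w ^ k * x" using x0 by (simp add: conjg_eq_iff)
  thus ?thesis by (simp add: conjg_def mult.assoc mult_2 power_add)
qed

lemma power_scaled:
  fixes z :: 'a
  shows "(inverse (of_int r) * z) ^ k = inverse (of_int r ^ k) * z ^ k"
proof -
  have "inverse (of_int r) * z = z * inverse (of_int r)"
    using inverse_comm[of "of_int r" z] by (simp add: mult_of_int_commute)
  from commuting_power_mult[OF this] show ?thesis by (simp only: power_inverse)
qed

text \<open>\<open>3 - 4 * y\<close> is idempotent modulo 5, so all its powers keep the same
  residues and the denominators 5 never cancel.\<close>

lemma pow_345: "\<exists>a b. (of_int 3 - of_int 4 * y) ^ Suc k = of_int a - of_int b * y \<and> a mod 5 = 3 \<and> b mod 5 = 4"
proof (induction k)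
  case 0 show ?case by (intro exI[of _ 3] exI[of _ 4]) simp
next
  case (Suc k)
  then obtain a b where ab: "(of_int 3 - of_int 4 * y) ^ Suc k = of_int a - of_int b * y" "a mod 5 = 3" "b mod 5 = 4" by blast
  have "(of_int 3 - of_int 4 * y) ^ Suc (Suc k) = (of_int 3 - of_int 4 * y) * (of_int a - of_int b * y)"
    unfolding ab(1)[symmetric] by simp
  also have "\<dots> = of_int (3 * a - 4 * b) - of_int (3 * b + 4 * a) * y"
    by (rule y_mult)
  finally have "(of_int 3 - of_int 4 * y) ^ Suc (Suc k) = of_int (3 * a - 4 * b) - of_int (3 * b + 4 * a) * y" .
  moreover define m l where "m = a div 5" and "l = b div 5"
  have "a = 5 * m + 3" "b = 5 * l + 4" using ab(2,3) mult_div_mod_eq[of 5 a] mult_div_mod_eq[of 5 b] by (simp_all only: m_def l_def)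
  hence "3 * a - 4 * b = 3 + 5 * (3 * m - 4 * l - 2)" "3 * b + 4 * a = 4 + 5 * (3 * l + 4 * m + 4)" by simp_all
  hence "(3 * a - 4 * b) mod 5 = 3" "(3 * b + 4 * a) mod 5 = 4" by (simp_all only: mod_mult_self2) simp_all
  ultimately show ?case by blast
qed

text \<open>Modulo 13 every power is a multiple of \<open>1 - 5 * y\<close>, because 25 is -1 and 12
  is 25. Each step multiplies \<open>a\<close> by 10 modulo 13, so it stays prime to 13.\<close>

lemma pow_51213: "\<exists>a b. (of_int 5 - of_int 12 * y) ^ Suc k = of_int a - of_int b * y \<and> \<not> 13 dvd a \<and> 13 dvd (b - 5 * a)"
proof (induction k)
  case 0 show ?case by (intro exI[of _ 5] exI[of _ 12]) simp
next
  case (Suc k)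
  then obtain a b where ab: "(of_int 5 - of_int 12 * y) ^ Suc k = of_int a - of_int b * y" "\<not> 13 dvd a" "13 dvd (b - 5 * a)" by blast
  have "(of_int 5 - of_int 12 * y) ^ Suc (Suc k) = (of_int 5 - of_int 12 * y) * (of_int a - of_int b * y)"
    unfolding ab(1)[symmetric] by simp
  also have "\<dots> = of_int (5 * a - 12 * b) - of_int (5 * b + 12 * a) * y"
    by (rule y_mult)
  finally have "(of_int 5 - of_int 12 * y) ^ Suc (Suc k) = of_int (5 * a - 12 * b) - of_int (5 * b + 12 * a) * y" .
  moreover have "\<not> 13 dvd (5 * a - 12 * b)"
  proof
    assume "13 dvd (5 * a - 12 * b)"
    then obtain t where t: "5 * a - 12 * b = 13 * t" by (rule dvdE)
    obtain m where m: "b - 5 * a = 13 * m" using ab(3) by (rule dvdE)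
    \<comment> \<open>From \<open>-55 * a = 13 * (t + 12 * m)\<close> and
      \<open>9 * 55 = 1 + 38 * 13\<close>.\<close>
    have "a = 13 * (- 9 * t - 108 * m - 38 * a)" using t m by (simp add: algebra_simps)
    thus False using ab(2) by (metis dvd_triv_left)
  qed
  moreover have "(5 * b + 12 * a) - 5 * (5 * a - 12 * b) = 13 * (5 * b - a)" by simp
  hence "13 dvd ((5 * b + 12 * a) - 5 * (5 * a - 12 * b))" by simp
  ultimately show ?case by blast
qed

text \<open>The stabilizer of the lattice at 5 contains \<open>M\<close> but not the chosen power of
  \<open>u\<close>, so by maximality it meets \<open>U\<close> exactly in \<open>M\<close>. The
  power of \<open>v\<close> stabilizes the lattice and lies in \<open>U\<close>, hence in
  \<open>M\<close>; but it sends \<open>x\<close> to an element whose denominator 13 does not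
  cancel.\<close>

lemma contradiction: False
proof -
  have rearr: "P + (Q - R) + S + (T - V) = 0" if "P + Q + S + T = R + V" for P Q R S T V :: 'a
  proof -
    have "P + (Q - R) + S + (T - V) = (P + Q + S + T) - (R + V)" by (simp add: algebra_simps)
    thus ?thesis using that by simp
  qed
  have scaled: "of_int (r ^ i) * (inverse (of_int r) * z) ^ i = w" if "r \<noteq> 0" "z ^ i = w" for r i and z w :: 'a
  proof -
    have "(of_int r ^ i :: 'a) \<noteq> 0" using char0[OF that(1)] by simp
    thus ?thesis unfolding power_scaled that(2) of_int_power by (simp add: mult.assoc[symmetric])
  qed
  have ef_x: "(of_int e - of_int f * y) * x = of_int e * x + of_int f * (x * y)" for e f
    by (simp add: algebra_simps quat intc mult.assoc)
  have p5: "prime (5::int)" by simp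
  define u where "u = inverse (of_int 5) * (of_int 3 - of_int 4 * y)"
  define v where "v = inverse (of_int 13) * (of_int 5 - of_int 12 * y)"
  have u: "conjg x u = inverse u" "u \<noteq> 0" using pythagorean[of 3 4 5] by (simp_all add: u_def)
  have v: "conjg x v = inverse v" "v \<noteq> 0" using pythagorean[of 5 12 13] by (simp_all add: v_def)
  \<comment> \<open>The exponent for which \<open>n\<close> squarings bring \<open>u\<close> and
    \<open>v\<close> down to \<open>U\<close>.\<close>
  define k where "k = (2::nat) ^ n"
  have k0: "k > 0" by (simp add: k_def)
  have uU: "u ^ k \<in> U" and vU: "v ^ k \<in> U" using square_chain u v by (simp_all add: k_def)
  have "u ^ k \<notin> lattice_stabilizer 5"
  proof
    assume "u ^ k \<in> lattice_stabilizer 5"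
    hence "conjg (u ^ k) x \<in> int_lattice 5" using int_lattice_units(2)[OF p5] by (auto simp: lattice_stabilizer_def)
    hence "u ^ (2 * k) * x \<in> int_lattice 5" by (simp add: conj_by_power[OF u(2,1)])
    then obtain s a b c d where s: "\<not> 5 dvd s" "of_int s * (u ^ (2 * k) * x) = of_int a + of_int b * x + of_int c * y + of_int d * (x * y)"
      unfolding int_lattice_def by blast
    obtain j where j: "2 * k = Suc j" using k0 by (cases "2 * k") auto
    obtain e f where ef: "(of_int 3 - of_int 4 * y) ^ (2 * k) = of_int e - of_int f * y" "e mod 5 = 3"
      using pow_345[of j] unfolding j by blast
    have r: "of_int (5 ^ (2 * k)) * u ^ (2 * k) = of_int e - of_int f * y"
      unfolding u_def by (rule scaled[OF _ ef(1)]) simp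
    have "of_int (5 ^ (2 * k)) * (of_int s * (u ^ (2 * k) * x)) = of_int s * ((of_int (5 ^ (2 * k)) * u ^ (2 * k)) * x)"
      by (simp only: mult.assoc) (rule int_swap)
    also have "\<dots> = of_int 0 + of_int (s * e) * x + of_int 0 * y + of_int (s * f) * (x * y)"
      unfolding r ef_x by (simp only: distrib_left of_int_mult mult.assoc of_int_0 mult_zero_left add_0_left add_0_right)
    finally have eq: "of_int (5 ^ (2 * k)) * (of_int a + of_int b * x + of_int c * y + of_int d * (x * y))
       = of_int 0 + of_int (s * e) * x + of_int 0 * y + of_int (s * f) * (x * y)" unfolding s(2) .
    let ?t = "5 ^ (2 * k) :: int"
    have "of_int ?t * of_int a + of_int ?t * (of_int b * x) + of_int ?t * (of_int c * y) + of_int ?t * (of_int d * (x * y))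
       = of_int (s * e) * x + of_int (s * f) * (x * y)"
      using eq by (simp only: distrib_left of_int_0 mult_zero_left add_0_left add_0_right)
    hence "of_int (?t * a) + of_int (?t * b - s * e) * x + of_int (?t * c) * y + of_int (?t * d - s * f) * (x * y) = 0"
      unfolding of_int_mult[of ?t] of_int_diff left_diff_distrib mult.assoc[of "of_int ?t"] by (rule rearr)
    hence "?t * b - s * e = 0" by (rule coords_unique(2))
    moreover have "5 dvd ?t" using k0 by simp
    ultimately have "5 dvd s * e" by (metis diff_eq_eq add_0 dvd_mult2)
    hence "5 dvd e" using s(1) p5 by (simp add: prime_dvd_mult_iff)
    thus False using ef(2) by presburger
  qed
  hence "U \<inter> lattice_stabilizer 5 \<noteq> U" using uU by blast
  moreover have "U \<inter> lattice_stabilizer 5 = M \<or> U \<inter> lattice_stabilizer 5 = U"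
    using maximal[OF mult_group_Int[OF G mult_group_lattice_stabilizer]] M_lattice_stabilizer[OF p5] MG by blast
  ultimately have stabM: "U \<inter> lattice_stabilizer 5 = M" by blast
  obtain j where j: "k = Suc j" using k0 by (cases k) auto
  obtain a b where ab: "(of_int 5 - of_int 12 * y) ^ k = of_int a - of_int b * y" using pow_51213[of j] unfolding j by blast
  have n5: "\<not> 5 dvd (13 ^ k :: int)"
  proof
    assume "5 dvd (13 ^ k :: int)"
    hence "5 dvd (13::int)" using p5 prime_dvd_power by blast
    thus False by simp
  qed
  have "of_int (13 ^ k) * v ^ k = of_int a - of_int b * y"
    unfolding v_def by (rule scaled[OF _ ab]) simp
  hence vk: "of_int (13 ^ k) * v ^ k = of_int a + of_int 0 * x + of_int (- b) * y + of_int 0 * (x * y)" by simp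
  hence vl: "v ^ k \<in> int_lattice 5" by (rule int_latticeI[OF n5])
  have iv: "conjg x (v ^ k) = inverse (v ^ k)" using x0 v by (simp add: conjg_power power_inverse)
  have "of_int (13 ^ k) * conjg x (v ^ k) = conjg x (of_int (13 ^ k) * v ^ k)" by (simp add: conjg_mult[OF x0] conjg_int[OF x0] del: of_int_power)
  also have "\<dots> = of_int a + of_int 0 * x + of_int b * y + of_int 0 * (x * y)"
    unfolding vk using x0 by (simp add: conjg_add conjg_diff conjg_mult conjg_int cjx conjg_minus)
  finally have il: "inverse (v ^ k) \<in> int_lattice 5" unfolding iv by (rule int_latticeI[OF n5])
  have "v ^ k \<in> lattice_stabilizer 5" unfolding lattice_stabilizer_def conjg_def
    using v(2) vl il int_lattice_mult[OF p5] by simp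
  hence "v ^ k \<in> M" using vU stabM by blast
  hence "conjg (v ^ k) x \<in> {x, y, x * y, - x, - y, - (x * y)}" using conj_unit xH xx xF by blast
  hence mem: "v ^ (2 * k) * x \<in> {x, y, x * y, - x, - y, - (x * y)}" by (simp add: conj_by_power[OF v(2,1)])
  obtain j where j: "2 * k = Suc j" using k0 by (cases "2 * k") auto
  obtain e f where ef: "(of_int 5 - of_int 12 * y) ^ (2 * k) = of_int e - of_int f * y" "\<not> 13 dvd e"
    using pow_51213[of j] unfolding j by blast
  let ?t = "13 ^ (2 * k) :: int"
  have "of_int ?t * v ^ (2 * k) = of_int e - of_int f * y"
    unfolding v_def by (rule scaled[OF _ ef(1)]) simp
  hence "of_int ?t * (v ^ (2 * k) * x) = (of_int e - of_int f * y) * x" by (simp only: mult.assoc[symmetric])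
  hence r: "of_int ?t * (v ^ (2 * k) * x) = of_int e * x + of_int f * (x * y)"
    by (simp only: ef_x)
  have "\<exists>b c d. v ^ (2 * k) * x = of_int 0 + of_int b * x + of_int c * y + of_int d * (x * y)"
    using mem
    by (elim insertE emptyE)
      (rule exI[of _ 1], rule exI[of _ 0], rule exI[of _ 0], simp,
       rule exI[of _ 0], rule exI[of _ 1], rule exI[of _ 0], simp,
       rule exI[of _ 0], rule exI[of _ 0], rule exI[of _ 1], simp,
       rule exI[of _ "-1"], rule exI[of _ 0], rule exI[of _ 0], simp,
       rule exI[of _ 0], rule exI[of _ "-1"], rule exI[of _ 0], simp,
       rule exI[of _ 0], rule exI[of _ 0], rule exI[of _ "-1"], simp)
  then obtain b c d where bcd: "v ^ (2 * k) * x = of_int 0 + of_int b * x + of_int c * y + of_int d * (x * y)" by blast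
  have "of_int ?t * of_int 0 + of_int ?t * (of_int b * x) + of_int ?t * (of_int c * y) + of_int ?t * (of_int d * (x * y))
     = of_int e * x + of_int f * (x * y)"
    using r unfolding bcd by (simp only: distrib_left)
  hence "of_int (?t * 0) + of_int (?t * b - e) * x + of_int (?t * c) * y + of_int (?t * d - f) * (x * y) = 0"
    unfolding of_int_mult[of ?t] of_int_diff left_diff_distrib mult.assoc[of "of_int ?t"] by (rule rearr)
  hence "?t * b - e = 0" by (rule coords_unique(2))
  moreover have "13 dvd ?t" using k0 by simp
  ultimately have "13 dvd e" by (metis diff_eq_eq add_0 dvd_mult2)
  thus False using ef(2) by simp
qed

end

context class_two begin

lemma impossible: False
proof -
  obtain x y where "x \<in> H" "y \<in> H" "x * x = -1" "y * y = -1" "x * y = - (y * x)" "x * y \<noteq> y * x"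
    using exists_quaternions by blast
  then interpret quaternion_case N n M H x y by unfold_locales
  show False by (rule contradiction)
qed

end

context maximal_solvable begin

text \<open>\<open>D\<close> is the last nonabelian term of the derived series of \<open>M\<close>.
  Its own derived group is abelian and normal in \<open>M\<close>, hence central if no splitting
  exists. Multiplying \<open>D\<close> by the central elements of \<open>M\<close> gives the
  \<open>H\<close> of the class two case.\<close>

theorem splitting_exists: "\<exists>K p. splitting K p"
proof (rule ccontr)
  assume no: "\<not> ?thesis"
  have hyp: "A \<subseteq> centralizer UNIV" if "mult_group A" "A \<subseteq> M" "normalizes M A" "A \<subseteq> centralizer A" for A
    using noncentral_abelian_normal[OF that] no by blast
  obtain k where k: "(derived_grp ^^ k) M \<subseteq> {1}" using solvM by (auto simp: solvable_set_def)
  let ?ab = "\<lambda>j. (derived_grp ^^ j) M \<subseteq> centralizer ((derived_grp ^^ j) M)"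
  have ex: "?ab k" using k by (auto simp: centralizer_def)
  define j where "j = (LEAST j. ?ab j)"
  have j: "?ab j" unfolding j_def by (rule LeastI[of ?ab k]) (rule ex)
  have "j \<noteq> 0" using j nonab by (metis funpow_0)
  then obtain i where i: "j = Suc i" by (cases j) auto
  have nab: "\<not> ?ab i" using not_less_Least[of i ?ab] i by (auto simp: j_def)
  define D where "D = (derived_grp ^^ i) M"
  have D: "mult_group D" "D \<subseteq> M" "normalizes M D" using derived_series_mult_group[OF M] derived_series_sub[OF M] drM_normalizes by (auto simp: D_def)
  have "derived_grp D \<subseteq> centralizer UNIV"
    using hyp[of "derived_grp D"] j i D derived_grp_mult_group derived_grp_sub[of D] derived_grp_normalizes[OF mult_groupD(2)[OF M] D(3)] by (auto simp: D_def)
  hence commutatorD: "commutator s t \<in> centralizer UNIV" if "s \<in> D" "t \<in> D" for s t using commutator_in_derived_grp[OF that] by blast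
  define Z where "Z = M \<inter> centralizer UNIV"
  have Z: "mult_group Z" unfolding Z_def by (rule mult_group_Int_div_subring[OF M div_subring_centralizer])
  have triv: "conjg m z = z" if "m \<noteq> 0" "z \<in> centralizer UNIV" for m z using that by (auto simp: conjg_fix_iff centralizer_def)
  have nDZ: "normalizes D Z" unfolding normalizes_def
  proof (intro ballI)
    fix g s assume "g \<in> D" "s \<in> Z"
    moreover have "conjg g s = s" using triv[of g s] mult_groupD(3)[OF D(1), of g] calculation by (simp add: Z_def)
    ultimately show "conjg g s \<in> Z" by simp
  qed
  define H where "H = set_product Z D"
  have HH: "mult_group H" unfolding H_def by (rule mult_group_set_product[OF Z D(1) nDZ])
  have sub: "Z \<subseteq> H" "D \<subseteq> H" using set_product_sub[OF Z D(1)] by (auto simp: H_def)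
  have "class_two N n M H"
  proof unfold_locales
    show "mult_group H" by (rule HH)
    show "H \<subseteq> M" using D mult_groupD(4)[OF M] by (auto simp: H_def set_product_def Z_def)
    show "normalizes M H"
      unfolding normalizes_def
    proof (intro ballI)
      fix m h assume m: "m \<in> M" and h: "h \<in> H"
      obtain z d where zd: "h = z * d" "z \<in> Z" "d \<in> D" using h by (auto simp: H_def set_product_def)
      have m0: "m \<noteq> 0" using mult_groupD(3)[OF M m] .
      have "conjg m h = z * conjg m d" using zd m0 triv[of m z] by (simp add: conjg_mult Z_def)
      thus "conjg m h \<in> H" using normalizesD[OF D(3) m zd(3)] zd by (auto simp: H_def set_product_def)
    qed
    show "M \<inter> centralizer UNIV \<subseteq> H" using sub by (simp add: Z_def)
    show "\<not> H \<subseteq> centralizer H" using nab sub(2) unfolding D_def[symmetric] by (auto simp: centralizer_def)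
    have nD: "normalizes D (centralizer UNIV)" unfolding normalizes_def
  proof (intro ballI)
    fix g s :: 'a assume "g \<in> D" "s \<in> centralizer UNIV"
    moreover have "conjg g s = s" using triv[of g s] mult_groupD(3)[OF D(1), of g] calculation by simp
    ultimately show "conjg g s \<in> centralizer UNIV" by simp
  qed
    interpret A: abelian_layer "centralizer UNIV" "scaled (centralizer UNIV) D"
      by (rule abelian_layer_scaled[OF div_subring_centralizer D(1) nD commutatorD])
    have "H \<subseteq> scaled (centralizer UNIV) D" using mult_groupD(3)[OF Z] unfolding H_def set_product_def scaled_def Z_def by blast
    thus "commutator s t \<in> centralizer UNIV" if "s \<in> H" "t \<in> H" for s t using A.comm that by blast
  qed (rule hyp)
  then interpret class_two N n M H .
  show False by (rule impossible)
qed

end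

section \<open>Cyclic algebras\<close>

text \<open>\<open>has_dim\<close> asks for a unique extensional coefficient function, hence the
  \<open>restrict\<close> in the proof.\<close>

lemma has_dimI:
  assumes L: "div_subring L" and B: "lin_indep L B" "B \<subseteq> V"
    and span: "\<And>v. v \<in> V \<Longrightarrow> \<exists>c. (\<forall>b\<in>B. c b \<in> L) \<and> v = (\<Sum>b\<in>B. c b * b)"
  shows "has_dim L V (card B)"
proof -
  have fB: "finite B" using B(1) by (simp add: lin_indep_def)
  have "\<exists>!c. c \<in> B \<rightarrow>\<^sub>E L \<and> v = (\<Sum>b\<in>B. c b * b)" if v: "v \<in> V" for v
  proof -
    obtain c where c: "\<forall>b\<in>B. c b \<in> L" "v = (\<Sum>b\<in>B. c b * b)" using span[OF v] by blast
    show ?thesis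
    proof (rule ex1I[of _ "restrict c B"])
      have "(\<Sum>b\<in>B. restrict c B b * b) = (\<Sum>b\<in>B. c b * b)" by (rule sum.cong) auto
      thus "restrict c B \<in> B \<rightarrow>\<^sub>E L \<and> v = (\<Sum>b\<in>B. restrict c B b * b)" using c by auto
    next
      fix d assume d: "d \<in> B \<rightarrow>\<^sub>E L \<and> v = (\<Sum>b\<in>B. d b * b)"
      hence eq: "(\<Sum>b\<in>B. d b * b) = (\<Sum>b\<in>B. c b * b)" using c(2) by metis
      have "(\<Sum>b\<in>B. (d b - c b) * b) = (\<Sum>b\<in>B. d b * b) - (\<Sum>b\<in>B. c b * b)"
        by (simp only: left_diff_distrib sum_subtractf)
      hence z: "(\<Sum>b\<in>B. (d b - c b) * b) = 0" unfolding eq by simp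
      have "\<forall>b\<in>B. d b - c b \<in> L" using c(1) d div_subring_diff[OF L] by (auto simp: PiE_iff)
      hence "d b - c b = 0" if "b \<in> B" for b using lin_indepD[OF B(1) _ z that] by blast
      hence "d b = restrict c B b" for b using d by (cases "b \<in> B") (auto simp: PiE_iff extensional_def)
      thus "d = restrict c B" by blast
    qed
  qed
  thus ?thesis unfolding has_dim_def using fB B(2) by blast
qed

lemma subringD:
  assumes "is_subring R"
  shows "0 \<in> R" "1 \<in> R" "a \<in> R \<Longrightarrow> b \<in> R \<Longrightarrow> a + b \<in> R" "a \<in> R \<Longrightarrow> b \<in> R \<Longrightarrow> a * b \<in> R" "a \<in> R \<Longrightarrow> - a \<in> R"
  using assms by (auto simp: is_subring_def)

lemma subring_sum: "is_subring R \<Longrightarrow> (\<And>i. i \<in> I \<Longrightarrow> f i \<in> R) \<Longrightarrow> sum f I \<in> R"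
  by (induction I rule: infinite_finite_induct) (simp_all add: subringD)

lemma subring_power: "is_subring R \<Longrightarrow> a \<in> R \<Longrightarrow> a ^ n \<in> R"
  by (induction n) (simp_all add: subringD)

text \<open>Factoring the relation at its lowest nonzero coefficient \<open>c j\<close> leaves
  \<open>c j + t * a = 0\<close>, which expresses \<open>inverse a\<close> through
  \<open>t\<close>.\<close>

lemma inverse_in_algebraic_subring:
  assumes F: "div_subring F" and R: "is_subring R" "F \<subseteq> R" and a: "a \<in> R" "a \<noteq> 0"
    and c: "\<And>i. i \<le> m \<Longrightarrow> c i \<in> F" "i0 \<le> m" "c i0 \<noteq> 0" and z: "(\<Sum>i\<le>m. c i * a ^ i) = 0"
  shows "inverse a \<in> R"
proof -
  define j where "j = (LEAST i. c i \<noteq> 0)"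
  have cj0: "c j \<noteq> 0" unfolding j_def by (rule LeastI[of _ i0]) (rule c(3))
  have jm: "j \<le> m" using Least_le[of "\<lambda>i. c i \<noteq> 0" i0] c(2,3) by (simp add: j_def)
  have low: "c i = 0" if "i < j" for i using not_less_Least[of i "\<lambda>i. c i \<noteq> 0"] that by (auto simp: j_def)
  define t where "t = (\<Sum>i\<in>{Suc j..m}. c i * a ^ (i - Suc j))"
  have tR: "t \<in> R" unfolding t_def
  proof (rule subring_sum[OF R(1)])
    fix i assume "i \<in> {Suc j..m}"
    hence "c i \<in> R" using c(1) R(2) by auto
    thus "c i * a ^ (i - Suc j) \<in> R" using subring_power[OF R(1) a(1)] by (simp add: subringD(4)[OF R(1)])
  qed
  have "(\<Sum>i\<le>m. c i * a ^ i) = (\<Sum>i\<in>{j..m}. c i * a ^ i)"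
    by (rule sum.mono_neutral_right) (auto simp: low)
  also have "\<dots> = c j * a ^ j + (\<Sum>i\<in>{Suc j..m}. c i * a ^ i)" using jm by (rule sum.atLeast_Suc_atMost)
  also have "(\<Sum>i\<in>{Suc j..m}. c i * a ^ i) = (\<Sum>i\<in>{Suc j..m}. c i * a ^ (i - Suc j) * a ^ Suc j)"
    by (rule sum.cong) (auto simp: mult.assoc power_add[symmetric] simp del: power_Suc)
  also have "\<dots> = t * a ^ Suc j" by (simp only: t_def sum_distrib_right)
  finally have "(c j + t * a) * a ^ j = 0" using z by (simp add: distrib_right mult.assoc)
  hence "c j + t * a = 0" using a(2) by simp
  hence "t * a = - c j" by (metis add_eq_0_iff)
  hence "(- inverse (c j) * t) * a = 1" using cj0 by (simp add: mult.assoc)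
  hence "inverse (- inverse (c j) * t) = a" by (rule inverse_unique)
  hence "inverse a = - inverse (c j) * t" by (metis inverse_inverse_eq)
  moreover have "inverse (c j) \<in> R" using div_subringD(6)[OF F c(1)[OF jm]] R(2) by blast
  ultimately show ?thesis using tR by (simp add: subringD(4,5)[OF R(1)])
qed

text \<open>\<open>gen\<close> speaks of generation as a division ring; through \<open>A\<close> it
  is improved to a direct sum over the powers of \<open>x\<close>.\<close>

locale cyclic_algebra = cyclic_layer +
  assumes xpK: "x ^ p \<in> K" and gen: "\<And>R. div_subring R \<Longrightarrow> K \<subseteq> R \<Longrightarrow> x \<in> R \<Longrightarrow> R = UNIV"
begin

lemma swap: "conjg (x ^ i) q * x ^ i = x ^ i * q" using x0 by (simp add: conjg_def mult.assoc)

lemma power_independent: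
  assumes k: "\<And>i. i < p \<Longrightarrow> k i \<in> K" and z: "(\<Sum>i<p. k i * x ^ i) = 0" and i: "i < p"
  shows "k i = 0"
proof -
  have "(\<Sum>i<p. conjg (x ^ i) q * (k i * x ^ i)) = 0" if q: "q \<in> K" for q
  proof -
    have "conjg (x ^ i) q * (k i * x ^ i) = k i * x ^ i * q" if "i < p" for i
      using Kcomm[OF pow_in[OF q] k[OF that]] swap[of i q] by (metis mult.assoc)
    hence "(\<Sum>i<p. conjg (x ^ i) q * (k i * x ^ i)) = (\<Sum>i<p. k i * x ^ i) * q"
      unfolding sum_distrib_right by (intro sum.cong) auto
    thus ?thesis unfolding z by simp
  qed
  from cyclic_dedekind[of "\<lambda>i. k i * x ^ i", OF this i] show ?thesis using x0 by simp
qed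

definition A where "A = {\<Sum>i<p. k i * x ^ i | k. \<forall>i. k i \<in> K}"

lemma AI: "(\<And>i. k i \<in> K) \<Longrightarrow> (\<Sum>i<p. k i * x ^ i) \<in> A" unfolding A_def by blast

lemma A_monomial: assumes k: "k \<in> K" shows "k * x ^ m \<in> A"
proof -
  define r where "r = m mod p"
  define k' where "k' = k * (x ^ p) ^ (m div p)"
  have k': "k' \<in> K" unfolding k'_def by (simp add: k xpK div_subringD(4)[OF K] div_subring_prod[OF K])
  have "x ^ m = (x ^ p) ^ (m div p) * x ^ r" unfolding r_def power_mult[symmetric] power_add[symmetric] by simp
  hence e: "k * x ^ m = k' * x ^ r" by (simp add: k'_def mult.assoc)
  have r: "r < p" using p0 by (simp add: r_def)
  have "(\<Sum>i<p. (if i = r then k' else 0) * x ^ i) = (\<Sum>i<p. if i = r then k' * x ^ i else 0)"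
    by (rule sum.cong) auto
  also have "\<dots> = k' * x ^ r" using r by simp
  finally have "k * x ^ m = (\<Sum>i<p. (if i = r then k' else 0) * x ^ i)" using e by simp
  also have "\<dots> \<in> A" by (rule AI) (simp add: k' div_subringD(1)[OF K])
  finally show ?thesis .
qed

lemma A_add: assumes "a \<in> A" "b \<in> A" shows "a + b \<in> A"
proof -
  obtain k l where e: "a = (\<Sum>i<p. k i * x ^ i)" "b = (\<Sum>i<p. l i * x ^ i)" and kl: "\<And>i. k i \<in> K" "\<And>i. l i \<in> K"
    using assms unfolding A_def by blast
  have "a + b = (\<Sum>i<p. (k i + l i) * x ^ i)" unfolding e by (simp only: distrib_right sum.distrib)
  also have "\<dots> \<in> A" using kl by (intro AI div_subringD(3)[OF K])
  finally show ?thesis .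
qed

lemma A_0: "0 \<in> A" using A_monomial[OF div_subringD(1)[OF K], of 0] by simp

lemma A_sum: "(\<And>i. i \<in> I \<Longrightarrow> f i \<in> A) \<Longrightarrow> sum f I \<in> A"
  by (induction I rule: infinite_finite_induct) (simp_all add: A_0 A_add)

lemma A_scale: assumes "k \<in> K" "a \<in> A" shows "k * a \<in> A"
proof -
  obtain l where e: "a = (\<Sum>i<p. l i * x ^ i)" and l: "\<And>i. l i \<in> K" using assms(2) unfolding A_def by blast
  have "k * a = (\<Sum>i<p. (k * l i) * x ^ i)" unfolding e by (simp only: sum_distrib_left mult.assoc)
  also have "\<dots> \<in> A" using assms(1) l by (intro AI div_subringD(4)[OF K])
  finally show ?thesis .
qed

lemma A_mult: assumes "a \<in> A" "b \<in> A" shows "a * b \<in> A"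
proof -
  obtain k l where e: "a = (\<Sum>i<p. k i * x ^ i)" "b = (\<Sum>i<p. l i * x ^ i)" and kl: "\<And>i. k i \<in> K" "\<And>i. l i \<in> K"
    using assms unfolding A_def by blast
  have m: "(k i * x ^ i) * (l j * x ^ j) \<in> A" for i j
  proof -
    have "(k i * x ^ i) * (l j * x ^ j) = k i * (x ^ i * l j) * x ^ j" by (simp only: mult.assoc)
    also have "\<dots> = (k i * conjg (x ^ i) (l j)) * x ^ (i + j)" unfolding swap[symmetric] by (simp only: mult.assoc power_add)
    also have "\<dots> \<in> A" by (rule A_monomial[OF div_subringD(4)[OF K kl(1) pow_in[OF kl(2)]]])
    finally show ?thesis .
  qed
  show ?thesis unfolding e sum_product by (intro A_sum m)
qed

text \<open>A dimension count over \<open>K\<close>: the \<open>p\<close> elements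
  \<open>x ^ j * a\<close> together with \<open>1\<close> are dependent, and the coefficient
  \<open>c p\<close> of \<open>1\<close> cannot vanish. This gives
  \<open>t * a = - c p\<close>.\<close>

lemma A_inverse: assumes a: "a \<in> A" "a \<noteq> 0" shows "inverse a \<in> A"
proof -
  have xA: "x ^ j \<in> A" for j using A_monomial[OF div_subringD(2)[OF K], of j] by simp
  define v where "v j = (if j < p then x ^ j * a else 1)" for j
  have "v j \<in> A" for j using A_mult[OF xA a(1)] xA[of 0] by (auto simp: v_def)
  hence "\<exists>k. v j = (\<Sum>i<p. k i * x ^ i) \<and> (\<forall>i. k i \<in> K)" for j unfolding A_def by blast
  then obtain k where k: "\<And>j. v j = (\<Sum>i<p. k j i * x ^ i)" "\<And>j i. k j i \<in> K" by metis
  obtain c where c: "\<forall>j\<in>{..<Suc p}. c j \<in> K" "\<exists>j\<in>{..<Suc p}. c j \<noteq> 0" "\<forall>i\<in>{..<p}. (\<Sum>j\<in>{..<Suc p}. c j * k j i) = 0"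
    using homogeneous_system[OF K, of "{..<p}" "{..<Suc p}" k] k(2) by auto
  have "(\<Sum>j<Suc p. c j * v j) = (\<Sum>j<Suc p. \<Sum>i<p. c j * k j i * x ^ i)" unfolding k(1) by (simp only: sum_distrib_left mult.assoc)
  also have "\<dots> = (\<Sum>i<p. (\<Sum>j<Suc p. c j * k j i) * x ^ i)" unfolding sum_distrib_right by (rule sum.swap)
  also have "\<dots> = 0" using c(3) by simp
  finally have "(\<Sum>j<p. c j * v j) + c p * v p = 0" by simp
  moreover define t where "t = (\<Sum>j<p. c j * x ^ j)"
  have "(\<Sum>j<p. c j * v j) = t * a" unfolding t_def sum_distrib_right by (rule sum.cong) (auto simp: v_def mult.assoc)
  ultimately have ta: "t * a + c p = 0" by (simp add: v_def)
  have cp: "c p \<noteq> 0"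
  proof
    assume "c p = 0"
    hence "t = 0" using ta a(2) by simp
    hence "c j = 0" if "j < p" for j using power_independent[of c, OF _ _ that] c(1) by (auto simp: t_def)
    thus False using c(2) \<open>c p = 0\<close> by (auto simp: less_Suc_eq)
  qed
  have "t * a = - c p" using ta by (metis add_eq_0_iff add.commute)
  hence "(- inverse (c p) * t) * a = 1" using cp by (simp add: mult.assoc)
  hence "inverse (- inverse (c p) * t) = a" by (rule inverse_unique)
  hence i: "inverse a = - inverse (c p) * t" by (metis inverse_inverse_eq)
  have tA: "t \<in> A" unfolding t_def using c(1) by (intro A_sum A_monomial) auto
  have "- inverse (c p) \<in> K" using c(1) div_subringD(5,6)[OF K] by auto
  thus ?thesis unfolding i using tA by (rule A_scale)
qed

lemma div_subring_A: "div_subring A"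
proof -
  have "1 \<in> A" using A_monomial[OF div_subringD(2)[OF K], of 0] by simp
  moreover have "- a \<in> A" if "a \<in> A" for a using A_scale[OF div_subringD(5)[OF K div_subringD(2)[OF K]] that] by simp
  moreover have "inverse a \<in> A" if "a \<in> A" for a using A_inverse[OF that] A_0 by (cases "a = 0") auto
  ultimately show ?thesis unfolding div_subring_def is_subring_def by (simp add: A_0 A_add A_mult)
qed

lemma A_UNIV: "A = UNIV"
  using gen[OF div_subring_A] A_monomial[of _ 0] A_monomial[OF div_subringD(2)[OF K], of 1] by auto

lemma representation: "\<exists>k. (\<forall>i. k i \<in> K) \<and> d = (\<Sum>i<p. k i * x ^ i)"
  using A_UNIV unfolding A_def by blast

text \<open>The exponents run from 1 to \<open>p\<close>, so the representation of
  \<open>d * inverse x\<close> with exponents below \<open>p\<close> is shifted by one.\<close>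

lemma unique_representation: "\<exists>!k. k \<in> {1..p} \<rightarrow>\<^sub>E K \<and> d = (\<Sum>i=1..p. k i * x ^ i)"
proof -
  have shift: "(\<Sum>i=1..p. k i * x ^ i) = (\<Sum>i<p. k (Suc i) * x ^ i) * x" for k :: "nat \<Rightarrow> 'a"
  proof -
    have "(\<Sum>i=1..p. k i * x ^ i) = (\<Sum>i<p. k (Suc i) * x ^ Suc i)" unfolding One_nat_def by (rule sum.atLeast1_atMost_eq)
    also have "\<dots> = (\<Sum>i<p. k (Suc i) * x ^ i) * x" unfolding sum_distrib_right by (simp add: mult.assoc power_commutes)
    finally show ?thesis .
  qed
  obtain l where l: "\<And>i. l i \<in> K" "d * inverse x = (\<Sum>i<p. l i * x ^ i)" using representation[of "d * inverse x"] by blast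
  define k where "k = restrict (\<lambda>i. l (i - 1)) {1..p}"
  have "(\<Sum>i<p. k (Suc i) * x ^ i) = d * inverse x" unfolding l(2) by (rule sum.cong) (auto simp: k_def)
  hence dk: "d = (\<Sum>i=1..p. k i * x ^ i)" unfolding shift using x0 by (simp add: mult.assoc)
  have kE: "k \<in> {1..p} \<rightarrow>\<^sub>E K" using l(1) by (auto simp: k_def)
  show ?thesis
  proof (rule ex1I[of _ k])
    show "k \<in> {1..p} \<rightarrow>\<^sub>E K \<and> d = (\<Sum>i=1..p. k i * x ^ i)" using kE dk by blast
  next
    fix m assume m: "m \<in> {1..p} \<rightarrow>\<^sub>E K \<and> d = (\<Sum>i=1..p. m i * x ^ i)"
    have "(\<Sum>i<p. m (Suc i) * x ^ i) * x = (\<Sum>i<p. k (Suc i) * x ^ i) * x" unfolding shift[symmetric] using m dk by metis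
    hence e: "(\<Sum>i<p. m (Suc i) * x ^ i) = (\<Sum>i<p. k (Suc i) * x ^ i)" using x0 by simp
    have "(\<Sum>i<p. (m (Suc i) - k (Suc i)) * x ^ i) = (\<Sum>i<p. m (Suc i) * x ^ i) - (\<Sum>i<p. k (Suc i) * x ^ i)"
      by (simp only: left_diff_distrib sum_subtractf)
    hence z: "(\<Sum>i<p. (m (Suc i) - k (Suc i)) * x ^ i) = 0" unfolding e by simp
    have mk: "m (Suc i) - k (Suc i) \<in> K" if "i < p" for i using m kE that div_subring_diff[OF K] by (auto simp: PiE_iff)
    have "m (Suc i) = k (Suc i)" if "i < p" for i using power_independent[OF mk z that] by simp
    moreover have "\<exists>j<p. i = Suc j" if "i \<in> {1..p}" for i using that by (intro exI[of _ "i - 1"]) auto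
    ultimately have "m i = k i" if "i \<in> {1..p}" for i using that by metis
    thus "m = k" using m kE by (intro PiE_ext[of m _ _ k]) auto
  qed
qed

text \<open>Commuting with \<open>q\<close> multiplies the coefficient of \<open>x ^ i\<close> by
  \<open>conjg (x ^ i) q - q\<close>, which for \<open>0 < i < p\<close> is nonzero at a suitable
  \<open>q\<close>.\<close>

lemma centralizer_K: "centralizer K = K"
proof
  show "K \<subseteq> centralizer K" by (rule Kc)
  show "centralizer K \<subseteq> K"
  proof
    fix d assume d: "d \<in> centralizer K"
    obtain k where k: "\<And>i. k i \<in> K" "d = (\<Sum>i<p. k i * x ^ i)" using representation[of d] by blast
    have "k i = 0" if i: "i < p" "i \<noteq> 0" for i
    proof -
      obtain q where q: "q \<in> K" "conjg (x ^ i) q \<noteq> conjg (x ^ 0) q"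
        using powers_distinct_on[OF x0 p xp xnc i(1) p0 i(2)] by blast
      have "(conjg (x ^ j) q - q) * k j * x ^ j = k j * x ^ j * q - q * (k j * x ^ j)" for j
        using Kcomm[OF pow_in[OF q(1)] k(1)] swap[of j q] by (simp add: left_diff_distrib) (metis mult.assoc)
      hence "(\<Sum>j<p. (conjg (x ^ j) q - q) * k j * x ^ j) = (\<Sum>j<p. k j * x ^ j) * q - q * (\<Sum>j<p. k j * x ^ j)"
        by (simp only: sum_subtractf sum_distrib_left sum_distrib_right)
      also have "\<dots> = 0" unfolding k(2)[symmetric] using centralizerD[OF d q(1)] by simp
      finally have z: "(\<Sum>j<p. (conjg (x ^ j) q - q) * k j * x ^ j) = 0" .
      have "(conjg (x ^ j) q - q) * k j \<in> K" for j by (simp add: div_subringD(4)[OF K] div_subring_diff[OF K] pow_in[OF q(1)] q(1) k(1))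
      hence "(conjg (x ^ i) q - q) * k i = 0" using power_independent[of "\<lambda>j. (conjg (x ^ j) q - q) * k j", OF _ z i(1)] by blast
      thus ?thesis using q(2) by (simp add: conjg_one)
    qed
    hence "d = (\<Sum>i\<in>{0}. k i * x ^ i)" unfolding k(2) using p0 by (intro sum.mono_neutral_right) auto
    thus "d \<in> K" using k(1) by simp
  qed
qed

lemma maximal: "maximal_subfield K"
  unfolding maximal_subfield_def
proof (intro conjI allI impI)
  show "is_subfield K" using K Kcomm by (simp add: is_subfield_def div_subring_def)
  fix L assume L: "is_subfield L \<and> K \<subseteq> L"
  hence "L \<subseteq> centralizer K" by (auto simp: is_subfield_def centralizer_def)
  thus "L = K" using L centralizer_K by blast
qed

lemma center: "center = S"
proof
  have "center \<subseteq> centralizer K \<inter> centralizer {x}" using center_subset_centralizer by blast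
  thus "center \<subseteq> S" by (simp add: centralizer_K)
  show "S \<subseteq> center"
  proof
    fix s assume s: "s \<in> S"
    have "centralizer {s} = UNIV"
      using gen[OF div_subring_centralizer[of "{s}"]] s Kcomm by (auto simp: centralizer_def)
    hence "z * s = s * z" for z using centralizerD[of z "{s}" s] by blast
    thus "s \<in> center" by (auto simp: center_def)
  qed
qed

lemma power_center: "x ^ p \<in> center" unfolding center using xpK by (simp add: centralizer_def power_commutes)

section \<open>The Galois group of K and the dimension of D\<close>

lemma GalD:
  assumes "\<sigma> \<in> Gal K S"
  shows "a \<in> K \<Longrightarrow> \<sigma> a \<in> K" "\<sigma> 1 = 1" "a \<in> K \<Longrightarrow> b \<in> K \<Longrightarrow> \<sigma> (a + b) = \<sigma> a + \<sigma> b"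
    "a \<in> K \<Longrightarrow> b \<in> K \<Longrightarrow> \<sigma> (a * b) = \<sigma> a * \<sigma> b" "s \<in> S \<Longrightarrow> \<sigma> s = s" "a \<notin> K \<Longrightarrow> \<sigma> a = undefined"
  using assms unfolding Gal_def by (auto simp: PiE_iff extensional_def)

lemma Gal_linear:
  assumes s: "\<sigma> \<in> Gal K S" and "finite B" "B \<subseteq> K" "\<forall>b\<in>B. c b \<in> S"
  shows "\<sigma> (\<Sum>b\<in>B. c b * b) = (\<Sum>b\<in>B. c b * \<sigma> b)"
  using assms(2-4)
proof (induction B)
  case empty
  show ?case using GalD(5)[OF s, of 0] div_subringD(1)[OF S] by simp
next
  case (insert b B)
  have K1: "c b * b \<in> K" "c b \<in> K" "b \<in> K" using insert.prems by (auto simp: div_subringD(4)[OF K])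
  have "(\<Sum>b\<in>B. c b * b) \<in> K" using insert.prems by (intro div_subring_sum[OF K] div_subringD(4)[OF K]) auto
  hence "\<sigma> (c b * b + (\<Sum>b\<in>B. c b * b)) = \<sigma> (c b) * \<sigma> b + \<sigma> (\<Sum>b\<in>B. c b * b)"
    using K1 by (simp add: GalD(3,4)[OF s])
  thus ?case using insert GalD(5)[OF s, of "c b"] by simp
qed

text \<open>With more automorphisms than spanning elements, the linear system on \<open>B\<close>
  has a nontrivial solution. By linearity it is a relation between the automorphisms on all of
  \<open>K\<close>, against Dedekind.\<close>

lemma Gal_card:
  assumes J: "finite J" "J \<subseteq> Gal K S" and B: "finite B" "B \<subseteq> K"
    and span: "\<And>v. v \<in> K \<Longrightarrow> \<exists>c. (\<forall>b\<in>B. c b \<in> S) \<and> v = (\<Sum>b\<in>B. c b * b)"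
  shows "card J \<le> card B"
proof (rule ccontr)
  assume "\<not> ?thesis"
  then obtain c where c: "\<forall>\<sigma>\<in>J. c \<sigma> \<in> K" "\<exists>\<sigma>\<in>J. c \<sigma> \<noteq> 0" "\<forall>b\<in>B. (\<Sum>\<sigma>\<in>J. c \<sigma> * \<sigma> b) = 0"
    using homogeneous_system[OF K B(1) J(1), of "\<lambda>\<sigma> b. \<sigma> b"] GalD(1) J(2) B(2) by (auto simp: subset_iff)
  have zero: "(\<Sum>\<sigma>\<in>J. \<sigma> q * c \<sigma>) = 0" if q: "q \<in> K" for q
  proof -
    obtain d where d: "\<forall>b\<in>B. d b \<in> S" "q = (\<Sum>b\<in>B. d b * b)" using span[OF q] by blast
    have "\<sigma> q * c \<sigma> = (\<Sum>b\<in>B. d b * (c \<sigma> * \<sigma> b))" if "\<sigma> \<in> J" for \<sigma>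
    proof -
      have s: "\<sigma> \<in> Gal K S" using that J(2) by blast
      have "\<sigma> q * c \<sigma> = (\<Sum>b\<in>B. d b * \<sigma> b * c \<sigma>)" unfolding d(2) Gal_linear[OF s B d(1)] by (rule sum_distrib_right)
      also have "\<dots> = (\<Sum>b\<in>B. d b * (c \<sigma> * \<sigma> b))"
      proof (rule sum.cong)
        fix b assume "b \<in> B"
        thus "d b * \<sigma> b * c \<sigma> = d b * (c \<sigma> * \<sigma> b)"
          using Kcomm[of "\<sigma> b" "c \<sigma>"] GalD(1)[OF s] B(2) c(1) that by (auto simp: mult.assoc)
      qed simp
      finally show ?thesis .
    qed
    hence "(\<Sum>\<sigma>\<in>J. \<sigma> q * c \<sigma>) = (\<Sum>\<sigma>\<in>J. \<Sum>b\<in>B. d b * (c \<sigma> * \<sigma> b))" by (intro sum.cong) auto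
    also have "\<dots> = (\<Sum>b\<in>B. d b * (\<Sum>\<sigma>\<in>J. c \<sigma> * \<sigma> b))" unfolding sum_distrib_left by (rule sum.swap)
    also have "\<dots> = 0" using c(3) by simp
    finally show ?thesis .
  qed
  have "c \<sigma> = 0" if "\<sigma> \<in> J" for \<sigma>
  proof (rule dedekind[where J = J and \<theta> = "\<lambda>\<sigma>. \<sigma>" and X = K and op = "(*)" and g = c])
    fix \<sigma> \<tau> assume "\<sigma> \<in> J" "\<tau> \<in> J" "\<sigma> \<noteq> \<tau>"
    moreover obtain a where "\<sigma> a \<noteq> \<tau> a" using \<open>\<sigma> \<noteq> \<tau>\<close> by blast
    moreover have "\<sigma> \<in> Gal K S" "\<tau> \<in> Gal K S" using \<open>\<sigma> \<in> J\<close> \<open>\<tau> \<in> J\<close> J(2) by blast+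
    ultimately show "\<exists>q\<in>K. \<sigma> q \<noteq> \<tau> q" using GalD(6)[of \<sigma> a] GalD(6)[of \<tau> a] by (cases "a \<in> K") auto
  next
    fix \<sigma> \<tau> q r assume "\<sigma> \<in> J" "\<tau> \<in> J" "q \<in> K" "r \<in> K"
    thus "\<sigma> q * \<tau> r = \<tau> r * \<sigma> q" using Kcomm GalD(1) J(2) by (meson subsetD)
  next
    fix \<sigma> assume "\<sigma> \<in> J"
    thus "\<exists>q\<in>K. \<sigma> q \<noteq> 0" using GalD(2)[of \<sigma>] J(2) div_subringD(2)[OF K] by (intro bexI[of _ 1]) auto
  qed (use J that zero GalD(4) div_subringD(4)[OF K] in \<open>auto simp: subset_iff\<close>)
  thus False using c(2) by blast
qed

lemma conjg_Gal:
  assumes g: "g \<noteq> 0" "conjg g ` K = K" shows "restrict (conjg g) K \<in> Gal K S"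
proof -
  have "inj_on (conjg g) K" using conjg_inv_cancel(1)[OF g(1)] by (metis inj_onI)
  moreover have "conjg g s = s" if "s \<in> S" for s
    using that unfolding center[symmetric] center_eq using g(1) by (auto simp: conjg_fix_iff centralizer_def)
  ultimately show ?thesis
    using g(2) div_subringD[OF K] unfolding Gal_def
    by (auto simp: conjg_add conjg_mult[OF g(1)] conjg_1[OF g(1)] bij_betw_def inj_on_restrict_eq)
qed

lemma power_image: "conjg (x ^ i) ` K = K"
proof (induction i)
  case (Suc i)
  have "conjg (x ^ Suc i) ` K = conjg x ` (conjg (x ^ i) ` K)" by (auto simp: conjg_conjg image_image)
  thus ?case using Suc xK by simp
qed (simp add: conjg_one)

abbreviation \<phi> where "\<phi> i \<equiv> restrict (conjg (x ^ i)) K"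

lemma \<phi>_Gal: "\<phi> i \<in> Gal K S" using conjg_Gal[OF _ power_image] x0 by simp

lemma \<phi>_inj: "inj_on \<phi> {..<p}"
proof (rule inj_onI, rule ccontr)
  fix i j assume ij: "i \<in> {..<p}" "j \<in> {..<p}" "\<phi> i = \<phi> j" "i \<noteq> j"
  then obtain q where "q \<in> K" "conjg (x ^ i) q \<noteq> conjg (x ^ j) q" using powers_distinct_on[OF x0 p xp xnc, of i j] by auto
  thus False using fun_cong[OF ij(3), of q] by simp
qed

text \<open>Artin's bound gives at most \<open>p\<close> elements, and the \<open>p\<close>
  automorphisms induced by powers of \<open>x\<close> require at least \<open>p\<close>.\<close>

lemma basis: "\<exists>B\<subseteq>K. lin_indep S B \<and> card B = p \<and> (\<forall>v\<in>K. \<exists>c. (\<forall>b\<in>B. c b \<in> S) \<and> v = (\<Sum>b\<in>B. c b * b))"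
proof -
  have "\<exists>B\<subseteq>K. lin_indep S B \<and> (\<forall>v\<in>K. \<exists>c. (\<forall>b\<in>B. c b \<in> S) \<and> v = (\<Sum>b\<in>B. c b * b))"
    by (rule ex_basis[OF S, of K p]) (rule indep_card)
  then obtain B where B: "B \<subseteq> K" "lin_indep S B" "\<forall>v\<in>K. \<exists>c. (\<forall>b\<in>B. c b \<in> S) \<and> v = (\<Sum>b\<in>B. c b * b)"
    by (elim exE conjE)
  have "card (\<phi> ` {..<p}) \<le> card B"
    using B \<phi>_Gal by (intro Gal_card) (auto simp: lin_indep_def)
  hence "card B = p" using indep_card[OF B(2,1)] by (simp add: card_image[OF \<phi>_inj])
  thus ?thesis using B by (intro exI[of _ B] conjI)
qed

lemma Gal_eq: "Gal K S = \<phi> ` {..<p}"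
proof
  show "\<phi> ` {..<p} \<subseteq> Gal K S" using \<phi>_Gal by blast
  show "Gal K S \<subseteq> \<phi> ` {..<p}"
  proof (rule subsetI, rule ccontr)
    fix \<sigma> assume s: "\<sigma> \<in> Gal K S" "\<sigma> \<notin> \<phi> ` {..<p}"
    obtain B where B: "B \<subseteq> K" "lin_indep S B" "card B = p" "\<forall>v\<in>K. \<exists>c. (\<forall>b\<in>B. c b \<in> S) \<and> v = (\<Sum>b\<in>B. c b * b)"
      using basis by (elim exE conjE)
    have "card (insert \<sigma> (\<phi> ` {..<p})) \<le> card B"
      using B \<phi>_Gal s(1) by (intro Gal_card) (auto simp: lin_indep_def)
    thus False using s(2) B(3) by (simp add: card_image[OF \<phi>_inj])
  qed
qed

lemma galois: "finite_galois K center"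
proof -
  obtain B where B: "B \<subseteq> K" "lin_indep S B" "card B = p" "\<forall>v\<in>K. \<exists>c. (\<forall>b\<in>B. c b \<in> S) \<and> v = (\<Sum>b\<in>B. c b * b)"
    using basis by (elim exE conjE)
  have "has_dim S K (card B)" using B(4) by (intro has_dimI[OF S B(2,1)]) blast
  moreover have "{a \<in> K. \<forall>\<sigma>\<in>Gal K S. \<sigma> a = a} = S"
  proof
    show "S \<subseteq> {a \<in> K. \<forall>\<sigma>\<in>Gal K S. \<sigma> a = a}" using GalD(5) by blast
    show "{a \<in> K. \<forall>\<sigma>\<in>Gal K S. \<sigma> a = a} \<subseteq> S"
    proof
      fix a assume a: "a \<in> {a \<in> K. \<forall>\<sigma>\<in>Gal K S. \<sigma> a = a}"
      hence "\<phi> 1 a = a" using \<phi>_Gal[of 1] by blast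
      hence "a \<in> K \<and> conjg x a = a" using a by simp
      thus "a \<in> S" unfolding S_iff .
    qed
  qed
  ultimately show ?thesis unfolding finite_galois_def center by blast
qed

text \<open>The tower law: a basis of \<open>K\<close> over the center times the powers of
  \<open>x\<close> below \<open>p\<close>.\<close>

lemma dimension: "has_dim center (UNIV :: 'a set) (p ^ 2)"
proof -
  obtain B where B: "B \<subseteq> K" "lin_indep S B" "card B = p" "\<forall>v\<in>K. \<exists>c. (\<forall>b\<in>B. c b \<in> S) \<and> v = (\<Sum>b\<in>B. c b * b)"
    using basis by (elim exE conjE)
  have fB: "finite B" using B(2) by (simp add: lin_indep_def)
  define f where "f = (\<lambda>(b, j). b * x ^ j)"
  define C where "C = f ` (B \<times> {..<p})"
  have tower: "(\<Sum>(b, j)\<in>B \<times> {..<p}. d b j * f (b, j)) = (\<Sum>j<p. (\<Sum>b\<in>B. d b j * b) * x ^ j)" for d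
  proof -
    have "(\<Sum>(b, j)\<in>B \<times> {..<p}. d b j * f (b, j)) = (\<Sum>b\<in>B. \<Sum>j<p. d b j * (b * x ^ j))"
      by (simp add: f_def sum.cartesian_product)
    also have "\<dots> = (\<Sum>j<p. \<Sum>b\<in>B. d b j * (b * x ^ j))" by (rule sum.swap)
    also have "\<dots> = (\<Sum>j<p. (\<Sum>b\<in>B. d b j * b) * x ^ j)" by (simp only: sum_distrib_right mult.assoc)
    finally show ?thesis .
  qed
  have ind: "d b j = 0" if "\<And>b j. d b j \<in> S" "(\<Sum>(b, j)\<in>B \<times> {..<p}. d b j * f (b, j)) = 0" "b \<in> B" "j < p" for d b j
  proof -
    have "(\<Sum>b\<in>B. d b j * b) \<in> K" for j using that(1) B(1) by (intro div_subring_sum[OF K] div_subringD(4)[OF K]) auto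
    hence "(\<Sum>b\<in>B. d b j * b) = 0" using power_independent[of "\<lambda>j. \<Sum>b\<in>B. d b j * b", OF _ _ that(4)] that(2) unfolding tower by blast
    thus ?thesis using lin_indepD[OF B(2) _ _ that(3), of "\<lambda>b. d b j"] that(1) by blast
  qed
  have S01: "0 \<in> S" "1 \<in> S" "- 1 \<in> S" using div_subringD(1,2,5)[OF S] by blast+
  have inj: "inj_on f (B \<times> {..<p})"
  proof (rule inj_onI, rule ccontr)
    fix u v assume uv: "u \<in> B \<times> {..<p}" "v \<in> B \<times> {..<p}" "f u = f v" "u \<noteq> v"
    \<comment> \<open>Equal products at two distinct places would be a relation with coefficients 1
      and -1.\<close>
    define d :: "'a \<Rightarrow> nat \<Rightarrow> 'a" where "d b j = (if (b, j) = u then 1 else if (b, j) = v then -1 else 0)" for b j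
    have "(\<Sum>(b, j)\<in>B \<times> {..<p}. d b j * f (b, j)) = (\<Sum>w\<in>B \<times> {..<p}. (if w = u then f u else 0) - (if w = v then f v else 0))"
      using uv(4) by (intro sum.cong) (auto simp: d_def)
    also have "\<dots> = 0" using uv fB by (simp add: sum_subtractf)
    finally have z: "(\<Sum>(b, j)\<in>B \<times> {..<p}. d b j * f (b, j)) = 0" .
    have "d b j \<in> S" for b j unfolding d_def using S01 by presburger
    hence "d (fst u) (snd u) = 0" using uv(1) by (intro ind[of d, OF _ z]) auto
    thus False by (simp add: d_def)
  qed
  have reidx: "(\<Sum>v\<in>C. c v * v) = (\<Sum>(b, j)\<in>B \<times> {..<p}. c (f (b, j)) * f (b, j))" for c
    unfolding C_def by (subst sum.reindex[OF inj]) (auto intro!: sum.cong)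
  have "lin_indep S C"
    unfolding lin_indep_def
  proof (intro conjI allI impI ballI)
    show "finite C" using fB by (simp add: C_def)
    fix c v assume c: "\<forall>b\<in>C. c b \<in> S" "(\<Sum>b\<in>C. c b * b) = 0" and v: "v \<in> C"
    obtain b j where bj: "v = f (b, j)" "b \<in> B" "j < p" using v by (auto simp: C_def)
    define d where "d b j = (if b \<in> B \<and> j < p then c (f (b, j)) else 0)" for b j
    have "(\<Sum>(b, j)\<in>B \<times> {..<p}. d b j * f (b, j)) = (\<Sum>(b, j)\<in>B \<times> {..<p}. c (f (b, j)) * f (b, j))"
      by (rule sum.cong) (auto simp: d_def)
    hence z: "(\<Sum>(b, j)\<in>B \<times> {..<p}. d b j * f (b, j)) = 0" using c(2) reidx[of c] by simp
    have "d b j \<in> S" for b j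
    proof (cases "b \<in> B \<and> j < p")
      case True
      hence "f (b, j) \<in> C" by (auto simp: C_def)
      thus ?thesis using c(1) True unfolding d_def by metis
    next
      case False
      hence "d b j = 0" by (auto simp: d_def)
      thus ?thesis using S01(1) by metis
    qed
    hence "d b j = 0" using ind[of d, OF _ z bj(2,3)] by blast
    thus "c v = 0" using bj by (simp add: d_def)
  qed
  moreover have "\<exists>c. (\<forall>v\<in>C. c v \<in> S) \<and> d = (\<Sum>v\<in>C. c v * v)" for d
  proof -
    obtain k where k: "\<And>i. k i \<in> K" "d = (\<Sum>i<p. k i * x ^ i)" using representation[of d] by blast
    have "\<exists>c. (\<forall>b\<in>B. c b \<in> S) \<and> k i = (\<Sum>b\<in>B. c b * b)" for i using B(4) k(1) by blast
    then obtain e where e: "\<And>i b. b \<in> B \<Longrightarrow> e i b \<in> S" "\<And>i. k i = (\<Sum>b\<in>B. e i b * b)" by metis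
    define c where "c v = (case inv_into (B \<times> {..<p}) f v of (b, j) \<Rightarrow> e j b)" for v
    have cf: "c (f (b, j)) = e j b" if "b \<in> B" "j < p" for b j
      using inv_into_f_f[OF inj, of "(b, j)"] that by (simp add: c_def)
    have "\<forall>v\<in>C. c v \<in> S" using cf e(1) by (auto simp: C_def)
    moreover have "d = (\<Sum>(b, j)\<in>B \<times> {..<p}. e j b * f (b, j))" unfolding tower k(2) e(2) by simp
    hence "d = (\<Sum>v\<in>C. c v * v)" unfolding reidx by (simp only:) (rule sum.cong, auto simp: cf)
    ultimately show ?thesis by blast
  qed
  ultimately have "has_dim S UNIV (card C)" by (intro has_dimI[OF S]) auto
  moreover have "card C = p ^ 2" unfolding C_def by (simp add: card_image[OF inj] B(3) power2_eq_square card_cartesian_product)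
  ultimately show ?thesis by (simp add: center)
qed

lemma \<phi>_add: assumes k: "k \<in> K" shows "conjg (x ^ i) (conjg (x ^ j) k) = conjg (x ^ ((i + j) mod p)) k"
proof -
  have "x ^ (i + j) = x ^ ((i + j) mod p) * (x ^ p) ^ ((i + j) div p)"
    unfolding power_mult[symmetric] power_add[symmetric] by simp
  hence "conjg (x ^ i) (conjg (x ^ j) k) = conjg (x ^ ((i + j) mod p)) (conjg ((x ^ p) ^ ((i + j) div p)) k)"
    by (simp add: conjg_conjg power_add[symmetric])
  moreover have "(x ^ p) ^ ((i + j) div p) \<in> K" using div_subring_prod[OF K xpK] .
  hence "conjg ((x ^ p) ^ ((i + j) div p)) k = k" using Kcomm[OF _ k] x0 by (simp add: conjg_fix_iff)
  ultimately show ?thesis by simp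
qed

lemma galgrp_iso: "(\<lambda>i. \<phi> (nat i)) \<in> iso (integer_mod_group p) (galgrp K center)"
proof -
  have car: "carrier (integer_mod_group p) = {0..<int p}" using p0 by (simp add: carrier_integer_mod_group)
  have "\<phi> (nat ((i + j) mod int p)) = compose K (\<phi> (nat i)) (\<phi> (nat j))" if "0 \<le> i" "0 \<le> j" for i j
  proof
    fix k
    have "nat ((i + j) mod int p) = (nat i + nat j) mod p" using that by (simp add: nat_mod_distrib nat_add_distrib)
    thus "\<phi> (nat ((i + j) mod int p)) k = compose K (\<phi> (nat i)) (\<phi> (nat j)) k"
      using \<phi>_add[of k "nat i" "nat j"] pow_in[of k] by (cases "k \<in> K") (auto simp: compose_def)
  qed
  hence "(\<lambda>i. \<phi> (nat i)) \<in> hom (integer_mod_group p) (galgrp K center)"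
    using \<phi>_Gal unfolding hom_def car center by (auto simp: galgrp_def)
  moreover have "bij_betw (\<lambda>i. \<phi> (nat i)) {0..<int p} (Gal K center)"
  proof -
    have "bij_betw nat {0..<int p} {..<p}" by (rule bij_betw_byWitness[of _ int]) auto
    moreover have "bij_betw \<phi> {..<p} (Gal K center)" using \<phi>_inj unfolding center Gal_eq by (simp add: bij_betw_def)
    ultimately have "bij_betw (\<phi> \<circ> nat) {0..<int p} (Gal K center)" by (rule bij_betw_trans)
    thus ?thesis by (simp add: comp_def)
  qed
  ultimately show ?thesis unfolding iso_def car by (simp add: galgrp_def)
qed

end

section \<open>The FC-center, the Fitting subgroup and the Galois group\<close>

lemma grp_simps [simp]: "carrier (grp H) = H" "x \<otimes>\<^bsub>grp H\<^esub> y = x * y" "\<one>\<^bsub>grp H\<^esub> = 1" "grp M\<lparr>carrier := H\<rparr> = grp H"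
  by (simp_all add: grp_def)

lemma group_grp: assumes "mult_group H" shows "group (grp H)"
proof (rule groupI)
  fix x assume "x \<in> carrier (grp H)"
  hence "inverse x \<in> H \<and> inverse x * x = 1" using mult_groupD(3,5)[OF assms] by simp
  thus "\<exists>y\<in>carrier (grp H). y \<otimes>\<^bsub>grp H\<^esub> x = \<one>\<^bsub>grp H\<^esub>" by auto
qed (use mult_groupD(1,4)[OF assms] in \<open>auto simp: mult.assoc\<close>)

lemma inv_grp: assumes "mult_group H" "x \<in> H" shows "inv\<^bsub>grp H\<^esub> x = inverse x"
  using group.inv_equality[OF group_grp[OF assms(1)], of "inverse x" x] mult_groupD(3,5)[OF assms] assms(2) by simp

lemma subgroup_grp: assumes G: "mult_group G" shows "subgroup H (grp G) \<longleftrightarrow> mult_group H \<and> H \<subseteq> G"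
proof
  assume s: "subgroup H (grp G)"
  have HG: "H \<subseteq> G" using subgroup.subset[OF s] by simp
  moreover have "inverse x \<in> H" if "x \<in> H" for x
    using subgroup.m_inv_closed[OF s that] inv_grp[OF G, of x] HG that by auto
  ultimately show "mult_group H \<and> H \<subseteq> G"
    using subgroup.one_closed[OF s] subgroup.m_closed[OF s] mult_groupD(2)[OF G] by (auto simp: mult_group_def)
next
  assume H: "mult_group H \<and> H \<subseteq> G"
  show "subgroup H (grp G)"
  proof (rule subgroup.intro)
    fix x assume "x \<in> H"
    thus "inv\<^bsub>grp G\<^esub> x \<in> H" using inv_grp[OF G, of x] H mult_groupD(5)[of H x] by auto
  qed (use H mult_groupD(1,4) in auto)
qed

lemma normal_grp: assumes G: "mult_group G" shows "H \<lhd> grp G \<longleftrightarrow> mult_group H \<and> H \<subseteq> G \<and> normalizes G H"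
  unfolding group.normal_inv_iff[OF group_grp[OF G]] subgroup_grp[OF G] normalizes_def
  using inv_grp[OF G] by (auto simp: conjg_def)

lemma subnormal_in_chain:
  assumes "subnormal_in G units_of_D"
  shows "\<exists>N n. subnormal_chain N n UNIV \<and> N 0 = G"
proof -
  obtain n N where N: "N 0 = G" "N n = units_of_D" "\<And>i. i < n \<Longrightarrow> N i \<lhd> grp (N (Suc i))"
    using assms unfolding subnormal_in_def by blast
  \<comment> \<open>Normality in \<open>N (Suc i)\<close> can be unfolded only once that set is
    known to be a group, so the induction descends from the top.\<close>
  have m: "mult_group (N i)" if "i \<le> n" for i
    using that
  proof (induction rule: inc_induct)
    case base thus ?case using mult_group_units[OF div_subring_UNIV] N(2) by (simp add: units_of_D_def)
  next
    case (step i)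
    show ?case using N(3)[OF step(2)] normal_grp[OF step(3)] by blast
  qed
  have "N i \<subseteq> N (Suc i) \<and> normalizes (N (Suc i)) (N i)" if "i < n" for i
    using N(3)[OF that] normal_grp[OF m[of "Suc i"]] that by auto
  hence "subnormal_chain N n UNIV" using N(2) m by (simp add: subnormal_chain_def units_of_D_def)
  thus ?thesis using N(1) by blast
qed

lemma solvable_solvable_set:
  assumes M: "mult_group M" and s: "solvable (grp M)" shows "solvable_set M"
proof -
  interpret G: group "grp M" by (rule group_grp[OF M])
  obtain k where k: "(derived (grp M) ^^ k) M = {1}" using s unfolding G.solvable_iff_trivial_derived_seq by auto
  have "(derived_grp ^^ k) M \<subseteq> (derived (grp M) ^^ k) M \<and> (derived (grp M) ^^ k) M \<subseteq> M" for k
  proof (induction k)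
    case (Suc k)
    let ?D = "(derived (grp M) ^^ k) M"
    have DM: "?D \<subseteq> M" using Suc by blast
    have "subgroup (derived (grp M) ?D) (grp M)" using DM by (intro G.derived_is_subgroup) simp
    hence 1: "mult_group (derived (grp M) ?D)" "derived (grp M) ?D \<subseteq> M" unfolding subgroup_grp[OF M] by auto
    have "derived_grp ((derived_grp ^^ k) M) \<subseteq> derived (grp M) ?D"
    proof (rule derived_grp_least[OF 1(1)])
      fix a b assume "a \<in> (derived_grp ^^ k) M" "b \<in> (derived_grp ^^ k) M"
      hence ab: "a \<in> ?D" "b \<in> ?D" using Suc by auto
      hence "a \<otimes>\<^bsub>grp M\<^esub> b \<otimes>\<^bsub>grp M\<^esub> inv\<^bsub>grp M\<^esub> a \<otimes>\<^bsub>grp M\<^esub> inv\<^bsub>grp M\<^esub> b \<in> derived (grp M) ?D"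
        unfolding derived_def by (intro generate.incl) blast
      moreover have "a \<in> M" "b \<in> M" using ab DM by auto
      ultimately show "commutator a b \<in> derived (grp M) ?D" by (simp add: inv_grp[OF M] commutator_def)
    qed
    thus ?case using 1(2) by simp
  qed simp
  thus ?thesis using k unfolding solvable_set_def by metis
qed

text \<open>Powers of each element repeat, so it has finite order; the product of these orders
  serves for all.\<close>

lemma finite_exponent:
  fixes A :: "'a::division_ring set"
  assumes fin: "finite A" and mult: "\<And>a b. a \<in> A \<Longrightarrow> b \<in> A \<Longrightarrow> a * b \<in> A" and A0: "0 \<notin> A"
  shows "\<exists>s>0. \<forall>a\<in>A. a ^ s = 1"
proof -
  have "\<exists>e>0. a ^ e = 1" if a: "a \<in> A" for a
  proof -
    have int_powers: "a ^ Suc i \<in> A" for i by (induction i) (auto simp: a mult)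
    hence "range (\<lambda>i. a ^ Suc i) \<subseteq> A" by blast
    hence "\<not> inj (\<lambda>i. a ^ Suc i)" using fin finite_subset finite_imageD infinite_UNIV_nat by blast
    then obtain i j where ij: "i \<noteq> j" "a ^ Suc i = a ^ Suc j" unfolding inj_def by blast
    have a0: "a \<noteq> 0" using a A0 by auto
    have *: "\<exists>e>0. a ^ e = 1" if "i < j" "a ^ Suc i = a ^ Suc j" for i j
    proof -
      have "Suc i + (j - i) = Suc j" using that(1) by simp
      hence "a ^ Suc i * a ^ (j - i) = a ^ Suc i * 1" using that(2) by (metis power_add mult.right_neutral)
      hence "a ^ (j - i) = 1" using a0 by simp
      thus ?thesis using that(1) by (intro exI[of _ "j - i"]) simp
    qed
    show ?thesis using *[of i j] *[of j i] ij by (metis linorder_neqE_nat)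
  qed
  then obtain e where e: "\<And>a. a \<in> A \<Longrightarrow> e a > 0 \<and> a ^ e a = 1" by metis
  have "a ^ (\<Prod>a\<in>A. e a) = 1" if a: "a \<in> A" for a
  proof -
    obtain q where "(\<Prod>a\<in>A. e a) = e a * q" using dvd_prodI[OF fin a, of e] by (auto elim: dvdE)
    thus ?thesis using e[OF a] by (simp add: power_mult)
  qed
  moreover have "(\<Prod>a\<in>A. e a) > 0" using e by (intro prod_pos) auto
  ultimately show ?thesis by blast
qed

section \<open>Invariants of M in the presence of the splitting field\<close>

locale solvable_splitting = maximal_solvable +
  fixes K :: "'a set" and p :: nat
  assumes sp: "splitting K p"
begin

lemma K: "div_subring K" and Kc: "K \<subseteq> centralizer K" and nK: "normalizes M K" and BM: "K \<inter> U \<subseteq> M" and MK: "\<not> M \<subseteq> K" and p: "prime p"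
  and Mc: "m \<in> M \<Longrightarrow> m \<in> centralizer K \<Longrightarrow> m \<in> K" and Mp: "m \<in> M \<Longrightarrow> m ^ p \<in> K"
  using sp by (auto simp: splitting_def)

lemma M0: "m \<in> M \<Longrightarrow> m \<noteq> 0" by (rule mult_groupD(3)[OF M])

lemma cyclic_algebra: assumes "x \<in> M" "x \<notin> K" shows "cyclic_algebra K x p"
proof unfold_locales
  show "conjg x ` K = K" by (rule normalizes_image[OF M nK assms(1)])
  show "x ^ p \<in> centralizer K" using Mp[OF assms(1)] Kc by blast
  show "x \<notin> centralizer K" using Mc assms by blast
  fix R assume R: "div_subring R" "K \<subseteq> R" "x \<in> R"
  interpret pl: power_layer K x by (rule power_layerI[OF K Kc M nK assms(1)])
  have "int_powers x \<subseteq> R" using div_subring_powi[OF R(1,3)] by (auto simp: int_powers_def)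
  hence "abelian_layer.fractions (scaled K (int_powers x)) \<subseteq> R" by (intro pl.fractions_least[OF R(1)] scaled_sub[OF R(1,2)])
  moreover have "abelian_layer.fractions (scaled K (int_powers x)) = UNIV" using sp assms by (auto simp: splitting_def)
  ultimately show "R = UNIV" by blast
qed (use K Kc M0 Mp p assms in auto)

abbreviation "B \<equiv> K \<inter> U"

lemma B: "mult_group B" using mult_group_Int_div_subring[OF G K] by (simp add: Int_commute)

lemma B_eq: "B = M \<inter> centralizer K" using BM MG Mc Kc by blast

lemma BI: "m \<in> M \<Longrightarrow> m \<in> K \<Longrightarrow> m \<in> B" using MG by blast

lemma B_normal: "B \<lhd> grp M"
proof -
  have "normalizes M B" by (rule normalizes_Int[OF nK nMG])
  thus ?thesis using B BM normal_grp[OF M] by blast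
qed

lemma commutator_iter_B: assumes "x \<in> M" "x \<notin> K" "k \<in> K" "k \<noteq> 0" shows "(commutator x ^^ n) k \<in> B"
proof -
  interpret C: cyclic_algebra K x p by (rule cyclic_algebra[OF assms(1,2)])
  show ?thesis using subnormal_chain_commutator[OF N _ UNIV_I assms(4), of x n] C.commutator_iter(1)[OF assms(3,4)] assms(1) MG by auto
qed

text \<open>\<open>M\<close> acts on \<open>K\<close> through the Galois group, so elements of
  \<open>B\<close> have at most \<open>p\<close> conjugates. Conversely, \<open>n\<close>
  commutators bring \<open>K - {0}\<close> into \<open>M\<close>, so one more commutator with an
  FC-element takes finitely many values. They are closed under multiplication and hence have a
  common exponent.\<close>

lemma FC_center_eq: "FC_center M = B"
proof
  obtain x where x: "x \<in> M" "x \<notin> K" using MK by blast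
  interpret C: cyclic_algebra K x p by (rule cyclic_algebra[OF x])
  show "B \<subseteq> FC_center M"
  proof
    fix b assume b: "b \<in> B"
    have "{y * b * inverse y | y. y \<in> M} \<subseteq> (\<lambda>i. conjg (x ^ i) b) ` {..<p}"
    proof
      fix c assume "c \<in> {y * b * inverse y | y. y \<in> M}"
      then obtain y where y: "y \<in> M" "c = conjg y b" by (auto simp: conjg_def)
      have "restrict (conjg y) K \<in> C.\<phi> ` {..<p}" unfolding C.Gal_eq[symmetric]
        by (rule C.conjg_Gal[OF M0[OF y(1)] normalizes_image[OF M nK y(1)]])
      then obtain i where i: "i < p" "restrict (conjg y) K = C.\<phi> i" by auto
      have "c = conjg (x ^ i) b" using fun_cong[OF i(2), of b] b y(2) by simp
      thus "c \<in> (\<lambda>i. conjg (x ^ i) b) ` {..<p}" using i(1) by blast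
    qed
    hence "finite {y * b * inverse y | y. y \<in> M}" by (rule finite_subset) simp
    thus "b \<in> FC_center M" using b BM by (auto simp: FC_center_def)
  qed
next
  show "FC_center M \<subseteq> B"
  proof (rule subsetI, rule ccontr)
    fix x assume xF: "x \<in> FC_center M" and xB: "x \<notin> B"
    have x: "x \<in> M" "x \<notin> K" using xF xB BI by (auto simp: FC_center_def)
    interpret C: cyclic_algebra K x p by (rule cyclic_algebra[OF x])
    let ?T = "{y * x * inverse y | y. y \<in> M}"
    have "finite ?T" using xF by (simp add: FC_center_def)
    hence fin: "finite ((\<lambda>t. x * inverse t) ` ?T)" by simp
    define A where "A = {(commutator x ^^ Suc n) k | k. k \<in> K \<and> k \<noteq> 0}"
    have "A \<subseteq> (\<lambda>t. x * inverse t) ` ?T"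
    proof
      fix a assume "a \<in> A"
      then obtain k where k: "k \<in> K" "k \<noteq> 0" "a = commutator x ((commutator x ^^ n) k)" by (auto simp: A_def)
      define b where "b = (commutator x ^^ n) k"
      have b: "b \<in> M" using commutator_iter_B[OF x k(1,2)] BM by (auto simp: b_def)
      have "a = x * inverse (b * x * inverse b)"
        unfolding k(3) b_def[symmetric] using M0[OF b] C.x0 by (simp add: commutator_def nonzero_inverse_mult_distrib mult.assoc)
      thus "a \<in> (\<lambda>t. x * inverse t) ` ?T" using b by blast
    qed
    hence "finite A" using fin by (rule finite_subset)
    moreover have "a * b \<in> A" if ab: "a \<in> A" "b \<in> A" for a b
    proof -
      obtain k l where kl: "k \<in> K" "k \<noteq> 0" "l \<in> K" "l \<noteq> 0" "a = (commutator x ^^ Suc n) k" "b = (commutator x ^^ Suc n) l"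
        using ab by (auto simp: A_def)
      have "(commutator x ^^ j) (k * l) = (commutator x ^^ j) k * (commutator x ^^ j) l" for j
        by (induction j) (simp_all add: C.commutator_mult C.commutator_iter[OF kl(1,2)] C.commutator_iter[OF kl(3,4)])
      hence "a * b = (commutator x ^^ Suc n) (k * l)" using kl(5,6) by metis
      moreover have "k * l \<in> K \<and> k * l \<noteq> 0" using kl div_subringD(4)[OF K] by simp
      ultimately show ?thesis unfolding A_def by blast
    qed
    moreover have "0 \<notin> A"
    proof
      assume "0 \<in> A"
      then obtain k where "k \<in> K" "k \<noteq> 0" "(commutator x ^^ Suc n) k = 0" unfolding A_def by force
      thus False using C.commutator_iter(2) by blast
    qed
    ultimately obtain s where s: "s > 0" "\<forall>a\<in>A. a ^ s = 1" using finite_exponent[of A] by metis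
    show False
    proof (rule C.engel_impossible[OF C.xpK s(1), of "Suc n"])
      fix k assume k: "k \<in> K" "k \<noteq> 0"
      hence "(commutator x ^^ Suc n) k \<in> A" unfolding A_def by blast
      hence "(commutator x ^^ Suc n) (k ^ s) = 1" using s(2) C.commutator_iter_power[OF k, of "Suc n" s] by metis
      thus "conjg x ((commutator x ^^ Suc n) (k ^ s)) = (commutator x ^^ Suc n) (k ^ s)" by (simp only: conjg_1[OF C.x0])
    qed
  qed
qed

text \<open>The index is \<open>Suc j\<close> because \<open>b\<close> itself may lie outside
  \<open>Q\<close>; the first commutator with \<open>x\<close> enters \<open>Q\<close> by
  normality.\<close>

lemma lower_central_contains:
  assumes Q: "mult_group Q" "Q \<subseteq> M" "normalizes M Q" and x: "x \<in> Q" "x \<notin> K" and b: "b \<in> B"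
  shows "(commutator x ^^ Suc j) b \<in> lower_central (grp Q) j \<and> (commutator x ^^ Suc j) b \<in> B"
proof (induction j)
  case 0
  have "x \<noteq> 0" using x Q M0 by blast
  have "commutator x b = x * conjg b (inverse x)" by (simp add: commutator_def conjg_def mult.assoc)
  moreover have "x * conjg b (inverse x) \<in> Q" using normalizesD[OF Q(3) _ mult_groupD(5)[OF Q(1) x(1)], of b] b BM mult_groupD(4)[OF Q(1) x(1)] by auto
  moreover have "commutator x b \<in> B" using normalizesD[OF normalizes_Int[OF nK nMG], of x b] x b Q(2) mult_groupD(4,5)[OF B] by (auto simp: commutator_conjg)
  ultimately show ?case by simp
next
  case (Suc j)
  define y where "y = (commutator x ^^ Suc j) b"
  have y: "y \<in> lower_central (grp Q) j" "y \<in> B" using Suc by (simp_all add: y_def)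
  have lc: "lower_central (grp Q) j \<subseteq> Q"
  proof (induction j)
    case (Suc j)
    have "(\<Union>u\<in>lower_central (grp Q) j. \<Union>v\<in>carrier (grp Q). {u \<otimes>\<^bsub>grp Q\<^esub> v \<otimes>\<^bsub>grp Q\<^esub> inv\<^bsub>grp Q\<^esub> u \<otimes>\<^bsub>grp Q\<^esub> inv\<^bsub>grp Q\<^esub> v}) \<subseteq> Q"
      using Suc by (auto simp: inv_grp[OF Q(1)] subset_iff mult_groupD(4,5)[OF Q(1)])
    hence "(\<Union>u\<in>lower_central (grp Q) j. \<Union>v\<in>carrier (grp Q). {u \<otimes>\<^bsub>grp Q\<^esub> v \<otimes>\<^bsub>grp Q\<^esub> inv\<^bsub>grp Q\<^esub> u \<otimes>\<^bsub>grp Q\<^esub> inv\<^bsub>grp Q\<^esub> v}) \<subseteq> carrier (grp Q)" by simp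
    from group.generate_incl[OF group_grp[OF Q(1)] this] show ?case by simp
  qed simp
  have yQ: "y \<in> Q" using y lc by blast
  have "y \<otimes>\<^bsub>grp Q\<^esub> x \<otimes>\<^bsub>grp Q\<^esub> inv\<^bsub>grp Q\<^esub> y \<otimes>\<^bsub>grp Q\<^esub> inv\<^bsub>grp Q\<^esub> x
      \<in> (\<Union>u\<in>lower_central (grp Q) j. \<Union>v\<in>carrier (grp Q). {u \<otimes>\<^bsub>grp Q\<^esub> v \<otimes>\<^bsub>grp Q\<^esub> inv\<^bsub>grp Q\<^esub> u \<otimes>\<^bsub>grp Q\<^esub> inv\<^bsub>grp Q\<^esub> v})"
    using y(1) x(1) by (intro UN_I[of y] UN_I[of x]) simp_all
  hence "commutator y x \<in> (\<Union>u\<in>lower_central (grp Q) j. \<Union>v\<in>carrier (grp Q). {u \<otimes>\<^bsub>grp Q\<^esub> v \<otimes>\<^bsub>grp Q\<^esub> inv\<^bsub>grp Q\<^esub> u \<otimes>\<^bsub>grp Q\<^esub> inv\<^bsub>grp Q\<^esub> v})"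
    by (simp add: inv_grp[OF Q(1)] yQ x(1) commutator_def)
  hence "inv\<^bsub>grp Q\<^esub> (commutator y x) \<in> lower_central (grp Q) (Suc j)" unfolding lower_central.simps by (rule generate.inv)
  \<comment> \<open>\<open>lower_central\<close> takes commutators with the group element on the
    right, so \<open>commutator x y\<close> is reached as the inverse of
    \<open>commutator y x\<close>.\<close>
  moreover have "inv\<^bsub>grp Q\<^esub> (commutator y x) = commutator x y"
    unfolding inv_grp[OF Q(1) mult_group_commutator[OF Q(1) yQ x(1)]] using mult_groupD(3)[OF Q(1)] yQ x(1)
    by (simp add: commutator_def nonzero_inverse_mult_distrib mult.assoc)
  moreover have "commutator x y \<in> B" using normalizesD[OF normalizes_Int[OF nK nMG], of x y] x y(2) Q(2) mult_groupD(4,5)[OF B] by (auto simp: commutator_conjg)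
  ultimately show ?case unfolding y_def by simp
qed

lemma nilpotent_normal_sub:
  assumes Q: "Q \<lhd> grp M" "nilpotent (grp Q)" shows "Q \<subseteq> B"
proof (rule subsetI, rule ccontr)
  have Q': "mult_group Q" "Q \<subseteq> M" "normalizes M Q" using Q(1) normal_grp[OF M] by auto
  fix x assume x: "x \<in> Q" "x \<notin> B"
  have xM: "x \<in> M" "x \<notin> K" using x Q' BI by auto
  interpret C: cyclic_algebra K x p by (rule cyclic_algebra[OF xM])
  obtain c where c: "lower_central (grp Q) c = {1}" using Q(2) by (auto simp: nilpotent_def)
  \<comment> \<open>\<open>n\<close> commutators bring \<open>k\<close> into \<open>B\<close>, and
    \<open>Suc c\<close> further ones run down the lower central series to 1.\<close>
  show False
  proof (rule C.engel_impossible[OF C.xpK, of 1 "Suc c + n"])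
    fix k assume k: "k \<in> K" "k \<noteq> 0"
    have "(commutator x ^^ Suc c) ((commutator x ^^ n) k) = 1"
      using lower_central_contains[OF Q' x(1) xM(2) commutator_iter_B[OF xM k], of c] c by blast
    hence "(commutator x ^^ (Suc c + n)) (k ^ 1) = 1" by (simp only: funpow_add comp_apply power_one_right)
    thus "conjg x ((commutator x ^^ (Suc c + n)) (k ^ 1)) = (commutator x ^^ (Suc c + n)) (k ^ 1)" by (simp only: conjg_1[OF C.x0])
  qed simp
qed

lemma fitting_eq: "fitting (grp M) = B"
proof
  have "\<Union> {Q. Q \<lhd> grp M \<and> nilpotent (grp M\<lparr>carrier := Q\<rparr>)} \<subseteq> B" using nilpotent_normal_sub by auto
  thus "fitting (grp M) \<subseteq> B" unfolding fitting_def
    using group.generate_subgroup_incl[OF group_grp[OF M]] normal_imp_subgroup[OF B_normal] by blast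
  have "commutator a b = 1" if "a \<in> B" "b \<in> B" for a b
    using that mult_groupD(3)[OF B] Kc by (auto simp: commutator_1_iff centralizer_def)
  hence "(\<Union>u\<in>carrier (grp B). \<Union>v\<in>carrier (grp B). {u \<otimes>\<^bsub>grp B\<^esub> v \<otimes>\<^bsub>grp B\<^esub> inv\<^bsub>grp B\<^esub> u \<otimes>\<^bsub>grp B\<^esub> inv\<^bsub>grp B\<^esub> v}) \<subseteq> {1}"
    by (auto simp: inv_grp[OF B] commutator_def)
  moreover have "subgroup {1} (grp B)" using group.triv_subgroup[OF group_grp[OF B]] by simp
  ultimately have "lower_central (grp B) 1 \<subseteq> {1}"
    using group.generate_subgroup_incl[OF group_grp[OF B]] by simp
  moreover have "1 \<in> lower_central (grp B) 1" using generate.one[of "grp B"] by simp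
  ultimately have "lower_central (grp B) 1 = {1}" by blast
  hence "nilpotent (grp B)" unfolding nilpotent_def grp_simps by (rule exI)
  hence "B \<subseteq> \<Union> {Q. Q \<lhd> grp M \<and> nilpotent (grp M\<lparr>carrier := Q\<rparr>)}" using B_normal by auto
  thus "B \<subseteq> fitting (grp M)" unfolding fitting_def by (auto intro: generate.incl)
qed

text \<open>The first isomorphism theorem for the action of \<open>M\<close> on \<open>K\<close>:
  the kernel is \<open>B\<close> by \<open>B_eq\<close>, and the powers of \<open>x\<close> already
  induce all automorphisms.\<close>

lemma galois_group:
  "galgrp K center \<cong> grp M Mod B" "grp M Mod B \<cong> integer_mod_group p"
proof -
  obtain x where x: "x \<in> M" "x \<notin> K" using MK by blast
  interpret C: cyclic_algebra K x p by (rule cyclic_algebra[OF x])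
  interpret GM: group "grp M" by (rule group_grp[OF M])
  let ?h = "\<lambda>m. restrict (conjg m) K"
  have im: "conjg m ` K = K" if "m \<in> M" for m by (rule normalizes_image[OF M nK that])
  have Gal: "?h m \<in> Gal K center" if "m \<in> M" for m unfolding C.center by (rule C.conjg_Gal[OF M0[OF that] im[OF that]])
  have one: "C.\<phi> 0 = restrict id K" by (auto simp: conjg_one)
  \<comment> \<open>The group laws are transported from the integers modulo \<open>p\<close>. The
    unit produced by the transport is \<open>C.\<phi> 0\<close>, which is the identity on
    \<open>K\<close>.\<close>
  have "group (galgrp K center\<lparr>one := C.\<phi> (nat \<one>\<^bsub>integer_mod_group p\<^esub>)\<rparr>)"
    by (rule group.iso_imp_img_group[OF group_integer_mod_group C.galgrp_iso])
  hence grG: "group (galgrp K center)" using one by (simp add: galgrp_def)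
  have "?h (a * b) = compose K (?h a) (?h b)" if "a \<in> M" "b \<in> M" for a b
  proof
    fix k
    show "?h (a * b) k = compose K (?h a) (?h b) k"
      using im[OF that(2)] by (cases "k \<in> K") (auto simp: compose_def conjg_conjg)
  qed
  hence "?h \<in> hom (grp M) (galgrp K center)" using Gal unfolding hom_def by (auto simp: galgrp_def)
  then interpret h: group_hom "grp M" "galgrp K center" ?h
    using grG GM.group_axioms by (simp add: group_hom_def group_hom_axioms_def)
  have "?h ` M = Gal K center"
  proof
    show "?h ` M \<subseteq> Gal K center" using Gal by blast
    show "Gal K center \<subseteq> ?h ` M" unfolding C.center C.Gal_eq using mult_group_power[OF M x(1)] by auto
  qed
  hence onto: "?h ` carrier (grp M) = carrier (galgrp K center)" by (simp add: galgrp_def)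
  have ker: "kernel (grp M) (galgrp K center) ?h = B"
  proof -
    have "?h m = restrict id K \<longleftrightarrow> m \<in> centralizer K" if "m \<in> M" for m
      using M0[OF that] by (auto simp: restrict_def fun_eq_iff conjg_fix_iff centralizer_def)
    thus ?thesis unfolding B_eq kernel_def by (auto simp: galgrp_def)
  qed
  have 1: "grp M Mod B \<cong> galgrp K center" using h.FactGroup_iso[OF onto] unfolding ker .
  have grB: "group (grp M Mod B)" by (rule normal.factorgroup_is_group[OF B_normal])
  show "galgrp K center \<cong> grp M Mod B" by (rule group.iso_sym[OF grB 1])
  have "integer_mod_group p \<cong> galgrp K center" using C.galgrp_iso by (auto simp: is_iso_def)
  hence "galgrp K center \<cong> integer_mod_group p" by (rule group.iso_sym[OF group_integer_mod_group])
  thus "grp M Mod B \<cong> integer_mod_group p" using 1 iso_trans by blast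
qed

text \<open>By finite dimension over the center, every element of the subring is algebraic, so the
  subring is closed under inverses. It is normalized by \<open>M\<close>, and since \<open>M\<close>
  is nonabelian the dichotomy leaves only the whole ring.\<close>

lemma gen_subring_UNIV: "gen_subring center M = UNIV"
proof -
  obtain x where x: "x \<in> M" "x \<notin> K" using MK by blast
  interpret C: cyclic_algebra K x p by (rule cyclic_algebra[OF x])
  define R where "R = gen_subring center M"
  have R: "is_subring R" unfolding R_def gen_subring_def is_subring_def by blast
  have sub: "M \<subseteq> R" "center \<subseteq> R" unfolding R_def gen_subring_def by blast+
  have F: "div_subring center" unfolding center_eq by (rule div_subring_centralizer)
  obtain E :: "'a set" where E: "finite E" "card E = p ^ 2" "\<forall>v\<in>UNIV. \<exists>!c. c \<in> E \<rightarrow>\<^sub>E center \<and> v = (\<Sum>b\<in>E. c b * b)"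
    using C.dimension unfolding has_dim_def by (elim exE conjE)
  have ex: "\<exists>c. c \<in> E \<rightarrow>\<^sub>E center \<and> v = (\<Sum>b\<in>E. c b * b)" for v by (rule ex1_implies_ex[OF bspec[OF E(3) UNIV_I]])
  have inv: "inverse a \<in> R" if a: "a \<in> R" "a \<noteq> 0" for a
  proof -
    have "\<forall>j. \<exists>c. c \<in> E \<rightarrow>\<^sub>E center \<and> a ^ j = (\<Sum>b\<in>E. c b * b)" by (rule allI, rule ex)
    hence "\<exists>k. \<forall>j. k j \<in> E \<rightarrow>\<^sub>E center \<and> a ^ j = (\<Sum>b\<in>E. k j b * b)" by (rule choice)
    then obtain k where k': "\<forall>j. k j \<in> E \<rightarrow>\<^sub>E center \<and> a ^ j = (\<Sum>b\<in>E. k j b * b)" by (rule exE)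
    note k = spec[OF k', THEN conjunct1] spec[OF k', THEN conjunct2]
    have "\<exists>c. (\<forall>j\<in>{..p ^ 2}. c j \<in> center) \<and> (\<exists>j\<in>{..p ^ 2}. c j \<noteq> 0) \<and> (\<forall>b\<in>E. (\<Sum>j\<in>{..p ^ 2}. c j * k j b) = 0)"
      by (rule homogeneous_system[OF F E(1)]) (use E(2) k(1) in \<open>auto simp: PiE_iff\<close>)
    then obtain c i where c: "\<forall>j\<in>{..p ^ 2}. c j \<in> center" "i \<le> p ^ 2" "c i \<noteq> 0" "\<forall>b\<in>E. (\<Sum>j\<in>{..p ^ 2}. c j * k j b) = 0"
      by auto
    have "(\<Sum>j\<le>p ^ 2. c j * a ^ j) = (\<Sum>j\<le>p ^ 2. \<Sum>b\<in>E. c j * k j b * b)"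
      unfolding k(2) by (simp only: sum_distrib_left mult.assoc)
    also have "\<dots> = (\<Sum>b\<in>E. (\<Sum>j\<le>p ^ 2. c j * k j b) * b)" unfolding sum_distrib_right by (rule sum.swap)
    also have "\<dots> = 0" using c(4) by simp
    finally have z: "(\<Sum>j\<le>p ^ 2. c j * a ^ j) = 0" .
    show ?thesis using inverse_in_algebraic_subring[OF F R sub(2) a _ c(2,3) z] c(1) by blast
  qed
  have dR: "div_subring R" unfolding div_subring_def
  proof (intro conjI ballI)
    fix a assume "a \<in> R"
    thus "inverse a \<in> R" using inv[of a] by (cases "a = 0") auto
  qed (rule R)
  have "normalizes M R" unfolding normalizes_def conjg_def using sub(1) div_subringD(4,6)[OF dR] by blast
  from dichotomy[OF dR this] show ?thesis unfolding R_def[symmetric]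
  proof
    assume "R \<inter> U \<subseteq> M \<and> R \<inter> U \<subseteq> centralizer R"
    hence "M \<subseteq> centralizer R" using sub(1) MG by blast
    hence "M \<subseteq> centralizer M" using centralizer_mono[OF sub(1)] by blast
    thus "R = UNIV" using nonab by blast
  qed
qed

theorem conclusion:
  "prime p \<and> maximal_subfield K \<and> finite_galois K center \<and> B \<lhd> grp M \<and>
   galgrp K center \<cong> grp M Mod B \<and> grp M Mod B \<cong> integer_mod_group p \<and>
   has_dim center (UNIV :: 'a set) (p ^ 2) \<and> FC_center M = B \<and> fitting (grp M) = B \<and>
   (\<forall>x \<in> M - K. x ^ p \<in> center \<and> gen_subring center M = UNIV \<and>
      (\<forall>d. \<exists>!k. k \<in> {1..p} \<rightarrow>\<^sub>E K \<and> d = (\<Sum>i=1..p. k i * x ^ i)))"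
proof -
  obtain x where x: "x \<in> M" "x \<notin> K" using MK by blast
  interpret C: cyclic_algebra K x p by (rule cyclic_algebra[OF x])
  have "\<forall>x \<in> M - K. x ^ p \<in> center \<and> gen_subring center M = UNIV \<and>
    (\<forall>d. \<exists>!k. k \<in> {1..p} \<rightarrow>\<^sub>E K \<and> d = (\<Sum>i=1..p. k i * x ^ i))"
  proof
    fix x assume "x \<in> M - K"
    then interpret C': cyclic_algebra K x p by (intro cyclic_algebra) auto
    show "x ^ p \<in> center \<and> gen_subring center M = UNIV \<and> (\<forall>d. \<exists>!k. k \<in> {1..p} \<rightarrow>\<^sub>E K \<and> d = (\<Sum>i=1..p. k i * x ^ i))"
      by (intro conjI allI C'.power_center gen_subring_UNIV C'.unique_representation)
  qed
  thus ?thesis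
    by (intro conjI p C.maximal C.galois B_normal galois_group C.dimension FC_center_eq fitting_eq)
qed

end

theorem (in maximal_solvable) cyclic_structure:
  "\<exists>K p. prime (p::nat) \<and> maximal_subfield K \<and> finite_galois K center \<and>
     (K - {0}) \<inter> U \<lhd> grp M \<and>
     galgrp K center \<cong> grp M Mod ((K - {0}) \<inter> U) \<and>
     grp M Mod ((K - {0}) \<inter> U) \<cong> integer_mod_group p \<and>
     has_dim center (UNIV :: 'a set) (p ^ 2) \<and>
     FC_center M = (K - {0}) \<inter> U \<and>
     fitting (grp M) = (K - {0}) \<inter> U \<and>
     (\<forall>x \<in> M - K. x ^ p \<in> center \<and> gen_subring center M = UNIV \<and>
        (\<forall>d. \<exists>!k. k \<in> {1..p} \<rightarrow>\<^sub>E K \<and> d = (\<Sum>i=1..p. k i * x ^ i)))"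
proof -
  obtain K p where "splitting K p" using splitting_exists by blast
  then interpret solvable_splitting N n M K p by unfold_locales
  have "(K - {0}) \<inter> U = K \<inter> U" using mult_groupD(2)[OF G] by auto
  thus ?thesis using conclusion by (intro exI[of _ K] exI[of _ p]) simp
qed

theorem theorem3p2:
  fixes G M :: "'a::division_ring set"
  assumes "subnormal_in G units_of_D"
    and "maximal_subgroup M G"
    and "\<not> is_abelian_set M"
    and "solvable (grp M)"
  shows "\<exists>K p. prime (p::nat) \<and> maximal_subfield K \<and> finite_galois K center \<and>
           (K - {0}) \<inter> G \<lhd> grp M \<and>
           galgrp K center \<cong> grp M Mod ((K - {0}) \<inter> G) \<and>
           grp M Mod ((K - {0}) \<inter> G) \<cong> integer_mod_group p \<and>
           has_dim center (UNIV :: 'a set) (p ^ 2) \<and>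
           FC_center M = (K - {0}) \<inter> G \<and>
           fitting (grp M) = (K - {0}) \<inter> G \<and>
           (\<forall>x \<in> M - K. x ^ p \<in> center \<and> gen_subring center M = UNIV \<and>
              (\<forall>d. \<exists>!k. k \<in> {1..p} \<rightarrow>\<^sub>E K \<and> d = (\<Sum>i=1..p. k i * x ^ i)))"
proof -
  obtain N n where chain: "subnormal_chain N n UNIV" "N 0 = G" using subnormal_in_chain[OF assms(1)] by blast
  have G: "mult_group G" using subnormal_chainD(2)[OF chain(1), of 0] chain(2) by simp
  have M: "mult_group M" "M \<subseteq> G" "M \<noteq> G" using assms(2) subgroup_grp[OF G] by (auto simp: maximal_subgroup_def)
  interpret maximal_solvable N n M
  proof unfold_locales
    fix H assume "mult_group H" "M \<subseteq> H" "H \<subseteq> N 0"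
    thus "H = M \<or> H = N 0" using assms(2) subgroup_grp[OF G] chain(2) by (auto simp: maximal_subgroup_def)
  next
    show "\<not> M \<subseteq> centralizer M" using assms(3) by (auto simp: is_abelian_set_def centralizer_def)
  qed (use chain M solvable_solvable_set[OF M(1) assms(4)] in auto)
  show ?thesis using cyclic_structure unfolding chain(2) .
qed

end
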